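(* Let $\mathcal{C}$ be a smashing triangulated category and let $\mathcal{A}$ be an additive subcategory of the subcategory $\mathcal{C}^{(\aleph_0)}$ of compact objects of $\mathcal{C}$ such that $\mathcal{A}$ compactly generates $\mathcal{C}$. Assume that the category $\mathrm{AddFun}(\mathcal{A},\mathrm{Ab})$ of additive functors is semi-simple and $\mathrm{Obj}\,\mathcal{A}\perp\bigcup_{i<0}\mathrm{Obj}\,\mathcal{A}[i]$. 1. Then there exist a smashing and cosmashing weight structure $w$ and a $t$-structure $t$ on $\mathcal{C}$ that are generated by $\mathrm{Obj}\,\mathcal{A}$, and they are right adjacent. 2. $t$ restricts to the subcategory $\mathcal{C}^{(\alpha)}$ of $\alpha$-small objects for any infinite cardinal $\alpha$. Moreover, for $\alpha=\aleph_0$ and the restricted $t$-structure $t^{(\aleph_0)}$ on $\mathcal{C}^{(\aleph_0)}$, the class $\mathcal{C}^{(\aleph_0)}_{t^{(\aleph_0)}\le 0}$ (resp. $\mathcal{C}^{(\aleph_0)}_{t^{(\aleph_0)}\ge 0}$) is the envelope of $\bigcup_{i\le 0}\mathrm{Obj}\,\mathcal{A}[i]$ (resp. of $\bigcup_{i\ge 0}\mathrm{Obj}\,\mathcal{A}[i]$) in $\mathcal{C}$.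
   Context: Conventions: all products and coproducts are small; subcategories are strictly full; $X\perp Y$ means $\mathcal{C}(X,Y)=0$; for classes $D,E$ of objects $D\perp E$ means $X\perp Y$ for all $X\in D$, $Y\in E$; $D^\perp=\{Y:\ X\perp Y\ \forall X\in D\}$. A triangulated category is (co)smashing if it has all small coproducts (resp. products). The envelope of a class $\mathcal{P}$ is the smallest additive class of objects containing $\mathcal{P}$ that is closed under retracts and extensions ($C$ is an extension of $B$ by $A$ if there is a distinguished triangle $A\to C\to B\to A[1]$). An object $M$ is $\alpha$-small if for any family $(N_i)_{i\in I}$ the obvious map $\varinjlim_{J\subset I,\ \#J<\alpha}\mathcal{C}(M,\coprod_{j\in J}N_j)\to\mathcal{C}(M,\coprod_{i\in I}N_i)$ is an isomorphism; compact means $\aleph_0$-small, i.e. $\mathcal{C}(M,-)$ respects coproducts. $\mathcal{C}^{(\alpha)}$ is the full subcategory of $\alpha$-small objects (a triangulated subcategory). $\mathcal{A}$ compactly generates $\mathcal{C}$ if $\mathcal{A}$ is essentially small, consists of compact objects, and the smallest triangulated subcategory of $\mathcal{C}$ containing $\mathcal{A}$ and closed under $\mathcal{C}$-coproducts is $\mathcal{C}$. A weight structure $w=(\mathcal{C}_{w\le 0},\mathcal{C}_{w\ge 0})$ on $\mathcal{C}$ is a pair of classes of objects closed under retracts such that $\mathcal{C}_{w\le 0}\subset \mathcal{C}_{w\le 0}[1]$, $\mathcal{C}_{w\ge 0}[1]\subset \mathcal{C}_{w\ge 0}$, $\mathcal{C}_{w\le 0}\perp \mathcal{C}_{w\ge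 0}[1]$, and every object $M$ fits into a distinguished triangle $L_wM\to M\to R_wM\to L_wM[1]$ with $L_wM\in \mathcal{C}_{w\le 0}$, $R_wM\in\mathcal{C}_{w\ge 0}[1]$. $w$ is smashing (resp. cosmashing) if $\mathcal{C}$ is and $\mathcal{C}_{w\ge 0}$ is closed under coproducts (resp. $\mathcal{C}_{w\le 0}$ is closed under products). A $t$-structure $t=(\mathcal{C}_{t\le 0},\mathcal{C}_{t\ge 0})$ on $\mathcal{C}$ (homological convention) is a pair of classes of objects closed under isomorphism such that $\mathcal{C}_{t\le 0}\subset \mathcal{C}_{t\le 0}[1]$, $\mathcal{C}_{t\ge 0}[1]\subset \mathcal{C}_{t\ge 0}$, $\mathcal{C}_{t\ge 0}[1]\perp \mathcal{C}_{t\le 0}$, and every object $M$ fits into a distinguished triangle $L_tM\to M\to R_tM\to L_tM[1]$ with $L_tM\in \mathcal{C}_{t\ge 0}$, $R_tM\in\mathcal{C}_{t\le 0}[-1]$. $t$ restricts to a full triangulated subcategory $\mathcal{C}^0$ if $(\mathcal{C}_{t\le 0}\cap\mathrm{Obj}\,\mathcal{C}^0,\mathcal{C}_{t\ge 0}\cap\mathrm{Obj}\,\mathcal{C}^0)$ is a $t$-structure on $\mathcal{C}^0$. A class $\mathcal{P}$ generates $w$ (resp. $t$) if $\mathcal{C}_{w\ge 0}=(\bigcup_{i>0}\mathcal{P}[-i])^\perp$ (resp. $\mathcal{C}_{t\le 0}=(\bigcup_{i>0}\mathcal{P}[i])^\perp$). $w$ and $t$ are right adjacent if $\mathcal{C}_{t\ge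 0}[1]\perp\mathcal{C}_{w\le 0}$ and $\mathcal{C}_{t\le 0}[-1]\perp\mathcal{C}_{w\ge 0}$ (equivalently, $\mathcal{C}_{t\le 0}=\mathcal{C}_{w\le 0}$). *)

theory Defs
  imports "HOL-Algebra.Group" "HOL-Library.FuncSet"
begin

unbundle cardinal_syntax

section \<open>Smallness\<close>

text \<open>
  Types are sets, so ``small'' is relative to a Grothendieck universe, represented by an
  uncountable strongly inaccessible cardinal \<open>\<kappa>\<close>: a set is small if its cardinality is less than
  \<open>\<kappa>\<close>. Up to bijection every small set is a subset of the type \<open>'u\<close> on which \<open>\<kappa>\<close> lives, so families
  indexed by subsets of \<open>'u\<close> and groups with carrier in \<open>'u\<close> suffice.
\<close>

definition small :: "'u rel \<Rightarrow> 'a set \<Rightarrow> bool"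
  where "small \<kappa> S \<longleftrightarrow> |S| <o \<kappa>"

definition inaccessible :: "'u rel \<Rightarrow> bool"
  where "inaccessible \<kappa> \<longleftrightarrow>
    Card_order \<kappa> \<and> natLeq <o \<kappa> \<and> regularCard \<kappa> \<and> (\<forall>S :: 'u set. small \<kappa> S \<longrightarrow> small \<kappa> (Pow S))"


section \<open>Categories\<close>

record ('o, 'm) category =
  Ob :: "'o set"
  Arr :: "'m set"
  Src :: "'m \<Rightarrow> 'o"
  Tgt :: "'m \<Rightarrow> 'o"
  Ident :: "'o \<Rightarrow> 'm"
  Comp :: "'m \<Rightarrow> 'm \<Rightarrow> 'm"  (infixl "\<cdot>\<index>" 70)

definition Hom :: "('o, 'm, 'z) category_scheme \<Rightarrow> 'o \<Rightarrow> 'o \<Rightarrow> 'm set"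
  where "Hom C X Y = {f \<in> Arr C. Src C f = X \<and> Tgt C f = Y}"

locale category =
  fixes C :: "('o, 'm, 'z) category_scheme" (structure)
  assumes Src_Ob: "f \<in> Arr C \<Longrightarrow> Src C f \<in> Ob C"
    and Tgt_Ob: "f \<in> Arr C \<Longrightarrow> Tgt C f \<in> Ob C"
    and Ident_Hom: "X \<in> Ob C \<Longrightarrow> Ident C X \<in> Hom C X X"
    and Comp_Hom: "\<lbrakk>f \<in> Hom C X Y; g \<in> Hom C Y Z\<rbrakk> \<Longrightarrow> g \<cdot> f \<in> Hom C X Z"
    and Comp_Ident: "f \<in> Hom C X Y \<Longrightarrow> f \<cdot> Ident C X = f"
    and Ident_Comp: "f \<in> Hom C X Y \<Longrightarrow> Ident C Y \<cdot> f = f"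
    and Comp_assoc: "\<lbrakk>f \<in> Hom C X Y; g \<in> Hom C Y Z; h \<in> Hom C Z W\<rbrakk> \<Longrightarrow> (h \<cdot> g) \<cdot> f = h \<cdot> (g \<cdot> f)"

definition locally_small :: "'u rel \<Rightarrow> ('o, 'm, 'z) category_scheme \<Rightarrow> bool"
  where "locally_small \<kappa> C \<longleftrightarrow> (\<forall>X\<in>Ob C. \<forall>Y\<in>Ob C. small \<kappa> (Hom C X Y))"

definition is_iso :: "('o, 'm, 'z) category_scheme \<Rightarrow> 'o \<Rightarrow> 'o \<Rightarrow> 'm \<Rightarrow> bool"
  where "is_iso C X Y f \<longleftrightarrow>
    f \<in> Hom C X Y \<and> (\<exists>g\<in>Hom C Y X. g \<cdot>\<^bsub>C\<^esub> f = Ident C X \<and> f \<cdot>\<^bsub>C\<^esub> g = Ident C Y)"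

definition isomorphic :: "('o, 'm, 'z) category_scheme \<Rightarrow> 'o \<Rightarrow> 'o \<Rightarrow> bool"
  where "isomorphic C X Y \<longleftrightarrow> X \<in> Ob C \<and> Y \<in> Ob C \<and> (\<exists>f. is_iso C X Y f)"

definition is_mono :: "('o, 'm, 'z) category_scheme \<Rightarrow> 'o \<Rightarrow> 'o \<Rightarrow> 'm \<Rightarrow> bool"
  where "is_mono C X Y f \<longleftrightarrow> f \<in> Hom C X Y \<and>
    (\<forall>T\<in>Ob C. \<forall>g\<in>Hom C T X. \<forall>h\<in>Hom C T X. f \<cdot>\<^bsub>C\<^esub> g = f \<cdot>\<^bsub>C\<^esub> h \<longrightarrow> g = h)"

definition is_retract :: "('o, 'm, 'z) category_scheme \<Rightarrow> 'o \<Rightarrow> 'o \<Rightarrow> bool"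
  where "is_retract C X Y \<longleftrightarrow> X \<in> Ob C \<and> Y \<in> Ob C \<and>
    (\<exists>i\<in>Hom C X Y. \<exists>p\<in>Hom C Y X. p \<cdot>\<^bsub>C\<^esub> i = Ident C X)"

definition zero_object :: "('o, 'm, 'z) category_scheme \<Rightarrow> 'o \<Rightarrow> bool"
  where "zero_object C Z \<longleftrightarrow> Z \<in> Ob C \<and>
    (\<forall>X\<in>Ob C. (\<exists>!f. f \<in> Hom C X Z) \<and> (\<exists>!f. f \<in> Hom C Z X))"

definition is_coproduct ::
    "('o, 'm, 'z) category_scheme \<Rightarrow> 'i set \<Rightarrow> ('i \<Rightarrow> 'o) \<Rightarrow> 'o \<Rightarrow> ('i \<Rightarrow> 'm) \<Rightarrow> bool"
  where "is_coproduct C I N S \<iota> \<longleftrightarrow> S \<in> Ob C \<and> (\<forall>i\<in>I. N i \<in> Ob C \<and> \<iota> i \<in> Hom C (N i) S) \<and>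
    (\<forall>T\<in>Ob C. \<forall>g. (\<forall>i\<in>I. g i \<in> Hom C (N i) T) \<longrightarrow>
       (\<exists>!h. h \<in> Hom C S T \<and> (\<forall>i\<in>I. h \<cdot>\<^bsub>C\<^esub> \<iota> i = g i)))"

definition is_product ::
    "('o, 'm, 'z) category_scheme \<Rightarrow> 'i set \<Rightarrow> ('i \<Rightarrow> 'o) \<Rightarrow> 'o \<Rightarrow> ('i \<Rightarrow> 'm) \<Rightarrow> bool"
  where "is_product C I N S \<pi> \<longleftrightarrow> S \<in> Ob C \<and> (\<forall>i\<in>I. N i \<in> Ob C \<and> \<pi> i \<in> Hom C S (N i)) \<and>
    (\<forall>T\<in>Ob C. \<forall>g. (\<forall>i\<in>I. g i \<in> Hom C T (N i)) \<longrightarrow>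
       (\<exists>!h. h \<in> Hom C T S \<and> (\<forall>i\<in>I. \<pi> i \<cdot>\<^bsub>C\<^esub> h = g i)))"

definition smashing :: "'u rel \<Rightarrow> ('o, 'm, 'z) category_scheme \<Rightarrow> bool"
  where "smashing \<kappa> C \<longleftrightarrow> (\<forall>(I :: 'u set) N. small \<kappa> I \<and> (\<forall>i\<in>I. N i \<in> Ob C) \<longrightarrow>
    (\<exists>S \<iota>. is_coproduct C I N S \<iota>))"

definition cosmashing :: "'u rel \<Rightarrow> ('o, 'm, 'z) category_scheme \<Rightarrow> bool"
  where "cosmashing \<kappa> C \<longleftrightarrow> (\<forall>(I :: 'u set) N. small \<kappa> I \<and> (\<forall>i\<in>I. N i \<in> Ob C) \<longrightarrow>
    (\<exists>S \<pi>. is_product C I N S \<pi>))"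

definition closed_iso :: "('o, 'm, 'z) category_scheme \<Rightarrow> 'o set \<Rightarrow> bool"
  where "closed_iso C D \<longleftrightarrow> (\<forall>X\<in>D. \<forall>Y. isomorphic C X Y \<longrightarrow> Y \<in> D)"

definition closed_retracts :: "('o, 'm, 'z) category_scheme \<Rightarrow> 'o set \<Rightarrow> bool"
  where "closed_retracts C D \<longleftrightarrow> (\<forall>Y\<in>D. \<forall>X. is_retract C X Y \<longrightarrow> X \<in> D)"

definition closed_coproducts :: "'u rel \<Rightarrow> ('o, 'm, 'z) category_scheme \<Rightarrow> 'o set \<Rightarrow> bool"
  where "closed_coproducts \<kappa> C D \<longleftrightarrow> (\<forall>(I :: 'u set) N S \<iota>.
    small \<kappa> I \<and> (\<forall>i\<in>I. N i \<in> D) \<and> is_coproduct C I N S \<iota> \<longrightarrow> S \<in> D)"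

definition closed_products :: "'u rel \<Rightarrow> ('o, 'm, 'z) category_scheme \<Rightarrow> 'o set \<Rightarrow> bool"
  where "closed_products \<kappa> C D \<longleftrightarrow> (\<forall>(I :: 'u set) N S \<pi>.
    small \<kappa> I \<and> (\<forall>i\<in>I. N i \<in> D) \<and> is_product C I N S \<pi> \<longrightarrow> S \<in> D)"

definition essentially_small :: "'u rel \<Rightarrow> ('o, 'm, 'z) category_scheme \<Rightarrow> 'o set \<Rightarrow> bool"
  where "essentially_small \<kappa> C D \<longleftrightarrow>
    (\<exists>R\<subseteq>D. small \<kappa> R \<and> (\<forall>X\<in>D. \<exists>Y\<in>R. isomorphic C X Y))"

definition simple_object :: "('o, 'm, 'z) category_scheme \<Rightarrow> 'o \<Rightarrow> bool"
  where "simple_object C X \<longleftrightarrow> X \<in> Ob C \<and> \<not> zero_object C X \<and>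
    (\<forall>Y\<in>Ob C. \<forall>f. is_mono C Y X f \<longrightarrow> zero_object C Y \<or> is_iso C Y X f)"

definition semisimple :: "'u rel \<Rightarrow> ('o, 'm, 'z) category_scheme \<Rightarrow> bool"
  where "semisimple \<kappa> C \<longleftrightarrow> (\<forall>X\<in>Ob C. \<exists>(I :: 'u set) N \<iota>.
    small \<kappa> I \<and> (\<forall>i\<in>I. simple_object C (N i)) \<and> is_coproduct C I N X \<iota>)"


section \<open>Additive categories\<close>

record ('o, 'm) additive_category = "('o, 'm) category" +
  Add :: "'m \<Rightarrow> 'm \<Rightarrow> 'm"
  Zero :: "'o \<Rightarrow> 'o \<Rightarrow> 'm"

definition hom_group :: "('o, 'm, 'z) additive_category_scheme \<Rightarrow> 'o \<Rightarrow> 'o \<Rightarrow> 'm monoid"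
  where "hom_group C X Y = \<lparr>carrier = Hom C X Y, mult = Add C, one = Zero C X Y\<rparr>"

definition is_biproduct ::
    "('o, 'm, 'z) additive_category_scheme \<Rightarrow> 'o \<Rightarrow> 'o \<Rightarrow> 'o \<Rightarrow> bool"
  where "is_biproduct C X Y S \<longleftrightarrow> X \<in> Ob C \<and> Y \<in> Ob C \<and> S \<in> Ob C \<and>
    (\<exists>i\<in>Hom C X S. \<exists>j\<in>Hom C Y S. \<exists>p\<in>Hom C S X. \<exists>q\<in>Hom C S Y.
       p \<cdot>\<^bsub>C\<^esub> i = Ident C X \<and> q \<cdot>\<^bsub>C\<^esub> j = Ident C Y \<and>
       q \<cdot>\<^bsub>C\<^esub> i = Zero C X Y \<and> p \<cdot>\<^bsub>C\<^esub> j = Zero C Y X \<and>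
       Add C (i \<cdot>\<^bsub>C\<^esub> p) (j \<cdot>\<^bsub>C\<^esub> q) = Ident C S)"

locale additive_category = category C
  for C :: "('o, 'm, 'z) additive_category_scheme" (structure) +
  assumes hom_group: "\<lbrakk>X \<in> Ob C; Y \<in> Ob C\<rbrakk> \<Longrightarrow> comm_group (hom_group C X Y)"
    and Comp_Add: "\<lbrakk>f \<in> Hom C X Y; f' \<in> Hom C X Y; g \<in> Hom C Y Z\<rbrakk>
      \<Longrightarrow> g \<cdot> Add C f f' = Add C (g \<cdot> f) (g \<cdot> f')"
    and Add_Comp: "\<lbrakk>f \<in> Hom C X Y; g \<in> Hom C Y Z; g' \<in> Hom C Y Z\<rbrakk>
      \<Longrightarrow> Add C g g' \<cdot> f = Add C (g \<cdot> f) (g' \<cdot> f)"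
    and ex_zero: "\<exists>Z. zero_object C Z"
    and ex_biproduct: "\<lbrakk>X \<in> Ob C; Y \<in> Ob C\<rbrakk> \<Longrightarrow> \<exists>S. is_biproduct C X Y S"

definition additive_class :: "('o, 'm, 'z) additive_category_scheme \<Rightarrow> 'o set \<Rightarrow> bool"
  where "additive_class C D \<longleftrightarrow> D \<subseteq> Ob C \<and> (\<forall>Z. zero_object C Z \<longrightarrow> Z \<in> D) \<and>
    (\<forall>X\<in>D. \<forall>Y\<in>D. \<forall>S. is_biproduct C X Y S \<longrightarrow> S \<in> D)"

text \<open>Subcategories are strictly full, hence given by classes of objects closed under isomorphism.\<close>

definition additive_subcategory :: "('o, 'm, 'z) additive_category_scheme \<Rightarrow> 'o set \<Rightarrow> bool"
  where "additive_subcategory C D \<longleftrightarrow> additive_class C D \<and> closed_iso C D"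

definition perp :: "('o, 'm, 'z) additive_category_scheme \<Rightarrow> 'o set \<Rightarrow> 'o set \<Rightarrow> bool"
  where "perp C D E \<longleftrightarrow> (\<forall>X\<in>D. \<forall>Y\<in>E. Hom C X Y = {Zero C X Y})"

definition right_perp :: "('o, 'm, 'z) additive_category_scheme \<Rightarrow> 'o set \<Rightarrow> 'o set"
  where "right_perp C D = {Y \<in> Ob C. perp C D {Y}}"


section \<open>The category of additive functors to abelian groups\<close>

type_synonym ('o, 'm, 'u) ab_functor = "('o \<Rightarrow> 'u monoid) \<times> ('m \<Rightarrow> 'u \<Rightarrow> 'u)"

definition additive_functor ::
    "'u rel \<Rightarrow> ('o, 'm, 'z) additive_category_scheme \<Rightarrow> ('o, 'm, 'u) ab_functor \<Rightarrow> bool"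
  where "additive_functor \<kappa> A F \<longleftrightarrow>
    (\<forall>X\<in>Ob A. comm_group (fst F X) \<and> small \<kappa> (carrier (fst F X))) \<and>
    (\<forall>f\<in>Arr A. snd F f \<in> hom (fst F (Src A f)) (fst F (Tgt A f))) \<and>
    (\<forall>X\<in>Ob A. \<forall>x\<in>carrier (fst F X). snd F (Ident A X) x = x) \<and>
    (\<forall>f\<in>Arr A. \<forall>g\<in>Arr A. Tgt A f = Src A g \<longrightarrow>
       (\<forall>x\<in>carrier (fst F (Src A f)). snd F (g \<cdot>\<^bsub>A\<^esub> f) x = snd F g (snd F f x))) \<and>
    (\<forall>f\<in>Arr A. \<forall>g\<in>Arr A. Src A f = Src A g \<and> Tgt A f = Tgt A g \<longrightarrow>
       (\<forall>x\<in>carrier (fst F (Src A f)).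
          snd F (Add A f g) x = snd F f x \<otimes>\<^bsub>fst F (Tgt A f)\<^esub> snd F g x))"

text \<open>
  A natural transformation is bundled with its source and target, and its components are
  undefined off the objects and carriers, so that equality of transformations is equality of all
  components.
\<close>

type_synonym ('o, 'm, 'u) ab_transf =
  "('o, 'm, 'u) ab_functor \<times> ('o, 'm, 'u) ab_functor \<times> ('o \<Rightarrow> 'u \<Rightarrow> 'u)"

definition nat_transf ::
    "('o, 'm, 'z) additive_category_scheme \<Rightarrow> ('o, 'm, 'u) ab_functor \<Rightarrow> ('o, 'm, 'u) ab_functor
      \<Rightarrow> ('o \<Rightarrow> 'u \<Rightarrow> 'u) \<Rightarrow> bool"
  where "nat_transf A F G \<eta> \<longleftrightarrow> \<eta> \<in> extensional (Ob A) \<and>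
    (\<forall>X\<in>Ob A. \<eta> X \<in> hom (fst F X) (fst G X) \<and> \<eta> X \<in> extensional (carrier (fst F X))) \<and>
    (\<forall>f\<in>Arr A. \<forall>x\<in>carrier (fst F (Src A f)).
       \<eta> (Tgt A f) (snd F f x) = snd G f (\<eta> (Src A f) x))"

definition AddFun ::
    "'u rel \<Rightarrow> ('o, 'm, 'z) additive_category_scheme
      \<Rightarrow> (('o, 'm, 'u) ab_functor, ('o, 'm, 'u) ab_transf) category"
  where "AddFun \<kappa> A = \<lparr>
    Ob = {F. additive_functor \<kappa> A F},
    Arr = {(F, G, \<eta>). additive_functor \<kappa> A F \<and> additive_functor \<kappa> A G \<and> nat_transf A F G \<eta>},
    Src = (\<lambda>(F, G, \<eta>). F),
    Tgt = (\<lambda>(F, G, \<eta>). G),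
    Ident = (\<lambda>F. (F, F, \<lambda>X\<in>Ob A. \<lambda>x\<in>carrier (fst F X). x)),
    Comp = (\<lambda>(G', H, \<theta>) (F, G, \<eta>).
      (F, H, \<lambda>X\<in>Ob A. \<lambda>x\<in>carrier (fst F X). \<theta> X (\<eta> X x)))\<rparr>"


section \<open>Triangulated categories\<close>

record ('o, 'm) triangulated_category = "('o, 'm) additive_category" +
  Shift :: "'o \<Rightarrow> 'o"
  ShiftA :: "'m \<Rightarrow> 'm"
  Tri :: "('m \<times> 'm \<times> 'm) set"

definition triangle ::
    "('o, 'm, 'z) triangulated_category_scheme \<Rightarrow> 'o \<Rightarrow> 'o \<Rightarrow> 'o \<Rightarrow> 'm \<Rightarrow> 'm \<Rightarrow> 'm \<Rightarrow> bool"
  where "triangle C X Y Z f g h \<longleftrightarrow>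
    f \<in> Hom C X Y \<and> g \<in> Hom C Y Z \<and> h \<in> Hom C Z (Shift C X) \<and> (f, g, h) \<in> Tri C"

definition neg_shift :: "('o, 'm, 'z) triangulated_category_scheme \<Rightarrow> 'o \<Rightarrow> 'o \<Rightarrow> 'm \<Rightarrow> 'm"
  where "neg_shift C X Y f = inv\<^bsub>hom_group C (Shift C X) (Shift C Y)\<^esub> (ShiftA C f)"

locale triangulated_category = additive_category C
  for C :: "('o, 'm, 'z) triangulated_category_scheme" (structure) +
  assumes Shift_bij: "bij_betw (Shift C) (Ob C) (Ob C)"
    and ShiftA_bij: "\<lbrakk>X \<in> Ob C; Y \<in> Ob C\<rbrakk>
      \<Longrightarrow> bij_betw (ShiftA C) (Hom C X Y) (Hom C (Shift C X) (Shift C Y))"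
    and ShiftA_Ident: "X \<in> Ob C \<Longrightarrow> ShiftA C (Ident C X) = Ident C (Shift C X)"
    and ShiftA_Comp: "\<lbrakk>f \<in> Hom C X Y; g \<in> Hom C Y Z\<rbrakk>
      \<Longrightarrow> ShiftA C (g \<cdot> f) = ShiftA C g \<cdot> ShiftA C f"
    and ShiftA_Add: "\<lbrakk>f \<in> Hom C X Y; g \<in> Hom C X Y\<rbrakk>
      \<Longrightarrow> ShiftA C (Add C f g) = Add C (ShiftA C f) (ShiftA C g)"
    and Tri_triangle: "(f, g, h) \<in> Tri C \<Longrightarrow> \<exists>X Y Z. triangle C X Y Z f g h"
    and Tri_iso: "\<lbrakk>triangle C X Y Z f g h;
        f' \<in> Hom C X' Y'; g' \<in> Hom C Y' Z'; h' \<in> Hom C Z' (Shift C X');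
        is_iso C X X' a; is_iso C Y Y' b; is_iso C Z Z' c;
        b \<cdot> f = f' \<cdot> a; c \<cdot> g = g' \<cdot> b; ShiftA C a \<cdot> h = h' \<cdot> c\<rbrakk>
      \<Longrightarrow> triangle C X' Y' Z' f' g' h'"
    and Tri_Ident: "\<lbrakk>X \<in> Ob C; zero_object C Z\<rbrakk>
      \<Longrightarrow> triangle C X X Z (Ident C X) (Zero C X Z) (Zero C Z (Shift C X))"
    and ex_cone: "f \<in> Hom C X Y \<Longrightarrow> \<exists>Z g h. triangle C X Y Z f g h"
    and Tri_rotate: "\<lbrakk>f \<in> Hom C X Y; g \<in> Hom C Y Z; h \<in> Hom C Z (Shift C X)\<rbrakk>
      \<Longrightarrow> triangle C X Y Z f g h \<longleftrightarrow> triangle C Y Z (Shift C X) g h (neg_shift C X Y f)"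
    and Tri_morphism: "\<lbrakk>triangle C X Y Z f g h; triangle C X' Y' Z' f' g' h';
        a \<in> Hom C X X'; b \<in> Hom C Y Y'; b \<cdot> f = f' \<cdot> a\<rbrakk>
      \<Longrightarrow> \<exists>c\<in>Hom C Z Z'. c \<cdot> g = g' \<cdot> b \<and> ShiftA C a \<cdot> h = h' \<cdot> c"
    and octahedron: "\<lbrakk>triangle C X Y Z' f f' f''; triangle C Y Z X' g g' g'';
        triangle C X Z Y' (g \<cdot> f) h' h''\<rbrakk>
      \<Longrightarrow> \<exists>u v. triangle C Z' Y' X' u v (ShiftA C f' \<cdot> g'') \<and>
            u \<cdot> f' = h' \<cdot> g \<and> h'' \<cdot> u = f'' \<and> v \<cdot> h' = g' \<and> g'' \<cdot> v = ShiftA C f \<cdot> h''"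

definition shift :: "('o, 'm, 'z) triangulated_category_scheme \<Rightarrow> int \<Rightarrow> 'o \<Rightarrow> 'o"
  where "shift C n =
    (if 0 \<le> n then Shift C ^^ nat n else inv_into (Ob C) (Shift C) ^^ nat (- n))"

text \<open>
  \<open>shifts C N D\<close> is the union of the \<open>D[i]\<close> for \<open>i \<in> N\<close>.
\<close>

definition shifts :: "('o, 'm, 'z) triangulated_category_scheme \<Rightarrow> int set \<Rightarrow> 'o set \<Rightarrow> 'o set"
  where "shifts C N D = (\<Union>i\<in>N. shift C i ` D)"

definition full_subcategory ::
    "('o, 'm, 'z) triangulated_category_scheme \<Rightarrow> 'o set \<Rightarrow> ('o, 'm, 'z) triangulated_category_scheme"
  where "full_subcategory C D = C\<lparr>
    Ob := D,
    Arr := {f \<in> Arr C. Src C f \<in> D \<and> Tgt C f \<in> D},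
    Tri := {(f, g, h). \<exists>X\<in>D. \<exists>Y\<in>D. \<exists>Z\<in>D. triangle C X Y Z f g h}\<rparr>"

definition triangulated_subcategory ::
    "('o, 'm, 'z) triangulated_category_scheme \<Rightarrow> 'o set \<Rightarrow> bool"
  where "triangulated_subcategory C D \<longleftrightarrow> additive_subcategory C D \<and>
    shift C 1 ` D \<subseteq> D \<and> shift C (- 1) ` D \<subseteq> D \<and>
    (\<forall>X\<in>D. \<forall>Y\<in>D. \<forall>Z f g h. triangle C X Y Z f g h \<longrightarrow> Z \<in> D)"

definition closed_extensions :: "('o, 'm, 'z) triangulated_category_scheme \<Rightarrow> 'o set \<Rightarrow> bool"
  where "closed_extensions C D \<longleftrightarrow>
    (\<forall>X\<in>D. \<forall>Z\<in>D. \<forall>Y f g h. triangle C X Y Z f g h \<longrightarrow> Y \<in> D)"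

definition envelope :: "('o, 'm, 'z) triangulated_category_scheme \<Rightarrow> 'o set \<Rightarrow> 'o set"
  where "envelope C P =
    \<Inter>{D. P \<subseteq> D \<and> additive_class C D \<and> closed_retracts C D \<and> closed_extensions C D}"


section \<open>Small and compact objects\<close>

text \<open>
  Direct limit in sets of a system \<open>G\<close> indexed by a directed set \<open>\<J>\<close> of sets ordered by inclusion,
  with transition maps \<open>\<phi>\<close>. A limit of groups has the same underlying set, and a group
  homomorphism is an isomorphism iff it is bijective.
\<close>

definition dirlim_rel ::
    "'i set set \<Rightarrow> ('i set \<Rightarrow> 'a set) \<Rightarrow> ('i set \<Rightarrow> 'i set \<Rightarrow> 'a \<Rightarrow> 'a) \<Rightarrow> ('i set \<times> 'a) rel"
  where "dirlim_rel \<J> G \<phi> = {((J, x), (K, y)). (J, x) \<in> Sigma \<J> G \<and> (K, y) \<in> Sigma \<J> G \<and>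
    (\<exists>L\<in>\<J>. J \<subseteq> L \<and> K \<subseteq> L \<and> \<phi> J L x = \<phi> K L y)}"

definition dirlim ::
    "'i set set \<Rightarrow> ('i set \<Rightarrow> 'a set) \<Rightarrow> ('i set \<Rightarrow> 'i set \<Rightarrow> 'a \<Rightarrow> 'a) \<Rightarrow> ('i set \<times> 'a) set set"
  where "dirlim \<J> G \<phi> = Sigma \<J> G // dirlim_rel \<J> G \<phi>"

text \<open>The map out of the direct limit induced by a compatible family of maps \<open>\<psi> J\<close> on \<open>G J\<close>.\<close>

definition dirlim_map :: "('i set \<Rightarrow> 'a \<Rightarrow> 'b) \<Rightarrow> ('i set \<times> 'a) set \<Rightarrow> 'b"
  where "dirlim_map \<psi> c = the_elem ((\<lambda>(J, x). \<psi> J x) ` c)"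

text \<open>
  If \<open>S J\<close> with injections \<open>\<iota> J\<close> is a coproduct of \<open>N j\<close>, \<open>j \<in> J\<close>, for each \<open>J\<close>, this is the canonical
  arrow from \<open>S J\<close> to \<open>S K\<close> for \<open>J \<subseteq> K\<close>.
\<close>

definition coproduct_incl ::
    "('o, 'm, 'z) category_scheme \<Rightarrow> ('i set \<Rightarrow> 'o) \<Rightarrow> ('i set \<Rightarrow> 'i \<Rightarrow> 'm) \<Rightarrow> 'i set \<Rightarrow> 'i set \<Rightarrow> 'm"
  where "coproduct_incl C S \<iota> J K = (THE h. h \<in> Hom C (S J) (S K) \<and> (\<forall>j\<in>J. h \<cdot>\<^bsub>C\<^esub> \<iota> J j = \<iota> K j))"

definition small_object ::
    "'u rel \<Rightarrow> 'c rel \<Rightarrow> ('o, 'm, 'z) category_scheme \<Rightarrow> 'o \<Rightarrow> bool"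
  where "small_object \<kappa> \<alpha> C M \<longleftrightarrow> M \<in> Ob C \<and>
    (\<forall>(I :: 'u set) N S \<iota>. small \<kappa> I \<and> (\<forall>J\<subseteq>I. is_coproduct C J N (S J) (\<iota> J)) \<longrightarrow>
       bij_betw
         (dirlim_map (\<lambda>J f. coproduct_incl C S \<iota> J I \<cdot>\<^bsub>C\<^esub> f))
         (dirlim {J. J \<subseteq> I \<and> |J| <o \<alpha>} (\<lambda>J. Hom C M (S J))
            (\<lambda>J K f. coproduct_incl C S \<iota> J K \<cdot>\<^bsub>C\<^esub> f))
         (Hom C M (S I)))"

definition small_objects ::
    "'u rel \<Rightarrow> 'c rel \<Rightarrow> ('o, 'm, 'z) category_scheme \<Rightarrow> 'o set"
  where "small_objects \<kappa> \<alpha> C = {M. small_object \<kappa> \<alpha> C M}"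

definition compact_objects :: "'u rel \<Rightarrow> ('o, 'm, 'z) category_scheme \<Rightarrow> 'o set"
  where "compact_objects \<kappa> C = small_objects \<kappa> natLeq C"

definition compactly_generates ::
    "'u rel \<Rightarrow> ('o, 'm, 'z) triangulated_category_scheme \<Rightarrow> 'o set \<Rightarrow> bool"
  where "compactly_generates \<kappa> C A \<longleftrightarrow> essentially_small \<kappa> C A \<and> A \<subseteq> compact_objects \<kappa> C \<and>
    \<Inter>{D. triangulated_subcategory C D \<and> A \<subseteq> D \<and> closed_coproducts \<kappa> C D} = Ob C"


section \<open>Weight structures and t-structures\<close>

definition weight_structure ::
    "('o, 'm, 'z) triangulated_category_scheme \<Rightarrow> 'o set \<Rightarrow> 'o set \<Rightarrow> bool"
  where "weight_structure C wle wge \<longleftrightarrow> wle \<subseteq> Ob C \<and> wge \<subseteq> Ob C \<and>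
    closed_retracts C wle \<and> closed_retracts C wge \<and>
    wle \<subseteq> shift C 1 ` wle \<and> shift C 1 ` wge \<subseteq> wge \<and>
    perp C wle (shift C 1 ` wge) \<and>
    (\<forall>M\<in>Ob C. \<exists>L\<in>wle. \<exists>R\<in>shift C 1 ` wge. \<exists>f g h. triangle C L M R f g h)"

definition smashing_weight_structure ::
    "'u rel \<Rightarrow> ('o, 'm, 'z) triangulated_category_scheme \<Rightarrow> 'o set \<Rightarrow> 'o set \<Rightarrow> bool"
  where "smashing_weight_structure \<kappa> C wle wge \<longleftrightarrow>
    weight_structure C wle wge \<and> smashing \<kappa> C \<and> closed_coproducts \<kappa> C wge"

definition cosmashing_weight_structure ::
    "'u rel \<Rightarrow> ('o, 'm, 'z) triangulated_category_scheme \<Rightarrow> 'o set \<Rightarrow> 'o set \<Rightarrow> bool"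
  where "cosmashing_weight_structure \<kappa> C wle wge \<longleftrightarrow>
    weight_structure C wle wge \<and> cosmashing \<kappa> C \<and> closed_products \<kappa> C wle"

definition t_structure ::
    "('o, 'm, 'z) triangulated_category_scheme \<Rightarrow> 'o set \<Rightarrow> 'o set \<Rightarrow> bool"
  where "t_structure C tle tge \<longleftrightarrow> tle \<subseteq> Ob C \<and> tge \<subseteq> Ob C \<and>
    closed_iso C tle \<and> closed_iso C tge \<and>
    tle \<subseteq> shift C 1 ` tle \<and> shift C 1 ` tge \<subseteq> tge \<and>
    perp C (shift C 1 ` tge) tle \<and>
    (\<forall>M\<in>Ob C. \<exists>L\<in>tge. \<exists>R\<in>shift C (- 1) ` tle. \<exists>f g h. triangle C L M R f g h)"

definition t_restricts ::
    "('o, 'm, 'z) triangulated_category_scheme \<Rightarrow> 'o set \<Rightarrow> 'o set \<Rightarrow> 'o set \<Rightarrow> bool"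
  where "t_restricts C tle tge D \<longleftrightarrow> triangulated_subcategory C D \<and>
    t_structure (full_subcategory C D) (tle \<inter> D) (tge \<inter> D)"

text \<open>Generation by \<open>P\<close> only involves one of the two classes, which determines the other.\<close>

definition generates_weight ::
    "('o, 'm, 'z) triangulated_category_scheme \<Rightarrow> 'o set \<Rightarrow> 'o set \<Rightarrow> bool"
  where "generates_weight C P wge \<longleftrightarrow> wge = right_perp C (shifts C {..<0} P)"

definition generates_t ::
    "('o, 'm, 'z) triangulated_category_scheme \<Rightarrow> 'o set \<Rightarrow> 'o set \<Rightarrow> bool"
  where "generates_t C P tle \<longleftrightarrow> tle = right_perp C (shifts C {0<..} P)"

definition right_adjacent ::
    "('o, 'm, 'z) triangulated_category_scheme \<Rightarrow> 'o set \<Rightarrow> 'o set \<Rightarrow> 'o set \<Rightarrow> 'o set \<Rightarrow> bool"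
  where "right_adjacent C wle wge tle tge \<longleftrightarrow>
    perp C (shift C 1 ` tge) wle \<and> perp C (shift C (- 1) ` tle) wge"

end

theory Submission
  imports Defs
begin

text \<open>
  Write \<open>H i M\<close> for the functor \<open>Hom(A[i], M)\<close> on \<open>A\<close>. The class of objects with \<open>H i = 0\<close> for \<open>i > 0\<close> is
  \<open>tle\<close>, that with \<open>H i = 0\<close> for \<open>i < 0\<close> is \<open>wge\<close>, and \<open>wle\<close> and \<open>tge\<close> are the left orthogonals of
  \<open>wge[1]\<close> and of \<open>tle[-1]\<close>.

  Both structures exist for any essentially small class of compact generators, by attaching cells. For a
  class \<open>G\<close> of compact objects, \<open>cellular_approximation\<close> builds a homotopy colimit of iterated extensions of
  coproducts of objects of \<open>G\<close>, with a map to \<open>M\<close> whose cone receives no maps from \<open>G\<close>. With \<open>G\<close> the union of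
  the \<open>A[i]\<close> for \<open>i \<le> 0\<close> this is a weight decomposition, with \<open>i \<ge> 0\<close> a t-decomposition, and with all \<open>i\<close> it
  proves Brown representability; the latter gives products and splits idempotents.

  The point is that \<open>wle = tle\<close>. One inclusion holds since there are no maps from \<open>A\<close> to \<open>A[i]\<close> for \<open>i < 0\<close>. The
  other one uses semisimplicity. Every functor \<open>H 0 M\<close> is isomorphic to \<open>H 0 P\<close> for a direct summand \<open>P\<close> of
  a coproduct of objects of \<open>A\<close>, by a map \<open>P \<rightarrow> M\<close> (\<open>heart_cover\<close>). Taking the cone of this map and of a cellular
  approximation in negative degrees, one continues every \<open>M\<close> in \<open>tle\<close> to a sequence in \<open>tle\<close> with transition
  maps that are zero on all \<open>H i\<close> (\<open>kill_homology\<close>). A map from \<open>M\<close> to \<open>wge[1]\<close> extends along the sequence to its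
  homotopy colimit, which is zero since \<open>A\<close> generates; so it vanishes.

  The hypothesis is about covariant functors on \<open>A\<close>, while \<open>H 0 M\<close> is contravariant. To switch sides, subfunctors
  of \<open>Hom(a, -)\<close> are shown to be generated by idempotents; so \<open>A\<close> is von Neumann regular and has no infinite
  sequences of nonzero orthogonal idempotents in an endomorphism ring, and both properties are symmetric
  (\<open>right_ideal_idempotent\<close>).

  For the restriction to \<open>\<alpha>\<close>-small objects let \<open>R\<close> be the truncation of a small \<open>M\<close>. By \<open>wle = tle\<close> maps from
  \<open>R\<close> to a coproduct lift to the coproduct of the weight truncations, which lies in \<open>tle\<close> up to a shift, where
  maps from \<open>R\<close> are determined by maps from \<open>M\<close> (\<open>truncation_small\<close>). Finally, a map from a compact object to
  a cellular object factors through a finite extension of cells (\<open>cellular_factor\<close>), which identifies the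
  compact parts with envelopes.
\<close>

section \<open>Small sets\<close>

lemma small_subset: "small \<kappa> B \<Longrightarrow> A \<subseteq> B \<Longrightarrow> small \<kappa> A"
  unfolding small_def using card_of_mono1 ordLeq_ordLess_trans by blast

lemma small_image: "small \<kappa> A \<Longrightarrow> small \<kappa> (f ` A)"
  unfolding small_def using card_of_image ordLeq_ordLess_trans by blast

lemma small_inj: "inj_on f A \<Longrightarrow> small \<kappa> (f ` A) \<Longrightarrow> small \<kappa> A"
  using small_image[of \<kappa> "f ` A" "inv_into A f"] by simp

locale universe =
  fixes \<kappa> :: "'u rel"
  assumes inacc: "inaccessible \<kappa>"
begin

lemma Cinfinite: "Cinfinite \<kappa>"
proof -
  have "natLeq \<le>o \<kappa>" using inacc ordLess_imp_ordLeq by (auto simp: inaccessible_def)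
  then show ?thesis using inacc natLeq_Cinfinite cinfinite_mono
    by (auto simp: inaccessible_def)
qed

lemma small_nat: "small \<kappa> (N :: nat set)"
  by (meson card_of_nat inacc inaccessible_def ordIso_ordLess_trans small_def small_subset subset_UNIV)

lemma small_finite: "finite A \<Longrightarrow> small \<kappa> A"
  by (metis finite_imp_nat_seg_image_inj_on small_image small_nat)

lemma small_UNION: "small \<kappa> I \<Longrightarrow> (\<And>i. i \<in> I \<Longrightarrow> small \<kappa> (B i)) \<Longrightarrow> small \<kappa> (\<Union>i\<in>I. B i)"
  unfolding small_def
  using card_of_UNION_ordLess_infinite_Field_regularCard[of \<kappa> I B] Cinfinite inacc
  by (auto simp: inaccessible_def)

lemma small_Sigma: "small \<kappa> I \<Longrightarrow> (\<And>i. i \<in> I \<Longrightarrow> small \<kappa> (B i)) \<Longrightarrow> small \<kappa> (Sigma I B)"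
proof -
  assume "small \<kappa> I" "\<And>i. i \<in> I \<Longrightarrow> small \<kappa> (B i)"
  then have "small \<kappa> (\<Union>i\<in>I. Pair i ` B i)" by (intro small_UNION small_image) auto
  moreover have "(\<Union>i\<in>I. Pair i ` B i) = Sigma I B" by auto
  ultimately show ?thesis by simp
qed

lemma small_encode:
  assumes "small \<kappa> S"
  obtains b :: "'a \<Rightarrow> 'u" where "inj_on b S"
proof -
  have "|S| \<le>o \<kappa>" using assms ordLess_imp_ordLeq by (auto simp: small_def)
  moreover have "\<kappa> =o |Field \<kappa>|"
    using inacc card_of_Field_ordIso ordIso_symmetric by (auto simp: inaccessible_def)
  ultimately have "|S| \<le>o |Field \<kappa>|" using ordLeq_ordIso_trans by blast
  then show thesis using that by (auto simp: card_of_ordLeq[symmetric])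
qed

text \<open>
  The power set axiom of the universe is only about subsets of \<open>'u\<close>; other small sets are coded in \<open>'u\<close>.
\<close>

lemma small_Pow:
  assumes "small \<kappa> (S :: 'a set)"
  shows "small \<kappa> (Pow S)"
proof -
  obtain b :: "'a \<Rightarrow> 'u" where b: "inj_on b S" using small_encode[OF assms] .
  have "small \<kappa> (Pow (b ` S))" using inacc small_image[OF assms] by (auto simp: inaccessible_def)
  then have "small \<kappa> ((`) b ` Pow S)" by (simp add: image_Pow_surj)
  then show ?thesis using small_inj inj_on_image_Pow[OF b] by blast
qed

text \<open>A choice function is determined by its graph, a subset of a small set.\<close>

lemma small_PiE:
  assumes "small \<kappa> I" "\<And>i. i \<in> I \<Longrightarrow> small \<kappa> (B i)"
  shows "small \<kappa> (Pi\<^sub>E I B)"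
proof (rule small_inj)
  show "inj_on (\<lambda>f. {(i, f i) | i. i \<in> I}) (Pi\<^sub>E I B)"
  proof (rule inj_onI)
    fix f g assume fg: "f \<in> Pi\<^sub>E I B" "g \<in> Pi\<^sub>E I B"
      and eq: "{(i, f i) | i. i \<in> I} = {(i, g i) | i. i \<in> I}"
    have "f i = g i" if "i \<in> I" for i
    proof -
      have "(i, f i) \<in> {(i, g i) | i. i \<in> I}" using that unfolding eq[symmetric] by blast
      then show ?thesis by blast
    qed
    then show "f = g" using fg by (rule PiE_ext[rotated 2])
  qed
  have "(\<lambda>f. {(i, f i) | i. i \<in> I}) ` Pi\<^sub>E I B \<subseteq> Pow (Sigma I B)" by (auto simp: PiE_iff)
  then show "small \<kappa> ((\<lambda>f. {(i, f i) | i. i \<in> I}) ` Pi\<^sub>E I B)"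
    using small_subset[OF small_Pow[OF small_Sigma[OF assms]]] by simp
qed

end


section \<open>Arrows and coproducts\<close>

context category begin

lemma Hom_iff: "f \<in> Hom C X Y \<longleftrightarrow> f \<in> Arr C \<and> Src C f = X \<and> Tgt C f = Y \<and> X \<in> Ob C \<and> Y \<in> Ob C"
  using Src_Ob Tgt_Ob by (auto simp: Hom_def)

lemma Arr_Comp [simp]:
  assumes "f \<in> Arr C" "g \<in> Arr C" "Src C g = Tgt C f"
  shows "g \<cdot> f \<in> Arr C" "Src C (g \<cdot> f) = Src C f" "Tgt C (g \<cdot> f) = Tgt C g"
  using Comp_Hom[of f "Src C f" "Tgt C f" g "Tgt C g"] assms by (auto simp: Hom_def)

lemma Arr_Ident [simp]:
  assumes "X \<in> Ob C"
  shows "Ident C X \<in> Arr C" "Src C (Ident C X) = X" "Tgt C (Ident C X) = X"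
  using Ident_Hom[OF assms] by (auto simp: Hom_def)

lemma Comp_Ident' [simp]: "f \<in> Arr C \<Longrightarrow> Src C f = X \<Longrightarrow> f \<cdot> Ident C X = f"
  using Comp_Ident[of f "Src C f" "Tgt C f"] by (auto simp: Hom_def)

lemma Ident_Comp' [simp]: "f \<in> Arr C \<Longrightarrow> Tgt C f = Y \<Longrightarrow> Ident C Y \<cdot> f = f"
  using Ident_Comp[of f "Src C f" "Tgt C f"] by (auto simp: Hom_def)

lemma Comp_assoc' [simp]:
  "\<lbrakk>f \<in> Arr C; g \<in> Arr C; h \<in> Arr C; Src C g = Tgt C f; Src C h = Tgt C g\<rbrakk>
    \<Longrightarrow> (h \<cdot> g) \<cdot> f = h \<cdot> (g \<cdot> f)"
  using Comp_assoc[of f "Src C f" "Tgt C f" g "Tgt C g" h "Tgt C h"] by (auto simp: Hom_def)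

lemma Hom_Ob: "f \<in> Hom C X Y \<Longrightarrow> X \<in> Ob C \<and> Y \<in> Ob C"
  by (simp add: Hom_iff)

lemma isomorphicE:
  assumes "isomorphic C X Y"
  obtains f g where "f \<in> Hom C X Y" "g \<in> Hom C Y X" "g \<cdot> f = Ident C X" "f \<cdot> g = Ident C Y"
  using assms by (auto simp: isomorphic_def is_iso_def)

lemma isomorphicI:
  "\<lbrakk>f \<in> Hom C X Y; g \<in> Hom C Y X; g \<cdot> f = Ident C X; f \<cdot> g = Ident C Y\<rbrakk> \<Longrightarrow> isomorphic C X Y"
  using Hom_Ob unfolding isomorphic_def is_iso_def by blast

lemma isomorphic_is_retract: "isomorphic C X Y \<Longrightarrow> is_retract C Y X"
  using Hom_Ob unfolding isomorphic_def is_iso_def is_retract_def by blast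

lemma closed_retracts_iso: "closed_retracts C D \<Longrightarrow> closed_iso C D"
  using isomorphic_is_retract by (auto simp: closed_retracts_def closed_iso_def)

lemma coproduct_D:
  assumes "is_coproduct C I N S \<iota>"
  shows "S \<in> Ob C" "i \<in> I \<Longrightarrow> N i \<in> Ob C" "i \<in> I \<Longrightarrow> \<iota> i \<in> Hom C (N i) S"
  using assms by (auto simp: is_coproduct_def)

definition copair :: "'i set \<Rightarrow> 'o \<Rightarrow> ('i \<Rightarrow> 'm) \<Rightarrow> 'o \<Rightarrow> ('i \<Rightarrow> 'm) \<Rightarrow> 'm"
  where "copair I S \<iota> T g = (THE h. h \<in> Hom C S T \<and> (\<forall>i\<in>I. h \<cdot> \<iota> i = g i))"

lemma copair:
  assumes "is_coproduct C I N S \<iota>" "T \<in> Ob C" "\<And>i. i \<in> I \<Longrightarrow> g i \<in> Hom C (N i) T"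
  shows copair_Hom: "copair I S \<iota> T g \<in> Hom C S T"
    and copair_Comp: "i \<in> I \<Longrightarrow> copair I S \<iota> T g \<cdot> \<iota> i = g i"
proof -
  have "\<exists>!h. h \<in> Hom C S T \<and> (\<forall>i\<in>I. h \<cdot> \<iota> i = g i)"
    using assms by (auto simp: is_coproduct_def)
  from theI'[OF this]
  show "copair I S \<iota> T g \<in> Hom C S T" "i \<in> I \<Longrightarrow> copair I S \<iota> T g \<cdot> \<iota> i = g i"
    by (auto simp: copair_def)
qed

lemma coproduct_eqI:
  assumes "is_coproduct C I N S \<iota>" "h \<in> Hom C S T" "h' \<in> Hom C S T"
    and "\<And>i. i \<in> I \<Longrightarrow> h \<cdot> \<iota> i = h' \<cdot> \<iota> i"
  shows "h = h'"
proof -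
  have "T \<in> Ob C" using assms(2) by (simp add: Hom_iff)
  moreover have "\<forall>i\<in>I. h \<cdot> \<iota> i \<in> Hom C (N i) T"
    using assms coproduct_D[OF assms(1)] by (auto simp: Hom_iff)
  ultimately have "\<exists>!k. k \<in> Hom C S T \<and> (\<forall>i\<in>I. k \<cdot> \<iota> i = h \<cdot> \<iota> i)"
    using assms(1) by (auto simp: is_coproduct_def)
  then show ?thesis using assms by metis
qed

lemma coproductI:
  assumes "S \<in> Ob C" "\<And>i. i \<in> I \<Longrightarrow> \<iota> i \<in> Hom C (N i) S"
    and "\<And>T g. T \<in> Ob C \<Longrightarrow> (\<And>i. i \<in> I \<Longrightarrow> g i \<in> Hom C (N i) T)
      \<Longrightarrow> \<exists>h \<in> Hom C S T. \<forall>i\<in>I. h \<cdot> \<iota> i = g i"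
    and "\<And>T h h'. \<lbrakk>h \<in> Hom C S T; h' \<in> Hom C S T; \<And>i. i \<in> I \<Longrightarrow> h \<cdot> \<iota> i = h' \<cdot> \<iota> i\<rbrakk> \<Longrightarrow> h = h'"
  shows "is_coproduct C I N S \<iota>"
  unfolding is_coproduct_def
proof (intro conjI ballI allI impI)
  fix T g assume "T \<in> Ob C" "\<forall>i\<in>I. g i \<in> Hom C (N i) T"
  then obtain h where "h \<in> Hom C S T" "\<forall>i\<in>I. h \<cdot> \<iota> i = g i" using assms(3)[of T g] by auto
  then show "\<exists>!h. h \<in> Hom C S T \<and> (\<forall>i\<in>I. h \<cdot> \<iota> i = g i)"
    using assms(4)[of _ T] by (intro ex1I[of _ h]) auto
qed (use assms in \<open>auto simp: Hom_iff\<close>)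

text \<open>
  Coproducts over small sets of any type, such as sets of pairs of an object and an arrow, are obtained
  from those indexed by subsets of \<open>'u\<close> by reindexing.
\<close>

lemma coproduct_reindex:
  assumes "is_coproduct C I N S \<iota>" "bij_betw b I' I"
  shows "is_coproduct C I' (\<lambda>i. N (b i)) S (\<lambda>i. \<iota> (b i))"
proof (rule coproductI)
  have b: "\<And>i. i \<in> I' \<Longrightarrow> b i \<in> I" and I: "I = b ` I'" and inj: "inj_on b I'"
    using assms(2) by (auto simp: bij_betw_def)
  show "S \<in> Ob C" "\<And>i. i \<in> I' \<Longrightarrow> \<iota> (b i) \<in> Hom C (N (b i)) S"
    using assms(1) b by (auto simp: is_coproduct_def)
  show "h = h'" if "h \<in> Hom C S T" "h' \<in> Hom C S T" "\<And>i. i \<in> I' \<Longrightarrow> h \<cdot> \<iota> (b i) = h' \<cdot> \<iota> (b i)"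
    for T h h'
    using coproduct_eqI[OF assms(1) that(1,2)] that(3) I by auto
  show "\<exists>h \<in> Hom C S T. \<forall>i\<in>I'. h \<cdot> \<iota> (b i) = g i"
    if T: "T \<in> Ob C" and g: "\<And>i. i \<in> I' \<Longrightarrow> g i \<in> Hom C (N (b i)) T" for T g
  proof -
    let ?g = "\<lambda>i. g (inv_into I' b i)"
    have "?g i \<in> Hom C (N i) T" if "i \<in> I" for i
      using that g[of "inv_into I' b i"] I by (auto simp: inv_into_into f_inv_into_f inj)
    from copair[OF assms(1) T this] show ?thesis using inj b
      by (intro bexI[of _ "copair I S \<iota> T ?g"]) auto
  qed
qed

lemma coproduct_cong:
  assumes "is_coproduct C I N S \<iota>" "\<And>i. i \<in> I \<Longrightarrow> N' i = N i" "\<And>i. i \<in> I \<Longrightarrow> \<iota>' i = \<iota> i"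
  shows "is_coproduct C I N' S \<iota>'"
  using assms by (auto simp: is_coproduct_def)

lemma closed_coproducts_any:
  fixes I :: "'i set" and \<kappa> :: "'u rel"
  assumes "inaccessible \<kappa>" "closed_coproducts \<kappa> C D" "small \<kappa> I" "\<And>i. i \<in> I \<Longrightarrow> N i \<in> D"
    "is_coproduct C I N S \<iota>"
  shows "S \<in> D"
proof -
  interpret universe \<kappa> using assms(1) by (rule universe.intro)
  obtain b :: "'i \<Rightarrow> 'u" where b: "inj_on b I" using small_encode[OF assms(3)] .
  have "bij_betw (inv_into I b) (b ` I) I" using b by (simp add: bij_betw_inv_into inj_on_imp_bij_betw)
  from coproduct_reindex[OF assms(5) this]
  have "is_coproduct C (b ` I) (\<lambda>i. N (inv_into I b i)) S (\<lambda>i. \<iota> (inv_into I b i))" .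
  moreover have "\<forall>i\<in>b ` I. N (inv_into I b i) \<in> D" using b assms(4) by auto
  ultimately show ?thesis
    using assms(2)[unfolded closed_coproducts_def, rule_format,
        of "b ` I" "\<lambda>i. N (inv_into I b i)" S "\<lambda>i. \<iota> (inv_into I b i)"]
      small_image[OF assms(3), of b] by blast
qed

lemma smashing_any:
  fixes I :: "'i set" and \<kappa> :: "'u rel"
  assumes "inaccessible \<kappa>" "smashing \<kappa> C" "small \<kappa> I" "\<And>i. i \<in> I \<Longrightarrow> N i \<in> Ob C"
  obtains S \<iota> where "is_coproduct C I N S \<iota>"
proof -
  interpret universe \<kappa> using assms(1) by (rule universe.intro)
  obtain b :: "'i \<Rightarrow> 'u" where b: "inj_on b I" using small_encode[OF assms(3)] .
  have "\<forall>i\<in>b ` I. N (inv_into I b i) \<in> Ob C" using b assms(4) by auto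
  then have "\<exists>S \<iota>. is_coproduct C (b ` I) (\<lambda>i. N (inv_into I b i)) S \<iota>"
    using assms(2) small_image[OF assms(3), of b] unfolding smashing_def by simp
  then obtain S \<iota> where S: "is_coproduct C (b ` I) (\<lambda>i. N (inv_into I b i)) S \<iota>" by blast
  have "bij_betw b I (b ` I)" using b by (simp add: inj_on_imp_bij_betw)
  from coproduct_reindex[OF S this] have "is_coproduct C I N S (\<lambda>i. \<iota> (b i))"
    by (rule coproduct_cong) (use b in auto)
  then show thesis by (rule that)
qed

end

section \<open>Additive structure\<close>

context additive_category begin

abbreviation add :: "'m \<Rightarrow> 'm \<Rightarrow> 'm"  (infixl "\<oplus>" 65) where "f \<oplus> g \<equiv> Add C f g"
abbreviation zero :: "'o \<Rightarrow> 'o \<Rightarrow> 'm"  ("\<zero>") where "\<zero> X Y \<equiv> Zero C X Y"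

definition neg :: "'m \<Rightarrow> 'm"
  where "neg f = inv\<^bsub>hom_group C (Src C f) (Tgt C f)\<^esub> f"

definition diff :: "'m \<Rightarrow> 'm \<Rightarrow> 'm"  (infixl "\<ominus>" 65)
  where "f \<ominus> g = f \<oplus> neg g"

lemma Hom_group:
  assumes "X \<in> Ob C" "Y \<in> Ob C"
  shows "comm_group (hom_group C X Y)" "carrier (hom_group C X Y) = Hom C X Y"
    "f \<otimes>\<^bsub>hom_group C X Y\<^esub> g = f \<oplus> g" "\<one>\<^bsub>hom_group C X Y\<^esub> = \<zero> X Y"
  using hom_group[OF assms] by (auto simp: hom_group_def)

lemma Add_Hom: "f \<in> Hom C X Y \<Longrightarrow> g \<in> Hom C X Y \<Longrightarrow> f \<oplus> g \<in> Hom C X Y"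
  and Zero_Hom: "X \<in> Ob C \<Longrightarrow> Y \<in> Ob C \<Longrightarrow> \<zero> X Y \<in> Hom C X Y"
  and neg_Hom: "f \<in> Hom C X Y \<Longrightarrow> neg f \<in> Hom C X Y"
proof -
  show Z: "\<zero> X Y \<in> Hom C X Y" if XY: "X \<in> Ob C" "Y \<in> Ob C"
  proof -
    interpret G: comm_group "hom_group C X Y" using XY Hom_group by blast
    show ?thesis using G.one_closed unfolding Hom_group(2-4)[OF XY] .
  qed
  show "f \<oplus> g \<in> Hom C X Y" if f: "f \<in> Hom C X Y" "g \<in> Hom C X Y"
  proof -
    have XY: "X \<in> Ob C" "Y \<in> Ob C" using f Hom_Ob by auto
    interpret G: comm_group "hom_group C X Y" using XY Hom_group by blast
    show ?thesis using G.m_closed[of f g] f unfolding Hom_group(2-4)[OF XY] by simp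
  qed
  show "neg f \<in> Hom C X Y" if f: "f \<in> Hom C X Y"
  proof -
    have XY: "X \<in> Ob C" "Y \<in> Ob C" using f Hom_Ob by auto
    interpret G: comm_group "hom_group C X Y" using XY Hom_group by blast
    have "neg f = inv\<^bsub>hom_group C X Y\<^esub> f" using f by (auto simp: Hom_iff neg_def)
    then show ?thesis using G.inv_closed[of f] f unfolding Hom_group(2-4)[OF XY] by simp
  qed
qed

lemma Arr_Zero [simp]:
  assumes "X \<in> Ob C" "Y \<in> Ob C"
  shows "\<zero> X Y \<in> Arr C" "Src C (\<zero> X Y) = X" "Tgt C (\<zero> X Y) = Y"
  using Zero_Hom[OF assms] by (auto simp: Hom_iff)

lemma Arr_Add [simp]:
  assumes "f \<in> Arr C" "g \<in> Arr C" "Src C f = Src C g" "Tgt C f = Tgt C g"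
  shows "f \<oplus> g \<in> Arr C" "Src C (f \<oplus> g) = Src C g" "Tgt C (f \<oplus> g) = Tgt C g"
  using Add_Hom[of f "Src C f" "Tgt C f" g] assms by (auto simp: Hom_def)

lemma Arr_neg [simp]:
  assumes "f \<in> Arr C"
  shows "neg f \<in> Arr C" "Src C (neg f) = Src C f" "Tgt C (neg f) = Tgt C f"
  using neg_Hom[of f "Src C f" "Tgt C f"] assms by (auto simp: Hom_def)

lemma Arr_diff [simp]:
  assumes "f \<in> Arr C" "g \<in> Arr C" "Src C f = Src C g" "Tgt C f = Tgt C g"
  shows "f \<ominus> g \<in> Arr C" "Src C (f \<ominus> g) = Src C g" "Tgt C (f \<ominus> g) = Tgt C g"
  using assms by (auto simp: diff_def)

lemma diff_Hom: "f \<in> Hom C X Y \<Longrightarrow> g \<in> Hom C X Y \<Longrightarrow> f \<ominus> g \<in> Hom C X Y"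
  by (auto simp: Hom_iff)

lemma group_laws:
  assumes "f \<in> Hom C X Y" "g \<in> Hom C X Y"
  shows "f \<oplus> g = g \<oplus> f" "\<zero> X Y \<oplus> f = f" "f \<oplus> neg f = \<zero> X Y"
    "h \<in> Hom C X Y \<Longrightarrow> (f \<oplus> g) \<oplus> h = f \<oplus> (g \<oplus> h)"
    "h \<in> Hom C X Y \<Longrightarrow> f \<oplus> h = g \<oplus> h \<Longrightarrow> f = g"
proof -
  have XY: "X \<in> Ob C" "Y \<in> Ob C" using assms(1) Hom_Ob by auto
  interpret G: comm_group "hom_group C X Y" using XY Hom_group by blast
  note G = Hom_group(2-4)[OF XY]
  have "neg f = inv\<^bsub>hom_group C X Y\<^esub> f" using assms by (simp add: neg_def Hom_iff)
  then show "f \<oplus> neg f = \<zero> X Y" using G.r_inv[of f] assms unfolding G by simp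
  show "f \<oplus> g = g \<oplus> f" using G.m_comm[of f g] assms unfolding G by simp
  show "\<zero> X Y \<oplus> f = f" using G.l_one[of f] assms unfolding G by simp
  show "h \<in> Hom C X Y \<Longrightarrow> (f \<oplus> g) \<oplus> h = f \<oplus> (g \<oplus> h)"
    using G.m_assoc[of f g h] assms unfolding G by simp
  show "h \<in> Hom C X Y \<Longrightarrow> f \<oplus> h = g \<oplus> h \<Longrightarrow> f = g"
    using G.right_cancel[of h f g] assms unfolding G by simp
qed

lemma Add_Zero:
  assumes "f \<in> Hom C X Y"
  shows "\<zero> X Y \<oplus> f = f" "f \<oplus> \<zero> X Y = f"
  using assms group_laws(1,2)[OF assms] Zero_Hom[of X Y] Hom_Ob by auto

lemma diff_add:
  assumes f: "f \<in> Hom C X Y" and g: "g \<in> Hom C X Y"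
  shows "(f \<ominus> g) \<oplus> g = f"
proof -
  have "(f \<oplus> neg g) \<oplus> g = f \<oplus> (neg g \<oplus> g)" using group_laws(4)[OF f neg_Hom[OF g] g] .
  also have "neg g \<oplus> g = \<zero> X Y" using group_laws(1)[OF neg_Hom[OF g] g] group_laws(3)[OF g g] by simp
  finally show ?thesis using Add_Zero(2)[OF f] by (simp add: diff_def)
qed

lemma add_diff:
  assumes f: "f \<in> Hom C X Y" and g: "g \<in> Hom C X Y"
  shows "(f \<oplus> g) \<ominus> g = f"
  using group_laws(4)[OF f g neg_Hom[OF g]] group_laws(3)[OF g g] Add_Zero(2)[OF f]
  by (simp add: diff_def)

lemma diff_self: "f \<in> Hom C X Y \<Longrightarrow> f \<ominus> f = \<zero> X Y"
  by (simp add: diff_def group_laws(3))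

lemma diff_Zero: "f \<in> Hom C X Y \<Longrightarrow> f \<ominus> \<zero> X Y = f"
  by (metis Add_Zero(2) Hom_Ob Zero_Hom add_diff)

lemma diff_eq_Zero: "f \<in> Hom C X Y \<Longrightarrow> g \<in> Hom C X Y \<Longrightarrow> f \<ominus> g = \<zero> X Y \<longleftrightarrow> f = g"
  by (metis Add_Zero(1) diff_add diff_self)

lemma idem_Zero: "f \<in> Hom C X Y \<Longrightarrow> f \<oplus> f = f \<Longrightarrow> f = \<zero> X Y"
  by (metis add_diff diff_self)

lemma Comp_Add' [simp]:
  "\<lbrakk>f \<in> Arr C; f' \<in> Arr C; g \<in> Arr C; Src C f = Src C f'; Tgt C f = Tgt C f'; Src C g = Tgt C f'\<rbrakk>
    \<Longrightarrow> g \<cdot> (f \<oplus> f') = (g \<cdot> f) \<oplus> (g \<cdot> f')"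
  by (rule Comp_Add[of _ "Src C f" "Tgt C f" _ _ "Tgt C g"]) (auto simp: Hom_def)

lemma Add_Comp' [simp]:
  "\<lbrakk>g \<in> Arr C; g' \<in> Arr C; f \<in> Arr C; Src C g = Src C g'; Tgt C g = Tgt C g'; Src C g' = Tgt C f\<rbrakk>
    \<Longrightarrow> (g \<oplus> g') \<cdot> f = (g \<cdot> f) \<oplus> (g' \<cdot> f)"
  by (rule Add_Comp[of _ "Src C f" "Src C g" _ "Tgt C g"]) (auto simp: Hom_def)

lemma Comp_Zero [simp]:
  assumes "g \<in> Arr C" "X \<in> Ob C" "Src C g = Y"
  shows "g \<cdot> \<zero> X Y = \<zero> X (Tgt C g)"
proof (rule idem_Zero)
  have Y: "Y \<in> Ob C" using assms Src_Ob by auto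
  show "g \<cdot> \<zero> X Y \<in> Hom C X (Tgt C g)" using assms Y by (auto simp: Hom_iff Tgt_Ob)
  have "\<zero> X Y \<oplus> \<zero> X Y = \<zero> X Y" using Add_Zero[OF Zero_Hom] assms(2) Y by blast
  then show "(g \<cdot> \<zero> X Y) \<oplus> (g \<cdot> \<zero> X Y) = g \<cdot> \<zero> X Y"
    using assms Y Comp_Add'[of "\<zero> X Y" "\<zero> X Y" g] by simp
qed

lemma Zero_Comp [simp]:
  assumes "f \<in> Arr C" "Z \<in> Ob C" "Tgt C f = Y"
  shows "\<zero> Y Z \<cdot> f = \<zero> (Src C f) Z"
proof (rule idem_Zero)
  have Y: "Y \<in> Ob C" using assms Tgt_Ob by auto
  show "\<zero> Y Z \<cdot> f \<in> Hom C (Src C f) Z" using assms Y by (auto simp: Hom_iff Src_Ob)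
  have "\<zero> Y Z \<oplus> \<zero> Y Z = \<zero> Y Z" using Add_Zero[OF Zero_Hom] assms(2) Y by blast
  then show "(\<zero> Y Z \<cdot> f) \<oplus> (\<zero> Y Z \<cdot> f) = \<zero> Y Z \<cdot> f"
    using assms Y Add_Comp'[of "\<zero> Y Z" "\<zero> Y Z" f] by simp
qed

lemma neg_unique: "f \<in> Hom C X Y \<Longrightarrow> g \<in> Hom C X Y \<Longrightarrow> f \<oplus> g = \<zero> X Y \<Longrightarrow> g = neg f"
  by (metis group_laws(1,3,5) neg_Hom)

lemma Comp_neg [simp]:
  assumes "f \<in> Arr C" "g \<in> Arr C" "Src C g = Tgt C f"
  shows "g \<cdot> neg f = neg (g \<cdot> f)"
proof (rule neg_unique[of _ "Src C f" "Tgt C g"])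
  have "g \<cdot> (f \<oplus> neg f) = (g \<cdot> f) \<oplus> (g \<cdot> neg f)" using assms by simp
  moreover have "f \<oplus> neg f = \<zero> (Src C f) (Tgt C f)"
    using group_laws(3)[of f "Src C f" "Tgt C f"] assms by (auto simp: Hom_def)
  ultimately show "(g \<cdot> f) \<oplus> (g \<cdot> neg f) = \<zero> (Src C f) (Tgt C g)" using assms Src_Ob by simp
qed (use assms in \<open>auto simp: Hom_def\<close>)

lemma neg_Comp [simp]:
  assumes "f \<in> Arr C" "g \<in> Arr C" "Src C g = Tgt C f"
  shows "neg g \<cdot> f = neg (g \<cdot> f)"
proof (rule neg_unique[of _ "Src C f" "Tgt C g"])
  have "(g \<oplus> neg g) \<cdot> f = (g \<cdot> f) \<oplus> (neg g \<cdot> f)" using assms by simp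
  moreover have "g \<oplus> neg g = \<zero> (Src C g) (Tgt C g)"
    using group_laws(3)[of g "Src C g" "Tgt C g"] assms by (auto simp: Hom_def)
  ultimately show "(g \<cdot> f) \<oplus> (neg g \<cdot> f) = \<zero> (Src C f) (Tgt C g)" using assms Tgt_Ob by simp
qed (use assms in \<open>auto simp: Hom_def\<close>)

lemma Comp_diff [simp]:
  "\<lbrakk>f \<in> Arr C; f' \<in> Arr C; g \<in> Arr C; Src C f = Src C f'; Tgt C f = Tgt C f'; Src C g = Tgt C f'\<rbrakk>
    \<Longrightarrow> g \<cdot> (f \<ominus> f') = (g \<cdot> f) \<ominus> (g \<cdot> f')"
  by (simp add: diff_def)

lemma diff_Comp [simp]:
  "\<lbrakk>g \<in> Arr C; g' \<in> Arr C; f \<in> Arr C; Src C g = Src C g'; Tgt C g = Tgt C g'; Src C g' = Tgt C f\<rbrakk>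
    \<Longrightarrow> (g \<ominus> g') \<cdot> f = (g \<cdot> f) \<ominus> (g' \<cdot> f)"
  by (simp add: diff_def)

lemma neg_neg: "f \<in> Hom C X Y \<Longrightarrow> neg (neg f) = f"
  by (metis group_laws(1,3) neg_Hom neg_unique)

lemma neg_inj: "f \<in> Hom C X Y \<Longrightarrow> g \<in> Hom C X Y \<Longrightarrow> neg f = neg g \<Longrightarrow> f = g"
  using neg_neg by metis

lemma neg_Zero: "X \<in> Ob C \<Longrightarrow> Y \<in> Ob C \<Longrightarrow> neg (\<zero> X Y) = \<zero> X Y"
  by (metis Add_Zero(1) Zero_Hom neg_unique)

lemma neg_eq_Zero: "f \<in> Hom C X Y \<Longrightarrow> neg f = \<zero> X Y \<longleftrightarrow> f = \<zero> X Y"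
  by (metis Hom_Ob neg_Zero neg_neg)

lemma zero_object_Ident: "X \<in> Ob C \<Longrightarrow> zero_object C X \<longleftrightarrow> Ident C X = \<zero> X X"
proof
  assume X: "X \<in> Ob C" "zero_object C X"
  then have "\<exists>!f. f \<in> Hom C X X" by (auto simp: zero_object_def)
  then show "Ident C X = \<zero> X X" using X Ident_Hom Zero_Hom by blast
next
  assume X: "X \<in> Ob C" "Ident C X = \<zero> X X"
  have *: "f = \<zero> Y X" if "f \<in> Hom C Y X" for f Y
    using Ident_Comp[OF that] X that Zero_Comp[of f X X] by (auto simp: Hom_iff)
  have **: "f = \<zero> X Y" if "f \<in> Hom C X Y" for f Y
    using Comp_Ident[OF that] X that Comp_Zero[of f X X] by (auto simp: Hom_iff)
  show "zero_object C X"
    unfolding zero_object_def using * ** X Zero_Hom by blast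
qed

lemma to_zero_object: "zero_object C Z \<Longrightarrow> f \<in> Hom C X Z \<Longrightarrow> f = \<zero> X Z"
  using Zero_Hom Hom_Ob unfolding zero_object_def by metis

lemma from_zero_object: "zero_object C Z \<Longrightarrow> f \<in> Hom C Z X \<Longrightarrow> f = \<zero> Z X"
  using Zero_Hom Hom_Ob unfolding zero_object_def by metis

text \<open>
  A map \<open>f\<close> into a coproduct factors through the summands with index in \<open>J\<close> if and only if
  \<open>restr J f = f\<close>. Smallness of objects is handled through these idempotents, so that no coproducts over
  subsets of the index set have to be chosen.
\<close>

definition restr :: "'i set \<Rightarrow> ('i \<Rightarrow> 'o) \<Rightarrow> 'o \<Rightarrow> ('i \<Rightarrow> 'm) \<Rightarrow> 'i set \<Rightarrow> 'm"
  where "restr I N S \<iota> J = copair I S \<iota> S (\<lambda>i. if i \<in> J then \<iota> i else \<zero> (N i) S)"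

definition cproj :: "'i set \<Rightarrow> ('i \<Rightarrow> 'o) \<Rightarrow> 'o \<Rightarrow> ('i \<Rightarrow> 'm) \<Rightarrow> 'i \<Rightarrow> 'm"
  where "cproj I N S \<iota> i =
    copair I S \<iota> (N i) (\<lambda>k. if k = i then Ident C (N i) else \<zero> (N k) (N i))"

context
  fixes I :: "'i set" and N S \<iota>
  assumes cop: "is_coproduct C I N S \<iota>"
begin

lemma restr_Hom: "restr I N S \<iota> J \<in> Hom C S S"
  and restr_in: "i \<in> I \<Longrightarrow> i \<in> J \<Longrightarrow> restr I N S \<iota> J \<cdot> \<iota> i = \<iota> i"
  and restr_notin: "i \<in> I \<Longrightarrow> i \<notin> J \<Longrightarrow> restr I N S \<iota> J \<cdot> \<iota> i = \<zero> (N i) S"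
proof -
  let ?g = "\<lambda>i. if i \<in> J then \<iota> i else \<zero> (N i) S"
  have g: "\<And>i. i \<in> I \<Longrightarrow> ?g i \<in> Hom C (N i) S" using coproduct_D[OF cop] Zero_Hom by auto
  note c = copair[OF cop coproduct_D(1)[OF cop] g, folded restr_def]
  show "restr I N S \<iota> J \<in> Hom C S S" using c by blast
  show "i \<in> I \<Longrightarrow> i \<in> J \<Longrightarrow> restr I N S \<iota> J \<cdot> \<iota> i = \<iota> i"
    and "i \<in> I \<Longrightarrow> i \<notin> J \<Longrightarrow> restr I N S \<iota> J \<cdot> \<iota> i = \<zero> (N i) S" using c(2) by auto
qed

lemma cproj_Hom: "i \<in> I \<Longrightarrow> cproj I N S \<iota> i \<in> Hom C S (N i)"
  and cproj_same: "i \<in> I \<Longrightarrow> cproj I N S \<iota> i \<cdot> \<iota> i = Ident C (N i)"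
  and cproj_other: "i \<in> I \<Longrightarrow> k \<in> I \<Longrightarrow> k \<noteq> i \<Longrightarrow> cproj I N S \<iota> i \<cdot> \<iota> k = \<zero> (N k) (N i)"
proof -
  assume i: "i \<in> I"
  let ?g = "\<lambda>k. if k = i then Ident C (N i) else \<zero> (N k) (N i)"
  have g: "\<And>k. k \<in> I \<Longrightarrow> ?g k \<in> Hom C (N k) (N i)"
    using coproduct_D[OF cop] i Zero_Hom Ident_Hom by auto
  note c = copair[OF cop coproduct_D(2)[OF cop i] g, folded cproj_def]
  show "cproj I N S \<iota> i \<in> Hom C S (N i)" using c by blast
  show "cproj I N S \<iota> i \<cdot> \<iota> i = Ident C (N i)" using c(2)[OF _ i] by auto
  show "k \<in> I \<Longrightarrow> k \<noteq> i \<Longrightarrow> cproj I N S \<iota> i \<cdot> \<iota> k = \<zero> (N k) (N i)" using c(2)[of k] by auto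
qed

lemma restr_restr: "restr I N S \<iota> J \<cdot> restr I N S \<iota> K = restr I N S \<iota> (J \<inter> K)"
proof (rule coproduct_eqI[OF cop])
  note r = restr_Hom[of J] restr_Hom[of K] restr_Hom[of "J \<inter> K"]
  show "restr I N S \<iota> J \<cdot> restr I N S \<iota> K \<in> Hom C S S" "restr I N S \<iota> (J \<inter> K) \<in> Hom C S S"
    using r by (auto simp: Hom_iff)
  fix i assume i: "i \<in> I"
  have \<iota>: "\<iota> i \<in> Hom C (N i) S" using coproduct_D(3)[OF cop i] .
  show "(restr I N S \<iota> J \<cdot> restr I N S \<iota> K) \<cdot> \<iota> i = restr I N S \<iota> (J \<inter> K) \<cdot> \<iota> i"
    using r \<iota> i
    by (cases "i \<in> J"; cases "i \<in> K") (auto simp: restr_in restr_notin Hom_iff)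
qed

lemma restr_mono:
  assumes "f \<in> Hom C M S" "restr I N S \<iota> J \<cdot> f = f" "J \<subseteq> K"
  shows "restr I N S \<iota> K \<cdot> f = f"
proof -
  have "restr I N S \<iota> K \<cdot> (restr I N S \<iota> J \<cdot> f) = (restr I N S \<iota> K \<cdot> restr I N S \<iota> J) \<cdot> f"
    using assms(1) restr_Hom[of J] restr_Hom[of K] by (auto simp: Hom_iff)
  then show ?thesis using assms(2,3) by (simp add: restr_restr Int_absorb1)
qed

lemma restr_empty: "restr I N S \<iota> {} = \<zero> S S"
proof (rule coproduct_eqI[OF cop restr_Hom])
  show "\<zero> S S \<in> Hom C S S" using coproduct_D(1)[OF cop] Zero_Hom by simp
  fix i assume i: "i \<in> I"
  then show "restr I N S \<iota> {} \<cdot> \<iota> i = \<zero> S S \<cdot> \<iota> i"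
    using coproduct_D(3)[OF cop i] by (simp add: restr_notin Hom_iff)
qed

lemma restr_insert:
  assumes "j \<in> I" "j \<notin> J"
  shows "restr I N S \<iota> (insert j J) = restr I N S \<iota> J \<oplus> (\<iota> j \<cdot> cproj I N S \<iota> j)"
proof (rule coproduct_eqI[OF cop])
  note H = restr_Hom[of "insert j J"] restr_Hom[of J] cproj_Hom[OF assms(1)]
    coproduct_D(3)[OF cop assms(1)]
  show "restr I N S \<iota> (insert j J) \<in> Hom C S S"
    "restr I N S \<iota> J \<oplus> (\<iota> j \<cdot> cproj I N S \<iota> j) \<in> Hom C S S" using H by (auto simp: Hom_iff)
  fix i assume i: "i \<in> I"
  have \<iota>: "\<iota> i \<in> Hom C (N i) S" using coproduct_D(3)[OF cop i] .
  have 0: "\<zero> (N i) S \<oplus> \<iota> i = \<iota> i" "\<iota> i \<oplus> \<zero> (N i) S = \<iota> i"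
    "\<zero> (N i) S \<oplus> \<zero> (N i) S = \<zero> (N i) S"
    using Add_Zero[OF \<iota>] Add_Zero(1)[OF Zero_Hom[of "N i" S]] \<iota> by (auto simp: Hom_iff)
  have d: "(restr I N S \<iota> J \<oplus> (\<iota> j \<cdot> cproj I N S \<iota> j)) \<cdot> \<iota> i
      = (restr I N S \<iota> J \<cdot> \<iota> i) \<oplus> (\<iota> j \<cdot> (cproj I N S \<iota> j \<cdot> \<iota> i))"
    using H \<iota> by (auto simp: Hom_iff)
  show "restr I N S \<iota> (insert j J) \<cdot> \<iota> i = (restr I N S \<iota> J \<oplus> (\<iota> j \<cdot> cproj I N S \<iota> j)) \<cdot> \<iota> i"
  proof (cases "i = j")
    case True
    then have "(restr I N S \<iota> J \<cdot> \<iota> i) \<oplus> (\<iota> j \<cdot> (cproj I N S \<iota> j \<cdot> \<iota> i)) = \<zero> (N i) S \<oplus> \<iota> i"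
      using assms \<iota> by (simp add: restr_notin cproj_same Hom_iff)
    then show ?thesis unfolding d 0 using True i by (simp add: restr_in)
  next
    case False
    then have 1: "\<iota> j \<cdot> (cproj I N S \<iota> j \<cdot> \<iota> i) = \<zero> (N i) S"
      using assms i H \<iota> by (simp add: cproj_other Hom_iff)
    show ?thesis unfolding d 1 using False i 0
      by (cases "i \<in> J") (simp_all add: restr_in restr_notin)
  qed
qed

text \<open>
  For finite \<open>J\<close> the idempotent \<open>restr J\<close> is the sum of the \<open>\<iota> j \<cdot> cproj j\<close>, so a map with finite support
  is determined by its components; for infinite coproducts this can fail.
\<close>

lemma finite_support_eq_Zero:
  assumes "y \<in> Hom C M S" "finite J" "restr I N S \<iota> J \<cdot> y = y"
    and "\<And>i. i \<in> I \<Longrightarrow> cproj I N S \<iota> i \<cdot> y = \<zero> M (N i)"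
  shows "y = \<zero> M S"
proof -
  have "J \<subseteq> I \<Longrightarrow> restr I N S \<iota> J \<cdot> y = \<zero> M S" if "finite J" for J using that
  proof (induction J)
    case empty
    then show ?case using assms(1) restr_empty by (auto simp: Hom_iff)
  next
    case (insert j J)
    then have j: "j \<in> I" by auto
    note H = restr_Hom[of J] cproj_Hom[OF j] coproduct_D(3)[OF cop j] assms(1)
    have "restr I N S \<iota> (insert j J) \<cdot> y
        = (restr I N S \<iota> J \<cdot> y) \<oplus> (\<iota> j \<cdot> (cproj I N S \<iota> j \<cdot> y))"
      using H by (simp add: restr_insert[OF j insert(2)] Hom_iff)
    also have "\<dots> = \<zero> M S \<oplus> \<zero> M S" using insert assms(4)[OF j] H by (auto simp: Hom_iff)
    also have "\<dots> = \<zero> M S" using Add_Zero(1)[OF Zero_Hom[of M S]] assms(1) by (auto simp: Hom_iff)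
    finally show ?case .
  qed
  from this[of "J \<inter> I"] have "restr I N S \<iota> (J \<inter> I) \<cdot> y = \<zero> M S" using assms(2) by auto
  moreover have "restr I N S \<iota> (J \<inter> I) = restr I N S \<iota> J"
  proof (rule coproduct_eqI[OF cop restr_Hom restr_Hom])
    fix i assume "i \<in> I"
    then show "restr I N S \<iota> (J \<inter> I) \<cdot> \<iota> i = restr I N S \<iota> J \<cdot> \<iota> i"
      by (cases "i \<in> J") (simp_all add: restr_in restr_notin)
  qed
  ultimately show ?thesis using assms(3) by simp
qed

end

end

section \<open>Orthogonality, exact triangles and shifts\<close>

context additive_category begin

definition orth :: "'o \<Rightarrow> 'o \<Rightarrow> bool"
  where "orth X Y \<longleftrightarrow> Hom C X Y = {\<zero> X Y}"

lemma orthD: "orth X Y \<Longrightarrow> f \<in> Hom C X Y \<Longrightarrow> f = \<zero> X Y"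
  by (auto simp: orth_def)

lemma orthI: "X \<in> Ob C \<Longrightarrow> Y \<in> Ob C \<Longrightarrow> (\<And>f. f \<in> Hom C X Y \<Longrightarrow> f = \<zero> X Y) \<Longrightarrow> orth X Y"
  using Zero_Hom by (auto simp: orth_def)

lemma perp_orth: "perp C D E \<longleftrightarrow> (\<forall>X\<in>D. \<forall>Y\<in>E. orth X Y)"
  by (simp add: perp_def orth_def)

lemma right_perp_orth: "Y \<in> right_perp C D \<longleftrightarrow> Y \<in> Ob C \<and> (\<forall>X\<in>D. orth X Y)"
  by (auto simp: right_perp_def perp_orth)

definition left_perp :: "'o set \<Rightarrow> 'o set"
  where "left_perp D = {X \<in> Ob C. \<forall>Y\<in>D. orth X Y}"

lemma biproductE:
  assumes "is_biproduct C X Y S"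
  obtains i j p q where "i \<in> Hom C X S" "j \<in> Hom C Y S" "p \<in> Hom C S X" "q \<in> Hom C S Y"
    "p \<cdot> i = Ident C X" "q \<cdot> j = Ident C Y" "q \<cdot> i = \<zero> X Y" "p \<cdot> j = \<zero> Y X"
    "(i \<cdot> p) \<oplus> (j \<cdot> q) = Ident C S"
  using assms by (auto simp: is_biproduct_def)

lemma orth_retract:
  assumes "is_retract C X Y"
  shows "orth Y T \<Longrightarrow> T \<in> Ob C \<Longrightarrow> orth X T" "orth T Y \<Longrightarrow> T \<in> Ob C \<Longrightarrow> orth T X"
proof -
  obtain i p where ip: "i \<in> Hom C X Y" "p \<in> Hom C Y X" "p \<cdot> i = Ident C X"
    and Ob: "X \<in> Ob C" "Y \<in> Ob C"
    using assms by (auto simp: is_retract_def)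
  show "orth X T" if o: "orth Y T" "T \<in> Ob C"
  proof (rule orthI)
    fix f assume f: "f \<in> Hom C X T"
    have "f \<cdot> (p \<cdot> i) = (f \<cdot> p) \<cdot> i" using Comp_assoc[OF ip(1,2) f] by simp
    also have "f \<cdot> p = \<zero> Y T" using orthD[OF o(1) Comp_Hom[OF ip(2) f]] .
    also have "\<zero> Y T \<cdot> i = \<zero> X T" using ip o by (simp add: Hom_iff)
    finally show "f = \<zero> X T" unfolding ip(3) Comp_Ident[OF f] .
  qed (use Ob o in auto)
  show "orth T X" if o: "orth T Y" "T \<in> Ob C"
  proof (rule orthI)
    fix f assume f: "f \<in> Hom C T X"
    have "(p \<cdot> i) \<cdot> f = p \<cdot> (i \<cdot> f)" using Comp_assoc[OF f ip(1,2)] .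
    also have "i \<cdot> f = \<zero> T Y" using orthD[OF o(1) Comp_Hom[OF f ip(1)]] .
    also have "p \<cdot> \<zero> T Y = \<zero> T X" using ip o by (simp add: Hom_iff)
    finally show "f = \<zero> T X" unfolding ip(3) Ident_Comp[OF f] .
  qed (use Ob o in auto)
qed

lemma orth_biproduct:
  assumes "is_biproduct C X Y S" "T \<in> Ob C"
  shows "orth X T \<Longrightarrow> orth Y T \<Longrightarrow> orth S T" "orth T X \<Longrightarrow> orth T Y \<Longrightarrow> orth T S"
proof -
  from assms(1) obtain i j p q where b: "i \<in> Hom C X S" "j \<in> Hom C Y S" "p \<in> Hom C S X" "q \<in> Hom C S Y"
    and e: "(i \<cdot> p) \<oplus> (j \<cdot> q) = Ident C S" by (rule biproductE)
  have Ob: "S \<in> Ob C" using b by (simp add: Hom_iff)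
  show "orth S T" if o: "orth X T" "orth Y T"
  proof (rule orthI)
    fix f assume f: "f \<in> Hom C S T"
    have "f \<cdot> ((i \<cdot> p) \<oplus> (j \<cdot> q)) = ((f \<cdot> i) \<cdot> p) \<oplus> ((f \<cdot> j) \<cdot> q)" using f b by (simp add: Hom_iff)
    also have "f \<cdot> i = \<zero> X T" using f b by (intro orthD[OF o(1)]) (simp add: Hom_iff)
    also have "f \<cdot> j = \<zero> Y T" using f b by (intro orthD[OF o(2)]) (simp add: Hom_iff)
    finally show "f = \<zero> S T" using f b e Add_Zero[OF Zero_Hom[of S T]] by (simp add: Hom_iff)
  qed (use Ob assms in auto)
  show "orth T S" if o: "orth T X" "orth T Y"
  proof (rule orthI)
    fix f assume f: "f \<in> Hom C T S"
    have "((i \<cdot> p) \<oplus> (j \<cdot> q)) \<cdot> f = (i \<cdot> (p \<cdot> f)) \<oplus> (j \<cdot> (q \<cdot> f))" using f b by (simp add: Hom_iff)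
    also have "p \<cdot> f = \<zero> T X" using f b by (intro orthD[OF o(1)]) (simp add: Hom_iff)
    also have "q \<cdot> f = \<zero> T Y" using f b by (intro orthD[OF o(2)]) (simp add: Hom_iff)
    finally show "f = \<zero> T S" using f b e Add_Zero[OF Zero_Hom[of T S]] by (simp add: Hom_iff)
  qed (use Ob assms in auto)
qed

lemma orth_zero_object:
  assumes "zero_object C Z" "T \<in> Ob C"
  shows "orth Z T" "orth T Z"
  using assms to_zero_object from_zero_object by (auto intro!: orthI simp: zero_object_def)

lemma orth_coproduct:
  assumes "is_coproduct C I N S \<iota>" "T \<in> Ob C" "\<And>i. i \<in> I \<Longrightarrow> orth (N i) T"
  shows "orth S T"
proof (rule orthI)
  show S: "S \<in> Ob C" using coproduct_D[OF assms(1)] by simp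
  fix f assume f: "f \<in> Hom C S T"
  show "f = \<zero> S T"
  proof (rule coproduct_eqI[OF assms(1) f Zero_Hom[OF S assms(2)]])
    fix i assume i: "i \<in> I"
    have \<iota>: "\<iota> i \<in> Hom C (N i) S" using coproduct_D(3)[OF assms(1) i] .
    then show "f \<cdot> \<iota> i = \<zero> S T \<cdot> \<iota> i"
      using f orthD[OF assms(3)[OF i], of "f \<cdot> \<iota> i"] assms(2) by (simp add: Hom_iff)
  qed
qed (rule assms(2))

lemma biproduct_coproduct:
  assumes "is_biproduct C X Y S"
  obtains \<iota> where "is_coproduct C (UNIV :: bool set) (\<lambda>b. if b then X else Y) S \<iota>"
proof -
  from assms obtain i j p q where b: "i \<in> Hom C X S" "j \<in> Hom C Y S" "p \<in> Hom C S X" "q \<in> Hom C S Y"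
    and pi: "p \<cdot> i = Ident C X" "q \<cdot> j = Ident C Y" "q \<cdot> i = \<zero> X Y" "p \<cdot> j = \<zero> Y X"
    and e: "(i \<cdot> p) \<oplus> (j \<cdot> q) = Ident C S" by (rule biproductE)
  let ?\<iota> = "\<lambda>b. if b then i else j"
  have "is_coproduct C (UNIV :: bool set) (\<lambda>b. if b then X else Y) S ?\<iota>"
  proof (rule coproductI)
    show "S \<in> Ob C" using b by (simp add: Hom_iff)
    show "\<And>k. ?\<iota> k \<in> Hom C (if k then X else Y) S" using b by simp
    show "\<exists>h\<in>Hom C S T. \<forall>k\<in>UNIV. h \<cdot> ?\<iota> k = g k"
      if T: "T \<in> Ob C" and g: "\<And>k. k \<in> UNIV \<Longrightarrow> g k \<in> Hom C (if k then X else Y) T" for T g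
    proof (rule bexI[of _ "(g True \<cdot> p) \<oplus> (g False \<cdot> q)"])
      have gT: "g True \<in> Hom C X T" "g False \<in> Hom C Y T" using g[of True] g[of False] by auto
      then show "(g True \<cdot> p) \<oplus> (g False \<cdot> q) \<in> Hom C S T" using b by (simp add: Hom_iff)
      have "((g True \<cdot> p) \<oplus> (g False \<cdot> q)) \<cdot> i = g True"
        using b pi gT Add_Zero[OF gT(1)] by (simp add: Hom_iff)
      moreover have "((g True \<cdot> p) \<oplus> (g False \<cdot> q)) \<cdot> j = g False"
        using b pi gT Add_Zero[OF gT(2)] by (simp add: Hom_iff)
      ultimately show "\<forall>k\<in>UNIV. ((g True \<cdot> p) \<oplus> (g False \<cdot> q)) \<cdot> ?\<iota> k = g k" by (auto split: if_splits)
    qed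
    show "h = h'" if h: "h \<in> Hom C S T" "h' \<in> Hom C S T" and eq: "\<And>k. k \<in> UNIV \<Longrightarrow> h \<cdot> ?\<iota> k = h' \<cdot> ?\<iota> k"
      for T h h'
    proof -
      have x: "k \<cdot> ((i \<cdot> p) \<oplus> (j \<cdot> q)) = ((k \<cdot> i) \<cdot> p) \<oplus> ((k \<cdot> j) \<cdot> q)" if "k \<in> Hom C S T" for k
        using that b by (simp add: Hom_iff)
      have "h \<cdot> ((i \<cdot> p) \<oplus> (j \<cdot> q)) = h' \<cdot> ((i \<cdot> p) \<oplus> (j \<cdot> q))"
        using eq[of True] eq[of False] by (simp add: x[OF h(1)] x[OF h(2)])
      then show ?thesis using e h by (simp add: Hom_iff)
    qed
  qed
  then show thesis by (rule that)
qed

lemma zero_object_coproduct: "zero_object C Z \<Longrightarrow> is_coproduct C {} N Z \<iota>"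
  by (auto simp: is_coproduct_def zero_object_def)

lemma isomorphic_coproduct:
  assumes "isomorphic C X Y"
  obtains \<iota> where "is_coproduct C {()} (\<lambda>_. X) Y \<iota>"
proof -
  obtain f g where fg: "f \<in> Hom C X Y" "g \<in> Hom C Y X" "g \<cdot> f = Ident C X" "f \<cdot> g = Ident C Y"
    using assms by (rule isomorphicE)
  have "is_coproduct C {()} (\<lambda>_. X) Y (\<lambda>_. f)"
  proof (rule coproductI)
    show "Y \<in> Ob C" "f \<in> Hom C X Y" using fg by (auto simp: Hom_iff)
    show "\<exists>h\<in>Hom C Y T. \<forall>i\<in>{()}. h \<cdot> f = k i" if "\<And>i. i \<in> {()} \<Longrightarrow> k i \<in> Hom C X T" for T k
      using that[of "()"] fg by (intro bexI[of _ "k () \<cdot> g"]) (auto simp: Hom_iff)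
    show "h = h'" if h: "h \<in> Hom C Y T" "h' \<in> Hom C Y T" "\<And>i. i \<in> {()} \<Longrightarrow> h \<cdot> f = h' \<cdot> f" for T h h'
    proof -
      have "(h \<cdot> f) \<cdot> g = (h' \<cdot> f) \<cdot> g" using h(3) by simp
      then have "h \<cdot> (f \<cdot> g) = h' \<cdot> (f \<cdot> g)" using h(1,2) fg(1,2) by (simp add: Hom_iff)
      then show ?thesis using h(1,2) fg by (simp add: Hom_iff)
    qed
  qed
  then show thesis by (rule that)
qed

end

context triangulated_category begin

lemma Shift_Ob [simp]: "X \<in> Ob C \<Longrightarrow> Shift C X \<in> Ob C"
  using Shift_bij by (auto simp: bij_betw_def)

lemma ShiftA_Hom: "f \<in> Hom C X Y \<Longrightarrow> ShiftA C f \<in> Hom C (Shift C X) (Shift C Y)"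
  using ShiftA_bij[of X Y] Hom_Ob by (auto simp: bij_betw_def)

lemma Arr_ShiftA [simp]:
  assumes "f \<in> Arr C"
  shows "ShiftA C f \<in> Arr C" "Src C (ShiftA C f) = Shift C (Src C f)"
    "Tgt C (ShiftA C f) = Shift C (Tgt C f)"
  using ShiftA_Hom[of f "Src C f" "Tgt C f"] assms by (auto simp: Hom_def)

lemma ShiftA_surj:
  assumes "g \<in> Hom C (Shift C X) (Shift C Y)" "X \<in> Ob C" "Y \<in> Ob C"
  obtains f where "f \<in> Hom C X Y" "g = ShiftA C f"
  using ShiftA_bij[OF assms(2,3)] assms(1) by (auto simp: bij_betw_def)

lemma ShiftA_inj: "f \<in> Hom C X Y \<Longrightarrow> g \<in> Hom C X Y \<Longrightarrow> ShiftA C f = ShiftA C g \<Longrightarrow> f = g"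
  using ShiftA_bij[of X Y] Hom_Ob by (auto simp: bij_betw_def inj_on_def)

lemma ShiftA_Comp' [simp]:
  "f \<in> Arr C \<Longrightarrow> g \<in> Arr C \<Longrightarrow> Src C g = Tgt C f \<Longrightarrow> ShiftA C (g \<cdot> f) = ShiftA C g \<cdot> ShiftA C f"
  using ShiftA_Comp[of f "Src C f" "Tgt C f" g "Tgt C g"] by (auto simp: Hom_def)

lemma ShiftA_Zero [simp]:
  assumes "X \<in> Ob C" "Y \<in> Ob C"
  shows "ShiftA C (\<zero> X Y) = \<zero> (Shift C X) (Shift C Y)"
proof (rule idem_Zero)
  show "ShiftA C (\<zero> X Y) \<in> Hom C (Shift C X) (Shift C Y)" using ShiftA_Hom Zero_Hom assms by blast
  show "ShiftA C (\<zero> X Y) \<oplus> ShiftA C (\<zero> X Y) = ShiftA C (\<zero> X Y)"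
    using ShiftA_Add[of "\<zero> X Y" X Y "\<zero> X Y"] Zero_Hom[OF assms] Add_Zero[OF Zero_Hom[OF assms]] by simp
qed

lemma ShiftA_eq_Zero:
  "f \<in> Hom C X Y \<Longrightarrow> ShiftA C f = \<zero> (Shift C X) (Shift C Y) \<longleftrightarrow> f = \<zero> X Y"
  using ShiftA_inj[of f X Y "\<zero> X Y"] Hom_Ob Zero_Hom ShiftA_Zero by metis

lemma ShiftA_neg:
  assumes "f \<in> Hom C X Y" shows "ShiftA C (neg f) = neg (ShiftA C f)"
proof (rule neg_unique[OF ShiftA_Hom[OF assms] ShiftA_Hom[OF neg_Hom[OF assms]]])
  have "ShiftA C (f \<oplus> neg f) = ShiftA C f \<oplus> ShiftA C (neg f)"
    using ShiftA_Add[OF assms neg_Hom[OF assms]] .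
  then show "ShiftA C f \<oplus> ShiftA C (neg f) = \<zero> (Shift C X) (Shift C Y)"
    using group_laws(3)[OF assms assms] assms by (simp add: Hom_iff)
qed

lemma Shift_obtain:
  assumes "X \<in> Ob C" obtains X' where "X' \<in> Ob C" "X = Shift C X'"
  using assms Shift_bij unfolding bij_betw_def by blast

lemma shift_0 [simp]: "shift C 0 X = X"
  by (simp add: shift_def)

lemma shift_1 [simp]: "shift C 1 X = Shift C X"
  by (simp add: shift_def)

lemma unshift_Ob: "X \<in> Ob C \<Longrightarrow> inv_into (Ob C) (Shift C) X \<in> Ob C"
  using Shift_bij by (metis bij_betw_def inv_into_into)

lemma Shift_unshift: "X \<in> Ob C \<Longrightarrow> Shift C (inv_into (Ob C) (Shift C) X) = X"
  using Shift_bij by (metis bij_betw_def f_inv_into_f)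

lemma unshift_Shift: "X \<in> Ob C \<Longrightarrow> inv_into (Ob C) (Shift C) (Shift C X) = X"
  using Shift_bij by (metis bij_betw_def inv_into_f_f)

lemma funpow_Shift_Ob: "X \<in> Ob C \<Longrightarrow> (Shift C ^^ n) X \<in> Ob C"
  by (induction n) auto

lemma funpow_unshift_Ob: "X \<in> Ob C \<Longrightarrow> (inv_into (Ob C) (Shift C) ^^ n) X \<in> Ob C"
  by (induction n) (auto simp: unshift_Ob)

lemma shift_Ob [simp]: "X \<in> Ob C \<Longrightarrow> shift C n X \<in> Ob C"
  by (simp add: shift_def funpow_Shift_Ob funpow_unshift_Ob)

lemma Shift_shift: 
  assumes "X \<in> Ob C" shows "Shift C (shift C n X) = shift C (n + 1) X"
proof (cases "0 \<le> n")
  case True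
  then have "nat (n + 1) = Suc (nat n)" by simp
  then show ?thesis using True by (simp add: shift_def)
next
  case False
  then have m: "nat (- n) = Suc (nat (- (n + 1)))" by simp
  have "Shift C (shift C n X) = (inv_into (Ob C) (Shift C) ^^ nat (- (n + 1))) X"
    using False unfolding shift_def m by (simp add: Shift_unshift funpow_unshift_Ob assms)
  then show ?thesis using False by (cases "n = -1") (auto simp: shift_def)
qed

lemma Shift_inj: "X \<in> Ob C \<Longrightarrow> Y \<in> Ob C \<Longrightarrow> Shift C X = Shift C Y \<Longrightarrow> X = Y"
  using Shift_bij by (auto simp: bij_betw_def inj_on_def)

lemma shift_add: 
  assumes "X \<in> Ob C" shows "shift C m (shift C n X) = shift C (m + n) X"
proof (induction m rule: int_induct[where k = 0])
  case (step1 i)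
  have "shift C (i + 1) (shift C n X) = Shift C (shift C (i + n) X)"
    using step1 assms by (simp add: Shift_shift[symmetric])
  then show ?case using assms by (simp add: Shift_shift algebra_simps)
next
  case (step2 i)
  have "Shift C (shift C (i - 1) (shift C n X)) = Shift C (shift C (i - 1 + n) X)"
    using step2 assms by (simp add: Shift_shift)
  then show ?case by (rule Shift_inj[rotated 2]) (use assms in auto)
qed simp

lemma shift_Shift: "X \<in> Ob C \<Longrightarrow> shift C n (Shift C X) = shift C (n + 1) X"
  using shift_add[of X n 1] by simp

lemma shift_image_iff:
  assumes "D \<subseteq> Ob C" "X \<in> Ob C"
  shows "X \<in> shift C n ` D \<longleftrightarrow> shift C (- n) X \<in> D"
proof
  assume "X \<in> shift C n ` D"
  then show "shift C (- n) X \<in> D" using assms by (auto simp: shift_add subset_eq)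
next
  assume "shift C (- n) X \<in> D"
  moreover have "X = shift C n (shift C (- n) X)" using assms by (simp add: shift_add)
  ultimately show "X \<in> shift C n ` D" by blast
qed

lemma orth_Shift: 
  assumes "X \<in> Ob C" "Y \<in> Ob C" shows "orth (Shift C X) (Shift C Y) \<longleftrightarrow> orth X Y"
proof
  assume o: "orth (Shift C X) (Shift C Y)"
  show "orth X Y" using assms ShiftA_eq_Zero orthD[OF o] ShiftA_Hom by (intro orthI) blast+
next
  assume o: "orth X Y"
  show "orth (Shift C X) (Shift C Y)"
  proof (rule orthI)
    fix f assume "f \<in> Hom C (Shift C X) (Shift C Y)"
    then obtain g where g: "g \<in> Hom C X Y" "f = ShiftA C g" using assms by (rule ShiftA_surj)
    show "f = \<zero> (Shift C X) (Shift C Y)" unfolding g(2) orthD[OF o g(1)] using assms by simp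
  qed (use assms in auto)
qed

lemma orth_shift: 
  assumes "X \<in> Ob C" "Y \<in> Ob C" shows "orth (shift C n X) (shift C n Y) \<longleftrightarrow> orth X Y"
proof (induction n rule: int_induct[where k = 0])
  case (step1 i)
  then show ?case using assms orth_Shift[of "shift C i X" "shift C i Y"] by (simp add: Shift_shift)
next
  case (step2 i)
  then show ?case using assms orth_Shift[of "shift C (i-1) X" "shift C (i-1) Y"] by (simp add: Shift_shift)
qed simp

lemma orth_shift_left:
  assumes "X \<in> Ob C" "Y \<in> Ob C" shows "orth (shift C n X) Y \<longleftrightarrow> orth X (shift C (- n) Y)"
  using orth_shift[of X "shift C (- n) Y" n] assms by (simp add: shift_add)

lemma orth_shift_both:
  assumes "X \<in> Ob C" "Y \<in> Ob C"
  shows "orth (shift C m X) (shift C n Y) \<longleftrightarrow> orth (shift C (m - n) X) Y"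
  using orth_shift[of "shift C (m - n) X" Y n] assms by (simp add: shift_add)

lemma shifts_Ob: "D \<subseteq> Ob C \<Longrightarrow> shifts C N D \<subseteq> Ob C"
  by (auto simp: shifts_def)

lemma triangle_D:
  assumes "triangle C X Y Z f g h"
  shows "f \<in> Hom C X Y" "g \<in> Hom C Y Z" "h \<in> Hom C Z (Shift C X)"
  using assms by (auto simp: triangle_def)

lemma triangle_Ob:
  assumes "triangle C X Y Z f g h"
  shows "X \<in> Ob C" "Y \<in> Ob C" "Z \<in> Ob C"
  using assms by (auto simp: triangle_def Hom_iff)

lemma neg_shift_eq: "f \<in> Hom C X Y \<Longrightarrow> neg_shift C X Y f = neg (ShiftA C f)"
  by (simp add: neg_shift_def neg_def Hom_iff)

lemma triangle_rotate: 
  "triangle C X Y Z f g h \<Longrightarrow> triangle C Y Z (Shift C X) g h (neg (ShiftA C f))"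
  using Tri_rotate[of f X Y g Z h] triangle_D[of X Y Z f g h] neg_shift_eq[of f X Y] by simp

lemma ex_fiber:
  assumes "g \<in> Hom C Y Z"
  obtains X f h where "triangle C X Y Z f g h"
proof -
  obtain W h k where t: "triangle C Y Z W g h k" using ex_cone[OF assms] by blast
  obtain X where X: "X \<in> Ob C" "W = Shift C X" using Shift_obtain triangle_Ob(3)[OF t] by metis
  have Y: "Y \<in> Ob C" using assms by (simp add: Hom_iff)
  have "neg k \<in> Hom C (Shift C X) (Shift C Y)" using triangle_D(3)[OF t] X neg_Hom by simp
  then obtain f where f: "f \<in> Hom C X Y" "neg k = ShiftA C f" using X(1) Y by (rule ShiftA_surj)
  have "neg (ShiftA C f) = k" using f(2) neg_neg triangle_D(3)[OF t] by metis
  then have "triangle C X Y Z f g h"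
    using Tri_rotate[OF f(1) assms, of h] t triangle_D(2)[OF t] X neg_shift_eq[OF f(1)] by simp
  then show thesis by (rule that)
qed

lemma triangle_unrotate:
  assumes t: "triangle C Y Z (Shift C X) g h k" and X: "X \<in> Ob C"
  obtains f where "triangle C X Y Z f g h"
proof -
  have Y: "Y \<in> Ob C" using triangle_Ob(1)[OF t] .
  have "neg k \<in> Hom C (Shift C X) (Shift C Y)" using triangle_D(3)[OF t] X neg_Hom by simp
  then obtain f where f: "f \<in> Hom C X Y" "neg k = ShiftA C f" using X Y by (rule ShiftA_surj)
  have "neg (ShiftA C f) = k" using f(2) neg_neg triangle_D(3)[OF t] by metis
  then have "triangle C X Y Z f g h"
    using Tri_rotate[OF f(1) triangle_D(1)[OF t], of h] t triangle_D(2)[OF t] X neg_shift_eq[OF f(1)] by simp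
  then show thesis by (rule that)
qed

lemma zero_triangle:
  assumes X: "X \<in> Ob C"
  obtains Z where "zero_object C Z" "triangle C Z X X (\<zero> Z X) (Ident C X) (\<zero> X (Shift C Z))"
proof -
  obtain Z where Z: "zero_object C Z" using ex_zero by blast
  then have ZOb: "Z \<in> Ob C" by (simp add: zero_object_def)
  have SZ: "zero_object C (Shift C Z)"
    using Z ZOb zero_object_Ident ShiftA_Ident[OF ZOb] by simp
  have "triangle C X X (Shift C Z) (Ident C X) (\<zero> X (Shift C Z)) (\<zero> (Shift C Z) (Shift C X))"
    using Tri_Ident[OF X SZ] .
  moreover have "neg_shift C Z X (\<zero> Z X) = \<zero> (Shift C Z) (Shift C X)"
    using X ZOb Zero_Hom neg_shift_eq neg_Zero by simp
  ultimately have "triangle C Z X X (\<zero> Z X) (Ident C X) (\<zero> X (Shift C Z))"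
    using Tri_rotate[of "\<zero> Z X" Z X "Ident C X" X "\<zero> X (Shift C Z)"] X ZOb Zero_Hom Ident_Hom by simp
  then show thesis using Z that by blast
qed

lemma triangle_Comp_Zero:
  assumes t: "triangle C X Y Z f g h"
  shows "g \<cdot> f = \<zero> X Z" "h \<cdot> g = \<zero> Y (Shift C X)" "ShiftA C f \<cdot> h = \<zero> Z (Shift C Y)"
proof -
  have gf: "g \<cdot> f = \<zero> X Z" if t: "triangle C X Y Z f g h" for X Y Z f g h
  proof -
    note H = triangle_D[OF t] and Ob = triangle_Ob[OF t]
    obtain Z0 where Z0: "zero_object C Z0" using ex_zero by blast
    have ZOb: "Z0 \<in> Ob C" using Z0 by (simp add: zero_object_def)
    have "f \<cdot> Ident C X = f \<cdot> Ident C X" ..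
    from Tri_morphism[OF Tri_Ident[OF Ob(1) Z0] t Ident_Hom[OF Ob(1)] H(1) this]
    obtain c where c: "c \<in> Hom C Z0 Z" "c \<cdot> \<zero> X Z0 = g \<cdot> f" by blast
    have "c \<cdot> \<zero> X Z0 = \<zero> X Z" using c(1) Ob(1) by (simp add: Hom_iff)
    then show ?thesis using c(2) by simp
  qed
  note H = triangle_D[OF t] and Ob = triangle_Ob[OF t]
  show "g \<cdot> f = \<zero> X Z" using gf[OF t] .
  show "h \<cdot> g = \<zero> Y (Shift C X)" using gf[OF triangle_rotate[OF t]] .
  have "neg (ShiftA C f) \<cdot> h = \<zero> Z (Shift C Y)"
    using gf[OF triangle_rotate[OF triangle_rotate[OF t]]] .
  moreover have "neg (ShiftA C f) \<cdot> h = neg (ShiftA C f \<cdot> h)" using H by (simp add: Hom_iff)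
  moreover have "ShiftA C f \<cdot> h \<in> Hom C Z (Shift C Y)" using H by (simp add: Hom_iff)
  ultimately show "ShiftA C f \<cdot> h = \<zero> Z (Shift C Y)" using neg_eq_Zero by metis
qed

text \<open>
  This lemma and the next complete a square to a morphism of triangles whose other triangle has a zero object. The
  rotations have signs, but vanishing of a composite does not see them.
\<close>

lemma triangle_lift:
  assumes t: "triangle C X Y Z f g h"
  shows triangle_lift1: "\<lbrakk>y \<in> Hom C T Y; g \<cdot> y = \<zero> T Z\<rbrakk> \<Longrightarrow> \<exists>x\<in>Hom C T X. y = f \<cdot> x"
    and triangle_lift2: "\<lbrakk>z \<in> Hom C T Z; h \<cdot> z = \<zero> T (Shift C X)\<rbrakk> \<Longrightarrow> \<exists>y\<in>Hom C T Y. z = g \<cdot> y"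
    and triangle_lift3: "\<lbrakk>w \<in> Hom C T (Shift C X); ShiftA C f \<cdot> w = \<zero> T (Shift C Y)\<rbrakk>
      \<Longrightarrow> \<exists>z\<in>Hom C T Z. w = h \<cdot> z"
proof -
  have l: "\<exists>x\<in>Hom C T X. y = f \<cdot> x"
    if t: "triangle C X Y Z f g h" and y: "y \<in> Hom C T Y" and 0: "g \<cdot> y = \<zero> T Z" for X Y Z f g h T y
  proof -
    note H = triangle_D[OF t] and Ob = triangle_Ob[OF t]
    have T: "T \<in> Ob C" using y by (simp add: Hom_iff)
    obtain Z0 where Z0: "zero_object C Z0" using ex_zero by blast
    have ZOb: "Z0 \<in> Ob C" using Z0 by (simp add: zero_object_def)
    have 1: "\<zero> Z0 Z \<cdot> \<zero> T Z0 = g \<cdot> y" using 0 T ZOb Ob by simp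
    from Tri_morphism[OF triangle_rotate[OF Tri_Ident[OF T Z0]] triangle_rotate[OF t] y Zero_Hom[OF ZOb Ob(3)] 1]
    obtain c where c: "c \<in> Hom C (Shift C T) (Shift C X)"
      "ShiftA C y \<cdot> neg (ShiftA C (Ident C T)) = neg (ShiftA C f) \<cdot> c" by blast
    obtain x where x: "x \<in> Hom C T X" "c = ShiftA C x" using c(1) T Ob(1) by (rule ShiftA_surj)
    have "neg (ShiftA C y) = neg (ShiftA C (f \<cdot> x))"
      using c(2) x H y T by (simp add: ShiftA_Ident Hom_iff)
    then have "ShiftA C y = ShiftA C (f \<cdot> x)"
      by (rule neg_inj[OF ShiftA_Hom[OF y] ShiftA_Hom[OF Comp_Hom[OF x(1) H(1)]]])
    then have "y = f \<cdot> x" using ShiftA_inj[OF y Comp_Hom[OF x(1) H(1)]] by simp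
    then show ?thesis using x by blast
  qed
  note H = triangle_D[OF t] and Ob = triangle_Ob[OF t]
  show "\<exists>x\<in>Hom C T X. y = f \<cdot> x" if "y \<in> Hom C T Y" "g \<cdot> y = \<zero> T Z" using l[OF t that] .
  show "\<exists>y\<in>Hom C T Y. z = g \<cdot> y" if "z \<in> Hom C T Z" "h \<cdot> z = \<zero> T (Shift C X)"
    using l[OF triangle_rotate[OF t] that] .
  show "\<exists>z\<in>Hom C T Z. w = h \<cdot> z" if w: "w \<in> Hom C T (Shift C X)" "ShiftA C f \<cdot> w = \<zero> T (Shift C Y)"
  proof (rule l[OF triangle_rotate[OF triangle_rotate[OF t]] w(1)])
    show "neg (ShiftA C f) \<cdot> w = \<zero> T (Shift C Y)"
      using w H neg_Zero Ob by (simp add: Hom_iff)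
  qed
qed

lemma triangle_extend:
  assumes t: "triangle C X Y Z f g h"
  shows triangle_extend1: "\<lbrakk>y \<in> Hom C Y T; y \<cdot> f = \<zero> X T\<rbrakk> \<Longrightarrow> \<exists>z\<in>Hom C Z T. y = z \<cdot> g"
    and triangle_extend2: "\<lbrakk>z \<in> Hom C Z T; z \<cdot> g = \<zero> Y T\<rbrakk> \<Longrightarrow> \<exists>w\<in>Hom C (Shift C X) T. z = w \<cdot> h"
    and triangle_extend3: "\<lbrakk>w \<in> Hom C (Shift C X) T; w \<cdot> h = \<zero> Z T\<rbrakk>
      \<Longrightarrow> \<exists>v\<in>Hom C (Shift C Y) T. w = v \<cdot> ShiftA C f"
proof -
  have e: "\<exists>z\<in>Hom C Z T. y = z \<cdot> g"
    if t: "triangle C X Y Z f g h" and y: "y \<in> Hom C Y T" and 0: "y \<cdot> f = \<zero> X T" for X Y Z f g h T y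
  proof -
    note H = triangle_D[OF t] and Ob = triangle_Ob[OF t]
    have T: "T \<in> Ob C" using y by (simp add: Hom_iff)
    obtain Z0 where Z0: "zero_object C Z0" "triangle C Z0 T T (\<zero> Z0 T) (Ident C T) (\<zero> T (Shift C Z0))"
      using zero_triangle[OF T] .
    have ZOb: "Z0 \<in> Ob C" using Z0 by (simp add: zero_object_def)
    have "y \<cdot> f = \<zero> Z0 T \<cdot> \<zero> X Z0" using 0 Ob T ZOb by simp
    from Tri_morphism[OF t Z0(2) Zero_Hom[OF Ob(1) ZOb] y this] obtain c where
      "c \<in> Hom C Z T" "c \<cdot> g = Ident C T \<cdot> y" by blast
    then show ?thesis using y by (intro bexI[of _ c]) (auto simp: Hom_iff)
  qed
  note H = triangle_D[OF t] and Ob = triangle_Ob[OF t]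
  show "\<exists>z\<in>Hom C Z T. y = z \<cdot> g" if "y \<in> Hom C Y T" "y \<cdot> f = \<zero> X T" using e[OF t that] .
  show "\<exists>w\<in>Hom C (Shift C X) T. z = w \<cdot> h" if "z \<in> Hom C Z T" "z \<cdot> g = \<zero> Y T"
    using e[OF triangle_rotate[OF t] that] .
  show "\<exists>v\<in>Hom C (Shift C Y) T. w = v \<cdot> ShiftA C f" if w: "w \<in> Hom C (Shift C X) T" "w \<cdot> h = \<zero> Z T"
  proof -
    obtain v where v: "v \<in> Hom C (Shift C Y) T" "w = v \<cdot> neg (ShiftA C f)"
      using e[OF triangle_rotate[OF triangle_rotate[OF t]] w] by blast
    then have "w = neg v \<cdot> ShiftA C f" using H by (simp add: Hom_iff)
    then show ?thesis using neg_Hom[OF v(1)] by blast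
  qed
qed

lemma orth_triangle:
  assumes t: "triangle C X Y Z f g h" and T: "T \<in> Ob C"
  shows orth_triangle_left: "orth X T \<Longrightarrow> orth Z T \<Longrightarrow> orth Y T"
    and orth_triangle_right: "orth T X \<Longrightarrow> orth T Z \<Longrightarrow> orth T Y"
proof -
  note H = triangle_D[OF t] and Ob = triangle_Ob[OF t]
  show "orth Y T" if o: "orth X T" "orth Z T"
  proof (rule orthI[OF Ob(2) T])
    fix y assume y: "y \<in> Hom C Y T"
    have "y \<cdot> f = \<zero> X T" using y H by (intro orthD[OF o(1)]) (simp add: Hom_iff)
    then obtain z where z: "z \<in> Hom C Z T" "y = z \<cdot> g" using triangle_extend1[OF t y] by blast
    show "y = \<zero> Y T" using z(2) H T unfolding orthD[OF o(2) z(1)] by (simp add: Hom_iff)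
  qed
  show "orth T Y" if o: "orth T X" "orth T Z"
  proof (rule orthI[OF T Ob(2)])
    fix y assume y: "y \<in> Hom C T Y"
    have "g \<cdot> y = \<zero> T Z" using y H by (intro orthD[OF o(2)]) (simp add: Hom_iff)
    then obtain x where x: "x \<in> Hom C T X" "y = f \<cdot> x" using triangle_lift1[OF t y] by blast
    show "y = \<zero> T Y" using x(2) H T unfolding orthD[OF o(1) x(1)] by (simp add: Hom_iff)
  qed
qed

text \<open>
  This is the long exact sequence of \<open>Hom(g, -)\<close>: surjectivity on \<open>Hom(g, L) \<rightarrow> Hom(g, M)\<close> and injectivity
  one degree further, on \<open>Hom(g[-1], L) \<rightarrow> Hom(g[-1], M)\<close>, leave no room for \<open>Hom(g, R)\<close>.
\<close>

lemma orth_cone: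
  assumes t: "triangle C L M R l p h" and g: "g' \<in> Ob C" "g = Shift C g'"
    and surj: "\<And>x. x \<in> Hom C g M \<Longrightarrow> \<exists>z\<in>Hom C g L. l \<cdot> z = x"
    and inj: "\<And>z. z \<in> Hom C g' L \<Longrightarrow> l \<cdot> z = \<zero> g' M \<Longrightarrow> z = \<zero> g' L"
  shows "orth g R"
proof (rule orthI)
  note l = triangle_D(1)[OF t] and p = triangle_D(2)[OF t] and h = triangle_D(3)[OF t] and Ob = triangle_Ob[OF t]
  show "g \<in> Ob C" "R \<in> Ob C" using g Ob by auto
  fix y assume y: "y \<in> Hom C g R"
  have "h \<cdot> y \<in> Hom C (Shift C g') (Shift C L)" using Comp_Hom[OF y h] g by simp
  then obtain z where z: "z \<in> Hom C g' L" "h \<cdot> y = ShiftA C z" using g(1) Ob(1) by (rule ShiftA_surj)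
  have "ShiftA C (l \<cdot> z) = (ShiftA C l \<cdot> h) \<cdot> y"
    using ShiftA_Comp[OF z(1) l] Comp_assoc[OF y h ShiftA_Hom[OF l]] z(2) by simp
  also have "\<dots> = \<zero> (Shift C g') (Shift C M)"
    unfolding triangle_Comp_Zero(3)[OF t] using y g Ob by (simp add: Hom_iff)
  finally have "l \<cdot> z = \<zero> g' M" using ShiftA_eq_Zero[OF Comp_Hom[OF z(1) l]] by simp
  then have "h \<cdot> y = \<zero> g (Shift C L)" using inj[OF z(1)] z(2) g Ob by simp
  then obtain x where x: "x \<in> Hom C g M" "y = p \<cdot> x" using triangle_lift2[OF t y] by blast
  obtain w where w: "w \<in> Hom C g L" "l \<cdot> w = x" using surj[OF x(1)] by blast
  have "y = (p \<cdot> l) \<cdot> w" using Comp_assoc[OF w(1) l p] w(2) x(2) by simp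
  then show "y = \<zero> g R" unfolding triangle_Comp_Zero(1)[OF t] using w(1) Ob by (simp add: Hom_iff)
qed

lemma coproduct_Shift:
  assumes cop: "is_coproduct C I N S \<iota>"
  shows "is_coproduct C I (\<lambda>i. Shift C (N i)) (Shift C S) (\<lambda>i. ShiftA C (\<iota> i))"
proof (rule coproductI)
  note D = coproduct_D[OF cop]
  show "Shift C S \<in> Ob C" "\<And>i. i \<in> I \<Longrightarrow> ShiftA C (\<iota> i) \<in> Hom C (Shift C (N i)) (Shift C S)"
    using D ShiftA_Hom by auto
  show "\<exists>h\<in>Hom C (Shift C S) T. \<forall>i\<in>I. h \<cdot> ShiftA C (\<iota> i) = g i"
    if T: "T \<in> Ob C" and g: "\<And>i. i \<in> I \<Longrightarrow> g i \<in> Hom C (Shift C (N i)) T" for T g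
  proof -
    obtain T' where T': "T' \<in> Ob C" "T = Shift C T'" using Shift_obtain[OF T] .
    have "\<forall>i\<in>I. \<exists>k. k \<in> Hom C (N i) T' \<and> g i = ShiftA C k"
    proof
      fix i assume i: "i \<in> I"
      have "g i \<in> Hom C (Shift C (N i)) (Shift C T')" using g[OF i] T' by simp
      from ShiftA_surj[OF this D(2)[OF i] T'(1)] show "\<exists>k. k \<in> Hom C (N i) T' \<and> g i = ShiftA C k" by metis
    qed
    then obtain k where k: "\<And>i. i \<in> I \<Longrightarrow> k i \<in> Hom C (N i) T'" "\<And>i. i \<in> I \<Longrightarrow> g i = ShiftA C (k i)" by metis
    note c = copair_Hom[OF cop T'(1) k(1)] copair_Comp[OF cop T'(1) k(1)]
    have "ShiftA C (copair I S \<iota> T' k) \<cdot> ShiftA C (\<iota> i) = g i" if i: "i \<in> I" for i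
      using ShiftA_Comp[OF D(3)[OF i] c(1)] c(2)[OF _ i] k(2)[OF i] by simp
    then show ?thesis using ShiftA_Hom[OF c(1)] T'(2) by blast
  qed
  show "h = h'" if h: "h \<in> Hom C (Shift C S) T" "h' \<in> Hom C (Shift C S) T"
    and eq: "\<And>i. i \<in> I \<Longrightarrow> h \<cdot> ShiftA C (\<iota> i) = h' \<cdot> ShiftA C (\<iota> i)" for T h h'
  proof -
    have T: "T \<in> Ob C" using h by (simp add: Hom_iff)
    obtain T' where T': "T' \<in> Ob C" "T = Shift C T'" using Shift_obtain[OF T] .
    obtain k where k: "k \<in> Hom C S T'" "h = ShiftA C k" using h(1) T' D(1) ShiftA_surj by metis
    obtain k' where k': "k' \<in> Hom C S T'" "h' = ShiftA C k'" using h(2) T' D(1) ShiftA_surj by metis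
    have "k = k'"
    proof (rule coproduct_eqI[OF cop k(1) k'(1)])
      fix i assume i: "i \<in> I"
      have "ShiftA C (k \<cdot> \<iota> i) = ShiftA C (k' \<cdot> \<iota> i)"
        using eq[OF i] k k' D(3)[OF i] by (simp add: Hom_iff)
      then show "k \<cdot> \<iota> i = k' \<cdot> \<iota> i"
        by (rule ShiftA_inj[OF Comp_Hom[OF D(3)[OF i] k(1)] Comp_Hom[OF D(3)[OF i] k'(1)]])
    qed
    then show ?thesis using k k' by simp
  qed
qed

lemma coproduct_unshift:
  assumes cop: "is_coproduct C I (\<lambda>i. Shift C (N i)) (Shift C S) (\<lambda>i. ShiftA C (\<iota> i))"
    and S: "S \<in> Ob C" and \<iota>: "\<And>i. i \<in> I \<Longrightarrow> \<iota> i \<in> Hom C (N i) S"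
  shows "is_coproduct C I N S \<iota>"
proof (rule coproductI[OF S \<iota>])
  note D = coproduct_D[OF cop]
  show "\<exists>h\<in>Hom C S T. \<forall>i\<in>I. h \<cdot> \<iota> i = g i"
    if T: "T \<in> Ob C" and g: "\<And>i. i \<in> I \<Longrightarrow> g i \<in> Hom C (N i) T" for T g
  proof -
    let ?g = "\<lambda>i. ShiftA C (g i)"
    have g': "\<And>i. i \<in> I \<Longrightarrow> ?g i \<in> Hom C (Shift C (N i)) (Shift C T)" using ShiftA_Hom g by blast
    note c = copair_Hom[OF cop Shift_Ob[OF T] g'] copair_Comp[OF cop Shift_Ob[OF T] g']
    obtain h where h: "h \<in> Hom C S T" "copair I (Shift C S) (\<lambda>i. ShiftA C (\<iota> i)) (Shift C T) ?g = ShiftA C h"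
      using ShiftA_surj[OF c(1) S T] by blast
    have "h \<cdot> \<iota> i = g i" if i: "i \<in> I" for i
    proof (rule ShiftA_inj[OF Comp_Hom[OF \<iota>[OF i] h(1)] g[OF i]])
      show "ShiftA C (h \<cdot> \<iota> i) = ShiftA C (g i)"
        using ShiftA_Comp[OF \<iota>[OF i] h(1)] c(2)[OF _ i] h(2) by simp
    qed
    then show ?thesis using h(1) by blast
  qed
  show "h = h'" if h: "h \<in> Hom C S T" "h' \<in> Hom C S T" and eq: "\<And>i. i \<in> I \<Longrightarrow> h \<cdot> \<iota> i = h' \<cdot> \<iota> i" for T h h'
  proof (rule ShiftA_inj[OF h], rule coproduct_eqI[OF cop ShiftA_Hom[OF h(1)] ShiftA_Hom[OF h(2)]])
    fix i assume i: "i \<in> I"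
    show "ShiftA C h \<cdot> ShiftA C (\<iota> i) = ShiftA C h' \<cdot> ShiftA C (\<iota> i)"
      using ShiftA_Comp[OF \<iota>[OF i] h(1)] ShiftA_Comp[OF \<iota>[OF i] h(2)] eq[OF i] by simp
  qed
qed

lemma coproduct_unshift_ex:
  assumes cop: "is_coproduct C I N S \<iota>" and S': "S' \<in> Ob C" "S = Shift C S'"
    and N': "\<And>i. i \<in> I \<Longrightarrow> N' i \<in> Ob C" "\<And>i. i \<in> I \<Longrightarrow> N i = Shift C (N' i)"
  obtains \<iota>' where "is_coproduct C I N' S' \<iota>'" "\<forall>i\<in>I. \<iota> i = ShiftA C (\<iota>' i)"
proof -
  have "\<exists>k. k \<in> Hom C (N' i) S' \<and> \<iota> i = ShiftA C k" if i: "i \<in> I" for i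
  proof -
    have "\<iota> i \<in> Hom C (Shift C (N' i)) (Shift C S')" using coproduct_D(3)[OF cop i] N'(2)[OF i] S' by simp
    from ShiftA_surj[OF this N'(1)[OF i] S'(1)] show ?thesis by metis
  qed
  then obtain k where k: "\<And>i. i \<in> I \<Longrightarrow> k i \<in> Hom C (N' i) S'" "\<And>i. i \<in> I \<Longrightarrow> \<iota> i = ShiftA C (k i)" by metis
  have c: "is_coproduct C I (\<lambda>i. Shift C (N' i)) (Shift C S') (\<lambda>i. ShiftA C (k i))"
    by (rule coproduct_cong[OF cop[unfolded S'(2)]]) (use N' k in auto)
  have "is_coproduct C I N' S' k" using coproduct_unshift[OF c S'(1) k(1)] .
  then show thesis using k(2) by (intro that[of k]) blast+
qed

end

section \<open>Small objects\<close>

lemma quotient_kernel_bij: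
  assumes "R = {(a, b). a \<in> A \<and> b \<in> A \<and> \<Psi> a = \<Psi> b}"
  shows "bij_betw (\<lambda>c. the_elem (\<Psi> ` c)) (A // R) (\<Psi> ` A)"
proof -
  have cls: "\<Psi> ` (R `` {a}) = {\<Psi> a}" if "a \<in> A" for a using that assms by auto
  have q: "A // R = (\<lambda>a. R `` {a}) ` A" by (auto simp: quotient_def)
  have "inj_on (\<lambda>c. the_elem (\<Psi> ` c)) (A // R)"
    unfolding q using cls assms by (auto simp: inj_on_def)
  moreover have "(\<lambda>c. the_elem (\<Psi> ` c)) ` (A // R) = \<Psi> ` A"
    unfolding q image_image using cls by simp
  ultimately show ?thesis by (simp add: bij_betw_def)
qed

context additive_category begin

context
  fixes \<alpha> :: "'c rel" and I :: "'i set" and N S \<iota> and M :: 'o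
  assumes cop: "\<And>J. J \<subseteq> I \<Longrightarrow> is_coproduct C J N (S J) (\<iota> J)" and M: "M \<in> Ob C"
    and \<alpha>: "Card_order \<alpha>" "infinite (Field \<alpha>)"
begin

abbreviation "incl J K \<equiv> coproduct_incl C S \<iota> J K"

lemma incl_copair: "incl J K = copair J (S J) (\<iota> J) (S K) (\<iota> K)"
  by (simp add: coproduct_incl_def copair_def)

lemma incl_Hom: "J \<subseteq> K \<Longrightarrow> K \<subseteq> I \<Longrightarrow> incl J K \<in> Hom C (S J) (S K)"
  and incl_Comp: "J \<subseteq> K \<Longrightarrow> K \<subseteq> I \<Longrightarrow> j \<in> J \<Longrightarrow> incl J K \<cdot> \<iota> J j = \<iota> K j"
proof -
  assume JK: "J \<subseteq> K" "K \<subseteq> I"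
  then have J: "J \<subseteq> I" by auto
  have "\<And>j. j \<in> J \<Longrightarrow> \<iota> K j \<in> Hom C (N j) (S K)" using coproduct_D(3)[OF cop[OF JK(2)]] JK by auto
  note c = copair[OF cop[OF J] coproduct_D(1)[OF cop[OF JK(2)]] this, folded incl_copair]
  show "incl J K \<in> Hom C (S J) (S K)" "j \<in> J \<Longrightarrow> incl J K \<cdot> \<iota> J j = \<iota> K j" using c by auto
qed

lemma incl_trans:
  assumes "J \<subseteq> K" "K \<subseteq> L" "L \<subseteq> I"
  shows "incl K L \<cdot> incl J K = incl J L"
proof (rule coproduct_eqI)
  have J: "J \<subseteq> I" "K \<subseteq> I" "J \<subseteq> L" using assms by auto
  note H = incl_Hom[OF assms(1) J(2)] incl_Hom[OF assms(2,3)]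
  show "is_coproduct C J N (S J) (\<iota> J)" by (rule cop[OF J(1)])
  show "incl K L \<cdot> incl J K \<in> Hom C (S J) (S L)" using Comp_Hom[OF H] .
  show "incl J L \<in> Hom C (S J) (S L)" using incl_Hom[OF J(3) assms(3)] .
  fix j assume j: "j \<in> J"
  have "(incl K L \<cdot> incl J K) \<cdot> \<iota> J j = incl K L \<cdot> (incl J K \<cdot> \<iota> J j)"
    using Comp_assoc[OF coproduct_D(3)[OF cop[OF J(1)] j] H] .
  then show "(incl K L \<cdot> incl J K) \<cdot> \<iota> J j = incl J L \<cdot> \<iota> J j"
    using incl_Comp[OF assms(1) J(2) j] incl_Comp[OF assms(2,3)] incl_Comp[OF J(3) assms(3) j] j assms(1)
    by auto
qed

lemma incl_split:
  assumes J: "J \<subseteq> I"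
  obtains r where "r \<in> Hom C (S I) (S J)" "incl J I \<cdot> r = restr I N (S I) (\<iota> I) J"
    "r \<cdot> incl J I = Ident C (S J)"
proof -
  note cI = cop[OF subset_refl] and cJ = cop[OF J]
  note Ob = coproduct_D(1)[OF cI] coproduct_D(1)[OF cJ]
  let ?g = "\<lambda>i. if i \<in> J then \<iota> J i else \<zero> (N i) (S J)"
  have "\<And>i. i \<in> I \<Longrightarrow> ?g i \<in> Hom C (N i) (S J)"
    using coproduct_D(3)[OF cJ] coproduct_D(2)[OF cI] Ob Zero_Hom by auto
  note r = copair_Hom[OF cI Ob(2) this] copair_Comp[OF cI Ob(2) this]
  let ?r = "copair I (S I) (\<iota> I) (S J) ?g"
  note H = incl_Hom[OF J subset_refl]
  have "incl J I \<cdot> ?r = restr I N (S I) (\<iota> I) J"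
  proof (rule coproduct_eqI[OF cI Comp_Hom[OF r(1) H] restr_Hom[OF cI]])
    fix i assume i: "i \<in> I"
    have "(incl J I \<cdot> ?r) \<cdot> \<iota> I i = incl J I \<cdot> (?r \<cdot> \<iota> I i)"
      using Comp_assoc[OF coproduct_D(3)[OF cI i] r(1) H] .
    then show "(incl J I \<cdot> ?r) \<cdot> \<iota> I i = restr I N (S I) (\<iota> I) J \<cdot> \<iota> I i"
      using r(2)[OF _ i] restr_in[OF cI i] restr_notin[OF cI i] incl_Comp[OF J subset_refl] H
        coproduct_D(2)[OF cI i]
      by (cases "i \<in> J") (simp_all add: Hom_iff)
  qed
  moreover have "?r \<cdot> incl J I = Ident C (S J)"
  proof (rule coproduct_eqI[OF cJ Comp_Hom[OF H r(1)] Ident_Hom[OF Ob(2)]])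
    fix i assume i: "i \<in> J"
    have "(?r \<cdot> incl J I) \<cdot> \<iota> J i = ?r \<cdot> (incl J I \<cdot> \<iota> J i)"
      using Comp_assoc[OF coproduct_D(3)[OF cJ i] H r(1)] .
    then show "(?r \<cdot> incl J I) \<cdot> \<iota> J i = Ident C (S J) \<cdot> \<iota> J i"
      using r(2)[of i] i J incl_Comp[OF J subset_refl i] Ident_Comp[OF coproduct_D(3)[OF cJ i]] by auto
  qed
  ultimately show thesis using that r(1) by blast
qed

lemma incl_cancel:
  assumes J: "J \<subseteq> I" and x: "x \<in> Hom C M (S J)" "y \<in> Hom C M (S J)" and eq: "incl J I \<cdot> x = incl J I \<cdot> y"
  shows "x = y"
proof -
  obtain r where r: "r \<in> Hom C (S I) (S J)" "r \<cdot> incl J I = Ident C (S J)" using incl_split[OF J] .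
  note H = incl_Hom[OF J subset_refl]
  have "r \<cdot> (incl J I \<cdot> x) = r \<cdot> (incl J I \<cdot> y)" using eq by simp
  then have "(r \<cdot> incl J I) \<cdot> x = (r \<cdot> incl J I) \<cdot> y"
    using Comp_assoc[OF x(1) H r(1)] Comp_assoc[OF x(2) H r(1)] by simp
  then show ?thesis unfolding r(2) Ident_Comp[OF x(1)] Ident_Comp[OF x(2)] .
qed

lemma dirlim_bij_iff:
  "bij_betw (dirlim_map (\<lambda>J f. incl J I \<cdot> f))
     (dirlim {J. J \<subseteq> I \<and> |J| <o \<alpha>} (\<lambda>J. Hom C M (S J)) (\<lambda>J K f. incl J K \<cdot> f)) (Hom C M (S I)) \<longleftrightarrow>
   (\<forall>f\<in>Hom C M (S I). \<exists>J\<subseteq>I. |J| <o \<alpha> \<and> restr I N (S I) (\<iota> I) J \<cdot> f = f)"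
proof -
  let ?\<J> = "{J. J \<subseteq> I \<and> |J| <o \<alpha>}"
  let ?A = "Sigma ?\<J> (\<lambda>J. Hom C M (S J))"
  let ?\<Psi> = "\<lambda>(J, f). incl J I \<cdot> f"
  let ?R = "dirlim_rel ?\<J> (\<lambda>J. Hom C M (S J)) (\<lambda>J K f. incl J K \<cdot> f)"
  have tr: "incl L I \<cdot> (incl J L \<cdot> x) = incl J I \<cdot> x" if "J \<subseteq> L" "L \<subseteq> I" "x \<in> Hom C M (S J)" for J L x
    using Comp_assoc[OF that(3) incl_Hom[OF that(1,2)] incl_Hom[OF that(2) subset_refl]]
      incl_trans[OF that(1,2) subset_refl] by simp
  have R: "?R = {(a, b). a \<in> ?A \<and> b \<in> ?A \<and> ?\<Psi> a = ?\<Psi> b}"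
  proof -
    have "((J, x), (K, y)) \<in> ?R \<longleftrightarrow> (J, x) \<in> ?A \<and> (K, y) \<in> ?A \<and> incl J I \<cdot> x = incl K I \<cdot> y" for J x K y
    proof
      assume "((J, x), (K, y)) \<in> ?R"
      then obtain L where L: "(J, x) \<in> ?A" "(K, y) \<in> ?A" "L \<in> ?\<J>" "J \<subseteq> L" "K \<subseteq> L"
        "incl J L \<cdot> x = incl K L \<cdot> y"
        by (auto simp: dirlim_rel_def)
      then show "(J, x) \<in> ?A \<and> (K, y) \<in> ?A \<and> incl J I \<cdot> x = incl K I \<cdot> y"
        using tr[of J L x] tr[of K L y] by auto
    next
      assume a: "(J, x) \<in> ?A \<and> (K, y) \<in> ?A \<and> incl J I \<cdot> x = incl K I \<cdot> y"
      let ?L = "J \<union> K"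
      have L: "?L \<in> ?\<J>" "?L \<subseteq> I" using a card_of_Un_ordLess_infinite_Field[OF \<alpha>(2,1), of J K] by auto
      have "incl J ?L \<cdot> x = incl K ?L \<cdot> y"
      proof (rule incl_cancel[OF L(2)])
        show "incl J ?L \<cdot> x \<in> Hom C M (S ?L)" "incl K ?L \<cdot> y \<in> Hom C M (S ?L)"
          using a L incl_Hom[of J ?L] incl_Hom[of K ?L] by (auto intro: Comp_Hom)
        show "incl ?L I \<cdot> (incl J ?L \<cdot> x) = incl ?L I \<cdot> (incl K ?L \<cdot> y)"
          using a L tr[of J ?L x] tr[of K ?L y] by auto
      qed
      then show "((J, x), (K, y)) \<in> ?R" using a L(1) unfolding dirlim_rel_def by blast
    qed
    then show ?thesis by auto
  qed
  have im: "?\<Psi> ` ?A = {f \<in> Hom C M (S I). \<exists>J\<subseteq>I. |J| <o \<alpha> \<and> restr I N (S I) (\<iota> I) J \<cdot> f = f}"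
  proof (rule subset_antisym; rule subsetI)
    fix f assume "f \<in> ?\<Psi> ` ?A"
    then obtain J x where J: "J \<subseteq> I" "|J| <o \<alpha>" and x: "x \<in> Hom C M (S J)" and f: "f = incl J I \<cdot> x" by auto
    obtain r where r: "r \<in> Hom C (S I) (S J)" "incl J I \<cdot> r = restr I N (S I) (\<iota> I) J"
      "r \<cdot> incl J I = Ident C (S J)" using incl_split[OF J(1)] .
    note H = incl_Hom[OF J(1) subset_refl]
    have "(incl J I \<cdot> r) \<cdot> (incl J I \<cdot> x) = incl J I \<cdot> ((r \<cdot> incl J I) \<cdot> x)"
      using x r(1) H by (simp add: Hom_iff)
    then have "restr I N (S I) (\<iota> I) J \<cdot> f = f" unfolding f r Ident_Comp[OF x] .
    then show "f \<in> {f \<in> Hom C M (S I). \<exists>J\<subseteq>I. |J| <o \<alpha> \<and> restr I N (S I) (\<iota> I) J \<cdot> f = f}"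
      using J Comp_Hom[OF x H] unfolding f by blast
  next
    fix f assume "f \<in> {f \<in> Hom C M (S I). \<exists>J\<subseteq>I. |J| <o \<alpha> \<and> restr I N (S I) (\<iota> I) J \<cdot> f = f}"
    then obtain J where f: "f \<in> Hom C M (S I)" and J: "J \<subseteq> I" "|J| <o \<alpha>" "restr I N (S I) (\<iota> I) J \<cdot> f = f"
      by auto
    obtain r where r: "r \<in> Hom C (S I) (S J)" "incl J I \<cdot> r = restr I N (S I) (\<iota> I) J"
      using incl_split[OF J(1)] .
    have "incl J I \<cdot> (r \<cdot> f) = f"
      using Comp_assoc[OF f r(1) incl_Hom[OF J(1) subset_refl]] r(2) J(3) by simp
    then show "f \<in> ?\<Psi> ` ?A" using J Comp_Hom[OF f r(1)] by (intro image_eqI[of _ _ "(J, r \<cdot> f)"]) auto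
  qed
  have m: "dirlim_map (\<lambda>J f. incl J I \<cdot> f) = (\<lambda>c. the_elem (?\<Psi> ` c))"
    by (simp add: dirlim_map_def fun_eq_iff)
  have "bij_betw (dirlim_map (\<lambda>J f. incl J I \<cdot> f)) (?A // ?R) (?\<Psi> ` ?A)"
    unfolding m by (rule quotient_kernel_bij[OF R])
  then have "bij_betw (dirlim_map (\<lambda>J f. incl J I \<cdot> f)) (?A // ?R) (Hom C M (S I)) \<longleftrightarrow> ?\<Psi> ` ?A = Hom C M (S I)"
    by (auto simp: bij_betw_def)
  then show ?thesis unfolding dirlim_def im by blast
qed

end

end


locale smashing_additive = universe \<kappa> + additive_category C
  for \<kappa> :: "'u rel" and C :: "('o, 'm, 'z) additive_category_scheme" (structure) +
  assumes smash: "smashing \<kappa> C"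
begin

lemma ex_coproduct:
  assumes "small \<kappa> I" "\<And>i. i \<in> I \<Longrightarrow> N i \<in> Ob C"
  obtains S \<iota> where "is_coproduct C I N S \<iota>"
  using smashing_any[OF inacc smash assms] .

text \<open>
  The comparison map from the direct limit is always injective, because the coproduct over \<open>J\<close> is a
  direct summand of the coproduct over \<open>I\<close>. So smallness only says that every map into a coproduct is
  supported on fewer than \<open>\<alpha>\<close> summands.
\<close>

lemma small_object_iff:
  fixes \<alpha> :: "'c rel"
  assumes \<alpha>: "Card_order \<alpha>" "infinite (Field \<alpha>)"
  shows "small_object \<kappa> \<alpha> C M \<longleftrightarrow> M \<in> Ob C \<and>
    (\<forall>(I :: 'u set) N S \<iota>. small \<kappa> I \<and> is_coproduct C I N S \<iota> \<longrightarrow>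
      (\<forall>f\<in>Hom C M S. \<exists>J\<subseteq>I. |J| <o \<alpha> \<and> restr I N S \<iota> J \<cdot> f = f))"
proof (intro iffI conjI allI impI; (elim conjE)?)
  assume s: "small_object \<kappa> \<alpha> C M"
  then show M: "M \<in> Ob C" by (simp add: small_object_def)
  fix I :: "'u set" and N S \<iota> assume I: "small \<kappa> I" and cop: "is_coproduct C I N S \<iota>"
  have "\<exists>S \<iota>. is_coproduct C J N S \<iota>" if J: "J \<subseteq> I" for J
  proof -
    have N: "N i \<in> Ob C" if "i \<in> J" for i
      using coproduct_D(2)[OF cop, of i] that J by blast
    obtain S0 \<iota>0 where "is_coproduct C J N S0 \<iota>0" using ex_coproduct[OF small_subset[OF I J] N] .
    then show ?thesis by (intro exI)
  qed
  then obtain S' \<iota>' where S': "\<And>J. J \<subseteq> I \<Longrightarrow> is_coproduct C J N (S' J) (\<iota>' J)" by metis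
  let ?S = "S'(I := S)" and ?\<iota> = "\<iota>'(I := \<iota>)"
  have c: "is_coproduct C J N (?S J) (?\<iota> J)" if "J \<subseteq> I" for J using S'[OF that] cop by simp
  have "\<forall>f\<in>Hom C M (?S I). \<exists>J\<subseteq>I. |J| <o \<alpha> \<and> restr I N (?S I) (?\<iota> I) J \<cdot> f = f"
  proof (rule dirlim_bij_iff[where I = I and S = ?S and \<iota> = ?\<iota>, OF c M \<alpha>, THEN iffD1])
    show "bij_betw (dirlim_map (\<lambda>J f. coproduct_incl C ?S ?\<iota> J I \<cdot> f))
     (dirlim {J. J \<subseteq> I \<and> |J| <o \<alpha>} (\<lambda>J. Hom C M (?S J)) (\<lambda>J K f. coproduct_incl C ?S ?\<iota> J K \<cdot> f))
     (Hom C M (?S I))"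
      by (rule s[unfolded small_object_def, THEN conjunct2, rule_format]) (use I c in blast)
  qed
  then show "\<forall>f\<in>Hom C M S. \<exists>J\<subseteq>I. |J| <o \<alpha> \<and> restr I N S \<iota> J \<cdot> f = f" by simp
next
  assume M: "M \<in> Ob C" and *: "\<forall>(I :: 'u set) N S \<iota>. small \<kappa> I \<and> is_coproduct C I N S \<iota> \<longrightarrow>
      (\<forall>f\<in>Hom C M S. \<exists>J\<subseteq>I. |J| <o \<alpha> \<and> restr I N S \<iota> J \<cdot> f = f)"
  show "small_object \<kappa> \<alpha> C M"
    unfolding small_object_def
  proof (intro conjI allI impI, rule M, elim conjE)
    fix I :: "'u set" and N S \<iota> assume I: "small \<kappa> I" and c: "\<forall>J\<subseteq>I. is_coproduct C J N (S J) (\<iota> J)"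
    then have c': "\<And>J. J \<subseteq> I \<Longrightarrow> is_coproduct C J N (S J) (\<iota> J)" by simp
    show "bij_betw (dirlim_map (\<lambda>J f. coproduct_incl C S \<iota> J I \<cdot> f))
     (dirlim {J. J \<subseteq> I \<and> |J| <o \<alpha>} (\<lambda>J. Hom C M (S J)) (\<lambda>J K f. coproduct_incl C S \<iota> J K \<cdot> f)) (Hom C M (S I))"
      using * I c'[OF subset_refl]
      by (intro dirlim_bij_iff[where I = I and S = S and \<iota> = \<iota>, OF c' M \<alpha>, THEN iffD2]) blast+
  qed
qed

lemma small_objectD:
  fixes \<alpha> :: "'c rel" and I :: "'i set"
  assumes \<alpha>: "Card_order \<alpha>" "infinite (Field \<alpha>)" and M: "small_object \<kappa> \<alpha> C M"
    and I: "small \<kappa> I" and cop: "is_coproduct C I N S \<iota>" and f: "f \<in> Hom C M S"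
  obtains J where "J \<subseteq> I" "|J| <o \<alpha>" "restr I N S \<iota> J \<cdot> f = f"
proof -
  obtain b :: "'i \<Rightarrow> 'u" where b: "inj_on b I" using small_encode[OF I] .
  let ?v = "inv_into I b" and ?I = "b ` I"
  have "bij_betw ?v ?I I" using b by (simp add: bij_betw_inv_into inj_on_imp_bij_betw)
  from coproduct_reindex[OF cop this]
  have c: "is_coproduct C ?I (\<lambda>i. N (?v i)) S (\<lambda>i. \<iota> (?v i))" .
  obtain J where J: "J \<subseteq> ?I" "|J| <o \<alpha>" "restr ?I (\<lambda>i. N (?v i)) S (\<lambda>i. \<iota> (?v i)) J \<cdot> f = f"
    using M c f small_image[OF I, of b] unfolding small_object_iff[OF \<alpha>] by blast
  have "restr ?I (\<lambda>i. N (?v i)) S (\<lambda>i. \<iota> (?v i)) J = restr I N S \<iota> (?v ` J)"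
  proof (rule coproduct_eqI[OF cop restr_Hom[OF c] restr_Hom[OF cop]])
    fix i assume i: "i \<in> I"
    have "b i \<in> J \<longleftrightarrow> i \<in> ?v ` J" using b i J(1)
      by (auto simp: image_iff subset_eq inv_into_f_f f_inv_into_f intro: bexI[of _ "b i"])
    then show "restr ?I (\<lambda>i. N (?v i)) S (\<lambda>i. \<iota> (?v i)) J \<cdot> \<iota> i = restr I N S \<iota> (?v ` J) \<cdot> \<iota> i"
      using restr_in[OF c, of "b i" J] restr_notin[OF c, of "b i" J] restr_in[OF cop i, of "?v ` J"]
        restr_notin[OF cop i, of "?v ` J"] b i by (cases "b i \<in> J") (auto simp: inv_into_f_f)
  qed
  moreover have "?v ` J \<subseteq> I" using J(1) b by auto
  moreover have "|?v ` J| <o \<alpha>" using card_of_image ordLeq_ordLess_trans J(2) by blast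
  ultimately show thesis using that J(3) by metis
qed

end


locale smashing_triangulated = universe \<kappa> + triangulated_category C
  for \<kappa> :: "'u rel" and C :: "('o, 'm, 'z) triangulated_category_scheme" (structure) +
  assumes smash: "smashing \<kappa> C"

sublocale smashing_triangulated \<subseteq> smashing_additive
  by unfold_locales (rule smash)

context smashing_triangulated begin

lemma restr_Shift:
  assumes cop: "is_coproduct C I N S \<iota>"
  shows "restr I (\<lambda>i. Shift C (N i)) (Shift C S) (\<lambda>i. ShiftA C (\<iota> i)) J = ShiftA C (restr I N S \<iota> J)"
proof -
  note c = coproduct_Shift[OF cop]
  show ?thesis
  proof (rule coproduct_eqI[OF c restr_Hom[OF c] ShiftA_Hom[OF restr_Hom[OF cop]]])
    fix i assume i: "i \<in> I"
    have "ShiftA C (restr I N S \<iota> J) \<cdot> ShiftA C (\<iota> i) = ShiftA C (restr I N S \<iota> J \<cdot> \<iota> i)"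
      using ShiftA_Comp[OF coproduct_D(3)[OF cop i] restr_Hom[OF cop]] by simp
    then show "restr I (\<lambda>i. Shift C (N i)) (Shift C S) (\<lambda>i. ShiftA C (\<iota> i)) J \<cdot> ShiftA C (\<iota> i)
        = ShiftA C (restr I N S \<iota> J) \<cdot> ShiftA C (\<iota> i)"
      using restr_in[OF c i] restr_notin[OF c i] restr_in[OF cop i] restr_notin[OF cop i]
        coproduct_D[OF cop] i by (cases "i \<in> J") auto
  qed
qed

context
  fixes \<alpha> :: "'c rel"
  assumes \<alpha>: "Card_order \<alpha>" "infinite (Field \<alpha>)"
begin

lemma small_objectI:
  assumes "M \<in> Ob C"
    and "\<And>(I :: 'u set) N S \<iota> f. \<lbrakk>small \<kappa> I; is_coproduct C I N S \<iota>; f \<in> Hom C M S\<rbrakk>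
      \<Longrightarrow> \<exists>J\<subseteq>I. |J| <o \<alpha> \<and> restr I N S \<iota> J \<cdot> f = f"
  shows "M \<in> small_objects \<kappa> \<alpha> C"
  unfolding small_objects_def mem_Collect_eq small_object_iff[OF \<alpha>]
  using assms by blast

lemma small_objects_Ob: "small_objects \<kappa> \<alpha> C \<subseteq> Ob C"
  by (auto simp: small_objects_def small_object_def)

lemma small_objectsD:
  assumes "M \<in> small_objects \<kappa> \<alpha> C" "small \<kappa> I" "is_coproduct C I N S \<iota>" "f \<in> Hom C M S"
  obtains J where "J \<subseteq> I" "|J| <o \<alpha>" "restr I N S \<iota> J \<cdot> f = f"
  using small_objectD[OF \<alpha> _ assms(2-4)] assms(1) by (auto simp: small_objects_def)

lemma ordLess_Un: "|J| <o \<alpha> \<Longrightarrow> |K| <o \<alpha> \<Longrightarrow> |J \<union> K| <o \<alpha>"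
  using card_of_Un_ordLess_infinite_Field[OF \<alpha>(2,1)] .

lemma small_objects_retract: "closed_retracts C (small_objects \<kappa> \<alpha> C)"
  unfolding closed_retracts_def
proof (intro ballI allI impI)
  fix X Y assume Y: "Y \<in> small_objects \<kappa> \<alpha> C" and "is_retract C X Y"
  then obtain i p where X: "X \<in> Ob C" and ip: "i \<in> Hom C X Y" "p \<in> Hom C Y X" "p \<cdot> i = Ident C X"
    by (auto simp: is_retract_def)
  show "X \<in> small_objects \<kappa> \<alpha> C"
  proof (rule small_objectI[OF X])
    fix I :: "'u set" and N S \<iota> f assume I: "small \<kappa> I" and cop: "is_coproduct C I N S \<iota>" and f: "f \<in> Hom C X S"
    obtain J where J: "J \<subseteq> I" "|J| <o \<alpha>" "restr I N S \<iota> J \<cdot> (f \<cdot> p) = f \<cdot> p"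
      using small_objectsD[OF Y I cop Comp_Hom[OF ip(2) f]] .
    have fpi: "(f \<cdot> p) \<cdot> i = f" using Comp_assoc[OF ip(1,2) f] ip(3) Comp_Ident[OF f] by simp
    have "restr I N S \<iota> J \<cdot> ((f \<cdot> p) \<cdot> i) = (f \<cdot> p) \<cdot> i"
      using Comp_assoc[OF ip(1) Comp_Hom[OF ip(2) f] restr_Hom[OF cop, of J]] J(3) by simp
    then show "\<exists>J\<subseteq>I. |J| <o \<alpha> \<and> restr I N S \<iota> J \<cdot> f = f" using J unfolding fpi by blast
  qed
qed

lemma small_objects_Shift_iff:
  assumes M: "M \<in> Ob C"
  shows "Shift C M \<in> small_objects \<kappa> \<alpha> C \<longleftrightarrow> M \<in> small_objects \<kappa> \<alpha> C"
proof
  assume s: "Shift C M \<in> small_objects \<kappa> \<alpha> C"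
  show "M \<in> small_objects \<kappa> \<alpha> C"
  proof (rule small_objectI[OF M])
    fix I :: "'u set" and N S \<iota> f assume I: "small \<kappa> I" and cop: "is_coproduct C I N S \<iota>" and f: "f \<in> Hom C M S"
    obtain J where J: "J \<subseteq> I" "|J| <o \<alpha>"
      "restr I (\<lambda>i. Shift C (N i)) (Shift C S) (\<lambda>i. ShiftA C (\<iota> i)) J \<cdot> ShiftA C f = ShiftA C f"
      using small_objectsD[OF s I coproduct_Shift[OF cop] ShiftA_Hom[OF f]] .
    then have "ShiftA C (restr I N S \<iota> J \<cdot> f) = ShiftA C f"
      using ShiftA_Comp[OF f restr_Hom[OF cop]] by (simp add: restr_Shift[OF cop])
    then have "restr I N S \<iota> J \<cdot> f = f" by (rule ShiftA_inj[OF Comp_Hom[OF f restr_Hom[OF cop]] f])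
    then show "\<exists>J\<subseteq>I. |J| <o \<alpha> \<and> restr I N S \<iota> J \<cdot> f = f" using J by blast
  qed
next
  assume s: "M \<in> small_objects \<kappa> \<alpha> C"
  show "Shift C M \<in> small_objects \<kappa> \<alpha> C"
  proof (rule small_objectI[OF Shift_Ob[OF M]])
    fix I :: "'u set" and N S \<iota> f assume I: "small \<kappa> I" and cop: "is_coproduct C I N S \<iota>"
      and f: "f \<in> Hom C (Shift C M) S"
    note D = coproduct_D[OF cop]
    obtain S' where S': "S' \<in> Ob C" "S = Shift C S'" using Shift_obtain[OF D(1)] .
    have "\<forall>i\<in>I. \<exists>X. X \<in> Ob C \<and> N i = Shift C X" using Shift_obtain[OF D(2)] by metis
    then obtain N' where N': "\<And>i. i \<in> I \<Longrightarrow> N' i \<in> Ob C" "\<And>i. i \<in> I \<Longrightarrow> N i = Shift C (N' i)" by metis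
    obtain k where c': "is_coproduct C I N' S' k" and k: "\<forall>i\<in>I. \<iota> i = ShiftA C (k i)"
      using coproduct_unshift_ex[OF cop S' N'] .
    note c = coproduct_Shift[OF c']
    obtain g where g: "g \<in> Hom C M S'" "f = ShiftA C g"
      using ShiftA_surj[OF f[unfolded S'(2)] M S'(1)] .
    obtain J where J: "J \<subseteq> I" "|J| <o \<alpha>" "restr I N' S' k J \<cdot> g = g" using small_objectsD[OF s I c' g(1)] .
    have "restr I N S \<iota> J = ShiftA C (restr I N' S' k J)"
    proof (rule coproduct_eqI[OF cop restr_Hom[OF cop]])
      show "ShiftA C (restr I N' S' k J) \<in> Hom C S S" unfolding S'(2) using ShiftA_Hom[OF restr_Hom[OF c']] .
      fix i assume i: "i \<in> I"
      show "restr I N S \<iota> J \<cdot> \<iota> i = ShiftA C (restr I N' S' k J) \<cdot> \<iota> i"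
        using restr_in[OF cop i, of J] restr_notin[OF cop i, of J] restr_in[OF c i, of J] restr_notin[OF c i, of J]
          N'(2)[OF i] bspec[OF k i] S'(2) unfolding restr_Shift[OF c'] by (cases "i \<in> J") auto
    qed
    moreover have "ShiftA C (restr I N' S' k J) \<cdot> ShiftA C g = ShiftA C g"
      using ShiftA_Comp[OF g(1) restr_Hom[OF c']] J(3) by metis
    ultimately show "\<exists>J\<subseteq>I. |J| <o \<alpha> \<and> restr I N S \<iota> J \<cdot> f = f" using J g(2) by metis
  qed
qed

text \<open>
  The support of a map out of the cone is bounded by the union of two supports, so singular \<open>\<alpha>\<close> are no
  exception.
\<close>

lemma small_objects_cone:
  assumes t: "triangle C X Y Z f g h" and X: "X \<in> small_objects \<kappa> \<alpha> C" and Y: "Y \<in> small_objects \<kappa> \<alpha> C"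
  shows "Z \<in> small_objects \<kappa> \<alpha> C"
proof (rule small_objectI[OF triangle_Ob(3)[OF t]])
  fix I :: "'u set" and N S \<iota> z assume I: "small \<kappa> I" and cop: "is_coproduct C I N S \<iota>" and z: "z \<in> Hom C Z S"
  note H = triangle_D[OF t] and r = restr_Hom[OF cop]
  obtain J where J: "J \<subseteq> I" "|J| <o \<alpha>" "restr I N S \<iota> J \<cdot> (z \<cdot> g) = z \<cdot> g"
    using small_objectsD[OF Y I cop Comp_Hom[OF H(2) z]] .
  \<comment> \<open>The part of \<open>z\<close> outside \<open>J\<close> vanishes on \<open>Y\<close>, hence factors through \<open>X[1]\<close>.\<close>
  define z' where "z' = z \<ominus> (restr I N S \<iota> J \<cdot> z)"
  have rz: "restr I N S \<iota> J \<cdot> z \<in> Hom C Z S" using Comp_Hom[OF z r] .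
  have z': "z' \<in> Hom C Z S" unfolding z'_def using diff_Hom[OF z rz] .
  have "z' \<cdot> g = (z \<cdot> g) \<ominus> (restr I N S \<iota> J \<cdot> (z \<cdot> g))"
    using z H r[of J] by (simp add: z'_def Hom_iff)
  then have "z' \<cdot> g = \<zero> Y S" using J(3) diff_self[OF Comp_Hom[OF H(2) z]] by simp
  then obtain w where w: "w \<in> Hom C (Shift C X) S" "z' = w \<cdot> h" using triangle_extend2[OF t z'] by blast
  have SX: "Shift C X \<in> small_objects \<kappa> \<alpha> C" using X small_objects_Shift_iff triangle_Ob[OF t] by blast
  obtain K where K: "K \<subseteq> I" "|K| <o \<alpha>" "restr I N S \<iota> K \<cdot> w = w" using small_objectsD[OF SX I cop w(1)] .
  have 1: "restr I N S \<iota> (J \<union> K) \<cdot> z' = z'"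
    using Comp_assoc[OF H(3) w(1) r] restr_mono[OF cop w(1) K(3), of "J \<union> K"] w(2) by (metis Un_upper2)
  have rrz: "restr I N S \<iota> J \<cdot> (restr I N S \<iota> J \<cdot> z) = restr I N S \<iota> J \<cdot> z"
    using Comp_assoc[OF z r r, of J J] restr_restr[OF cop, of J J] by simp
  have 2: "restr I N S \<iota> (J \<union> K) \<cdot> (restr I N S \<iota> J \<cdot> z) = restr I N S \<iota> J \<cdot> z"
    using restr_mono[OF cop rz rrz] by blast
  have "z = z' \<oplus> (restr I N S \<iota> J \<cdot> z)" unfolding z'_def using diff_add[OF z rz] by simp
  moreover have "restr I N S \<iota> (J \<union> K) \<cdot> (z' \<oplus> (restr I N S \<iota> J \<cdot> z))
     = (restr I N S \<iota> (J \<union> K) \<cdot> z') \<oplus> (restr I N S \<iota> (J \<union> K) \<cdot> (restr I N S \<iota> J \<cdot> z))"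
    using Comp_Add[OF z' rz r] .
  ultimately have "restr I N S \<iota> (J \<union> K) \<cdot> z = z" using 1 2 by simp
  then show "\<exists>J\<subseteq>I. |J| <o \<alpha> \<and> restr I N S \<iota> J \<cdot> z = z"
    using J K ordLess_Un by (intro exI[of _ "J \<union> K"]) auto
qed

lemma small_objects_fiber:
  assumes t: "triangle C X Y Z f g h" and "Y \<in> small_objects \<kappa> \<alpha> C" "Z \<in> small_objects \<kappa> \<alpha> C"
  shows "X \<in> small_objects \<kappa> \<alpha> C"
  using small_objects_cone[OF triangle_rotate[OF t]] assms(2,3)
    small_objects_Shift_iff[OF triangle_Ob(1)[OF t]] by simp

lemma small_objects_additive: "additive_class C (small_objects \<kappa> \<alpha> C)"
  unfolding additive_class_def
proof (intro conjI allI ballI impI)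
  show "small_objects \<kappa> \<alpha> C \<subseteq> Ob C" by (rule small_objects_Ob)
  fix Z assume Z: "zero_object C Z"
  then have ZO: "Z \<in> Ob C" by (simp add: zero_object_def)
  have e: "|{} :: 'u set| <o \<alpha>"
  proof (rule finite_ordLess_infinite)
    show "Well_order \<alpha>" using \<alpha>(1) by (rule card_order_on_well_order_on)
    show "Well_order |{} :: 'u set|" by (rule card_of_Well_order)
  qed (use \<alpha>(2) in \<open>simp_all add: Field_card_of\<close>)
  show "Z \<in> small_objects \<kappa> \<alpha> C"
  proof (rule small_objectI[OF ZO])
    fix I :: "'u set" and N S \<iota> f assume I: "small \<kappa> I" and cop: "is_coproduct C I N S \<iota>" and f: "f \<in> Hom C Z S"
    have "restr I N S \<iota> {} \<cdot> f = f"
      using from_zero_object[OF Z f] from_zero_object[OF Z Comp_Hom[OF f restr_Hom[OF cop]]] by simp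
    then show "\<exists>J\<subseteq>I. |J| <o \<alpha> \<and> restr I N S \<iota> J \<cdot> f = f" using e by blast
  qed
next
  fix X Y S0 assume X: "X \<in> small_objects \<kappa> \<alpha> C" and Y: "Y \<in> small_objects \<kappa> \<alpha> C" and b: "is_biproduct C X Y S0"
  then obtain i j p q where m: "i \<in> Hom C X S0" "j \<in> Hom C Y S0" "p \<in> Hom C S0 X" "q \<in> Hom C S0 Y"
    and e: "(i \<cdot> p) \<oplus> (j \<cdot> q) = Ident C S0" using biproductE by metis
  show "S0 \<in> small_objects \<kappa> \<alpha> C"
  proof (rule small_objectI)
    show "S0 \<in> Ob C" using m by (simp add: Hom_iff)
    fix I :: "'u set" and N S \<iota> f assume I: "small \<kappa> I" and cop: "is_coproduct C I N S \<iota>" and f: "f \<in> Hom C S0 S"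
    note fi = Comp_Hom[OF m(1) f] and fj = Comp_Hom[OF m(2) f]
    obtain J where J: "J \<subseteq> I" "|J| <o \<alpha>" "restr I N S \<iota> J \<cdot> (f \<cdot> i) = f \<cdot> i" using small_objectsD[OF X I cop fi] .
    obtain K where K: "K \<subseteq> I" "|K| <o \<alpha>" "restr I N S \<iota> K \<cdot> (f \<cdot> j) = f \<cdot> j" using small_objectsD[OF Y I cop fj] .
    let ?r = "restr I N S \<iota> (J \<union> K)"
    have r: "?r \<cdot> (f \<cdot> i) = f \<cdot> i" "?r \<cdot> (f \<cdot> j) = f \<cdot> j"
      using restr_mono[OF cop fi J(3)] restr_mono[OF cop fj K(3)] by auto
    have "f \<cdot> ((i \<cdot> p) \<oplus> (j \<cdot> q)) = ((f \<cdot> i) \<cdot> p) \<oplus> ((f \<cdot> j) \<cdot> q)" using f m by (simp add: Hom_iff)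
    then have f2: "f = ((f \<cdot> i) \<cdot> p) \<oplus> ((f \<cdot> j) \<cdot> q)" unfolding e using Comp_Ident[OF f] by simp
    have "?r \<cdot> (((f \<cdot> i) \<cdot> p) \<oplus> ((f \<cdot> j) \<cdot> q)) = ((?r \<cdot> (f \<cdot> i)) \<cdot> p) \<oplus> ((?r \<cdot> (f \<cdot> j)) \<cdot> q)"
      using f m restr_Hom[OF cop, of "J \<union> K"] by (simp add: Hom_iff)
    then have "?r \<cdot> f = f" unfolding r using f2 by simp
    then show "\<exists>J\<subseteq>I. |J| <o \<alpha> \<and> restr I N S \<iota> J \<cdot> f = f"
      using J K ordLess_Un by (intro exI[of _ "J \<union> K"]) auto
  qed
qed

lemma small_objects_triangulated: "triangulated_subcategory C (small_objects \<kappa> \<alpha> C)"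
  unfolding triangulated_subcategory_def additive_subcategory_def
proof (intro conjI ballI allI impI)
  show "additive_class C (small_objects \<kappa> \<alpha> C)" by (rule small_objects_additive)
  show "closed_iso C (small_objects \<kappa> \<alpha> C)" using closed_retracts_iso small_objects_retract by blast
  show "shift C 1 ` small_objects \<kappa> \<alpha> C \<subseteq> small_objects \<kappa> \<alpha> C"
    using small_objects_Shift_iff small_objects_Ob by auto
  show "shift C (- 1) ` small_objects \<kappa> \<alpha> C \<subseteq> small_objects \<kappa> \<alpha> C"
  proof clarify
    fix X assume X: "X \<in> small_objects \<kappa> \<alpha> C"
    then have "X \<in> Ob C" using small_objects_Ob by blast
    then show "shift C (- 1) X \<in> small_objects \<kappa> \<alpha> C"
      using X small_objects_Shift_iff[of "shift C (- 1) X"] Shift_shift[of X "-1"] by simp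
  qed
qed (use small_objects_cone in blast)

end

end

section \<open>Homotopy colimits of sequences\<close>

context triangulated_category begin

lemma ShiftA_diff:
  assumes "f \<in> Hom C X Y" "g \<in> Hom C X Y"
  shows "ShiftA C (f \<ominus> g) = ShiftA C f \<ominus> ShiftA C g"
  unfolding diff_def using ShiftA_Add[OF assms(1) neg_Hom[OF assms(2)]] ShiftA_neg[OF assms(2)] by simp

end

context smashing_triangulated begin

lemmas natLeq_infinite = natLeq_Card_order Field_natLeq[THEN arg_cong[where f = infinite], THEN iffD2, OF infinite_UNIV_nat]

abbreviation compacts :: "'o set" where "compacts \<equiv> compact_objects \<kappa> C"

lemma compact_Ob: "c \<in> compacts \<Longrightarrow> c \<in> Ob C"
  using small_objects_Ob[OF natLeq_infinite] by (auto simp: compact_objects_def)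

lemma compactD:
  assumes "c \<in> compacts" "small \<kappa> I" "is_coproduct C I N S \<iota>" "f \<in> Hom C c S"
  obtains J where "J \<subseteq> I" "finite J" "restr I N S \<iota> J \<cdot> f = f"
  using small_objectsD[OF natLeq_infinite assms(1)[unfolded compact_objects_def] assms(2-4)]
    finite_iff_ordLess_natLeq by metis

lemma compact_eq_Zero:
  assumes "c \<in> compacts" "small \<kappa> I" and cop: "is_coproduct C I N S \<iota>" and f: "f \<in> Hom C c S"
    and "\<And>i. i \<in> I \<Longrightarrow> cproj I N S \<iota> i \<cdot> f = \<zero> c (N i)"
  shows "f = \<zero> c S"
proof -
  obtain J where "finite J" "restr I N S \<iota> J \<cdot> f = f" using compactD[OF assms(1-4)] .
  from finite_support_eq_Zero[OF cop f this assms(5)] show ?thesis .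
qed

lemma compact_Shift_iff: "M \<in> Ob C \<Longrightarrow> Shift C M \<in> compacts \<longleftrightarrow> M \<in> compacts"
  unfolding compact_objects_def by (rule small_objects_Shift_iff[OF natLeq_infinite])

lemma compact_fiber: "triangle C X Y Z f g h \<Longrightarrow> Y \<in> compacts \<Longrightarrow> Z \<in> compacts \<Longrightarrow> X \<in> compacts"
  unfolding compact_objects_def by (rule small_objects_fiber[OF natLeq_infinite])

text \<open>
  The properties of the cone of \<open>1 - shift\<close> on the coproduct of the \<open>X k\<close> that matter below. Extensions of
  compatible families of maps to \<open>T\<close> exist but are not unique; the clause with \<open>g = \<zero> T Y\<close> gives uniqueness for
  targets \<open>Y\<close> such that the transition maps of the tower \<open>Hom(X k[1], Y)\<close> are onto, where its \<open>lim\<^sup>1\<close> vanishes.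
\<close>

definition is_hocolim :: "(nat \<Rightarrow> 'o) \<Rightarrow> (nat \<Rightarrow> 'm) \<Rightarrow> 'o \<Rightarrow> (nat \<Rightarrow> 'm) \<Rightarrow> bool"
  where "is_hocolim X j T u \<longleftrightarrow> T \<in> Ob C \<and> (\<forall>k. u k \<in> Hom C (X k) T \<and> u (Suc k) \<cdot> j k = u k) \<and>
    (\<forall>Y f. Y \<in> Ob C \<and> (\<forall>k. f k \<in> Hom C (X k) Y \<and> f (Suc k) \<cdot> j k = f k) \<longrightarrow>
      (\<exists>g\<in>Hom C T Y. \<forall>k. g \<cdot> u k = f k)) \<and>
    (\<forall>Y. \<forall>g\<in>Hom C T Y. (\<forall>k. g \<cdot> u k = \<zero> (X k) Y) \<and>
      (\<forall>k. \<forall>f\<in>Hom C (Shift C (X k)) Y. \<exists>f'\<in>Hom C (Shift C (X (Suc k))) Y. f = f' \<cdot> ShiftA C (j k)) \<longrightarrow>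
      g = \<zero> T Y) \<and>
    (\<forall>c\<in>compacts. \<forall>x\<in>Hom C c T. \<exists>k. \<exists>y\<in>Hom C c (X k). x = u k \<cdot> y)"

text \<open>
  For a compact \<open>c\<close>, a map \<open>y\<close> from \<open>c\<close> to the coproduct with \<open>(1 - shift) y = 0\<close> has zero components, one
  after the other, so \<open>y = 0\<close>. Hence maps from \<open>c\<close> to the cone lift to the coproduct, where they have finite
  support and can be pushed to a single stage.
\<close>

lemma ex_hocolim:
  assumes j: "\<And>k. j k \<in> Hom C (X k) (X (Suc k))"
  obtains T u where "is_hocolim X j T u"
proof -
  have X: "\<And>k. X k \<in> Ob C" using j by (simp add: Hom_iff)
  obtain S \<iota> where cop: "is_coproduct C (UNIV :: nat set) X S \<iota>"
    using ex_coproduct[of "UNIV :: nat set" X] small_nat X by blast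
  have S: "S \<in> Ob C" and \<iota>: "\<And>k. \<iota> k \<in> Hom C (X k) S" using coproduct_D[OF cop] by auto
  have \<iota>j: "\<And>k. \<iota> (Suc k) \<cdot> j k \<in> Hom C (X k) S" using Comp_Hom[OF j \<iota>] .
  define \<sigma> where "\<sigma> = copair UNIV S \<iota> S (\<lambda>k. \<iota> (Suc k) \<cdot> j k)"
  have \<sigma>: "\<sigma> \<in> Hom C S S" "\<And>k. \<sigma> \<cdot> \<iota> k = \<iota> (Suc k) \<cdot> j k"
    unfolding \<sigma>_def using copair_Hom[OF cop S \<iota>j] copair_Comp[OF cop S \<iota>j] by auto
  define s where "s = Ident C S \<ominus> \<sigma>"
  have s: "s \<in> Hom C S S" unfolding s_def using diff_Hom[OF Ident_Hom[OF S] \<sigma>(1)] .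
  have s\<iota>: "s \<cdot> \<iota> k = \<iota> k \<ominus> (\<iota> (Suc k) \<cdot> j k)" for k
    using \<iota>[of k] \<sigma> S by (simp add: s_def Hom_iff)
  obtain T p h where t: "triangle C S S T s p h" using ex_cone[OF s] by blast
  note p = triangle_D(2)[OF t] and h = triangle_D(3)[OF t] and T = triangle_Ob(3)[OF t]
  define u where "u k = p \<cdot> \<iota> k" for k
  have u: "u k \<in> Hom C (X k) T" for k unfolding u_def using Comp_Hom[OF \<iota> p] .
  have fs: "(f \<cdot> s) \<cdot> \<iota> k = (f \<cdot> \<iota> k) \<ominus> ((f \<cdot> \<iota> (Suc k)) \<cdot> j k)" if f: "f \<in> Hom C S Y" for f Y k
  proof -
    have "(f \<cdot> s) \<cdot> \<iota> k = f \<cdot> (\<iota> k \<ominus> (\<iota> (Suc k) \<cdot> j k))" using Comp_assoc[OF \<iota> s f] s\<iota> by simp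
    also have "\<dots> = (f \<cdot> \<iota> k) \<ominus> ((f \<cdot> \<iota> (Suc k)) \<cdot> j k)"
      using f \<iota>[of k] \<iota>[of "Suc k"] j[of k] by (simp add: Hom_iff)
    finally show ?thesis .
  qed
  have uj: "u (Suc k) \<cdot> j k = u k" for k
  proof -
    have "(p \<cdot> s) \<cdot> \<iota> k = \<zero> (X k) T" using triangle_Comp_Zero(1)[OF t] \<iota>[of k] T by (simp add: Hom_iff)
    then have "u k \<ominus> (u (Suc k) \<cdot> j k) = \<zero> (X k) T" unfolding fs[OF p] u_def .
    then show ?thesis using diff_eq_Zero[OF u Comp_Hom[OF j u]] by simp
  qed
  have ext: "\<exists>g\<in>Hom C T Y. \<forall>k. g \<cdot> u k = f k"
    if Y: "Y \<in> Ob C" and f: "\<And>k. f k \<in> Hom C (X k) Y" "\<And>k. f (Suc k) \<cdot> j k = f k" for Y f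
  proof -
    define F where "F = copair UNIV S \<iota> Y f"
    have F: "F \<in> Hom C S Y" "\<And>k. F \<cdot> \<iota> k = f k"
      unfolding F_def using copair_Hom[OF cop Y f(1)] copair_Comp[OF cop Y f(1)] by auto
    have "F \<cdot> s = \<zero> S Y"
    proof (rule coproduct_eqI[OF cop Comp_Hom[OF s F(1)] Zero_Hom[OF S Y]])
      fix k show "(F \<cdot> s) \<cdot> \<iota> k = \<zero> S Y \<cdot> \<iota> k"
        unfolding fs[OF F(1)] F(2) f(2) using diff_self[OF f(1)] \<iota>[of k] Y by (simp add: Hom_iff)
    qed
    then obtain g where g: "g \<in> Hom C T Y" "F = g \<cdot> p" using triangle_extend1[OF t F(1)] by blast
    have "g \<cdot> u k = f k" for k unfolding u_def using Comp_assoc[OF \<iota> p g(1)] F(2) g(2) by simp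
    then show ?thesis using g by blast
  qed
  have ShS: "is_coproduct C UNIV (\<lambda>i. Shift C (X i)) (Shift C S) (\<lambda>i. ShiftA C (\<iota> i))"
    by (rule coproduct_Shift[OF cop])
  let ?\<iota> = "\<lambda>k. ShiftA C (\<iota> k)" and ?j = "\<lambda>k. ShiftA C (j k)" and ?X = "\<lambda>k. Shift C (X k)"
  note \<iota>' = ShiftA_Hom[OF \<iota>] and j' = ShiftA_Hom[OF j] and s' = ShiftA_Hom[OF s]
  have fs': "(f \<cdot> ShiftA C s) \<cdot> ?\<iota> k = (f \<cdot> ?\<iota> k) \<ominus> ((f \<cdot> ?\<iota> (Suc k)) \<cdot> ?j k)"
    if f: "f \<in> Hom C (Shift C S) Y" for f Y k
  proof -
    have "ShiftA C s \<cdot> ?\<iota> k = ?\<iota> k \<ominus> (?\<iota> (Suc k) \<cdot> ?j k)"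
      using ShiftA_Comp[OF \<iota> s] ShiftA_diff[OF \<iota> \<iota>j] ShiftA_Comp[OF j \<iota>] s\<iota> by simp
    then have "(f \<cdot> ShiftA C s) \<cdot> ?\<iota> k = f \<cdot> (?\<iota> k \<ominus> (?\<iota> (Suc k) \<cdot> ?j k))"
      using Comp_assoc[OF \<iota>' s' f] by simp
    also have "\<dots> = (f \<cdot> ?\<iota> k) \<ominus> ((f \<cdot> ?\<iota> (Suc k)) \<cdot> ?j k)"
      using f \<iota>'[of k] \<iota>'[of "Suc k"] j'[of k] by (simp add: Hom_iff)
    finally show ?thesis .
  qed
  have uniq: "g = \<zero> T Y"
    if g: "g \<in> Hom C T Y" and 0: "\<And>k. g \<cdot> u k = \<zero> (X k) Y"
      and e: "\<And>k f. f \<in> Hom C (Shift C (X k)) Y \<Longrightarrow> \<exists>f'\<in>Hom C (Shift C (X (Suc k))) Y. f = f' \<cdot> ?j k"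
    for Y g
  proof -
    have Y: "Y \<in> Ob C" using g by (simp add: Hom_iff)
    have "g \<cdot> p = \<zero> S Y"
    proof (rule coproduct_eqI[OF cop Comp_Hom[OF p g] Zero_Hom[OF S Y]])
      fix k show "(g \<cdot> p) \<cdot> \<iota> k = \<zero> S Y \<cdot> \<iota> k"
        using Comp_assoc[OF \<iota> p g] 0[of k] \<iota>[of k] Y by (simp add: u_def Hom_iff)
    qed
    then obtain w where w: "w \<in> Hom C (Shift C S) Y" "g = w \<cdot> h" using triangle_extend2[OF t g] by blast
    have w\<iota>: "\<And>k. w \<cdot> ?\<iota> k \<in> Hom C (?X k) Y" using Comp_Hom[OF \<iota>' w(1)] .
    \<comment> \<open>Solve \<open>v k - v (k + 1) j = w k\<close> recursively; this is where the \<open>lim\<^sup>1\<close>-term vanishes.\<close>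
    have "\<exists>v. \<forall>k. v k \<in> Hom C (?X k) Y \<and> v (Suc k) \<cdot> ?j k = v k \<ominus> (w \<cdot> ?\<iota> k)"
    proof (rule dependent_nat_choice)
      show "\<exists>x. x \<in> Hom C (?X 0) Y" using Zero_Hom[OF Shift_Ob[OF X] Y] by blast
      fix x k assume x: "x \<in> Hom C (?X k) Y"
      show "\<exists>y. y \<in> Hom C (?X (Suc k)) Y \<and> y \<cdot> ?j k = x \<ominus> (w \<cdot> ?\<iota> k)"
        using e[OF diff_Hom[OF x w\<iota>]] by metis
    qed
    then obtain v where v: "\<And>k. v k \<in> Hom C (?X k) Y" "\<And>k. v (Suc k) \<cdot> ?j k = v k \<ominus> (w \<cdot> ?\<iota> k)" by blast
    define V where "V = copair UNIV (Shift C S) ?\<iota> Y v"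
    have V: "V \<in> Hom C (Shift C S) Y" "\<And>k. V \<cdot> ?\<iota> k = v k"
      unfolding V_def using copair_Hom[OF ShS Y v(1)] copair_Comp[OF ShS Y v(1)] by auto
    have "V \<cdot> ShiftA C s = w"
    proof (rule coproduct_eqI[OF ShS Comp_Hom[OF s' V(1)] w(1)])
      fix k
      have "v k \<ominus> (v k \<ominus> (w \<cdot> ?\<iota> k)) = w \<cdot> ?\<iota> k"
        using diff_add[OF v(1) w\<iota>] add_diff[OF w\<iota> diff_Hom[OF v(1) w\<iota>]]
          group_laws(1)[OF w\<iota> diff_Hom[OF v(1) w\<iota>]] by metis
      then show "(V \<cdot> ShiftA C s) \<cdot> ?\<iota> k = w \<cdot> ?\<iota> k" unfolding fs'[OF V(1)] V(2) v(2) .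
    qed
    then have "g = V \<cdot> (ShiftA C s \<cdot> h)" using w(2) Comp_assoc[OF h s' V(1)] by simp
    then show ?thesis using triangle_Comp_Zero(3)[OF t] V(1) T by (simp add: Hom_iff)
  qed
  have cpt: "\<exists>k. \<exists>y\<in>Hom C c (X k). x = u k \<cdot> y" if c: "c \<in> compacts" and x: "x \<in> Hom C c T" for c x
  proof -
    note cO = compact_Ob[OF c]
    let ?\<pi> = "cproj UNIV ?X (Shift C S) ?\<iota>"
    have \<pi>: "\<And>k. ?\<pi> k \<in> Hom C (Shift C S) (?X k)" "\<And>k. ?\<pi> k \<cdot> ?\<iota> k = Ident C (?X k)"
      "\<And>k l. l \<noteq> k \<Longrightarrow> ?\<pi> k \<cdot> ?\<iota> l = \<zero> (?X l) (?X k)"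
      using cproj_Hom[OF ShS] cproj_same[OF ShS] cproj_other[OF ShS] by auto
    have \<pi>0: "?\<pi> 0 \<cdot> ShiftA C s = ?\<pi> 0"
    proof (rule coproduct_eqI[OF ShS Comp_Hom[OF s' \<pi>(1)] \<pi>(1)])
      fix k
      have "(?\<pi> 0 \<cdot> ?\<iota> (Suc k)) \<cdot> ?j k = \<zero> (?X k) (?X 0)"
        using \<pi>(3)[of "Suc k" 0] j'[of k] X by (simp add: Hom_iff)
      then show "(?\<pi> 0 \<cdot> ShiftA C s) \<cdot> ?\<iota> k = ?\<pi> 0 \<cdot> ?\<iota> k"
        unfolding fs'[OF \<pi>(1)] using diff_Zero[OF Comp_Hom[OF \<iota>' \<pi>(1)]] by simp
    qed
    have \<pi>S: "?\<pi> (Suc n) \<cdot> ShiftA C s = ?\<pi> (Suc n) \<ominus> (?j n \<cdot> ?\<pi> n)" for n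
    proof (rule coproduct_eqI[OF ShS Comp_Hom[OF s' \<pi>(1)] diff_Hom[OF \<pi>(1) Comp_Hom[OF \<pi>(1) j']]])
      fix k
      have r: "(?\<pi> (Suc n) \<ominus> (?j n \<cdot> ?\<pi> n)) \<cdot> ?\<iota> k = (?\<pi> (Suc n) \<cdot> ?\<iota> k) \<ominus> (?j n \<cdot> (?\<pi> n \<cdot> ?\<iota> k))"
        using \<pi>(1)[of n] \<pi>(1)[of "Suc n"] j'[of n] \<iota>'[of k] by (simp add: Hom_iff)
      have "(?\<pi> (Suc n) \<cdot> ?\<iota> (Suc k)) \<cdot> ?j k = ?j n \<cdot> (?\<pi> n \<cdot> ?\<iota> k)"
      proof (cases "k = n")
        case True
        then show ?thesis using \<pi>(2)[of n] \<pi>(2)[of "Suc n"] j'[of n] by (simp add: Hom_iff)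
      next
        case False
        then show ?thesis using \<pi>(3)[of k n] \<pi>(3)[of "Suc k" "Suc n"] j'[of n] j'[of k] X by (simp add: Hom_iff)
      qed
      then show "(?\<pi> (Suc n) \<cdot> ShiftA C s) \<cdot> ?\<iota> k = (?\<pi> (Suc n) \<ominus> (?j n \<cdot> ?\<pi> n)) \<cdot> ?\<iota> k"
        unfolding fs'[OF \<pi>(1)] r by simp
    qed
    have y: "h \<cdot> x \<in> Hom C c (Shift C S)" using Comp_Hom[OF x h] .
    have sy: "ShiftA C s \<cdot> (h \<cdot> x) = \<zero> c (Shift C S)"
      using Comp_assoc[OF x h s'] triangle_Comp_Zero(3)[OF t] x S by (simp add: Hom_iff)
    have \<pi>sy: "(?\<pi> k \<cdot> ShiftA C s) \<cdot> (h \<cdot> x) = \<zero> c (?X k)" for k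
      using Comp_assoc[OF y s' \<pi>(1), of k] sy \<pi>(1)[of k] cO by (simp add: Hom_iff)
    have "?\<pi> k \<cdot> (h \<cdot> x) = \<zero> c (?X k)" for k
    proof (induction k)
      case 0
      then show ?case using \<pi>sy[of 0] unfolding \<pi>0 .
    next
      case (Suc n)
      have "(?\<pi> (Suc n) \<ominus> (?j n \<cdot> ?\<pi> n)) \<cdot> (h \<cdot> x) = (?\<pi> (Suc n) \<cdot> (h \<cdot> x)) \<ominus> (?j n \<cdot> (?\<pi> n \<cdot> (h \<cdot> x)))"
        using \<pi>(1)[of n] \<pi>(1)[of "Suc n"] j'[of n] y by (simp add: Hom_iff)
      also have "?j n \<cdot> (?\<pi> n \<cdot> (h \<cdot> x)) = \<zero> c (?X (Suc n))" unfolding Suc using j'[of n] cO by (simp add: Hom_iff)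
      finally show ?case using \<pi>sy[of "Suc n"] diff_Zero[OF Comp_Hom[OF y \<pi>(1), of "Suc n"]] unfolding \<pi>S by simp
    qed
    from compact_eq_Zero[OF c small_nat ShS y this] have "h \<cdot> x = \<zero> c (Shift C S)" .
    then obtain z where z: "z \<in> Hom C c S" "x = p \<cdot> z" using triangle_lift2[OF t x] by blast
    obtain J where J: "finite J" "restr UNIV X S \<iota> J \<cdot> z = z" using compactD[OF c small_nat cop z(1)] .
    obtain n where n: "\<And>k. k \<in> J \<Longrightarrow> k \<le> n" using J(1) finite_nat_set_iff_bounded_le by metis
    have "\<exists>m. m \<in> Hom C (X k) (X n) \<and> u n \<cdot> m = u k" if "k \<le> n" for k using that
    proof (induction n rule: nat_induct_at_least)
      case base
      then show ?case using Ident_Hom[OF X] u[of k] by (intro exI[of _ "Ident C (X k)"]) (simp add: Hom_iff)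
    next
      case (Suc n)
      then obtain m where m: "m \<in> Hom C (X k) (X n)" "u n \<cdot> m = u k" by blast
      have "u (Suc n) \<cdot> (j n \<cdot> m) = u k" using Comp_assoc[OF m(1) j u] uj m(2) by simp
      then show ?case using Comp_Hom[OF m(1) j] by blast
    qed
    then obtain m where m: "\<And>k. k \<le> n \<Longrightarrow> m k \<in> Hom C (X k) (X n)" "\<And>k. k \<le> n \<Longrightarrow> u n \<cdot> m k = u k" by metis
    define v where "v = copair UNIV S \<iota> (X n) (\<lambda>k. if k \<le> n then m k else \<zero> (X k) (X n))"
    have "\<And>k. (if k \<le> n then m k else \<zero> (X k) (X n)) \<in> Hom C (X k) (X n)" using m Zero_Hom X by auto
    then have v: "v \<in> Hom C S (X n)" "\<And>k. k \<le> n \<Longrightarrow> v \<cdot> \<iota> k = m k"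
      unfolding v_def using copair_Hom[OF cop X] copair_Comp[OF cop X] by auto
    let ?r = "restr UNIV X S \<iota> J"
    note r = restr_Hom[OF cop, of J]
    have "(u n \<cdot> v) \<cdot> ?r = p \<cdot> ?r"
    proof (rule coproduct_eqI[OF cop Comp_Hom[OF r Comp_Hom[OF v(1) u]] Comp_Hom[OF r p]])
      fix k
      have l: "((u n \<cdot> v) \<cdot> ?r) \<cdot> \<iota> k = u n \<cdot> (v \<cdot> (?r \<cdot> \<iota> k))" "(p \<cdot> ?r) \<cdot> \<iota> k = p \<cdot> (?r \<cdot> \<iota> k)"
        using u[of n] v(1) r \<iota>[of k] p by (simp_all add: Hom_iff)
      show "((u n \<cdot> v) \<cdot> ?r) \<cdot> \<iota> k = (p \<cdot> ?r) \<cdot> \<iota> k"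
      proof (cases "k \<in> J")
        case True
        then show ?thesis unfolding l using restr_in[OF cop, of k J] n[OF True] m(2) v(2) by (simp add: u_def)
      next
        case False
        then show ?thesis unfolding l using restr_notin[OF cop, of k J] u[of n] v(1) p X S by (simp add: Hom_iff)
      qed
    qed
    then have "((u n \<cdot> v) \<cdot> ?r) \<cdot> z = (p \<cdot> ?r) \<cdot> z" by simp
    moreover have "((u n \<cdot> v) \<cdot> ?r) \<cdot> z = u n \<cdot> (v \<cdot> (?r \<cdot> z))" "(p \<cdot> ?r) \<cdot> z = p \<cdot> (?r \<cdot> z)"
      using u[of n] v(1) r z p by (simp_all add: Hom_iff)
    ultimately have "x = u n \<cdot> (v \<cdot> z)" using z(2) J(2) by simp
    then show ?thesis using Comp_Hom[OF z(1) v(1)] by blast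
  qed
  have "is_hocolim X j T u"
    unfolding is_hocolim_def using T u uj ext uniq cpt by blast
  then show thesis by (rule that)
qed

lemma is_hocolimD:
  assumes "is_hocolim X j T u"
  shows hocolim_Ob: "T \<in> Ob C"
    and hocolim_Hom: "u k \<in> Hom C (X k) T"
    and hocolim_compat: "u (Suc k) \<cdot> j k = u k"
    and hocolim_extend: "\<lbrakk>Y \<in> Ob C; \<And>k. f k \<in> Hom C (X k) Y; \<And>k. f (Suc k) \<cdot> j k = f k\<rbrakk>
      \<Longrightarrow> \<exists>g\<in>Hom C T Y. \<forall>k. g \<cdot> u k = f k"
    and hocolim_compact: "\<lbrakk>c \<in> compacts; x \<in> Hom C c T\<rbrakk> \<Longrightarrow> \<exists>k. \<exists>y\<in>Hom C c (X k). x = u k \<cdot> y"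
    and hocolim_eq_Zero: "\<lbrakk>g \<in> Hom C T Y; \<And>k. g \<cdot> u k = \<zero> (X k) Y;
      \<And>k f. f \<in> Hom C (Shift C (X k)) Y \<Longrightarrow> \<exists>f'\<in>Hom C (Shift C (X (Suc k))) Y. f = f' \<cdot> ShiftA C (j k)\<rbrakk>
      \<Longrightarrow> g = \<zero> T Y"
proof -
  note h = assms[unfolded is_hocolim_def]
  show "T \<in> Ob C" "u k \<in> Hom C (X k) T" "u (Suc k) \<cdot> j k = u k" using h by simp_all
  show "\<lbrakk>Y \<in> Ob C; \<And>k. f k \<in> Hom C (X k) Y; \<And>k. f (Suc k) \<cdot> j k = f k\<rbrakk>
      \<Longrightarrow> \<exists>g\<in>Hom C T Y. \<forall>k. g \<cdot> u k = f k"
    using h[THEN conjunct2, THEN conjunct2, THEN conjunct1, rule_format, of Y f] by blast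
  show "\<lbrakk>c \<in> compacts; x \<in> Hom C c T\<rbrakk> \<Longrightarrow> \<exists>k. \<exists>y\<in>Hom C c (X k). x = u k \<cdot> y"
    using h[THEN conjunct2, THEN conjunct2, THEN conjunct2, THEN conjunct2, rule_format] .
  show "\<lbrakk>g \<in> Hom C T Y; \<And>k. g \<cdot> u k = \<zero> (X k) Y;
      \<And>k f. f \<in> Hom C (Shift C (X k)) Y \<Longrightarrow> \<exists>f'\<in>Hom C (Shift C (X (Suc k))) Y. f = f' \<cdot> ShiftA C (j k)\<rbrakk>
      \<Longrightarrow> g = \<zero> T Y"
    using h[THEN conjunct2, THEN conjunct2, THEN conjunct2, THEN conjunct1, rule_format, of g Y] by blast
qed

end

section \<open>Cellular objects\<close>

context smashing_triangulated begin

definition cells :: "'o set \<Rightarrow> 'o set"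
  where "cells G = {S. \<exists>(I :: 'u set) N \<iota>. small \<kappa> I \<and> (\<forall>i\<in>I. N i \<in> G) \<and> is_coproduct C I N S \<iota>}"

text \<open>
  The cofibres \<open>Q\<close> of the stages are coproducts of objects of \<open>G\<close>, so what is attached to \<open>X k\<close> are maps from
  \<open>Q[-1]\<close>.
\<close>

definition cellular :: "'o set \<Rightarrow> 'o set"
  where "cellular G = {T. \<exists>X j u. X 0 \<in> cells G \<and>
    (\<forall>k. \<exists>Q q r. Q \<in> cells G \<and> triangle C (X k) (X (Suc k)) Q (j k) q r) \<and> is_hocolim X j T u}"

lemma cellsI:
  fixes I :: "'i set"
  assumes "small \<kappa> I" "\<And>i. i \<in> I \<Longrightarrow> N i \<in> G" "is_coproduct C I N S \<iota>"
  shows "S \<in> cells G"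
proof -
  obtain b :: "'i \<Rightarrow> 'u" where b: "inj_on b I" using small_encode[OF assms(1)] .
  have "bij_betw (inv_into I b) (b ` I) I" using b by (simp add: bij_betw_inv_into inj_on_imp_bij_betw)
  from coproduct_reindex[OF assms(3) this]
  have "is_coproduct C (b ` I) (\<lambda>i. N (inv_into I b i)) S (\<lambda>i. \<iota> (inv_into I b i))" .
  moreover have "\<forall>i\<in>b ` I. N (inv_into I b i) \<in> G" using b assms(2) by auto
  ultimately show ?thesis using small_image[OF assms(1), of b] unfolding cells_def mem_Collect_eq
    by (intro exI[of _ "b ` I"] exI[of _ "\<lambda>i. N (inv_into I b i)"] exI[of _ "\<lambda>i. \<iota> (inv_into I b i)"]) simp
qed

lemma cellsE:
  assumes "S \<in> cells G"
  obtains I :: "'u set" and N \<iota> where "small \<kappa> I" "\<forall>i\<in>I. N i \<in> G" "is_coproduct C I N S \<iota>"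
  using assms unfolding cells_def by blast

lemma cells_left_perp:
  assumes "S \<in> cells G" "Y \<in> right_perp C G"
  shows "orth S Y"
proof -
  obtain I :: "'u set" and N \<iota> where I: "small \<kappa> I" "\<forall>i\<in>I. N i \<in> G" and cop: "is_coproduct C I N S \<iota>"
    using assms(1) by (rule cellsE)
  show ?thesis by (rule orth_coproduct[OF cop]) (use assms(2) I(2) in \<open>simp_all add: right_perp_orth\<close>)
qed

lemma compact_orth_cells:
  assumes c: "c \<in> compacts" and o: "\<And>g. g \<in> G \<Longrightarrow> orth c g" and S: "S \<in> cells G"
  shows "orth c S"
proof -
  obtain I :: "'u set" and N \<iota> where I: "small \<kappa> I" "\<forall>i\<in>I. N i \<in> G" and cop: "is_coproduct C I N S \<iota>"
    using S by (rule cellsE)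
  show ?thesis
  proof (rule orthI[OF compact_Ob[OF c] coproduct_D(1)[OF cop]])
    fix f assume f: "f \<in> Hom C c S"
    show "f = \<zero> c S"
    proof (rule compact_eq_Zero[OF c I(1) cop f])
      fix i assume i: "i \<in> I"
      show "cproj I N S \<iota> i \<cdot> f = \<zero> c (N i)"
        by (rule orthD[OF o[OF bspec[OF I(2) i]] Comp_Hom[OF f cproj_Hom[OF cop i]]])
    qed
  qed
qed

lemma cellularE:
  assumes "T \<in> cellular G"
  obtains X j u where "X 0 \<in> cells G" "is_hocolim X j T u"
    "\<forall>k. \<exists>Q q r. Q \<in> cells G \<and> triangle C (X k) (X (Suc k)) Q (j k) q r"
  using assms unfolding cellular_def by blast

lemma cellular_Ob: "T \<in> cellular G \<Longrightarrow> T \<in> Ob C"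
  using hocolim_Ob by (auto elim: cellularE)

text \<open>
  Maps from every stage to \<open>Y\<close> vanish; those from the homotopy colimit do as well, because maps
  \<open>X k[1] \<rightarrow> Y\<close> extend to the next stage, the obstruction being a map from a coproduct of objects of \<open>G\<close> to \<open>Y\<close>.
\<close>

lemma cellular_left_perp:
  assumes T: "T \<in> cellular G" and Y: "Y \<in> right_perp C G"
  shows "orth T Y"
proof -
  obtain X j u where X0: "X 0 \<in> cells G" and hc: "is_hocolim X j T u"
    and st: "\<forall>k. \<exists>Q q r. Q \<in> cells G \<and> triangle C (X k) (X (Suc k)) Q (j k) q r"
    using T by (rule cellularE)
  have YO: "Y \<in> Ob C" using Y by (simp add: right_perp_orth)
  have X: "orth (X k) Y" for k
  proof (induction k)
    case 0 then show ?case by (rule cells_left_perp[OF X0 Y])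
  next
    case (Suc k)
    obtain Q q r where "Q \<in> cells G" "triangle C (X k) (X (Suc k)) Q (j k) q r" using st by blast
    then show ?case using orth_triangle_left[OF _ YO Suc] cells_left_perp[OF _ Y] by blast
  qed
  show ?thesis
  proof (rule orthI[OF hocolim_Ob[OF hc] YO])
    fix g assume g: "g \<in> Hom C T Y"
    show "g = \<zero> T Y"
    proof (rule hocolim_eq_Zero[OF hc g])
      show "g \<cdot> u k = \<zero> (X k) Y" for k by (rule orthD[OF X Comp_Hom[OF hocolim_Hom[OF hc] g]])
      fix k f assume f: "f \<in> Hom C (Shift C (X k)) Y"
      obtain Q q r where Q: "Q \<in> cells G" and t: "triangle C (X k) (X (Suc k)) Q (j k) q r" using st by blast
      have "f \<cdot> r = \<zero> Q Y" by (rule orthD[OF cells_left_perp[OF Q Y] Comp_Hom[OF triangle_D(3)[OF t] f]])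
      then show "\<exists>f'\<in>Hom C (Shift C (X (Suc k))) Y. f = f' \<cdot> ShiftA C (j k)"
        by (rule triangle_extend3[OF t f])
    qed
  qed
qed

lemma compact_orth_cellular:
  assumes c: "c \<in> compacts" and o: "\<And>g. g \<in> G \<Longrightarrow> orth c g" and T: "T \<in> cellular G"
  shows "orth c T"
proof -
  obtain X j u where X0: "X 0 \<in> cells G" and hc: "is_hocolim X j T u"
    and st: "\<forall>k. \<exists>Q q r. Q \<in> cells G \<and> triangle C (X k) (X (Suc k)) Q (j k) q r"
    using T by (rule cellularE)
  note cO = compact_Ob[OF c]
  have X: "orth c (X k)" for k
  proof (induction k)
    case 0 then show ?case by (rule compact_orth_cells[OF c o X0])
  next
    case (Suc k)
    obtain Q q r where "Q \<in> cells G" "triangle C (X k) (X (Suc k)) Q (j k) q r" using st by blast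
    then show ?case using orth_triangle_right[OF _ cO Suc] compact_orth_cells[OF c o] by blast
  qed
  show ?thesis
  proof (rule orthI[OF cO hocolim_Ob[OF hc]])
    fix x assume "x \<in> Hom C c T"
    then obtain k y where y: "y \<in> Hom C c (X k)" "x = u k \<cdot> y" using hocolim_compact[OF hc c] by blast
    show "x = \<zero> c T" unfolding y(2) orthD[OF X y(1)] using hocolim_Hom[OF hc, of k] cO by (simp add: Hom_iff)
  qed
qed

text \<open>
  The construction behind Brown representability. Cells from \<open>G\<close> are attached to kill, one stage at
  a time, all maps from objects \<open>G[-1]\<close> that become zero in the functor to be represented, which is the
  product over \<open>I\<close> of the direct summands of \<open>Hom(-, N i)\<close> cut out by idempotents \<open>e i\<close>.
\<close>

lemma cellular_approximation:
  fixes I :: "'i set"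
  assumes ls: "locally_small \<kappa> C" and G: "essentially_small \<kappa> C G" "G \<subseteq> compacts"
    and I: "small \<kappa> I" and e: "\<And>i. i \<in> I \<Longrightarrow> e i \<in> Hom C (N i) (N i)" "\<And>i. i \<in> I \<Longrightarrow> e i \<cdot> e i = e i"
  obtains T \<phi> where "T \<in> cellular G"
    "\<And>i. i \<in> I \<Longrightarrow> \<phi> i \<in> Hom C T (N i)" "\<And>i. i \<in> I \<Longrightarrow> e i \<cdot> \<phi> i = \<phi> i"
    "\<And>g f. g \<in> G \<Longrightarrow> (\<And>i. i \<in> I \<Longrightarrow> f i \<in> Hom C g (N i)) \<Longrightarrow> (\<And>i. i \<in> I \<Longrightarrow> e i \<cdot> f i = f i)
      \<Longrightarrow> \<exists>x\<in>Hom C g T. \<forall>i\<in>I. \<phi> i \<cdot> x = f i"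
    "\<And>g x. g \<in> Ob C \<Longrightarrow> Shift C g \<in> G \<Longrightarrow> x \<in> Hom C g T \<Longrightarrow> (\<And>i. i \<in> I \<Longrightarrow> \<phi> i \<cdot> x = \<zero> g (N i))
      \<Longrightarrow> x = \<zero> g T"
proof -
  obtain R where R: "R \<subseteq> G" "small \<kappa> R" "\<And>g. g \<in> G \<Longrightarrow> \<exists>r\<in>R. isomorphic C g r"
    using G(1) unfolding essentially_small_def by blast
  have RO: "\<And>r. r \<in> R \<Longrightarrow> r \<in> Ob C" using R(1) G(2) compact_Ob by blast
  have N: "\<And>i. i \<in> I \<Longrightarrow> N i \<in> Ob C" using e(1) Hom_Ob by blast
  define good where "good = (\<lambda>(X, \<phi>). X \<in> Ob C \<and>
    (\<forall>i\<in>I. \<phi> i \<in> Hom C X (N i) \<and> e i \<cdot> \<phi> i = \<phi> i))"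
  define stage where "stage = (\<lambda>(X, \<phi>) (X', \<phi>'). \<exists>j Q q r. Q \<in> cells G \<and> triangle C X X' Q j q r \<and>
    (\<forall>i\<in>I. \<phi>' i \<cdot> j = \<phi> i) \<and>
    (\<forall>g x. g \<in> Ob C \<and> Shift C g \<in> R \<and> x \<in> Hom C g X \<and> (\<forall>i\<in>I. \<phi> i \<cdot> x = \<zero> g (N i)) \<longrightarrow> j \<cdot> x = \<zero> g X'))"
  define H where "H g = Pi\<^sub>E I (\<lambda>i. {f \<in> Hom C g (N i). e i \<cdot> f = f})" for g
  have smallH: "small \<kappa> (H g)" if "g \<in> Ob C" for g
    unfolding H_def using ls that N I
    by (intro small_PiE) (auto intro: small_subset[of \<kappa> "Hom C g _"] simp: locally_small_def)
  \<comment> \<open>Stage \<open>0\<close>: one cell for every element of the functor.\<close>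
  let ?K = "Sigma R H"
  have K: "small \<kappa> ?K" by (rule small_Sigma[OF R(2) smallH[OF RO]])
  have "\<And>k. k \<in> ?K \<Longrightarrow> fst k \<in> Ob C" using RO by auto
  then obtain X0 \<iota>0 where c0: "is_coproduct C ?K fst X0 \<iota>0" using ex_coproduct[OF K] by metis
  note X0 = coproduct_D(1)[OF c0]
  define \<phi>0 where "\<phi>0 i = copair ?K X0 \<iota>0 (N i) (\<lambda>(g, f). f i)" for i
  have \<phi>0: "\<phi>0 i \<in> Hom C X0 (N i)" "\<And>g f. g \<in> R \<Longrightarrow> f \<in> H g \<Longrightarrow> \<phi>0 i \<cdot> \<iota>0 (g, f) = f i" if i: "i \<in> I" for i
  proof -
    have h: "\<And>k. k \<in> ?K \<Longrightarrow> (\<lambda>(g, f). f i) k \<in> Hom C (fst k) (N i)" using i by (auto simp: H_def PiE_iff)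
    show "\<phi>0 i \<in> Hom C X0 (N i)" unfolding \<phi>0_def by (rule copair_Hom[OF c0 N[OF i] h])
    show "\<phi>0 i \<cdot> \<iota>0 (g, f) = f i" if "g \<in> R" "f \<in> H g" for g f
      unfolding \<phi>0_def using copair_Comp[OF c0 N[OF i] h, of "(g, f)"] that by simp
  qed
  have good0: "good (X0, \<phi>0)"
  proof -
    have "e i \<cdot> \<phi>0 i = \<phi>0 i" if i: "i \<in> I" for i
    proof (rule coproduct_eqI[OF c0 Comp_Hom[OF \<phi>0(1)[OF i] e(1)[OF i]] \<phi>0(1)[OF i]])
      fix k assume "k \<in> ?K"
      then obtain g f where k: "k = (g, f)" "g \<in> R" "f \<in> H g" by auto
      have "e i \<cdot> f i = f i" using k(3) i by (auto simp: H_def PiE_iff)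
      then show "(e i \<cdot> \<phi>0 i) \<cdot> \<iota>0 k = \<phi>0 i \<cdot> \<iota>0 k"
        using Comp_assoc[OF coproduct_D(3)[OF c0 \<open>k \<in> ?K\<close>] \<phi>0(1)[OF i] e(1)[OF i]]
          \<phi>0(2)[OF i k(2,3)] k(1) by simp
    qed
    then show ?thesis unfolding good_def using X0 \<phi>0(1) by simp
  qed
  have cells0: "X0 \<in> cells G" by (rule cellsI[OF K _ c0]) (use R(1) in auto)
  have step: "\<exists>Y. good Y \<and> stage X Y" if good: "good X" for X
  proof -
    obtain X1 \<phi> where X: "X = (X1, \<phi>)" by (cases X)
    have X1: "X1 \<in> Ob C" and \<phi>: "\<And>i. i \<in> I \<Longrightarrow> \<phi> i \<in> Hom C X1 (N i)" "\<And>i. i \<in> I \<Longrightarrow> e i \<cdot> \<phi> i = \<phi> i"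
      using good unfolding good_def X by auto
    define R' where "R' = {g \<in> Ob C. Shift C g \<in> R}"
    have "R' \<subseteq> inv_into (Ob C) (Shift C) ` R"
      unfolding R'_def using unshift_Shift by (auto intro: image_eqI[of _ _ "Shift C _"] simp: image_iff) metis
    then have R': "small \<kappa> R'" using small_subset small_image[OF R(2)] by blast
    define L where "L = Sigma R' (\<lambda>g. {x \<in> Hom C g X1. \<forall>i\<in>I. \<phi> i \<cdot> x = \<zero> g (N i)})"
    have L: "small \<kappa> L"
      unfolding L_def using R' X1 ls
      by (intro small_Sigma) (auto intro: small_subset[of \<kappa> "Hom C _ X1"] simp: R'_def locally_small_def)
    have "\<And>k. k \<in> L \<Longrightarrow> fst k \<in> Ob C" by (auto simp: L_def R'_def)
    then obtain Q \<iota> where cQ: "is_coproduct C L fst Q \<iota>" using ex_coproduct[OF L] by metis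
    have snd: "\<And>k. k \<in> L \<Longrightarrow> snd k \<in> Hom C (fst k) X1" by (auto simp: L_def)
    define a where "a = copair L Q \<iota> X1 snd"
    have a: "a \<in> Hom C Q X1" "\<And>k. k \<in> L \<Longrightarrow> a \<cdot> \<iota> k = snd k"
      unfolding a_def using copair_Hom[OF cQ X1 snd] copair_Comp[OF cQ X1 snd] by auto
    obtain X2 j h where t: "triangle C Q X1 X2 a j h" using ex_cone[OF a(1)] by blast
    note j = triangle_D(2)[OF t] and X2 = triangle_Ob(3)[OF t]
    have "\<exists>\<psi>. \<psi> \<in> Hom C X2 (N i) \<and> e i \<cdot> \<psi> = \<psi> \<and> \<psi> \<cdot> j = \<phi> i" if i: "i \<in> I" for i
    proof -
      have "\<phi> i \<cdot> a = \<zero> Q (N i)"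
      proof (rule coproduct_eqI[OF cQ Comp_Hom[OF a(1) \<phi>(1)[OF i]] Zero_Hom[OF coproduct_D(1)[OF cQ] N[OF i]]])
        fix k assume k: "k \<in> L"
        note \<iota>k = coproduct_D(3)[OF cQ k]
        have "(\<phi> i \<cdot> a) \<cdot> \<iota> k = \<phi> i \<cdot> snd k" using Comp_assoc[OF \<iota>k a(1) \<phi>(1)[OF i]] a(2)[OF k] by simp
        also have "\<dots> = \<zero> (fst k) (N i)" using k i by (auto simp: L_def)
        finally show "(\<phi> i \<cdot> a) \<cdot> \<iota> k = \<zero> Q (N i) \<cdot> \<iota> k" using \<iota>k N[OF i] by (simp add: Hom_iff)
      qed
      then obtain \<psi> where \<psi>: "\<psi> \<in> Hom C X2 (N i)" "\<phi> i = \<psi> \<cdot> j" using triangle_extend1[OF t \<phi>(1)[OF i]] by blast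
      have "e i \<cdot> (e i \<cdot> \<psi>) = e i \<cdot> \<psi>"
        using Comp_assoc[OF \<psi>(1) e(1)[OF i] e(1)[OF i]] e(2)[OF i] by simp
      moreover have "(e i \<cdot> \<psi>) \<cdot> j = \<phi> i" using Comp_assoc[OF j \<psi>(1) e(1)[OF i]] \<psi>(2) \<phi>(2)[OF i] by simp
      ultimately show ?thesis using Comp_Hom[OF \<psi>(1) e(1)[OF i]] by blast
    qed
    then obtain \<psi> where \<psi>: "\<And>i. i \<in> I \<Longrightarrow> \<psi> i \<in> Hom C X2 (N i) \<and> e i \<cdot> \<psi> i = \<psi> i \<and> \<psi> i \<cdot> j = \<phi> i" by metis
    have "j \<cdot> x = \<zero> g X2" if "g \<in> Ob C" "Shift C g \<in> R" "x \<in> Hom C g X1" "\<forall>i\<in>I. \<phi> i \<cdot> x = \<zero> g (N i)" for g x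
    proof -
      have k: "(g, x) \<in> L" using that by (simp add: L_def R'_def)
      have "j \<cdot> (a \<cdot> \<iota> (g, x)) = (j \<cdot> a) \<cdot> \<iota> (g, x)"
        using Comp_assoc[OF coproduct_D(3)[OF cQ k] a(1) j] by simp
      also have "\<dots> = \<zero> g X2"
        unfolding triangle_Comp_Zero(1)[OF t] using coproduct_D(3)[OF cQ k] X2 by (simp add: Hom_iff)
      finally show ?thesis using a(2)[OF k] by simp
    qed
    moreover have "Shift C Q \<in> cells G"
      by (rule cellsI[OF L _ coproduct_Shift[OF cQ]]) (use R(1) in \<open>auto simp: L_def R'_def\<close>)
    ultimately have "stage X (X2, \<psi>)"
      unfolding stage_def X prod.case using triangle_rotate[OF t] \<psi> by blast
    moreover have "good (X2, \<psi>)" unfolding good_def using X2 \<psi> by simp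
    ultimately show ?thesis by blast
  qed
  have "\<exists>F. \<forall>n. (good (F n) \<and> (n = 0 \<longrightarrow> F n = (X0, \<phi>0))) \<and> stage (F n) (F (Suc n))"
    by (rule dependent_nat_choice) (use good0 step in auto)
  then obtain F where F: "\<And>n. good (F n)" "F 0 = (X0, \<phi>0)" "\<And>n. stage (F n) (F (Suc n))" by blast
  define X where "X n = fst (F n)" for n
  define \<phi> where "\<phi> n = snd (F n)" for n
  have FX: "F n = (X n, \<phi> n)" for n by (simp add: X_def \<phi>_def)
  have \<phi>: "\<phi> n i \<in> Hom C (X n) (N i)" "e i \<cdot> \<phi> n i = \<phi> n i" if "i \<in> I" for n i
    using F(1)[of n] that unfolding FX good_def by auto
  have "\<exists>j. (\<exists>Q q r. Q \<in> cells G \<and> triangle C (X n) (X (Suc n)) Q j q r) \<and> (\<forall>i\<in>I. \<phi> (Suc n) i \<cdot> j = \<phi> n i) \<and>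
    (\<forall>g x. g \<in> Ob C \<and> Shift C g \<in> R \<and> x \<in> Hom C g (X n) \<and> (\<forall>i\<in>I. \<phi> n i \<cdot> x = \<zero> g (N i))
      \<longrightarrow> j \<cdot> x = \<zero> g (X (Suc n)))" for n
    using F(3)[of n] unfolding FX stage_def prod.case by blast
  then obtain j where
    st: "\<And>n. \<exists>Q q r. Q \<in> cells G \<and> triangle C (X n) (X (Suc n)) Q (j n) q r"
    and \<phi>j: "\<And>n i. i \<in> I \<Longrightarrow> \<phi> (Suc n) i \<cdot> j n = \<phi> n i"
    and kill: "\<And>n g x. \<lbrakk>g \<in> Ob C; Shift C g \<in> R; x \<in> Hom C g (X n); \<forall>i\<in>I. \<phi> n i \<cdot> x = \<zero> g (N i)\<rbrakk>
      \<Longrightarrow> j n \<cdot> x = \<zero> g (X (Suc n))" by metis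
  have j: "j n \<in> Hom C (X n) (X (Suc n))" for n using st triangle_D(1) by blast
  obtain T u where hc: "is_hocolim X j T u" using ex_hocolim[of j X, OF j] .
  note T = hocolim_Ob[OF hc] and u = hocolim_Hom[OF hc] and uj = hocolim_compat[OF hc]
  have "\<exists>\<chi>. \<chi> \<in> Hom C T (N i) \<and> e i \<cdot> \<chi> = \<chi> \<and> (\<forall>k. \<chi> \<cdot> u k = \<phi> k i)" if i: "i \<in> I" for i
  proof -
    obtain g where g: "g \<in> Hom C T (N i)" "\<And>k. g \<cdot> u k = \<phi> k i"
      using hocolim_extend[OF hc N[OF i] \<phi>(1)[OF i] \<phi>j[OF i]] by blast
    have "(e i \<cdot> g) \<cdot> u k = \<phi> k i" for k
      using Comp_assoc[OF u g(1) e(1)[OF i]] g(2) \<phi>(2)[OF i] by simp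
    moreover have "e i \<cdot> (e i \<cdot> g) = e i \<cdot> g" using Comp_assoc[OF g(1) e(1)[OF i] e(1)[OF i]] e(2)[OF i] by simp
    ultimately show ?thesis using Comp_Hom[OF g(1) e(1)[OF i]] by blast
  qed
  then obtain \<chi> where \<chi>: "\<And>i. i \<in> I \<Longrightarrow> \<chi> i \<in> Hom C T (N i)" "\<And>i. i \<in> I \<Longrightarrow> e i \<cdot> \<chi> i = \<chi> i"
    "\<And>i k. i \<in> I \<Longrightarrow> \<chi> i \<cdot> u k = \<phi> k i" by metis
  have surj: "\<exists>x\<in>Hom C g T. \<forall>i\<in>I. \<chi> i \<cdot> x = f i"
    if g: "g \<in> G" and f: "\<And>i. i \<in> I \<Longrightarrow> f i \<in> Hom C g (N i)" "\<And>i. i \<in> I \<Longrightarrow> e i \<cdot> f i = f i" for g f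
  proof -
    obtain r where r: "r \<in> R" "isomorphic C g r" using R(3)[OF g] by blast
    obtain a b where ab: "a \<in> Hom C g r" "b \<in> Hom C r g" "b \<cdot> a = Ident C g" using r(2) by (rule isomorphicE)
    let ?f = "\<lambda>i\<in>I. f i \<cdot> b"
    have fb: "f i \<cdot> b \<in> Hom C r (N i)" "e i \<cdot> (f i \<cdot> b) = f i \<cdot> b" if i: "i \<in> I" for i
      using Comp_Hom[OF ab(2) f(1)[OF i]] Comp_assoc[OF ab(2) f(1)[OF i] e(1)[OF i]] f(2)[OF i] by auto
    then have "?f \<in> H r" by (auto simp: H_def)
    then have k: "(r, ?f) \<in> ?K" using r by simp
    have \<iota>k: "\<iota>0 (r, ?f) \<in> Hom C r (X 0)" using coproduct_D(3)[OF c0 k] F(2) by (simp add: X_def)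
    note uk = Comp_Hom[OF \<iota>k u]
    have "\<chi> i \<cdot> ((u 0 \<cdot> \<iota>0 (r, ?f)) \<cdot> a) = f i" if i: "i \<in> I" for i
    proof -
      have "\<chi> i \<cdot> ((u 0 \<cdot> \<iota>0 (r, ?f)) \<cdot> a) = ((\<chi> i \<cdot> u 0) \<cdot> \<iota>0 (r, ?f)) \<cdot> a"
        using Comp_assoc[OF ab(1) uk \<chi>(1)[OF i]] Comp_assoc[OF \<iota>k u \<chi>(1)[OF i]] by simp
      also have "(\<chi> i \<cdot> u 0) \<cdot> \<iota>0 (r, ?f) = f i \<cdot> b"
        using \<chi>(3)[OF i, of 0] \<phi>0(2)[OF i r(1) \<open>?f \<in> H r\<close>] F(2) i by (simp add: \<phi>_def)
      also have "(f i \<cdot> b) \<cdot> a = f i" using Comp_assoc[OF ab(1,2) f(1)[OF i]] ab(3) Comp_Ident[OF f(1)[OF i]] by simp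
      finally show ?thesis .
    qed
    then show ?thesis using Comp_Hom[OF ab(1) uk] by blast
  qed
  have inj: "x = \<zero> g T"
    if g: "g \<in> Ob C" "Shift C g \<in> G" and x: "x \<in> Hom C g T" "\<And>i. i \<in> I \<Longrightarrow> \<chi> i \<cdot> x = \<zero> g (N i)" for g x
  proof -
    obtain r where r: "r \<in> R" "isomorphic C (Shift C g) r" using R(3)[OF g(2)] by blast
    obtain r' where r': "r' \<in> Ob C" "r = Shift C r'" using Shift_obtain[OF RO[OF r(1)]] .
    obtain a' b' where ab': "a' \<in> Hom C (Shift C g) r" "b' \<in> Hom C r (Shift C g)" "b' \<cdot> a' = Ident C (Shift C g)"
      using r(2) by (rule isomorphicE)
    obtain a where a: "a \<in> Hom C g r'" "a' = ShiftA C a" using ShiftA_surj ab'(1) g(1) r' by metis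
    obtain b where b: "b \<in> Hom C r' g" "b' = ShiftA C b" using ShiftA_surj ab'(2) g(1) r' by metis
    have "ShiftA C (b \<cdot> a) = ShiftA C (Ident C g)"
      using ab'(3) a b ShiftA_Comp[OF a(1) b(1)] ShiftA_Ident[OF g(1)] by simp
    then have ba: "b \<cdot> a = Ident C g" by (rule ShiftA_inj[OF Comp_Hom[OF a(1) b(1)] Ident_Hom[OF g(1)]])
    have "Shift C r' \<in> compacts" using r(1) r'(2) R(1) G(2) by blast
    then have c: "r' \<in> compacts" using compact_Shift_iff[OF r'(1)] by simp
    obtain k y where y: "y \<in> Hom C r' (X k)" "x \<cdot> b = u k \<cdot> y"
      using hocolim_compact[OF hc c Comp_Hom[OF b(1) x(1)]] by blast
    have "\<phi> k i \<cdot> y = \<zero> r' (N i)" if i: "i \<in> I" for i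
    proof -
      have "\<phi> k i \<cdot> y = \<chi> i \<cdot> (x \<cdot> b)" using Comp_assoc[OF y(1) u \<chi>(1)[OF i]] \<chi>(3)[OF i, of k] y(2) by simp
      also have "\<dots> = (\<chi> i \<cdot> x) \<cdot> b" using Comp_assoc[OF b(1) x(1) \<chi>(1)[OF i]] by simp
      also have "\<dots> = \<zero> r' (N i)" unfolding x(2)[OF i] using b(1) N[OF i] by (simp add: Hom_iff)
      finally show ?thesis .
    qed
    then have "j k \<cdot> y = \<zero> r' (X (Suc k))" using kill[OF r'(1) _ y(1)] r r' by blast
    then have "u k \<cdot> y = \<zero> r' T"
      using Comp_assoc[OF y(1) j u] uj[of k] u[of "Suc k"] r'(1) by (simp add: Hom_iff)
    then have "(x \<cdot> b) \<cdot> a = \<zero> g T" using y(2) a(1) T by (simp add: Hom_iff)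
    then show ?thesis using Comp_assoc[OF a(1) b(1) x(1)] ba Comp_Ident[OF x(1)] by simp
  qed
  have "T \<in> cellular G"
    unfolding cellular_def mem_Collect_eq
    by (intro exI[of _ X] exI[of _ j] exI[of _ u]) (use hc st cells0 F(2) in \<open>simp add: X_def\<close>)
  then show thesis using that[of T \<chi>] \<chi>(1,2) surj inj by blast
qed

text \<open>
  The class of all cellular objects and the right orthogonal of \<open>G\<close> thus form a torsion pair up to direct
  summands. Approximate \<open>Hom(-, M)\<close> by \<open>L\<close>: the map is onto on \<open>G\<close> and injective on \<open>G[-1]\<close>, which is what the
  cone needs.
\<close>

lemma cellular_decomposition:
  assumes ls: "locally_small \<kappa> C" and G: "essentially_small \<kappa> C G" "G \<subseteq> compacts" and M: "M \<in> Ob C"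
  obtains L R f g h where "L \<in> cellular G" "R \<in> right_perp C G" "triangle C L M R f g h"
proof -
  have I: "small \<kappa> {()}" by (simp add: small_finite)
  obtain L \<phi> where L: "L \<in> cellular G" and \<phi>: "\<phi> () \<in> Hom C L M"
    and surj: "\<And>g f. g \<in> G \<Longrightarrow> f \<in> Hom C g M \<Longrightarrow> \<exists>x\<in>Hom C g L. \<phi> () \<cdot> x = f"
    and inj: "\<And>g x. g \<in> Ob C \<Longrightarrow> Shift C g \<in> G \<Longrightarrow> x \<in> Hom C g L \<Longrightarrow> \<phi> () \<cdot> x = \<zero> g M \<Longrightarrow> x = \<zero> g L"
  proof (rule cellular_approximation[OF ls G I, of "\<lambda>_. Ident C M" "\<lambda>_. M"])
    show "Ident C M \<in> Hom C M M" "Ident C M \<cdot> Ident C M = Ident C M" using M Ident_Hom by auto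
    fix T \<phi>
    assume T: "T \<in> cellular G" "\<And>i. i \<in> {()} \<Longrightarrow> \<phi> i \<in> Hom C T M"
      and s: "\<And>g f. g \<in> G \<Longrightarrow> (\<And>i. i \<in> {()} \<Longrightarrow> f i \<in> Hom C g M) \<Longrightarrow> (\<And>i. i \<in> {()} \<Longrightarrow> Ident C M \<cdot> f i = f i)
        \<Longrightarrow> \<exists>x\<in>Hom C g T. \<forall>i\<in>{()}. \<phi> i \<cdot> x = f i"
      and i: "\<And>g x. g \<in> Ob C \<Longrightarrow> Shift C g \<in> G \<Longrightarrow> x \<in> Hom C g T \<Longrightarrow> (\<And>i. i \<in> {()} \<Longrightarrow> \<phi> i \<cdot> x = \<zero> g M)
        \<Longrightarrow> x = \<zero> g T"
    show thesis
    proof (rule that[of T \<phi>, OF T(1)])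
      show "\<phi> () \<in> Hom C T M" using T(2) by simp
      show "\<exists>x\<in>Hom C g T. \<phi> () \<cdot> x = f" if "g \<in> G" "f \<in> Hom C g M" for g f
        using s[OF that(1), of "\<lambda>_. f"] that(2) Ident_Comp[OF that(2)] by simp
      show "x = \<zero> g T" if "g \<in> Ob C" "Shift C g \<in> G" "x \<in> Hom C g T" "\<phi> () \<cdot> x = \<zero> g M" for g x
        using i[OF that(1-3)] that(4) by simp
    qed
  qed
  obtain R p h where t: "triangle C L M R (\<phi> ()) p h" using ex_cone[OF \<phi>] by blast
  note p = triangle_D(2)[OF t] and h = triangle_D(3)[OF t] and R = triangle_Ob(3)[OF t] and LO = triangle_Ob(1)[OF t]
  have "orth g R" if g: "g \<in> G" for g
  proof -
    have gO: "g \<in> Ob C" using g G(2) compact_Ob by blast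
    obtain g' where g': "g' \<in> Ob C" "g = Shift C g'" using Shift_obtain[OF gO] .
    show ?thesis by (rule orth_cone[OF t g' surj[OF g] inj[OF g'(1)]]) (use g g'(2) in simp_all)
  qed
  then have "R \<in> right_perp C G" using R by (simp add: right_perp_orth)
  then show thesis using that L t by blast
qed

text \<open>
  Maps from compact objects to cellular objects factor through finite extensions of cells. The
  factorization itself does not survive an extension, since lifts need not exist; what does is the
  existence of \<open>M' \<rightarrow> M\<close> that kills the map and has its cone in the given class.
\<close>

context
  fixes E :: "'o set"
  assumes E: "additive_class C E" "closed_extensions C E" "E \<subseteq> compacts"
begin

definition killable :: "'o \<Rightarrow> 'o \<Rightarrow> 'm \<Rightarrow> bool"
  where "killable M Y f \<longleftrightarrow> (\<exists>M' m E0 q r. M' \<in> compacts \<and> E0 \<in> E \<and> triangle C M' M E0 m q r \<and>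
    f \<cdot> m = \<zero> M' Y)"

text \<open>
  By the octahedral axiom the cone of a composite is an extension of the two cones.
\<close>

lemma killable_Comp:
  assumes "triangle C M' M E0 m q r" "E0 \<in> E" "f \<in> Hom C M Y" "killable M' Y (f \<cdot> m)"
  shows "killable M Y f"
proof -
  obtain M'' m' E1 q' r' where 1: "M'' \<in> compacts" "E1 \<in> E" "triangle C M'' M' E1 m' q' r'"
    "(f \<cdot> m) \<cdot> m' = \<zero> M'' Y" using assms(4) unfolding killable_def by blast
  note m = triangle_D(1)[OF assms(1)] and m' = triangle_D(1)[OF 1(3)]
  obtain E2 q2 r2 where 2: "triangle C M'' M E2 (m \<cdot> m') q2 r2" using ex_cone[OF Comp_Hom[OF m' m]] by blast
  obtain v w where "triangle C E1 E2 E0 v w (ShiftA C q' \<cdot> r)" using octahedron[OF 1(3) assms(1) 2] by blast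
  then have "E2 \<in> E" using E(2) 1(2) assms(2) unfolding closed_extensions_def by blast
  moreover have "f \<cdot> (m \<cdot> m') = \<zero> M'' Y" using 1(4) Comp_assoc[OF m' m assms(3)] by simp
  ultimately show ?thesis unfolding killable_def using 1(1) 2 by blast
qed

lemma killable_Zero:
  assumes "M \<in> compacts" "Y \<in> Ob C"
  shows "killable M Y (\<zero> M Y)"
proof -
  obtain Z where Z: "zero_object C Z" using ex_zero by blast
  then have "Z \<in> E" using E(1) by (simp add: additive_class_def)
  moreover have "triangle C M M Z (Ident C M) (\<zero> M Z) (\<zero> Z (Shift C M))"
    using Tri_Ident[OF compact_Ob[OF assms(1)] Z] .
  moreover have "\<zero> M Y \<cdot> Ident C M = \<zero> M Y" using Comp_Ident[OF Zero_Hom[OF compact_Ob[OF assms(1)] assms(2)]] .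
  ultimately show ?thesis unfolding killable_def using assms(1) by blast
qed

lemma killable_cells:
  assumes "G \<subseteq> E" "S \<in> cells G" "M \<in> compacts" "f \<in> Hom C M S"
  shows "killable M S f"
proof -
  obtain I :: "'u set" and N \<iota> where I: "small \<kappa> I" "\<forall>i\<in>I. N i \<in> G" and cop: "is_coproduct C I N S \<iota>"
    using assms(2) by (rule cellsE)
  note S = coproduct_D(1)[OF cop]
  have "killable M S f" if "finite J" "J \<subseteq> I" "restr I N S \<iota> J \<cdot> f = f" "M \<in> compacts" "f \<in> Hom C M S" for J M f
    using that
  proof (induction J arbitrary: M f)
    case empty
    have "f = \<zero> M S" using empty(2-4) S unfolding restr_empty[OF cop] by (simp add: Hom_iff)
    then show ?case using killable_Zero[OF empty(3) S] by simp
  next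
    case (insert i J)
    have i: "i \<in> I" using insert(4) by simp
    note f = insert(7) and M = insert(6)
    let ?\<pi> = "cproj I N S \<iota> i" and ?r = "restr I N S \<iota>"
    note \<pi> = cproj_Hom[OF cop i] and \<iota> = coproduct_D(3)[OF cop i] and r = restr_Hom[OF cop]
    have Ni: "N i \<in> E" using bspec[OF I(2) i] assms(1) by blast
    obtain M' m h where t: "triangle C M' M (N i) m (?\<pi> \<cdot> f) h" using ex_fiber[OF Comp_Hom[OF f \<pi>]] .
    note m = triangle_D(1)[OF t]
    have M': "M' \<in> compacts" using compact_fiber[OF t M] Ni E(3) by blast
    have fm: "f \<cdot> m \<in> Hom C M' S" using Comp_Hom[OF m f] .
    have "(?r (insert i J) \<cdot> f) \<cdot> m = f \<cdot> m" unfolding insert(5) ..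
    then have "?r (insert i J) \<cdot> (f \<cdot> m) = f \<cdot> m" using Comp_assoc[OF m f r] by simp
    moreover have "?r (insert i J) \<cdot> (f \<cdot> m) = (?r J \<cdot> (f \<cdot> m)) \<oplus> (\<iota> i \<cdot> ((?\<pi> \<cdot> f) \<cdot> m))"
      unfolding restr_insert[OF cop i insert(2)] using r[of J] \<pi> \<iota> f m by (simp add: Hom_iff)
    moreover have "\<iota> i \<cdot> ((?\<pi> \<cdot> f) \<cdot> m) = \<zero> M' S"
      unfolding triangle_Comp_Zero(1)[OF t] using \<iota> m by (simp add: Hom_iff)
    ultimately have "?r J \<cdot> (f \<cdot> m) = f \<cdot> m" using Add_Zero(2)[OF Comp_Hom[OF fm r]] by metis
    from insert(3)[OF _ this M' fm] have "killable M' S (f \<cdot> m)" using insert(4) by blast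
    then show ?case by (rule killable_Comp[OF t Ni f])
  qed
  moreover obtain J where "J \<subseteq> I" "finite J" "restr I N S \<iota> J \<cdot> f = f"
    using compactD[OF assms(3) I(1) cop assms(4)] .
  ultimately show ?thesis using assms by blast
qed

lemma cellular_factor:
  assumes GE: "G \<subseteq> E" and T: "T \<in> cellular G" and M: "M \<in> compacts" and f: "f \<in> Hom C M T"
  obtains E0 a b where "E0 \<in> E" "a \<in> Hom C M E0" "b \<in> Hom C E0 T" "f = b \<cdot> a"
proof -
  obtain X j u where X0: "X 0 \<in> cells G" and hc: "is_hocolim X j T u"
    and st: "\<forall>k. \<exists>Q q r. Q \<in> cells G \<and> triangle C (X k) (X (Suc k)) Q (j k) q r"
    using T by (rule cellularE)
  have X: "killable M (X k) f" if "M \<in> compacts" "f \<in> Hom C M (X k)" for M k f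
    using that
  proof (induction k arbitrary: M f)
    case 0 then show ?case using killable_cells[OF GE X0] by blast
  next
    case (Suc k)
    obtain Q q r where Q: "Q \<in> cells G" and t: "triangle C (X k) (X (Suc k)) Q (j k) q r" using st by blast
    note j = triangle_D(1)[OF t] and q = triangle_D(2)[OF t] and f = Suc(3)
    have "killable M Q (q \<cdot> f)" by (rule killable_cells[OF GE Q Suc(2) Comp_Hom[OF f q]])
    then obtain M' m E0 q' r' where 1: "M' \<in> compacts" "E0 \<in> E" "triangle C M' M E0 m q' r'"
      "(q \<cdot> f) \<cdot> m = \<zero> M' Q" unfolding killable_def by blast
    note m = triangle_D(1)[OF 1(3)]
    have "q \<cdot> (f \<cdot> m) = \<zero> M' Q" using 1(4) Comp_assoc[OF m f q] by simp
    then obtain y where y: "y \<in> Hom C M' (X k)" "f \<cdot> m = j k \<cdot> y" using triangle_lift1[OF t Comp_Hom[OF m f]] by blast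
    obtain M'' m' E1 q'' r'' where 2: "M'' \<in> compacts" "E1 \<in> E" "triangle C M'' M' E1 m' q'' r''"
      "y \<cdot> m' = \<zero> M'' (X k)" using Suc(1)[OF 1(1) y(1)] unfolding killable_def by blast
    note m' = triangle_D(1)[OF 2(3)]
    have "(f \<cdot> m) \<cdot> m' = \<zero> M'' (X (Suc k))"
      unfolding y(2) Comp_assoc[OF m' y(1) j] 2(4) using j m' by (simp add: Hom_iff)
    then have "killable M' (X (Suc k)) (f \<cdot> m)" unfolding killable_def using 2 by blast
    then show ?case by (rule killable_Comp[OF 1(3,2) f])
  qed
  obtain k y where y: "y \<in> Hom C M (X k)" "f = u k \<cdot> y" using hocolim_compact[OF hc M f] by blast
  obtain M' m E0 q r where k: "E0 \<in> E" "triangle C M' M E0 m q r" "y \<cdot> m = \<zero> M' (X k)"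
    using X[OF M y(1)] unfolding killable_def by blast
  note u = hocolim_Hom[OF hc, of k]
  obtain z where z: "z \<in> Hom C E0 (X k)" "y = z \<cdot> q" using triangle_extend1[OF k(2) y(1) k(3)] by blast
  have "f = (u k \<cdot> z) \<cdot> q" using Comp_assoc[OF triangle_D(2)[OF k(2)] z(1) u] z(2) y(2) by simp
  then show thesis using that[OF k(1) triangle_D(2)[OF k(2)] Comp_Hom[OF z(1) u]] by blast
qed

end

end

section \<open>Shifting triangles, coproducts and perpendicular classes\<close>

context triangulated_category begin

lemma triangle_Shift:
  assumes "triangle C X Y Z f g h"
  shows "\<exists>f g h. triangle C (Shift C X) (Shift C Y) (Shift C Z) f g h"
  using triangle_rotate[OF triangle_rotate[OF triangle_rotate[OF assms]]] by blast

lemma triangle_unshift: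
  assumes t: "triangle C (Shift C X) (Shift C Y) (Shift C Z) f g h" and X: "X \<in> Ob C" "Y \<in> Ob C" "Z \<in> Ob C"
  shows "\<exists>f g h. triangle C X Y Z f g h"
proof -
  obtain a where "triangle C Z (Shift C X) (Shift C Y) a f g" using triangle_unrotate[OF t X(3)] .
  then obtain b where "triangle C Y Z (Shift C X) b a f" by (rule triangle_unrotate[OF _ X(2)])
  then obtain c where "triangle C X Y Z c b a" by (rule triangle_unrotate[OF _ X(1)])
  then show ?thesis by blast
qed

lemma triangle_shift:
  assumes t: "triangle C X Y Z f g h"
  shows "\<exists>f g h. triangle C (shift C n X) (shift C n Y) (shift C n Z) f g h"
proof (induction n rule: int_induct[where k = 0])
  case base
  show ?case using t by auto
next
  case (step1 i)
  then show ?case using triangle_Shift triangle_Ob[OF t] by (metis Shift_shift)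
next
  case (step2 i)
  then obtain f g h where "triangle C (shift C i X) (shift C i Y) (shift C i Z) f g h" by blast
  then have "triangle C (Shift C (shift C (i - 1) X)) (Shift C (shift C (i - 1) Y)) (Shift C (shift C (i - 1) Z)) f g h"
    using triangle_Ob[OF t] by (simp add: Shift_shift)
  from triangle_unshift[OF this] show ?case using triangle_Ob[OF t] by simp
qed

lemma coproduct_shift_ex:
  assumes cop: "is_coproduct C I N S \<iota>"
  shows "\<exists>\<iota>'. is_coproduct C I (\<lambda>i. shift C n (N i)) (shift C n S) \<iota>'"
proof (induction n rule: int_induct[where k = 0])
  case base
  have "is_coproduct C I (\<lambda>i. shift C 0 (N i)) (shift C 0 S) \<iota>" using cop by simp
  then show ?case by (rule exI[of _ \<iota>])
next
  case (step1 m)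
  then obtain \<iota>' where c: "is_coproduct C I (\<lambda>i. shift C m (N i)) (shift C m S) \<iota>'" by (elim exE)
  have "is_coproduct C I (\<lambda>i. shift C (m + 1) (N i)) (shift C (m + 1) S) (\<lambda>i. ShiftA C (\<iota>' i))"
    by (rule coproduct_cong[OF coproduct_Shift[OF c, unfolded Shift_shift[OF coproduct_D(1)[OF cop]]]])
      (use coproduct_D(2)[OF cop] in \<open>simp_all add: Shift_shift\<close>)
  then show ?case by (rule exI[of _ "\<lambda>i. ShiftA C (\<iota>' i)"])
next
  case (step2 m)
  then obtain \<iota>' where c: "is_coproduct C I (\<lambda>i. shift C m (N i)) (shift C m S) \<iota>'" by (elim exE)
  obtain \<iota>'' where "is_coproduct C I (\<lambda>i. shift C (m - 1) (N i)) (shift C (m - 1) S) \<iota>''"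
    by (rule coproduct_unshift_ex[OF c, of "shift C (m - 1) S" "\<lambda>i. shift C (m - 1) (N i)"])
      (use coproduct_D[OF cop] in \<open>simp_all add: Shift_shift\<close>)
  then show ?case by (rule exI[of _ \<iota>''])
qed

lemma isomorphic_Shift_iff:
  assumes "X \<in> Ob C" "Y \<in> Ob C"
  shows "isomorphic C (Shift C X) (Shift C Y) \<longleftrightarrow> isomorphic C X Y"
proof
  assume "isomorphic C X Y"
  then obtain f g where fg: "f \<in> Hom C X Y" "g \<in> Hom C Y X" "g \<cdot> f = Ident C X" "f \<cdot> g = Ident C Y"
    by (rule isomorphicE)
  show "isomorphic C (Shift C X) (Shift C Y)"
    by (rule isomorphicI[OF ShiftA_Hom[OF fg(1)] ShiftA_Hom[OF fg(2)]])
      (use ShiftA_Comp[OF fg(1,2)] ShiftA_Comp[OF fg(2,1)] fg(3,4) assms ShiftA_Ident in simp_all)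
next
  assume "isomorphic C (Shift C X) (Shift C Y)"
  then obtain f' g' where fg': "f' \<in> Hom C (Shift C X) (Shift C Y)" "g' \<in> Hom C (Shift C Y) (Shift C X)"
    "g' \<cdot> f' = Ident C (Shift C X)" "f' \<cdot> g' = Ident C (Shift C Y)" by (rule isomorphicE)
  obtain f where f: "f \<in> Hom C X Y" "f' = ShiftA C f" using ShiftA_surj[OF fg'(1) assms] .
  obtain g where g: "g \<in> Hom C Y X" "g' = ShiftA C g" using ShiftA_surj[OF fg'(2) assms(2,1)] .
  show "isomorphic C X Y"
  proof (rule isomorphicI[OF f(1) g(1)])
    show "g \<cdot> f = Ident C X"
      by (rule ShiftA_inj[OF Comp_Hom[OF f(1) g(1)] Ident_Hom[OF assms(1)]])
        (use ShiftA_Comp[OF f(1) g(1)] fg'(3) f g ShiftA_Ident[OF assms(1)] in simp)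
    show "f \<cdot> g = Ident C Y"
      by (rule ShiftA_inj[OF Comp_Hom[OF g(1) f(1)] Ident_Hom[OF assms(2)]])
        (use ShiftA_Comp[OF g(1) f(1)] fg'(4) f g ShiftA_Ident[OF assms(2)] in simp)
  qed
qed

lemma isomorphic_shift:
  assumes "isomorphic C X Y"
  shows "isomorphic C (shift C n X) (shift C n Y)"
proof (induction n rule: int_induct[where k = 0])
  have Ob: "X \<in> Ob C" "Y \<in> Ob C" using assms by (auto simp: isomorphic_def)
  case (step1 i)
  then show ?case using isomorphic_Shift_iff[of "shift C i X" "shift C i Y"] Ob by (simp add: Shift_shift)
next
  have Ob: "X \<in> Ob C" "Y \<in> Ob C" using assms by (auto simp: isomorphic_def)
  case (step2 i)
  then show ?case using isomorphic_Shift_iff[of "shift C (i-1) X" "shift C (i-1) Y"] Ob by (simp add: Shift_shift)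
qed (simp add: assms)

lemma right_perp_shifts:
  assumes "A \<subseteq> Ob C"
  shows "Y \<in> right_perp C (shifts C N A) \<longleftrightarrow> Y \<in> Ob C \<and> (\<forall>n\<in>N. \<forall>a\<in>A. orth (shift C n a) Y)"
  by (auto simp: right_perp_orth shifts_def)

lemma shift_right_perp:
  assumes A: "A \<subseteq> Ob C" and M: "M = (\<lambda>n. n + m) ` N"
  shows "shift C m ` right_perp C (shifts C N A) = right_perp C (shifts C M A)"
proof (rule Set.set_eqI)
  fix Y
  have RO: "right_perp C (shifts C N A) \<subseteq> Ob C" by (auto simp: right_perp_orth)
  show "Y \<in> shift C m ` right_perp C (shifts C N A) \<longleftrightarrow> Y \<in> right_perp C (shifts C M A)"
  proof (cases "Y \<in> Ob C")
    case True
    have "orth (shift C n a) (shift C (- m) Y) \<longleftrightarrow> orth (shift C (n + m) a) Y" if "a \<in> A" for n a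
      using orth_shift_both[of a Y n "- m"] that A True by (auto simp: subset_eq)
    then show ?thesis using True unfolding shift_image_iff[OF RO True] right_perp_shifts[OF A] M by auto
  next
    case False
    then show ?thesis using RO by (auto simp: right_perp_orth)
  qed
qed

lemma left_perp_Ob: "left_perp D \<subseteq> Ob C"
  by (auto simp: left_perp_def)

lemma shift_left_perp:
  assumes D: "D \<subseteq> Ob C"
  shows "shift C m ` left_perp D = left_perp (shift C m ` D)"
proof (rule Set.set_eqI)
  fix X
  show "X \<in> shift C m ` left_perp D \<longleftrightarrow> X \<in> left_perp (shift C m ` D)"
  proof (cases "X \<in> Ob C")
    case True
    have "orth (shift C (- m) X) Y \<longleftrightarrow> orth X (shift C m Y)" if "Y \<in> D" for Y
      using orth_shift_left[of X Y "- m"] that D True by (auto simp: subset_eq)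
    then show ?thesis using True unfolding shift_image_iff[OF left_perp_Ob True] by (auto simp: left_perp_def)
  next
    case False
    then show ?thesis using D by (auto simp: left_perp_def)
  qed
qed

lemma left_perp_antimono: "D \<subseteq> D' \<Longrightarrow> left_perp D' \<subseteq> left_perp D"
  by (auto simp: left_perp_def)

lemma right_perp_shifts_antimono: "N \<subseteq> N' \<Longrightarrow> right_perp C (shifts C N' A) \<subseteq> right_perp C (shifts C N A)"
proof
  fix Y assume "N \<subseteq> N'" "Y \<in> right_perp C (shifts C N' A)"
  then show "Y \<in> right_perp C (shifts C N A)" unfolding right_perp_orth shifts_def by blast
qed

lemma left_perp_retracts:
  assumes "D \<subseteq> Ob C" shows "closed_retracts C (left_perp D)"
  unfolding closed_retracts_def
proof (intro ballI allI impI)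
  fix Y X assume Y: "Y \<in> left_perp D" and r: "is_retract C X Y"
  have "orth X T" if "T \<in> D" for T
    by (rule orth_retract(1)[OF r]) (use that Y assms in \<open>auto simp: left_perp_def\<close>)
  then show "X \<in> left_perp D" using r by (simp add: left_perp_def is_retract_def)
qed

lemma right_perp_retracts:
  assumes "D \<subseteq> Ob C" shows "closed_retracts C (right_perp C D)"
  unfolding closed_retracts_def
proof (intro ballI allI impI)
  fix Y X assume Y: "Y \<in> right_perp C D" and r: "is_retract C X Y"
  have "orth T X" if "T \<in> D" for T
    by (rule orth_retract(2)[OF r]) (use that Y assms in \<open>auto simp: right_perp_orth\<close>)
  then show "X \<in> right_perp C D" using r by (simp add: right_perp_orth is_retract_def)
qed

end

section \<open>Compactly generated triangulated categories\<close>

locale compactly_generated = smashing_triangulated \<kappa> C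
  for \<kappa> :: "'u rel" and C :: "('o, 'm, 'z) triangulated_category_scheme" (structure) +
  fixes A :: "'o set"
  assumes ls: "locally_small \<kappa> C" and A_generates: "compactly_generates \<kappa> C A"
begin

lemma A_compact: "A \<subseteq> compacts"
  using A_generates by (simp add: compactly_generates_def)

lemma A_Ob: "A \<subseteq> Ob C"
  using A_compact compact_Ob by blast

lemma compact_shift: "c \<in> compacts \<Longrightarrow> shift C n c \<in> compacts"
proof (induction n rule: int_induct[where k = 0])
  case (step1 i)
  then show ?case using compact_Shift_iff[of "shift C i c"] compact_Ob by (simp add: Shift_shift)
next
  case (step2 i)
  then show ?case using compact_Shift_iff[of "shift C (i - 1) c"] compact_Ob by (simp add: Shift_shift)
qed simp

lemma shifts_compact: "shifts C N A \<subseteq> compacts"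
  using A_compact compact_shift by (auto simp: shifts_def)

lemma shifts_essentially_small: "essentially_small \<kappa> C (shifts C N A)"
proof -
  obtain R where R: "R \<subseteq> A" "small \<kappa> R" "\<And>a. a \<in> A \<Longrightarrow> \<exists>r\<in>R. isomorphic C a r"
    using A_generates[unfolded compactly_generates_def, THEN conjunct1] unfolding essentially_small_def by blast
  have "inj_on (\<lambda>n. nat (if 0 \<le> n then 2 * n else - 2 * n - 1)) N"
  proof (rule inj_onI)
    fix x y :: int
    assume e: "nat (if 0 \<le> x then 2 * x else - 2 * x - 1) = nat (if 0 \<le> y then 2 * y else - 2 * y - 1)"
    show "x = y" using e by (cases "0 \<le> x"; cases "0 \<le> y") (simp_all add: nat_eq_iff, presburger+)
  qed
  from small_inj[OF this small_nat] have "small \<kappa> N" .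
  then have "small \<kappa> (\<Union>n\<in>N. shift C n ` R)" by (rule small_UNION) (rule small_image[OF R(2)])
  then show ?thesis
    unfolding essentially_small_def
  proof (intro exI[of _ "\<Union>n\<in>N. shift C n ` R"] conjI ballI)
    show "(\<Union>n\<in>N. shift C n ` R) \<subseteq> shifts C N A" using R(1) by (auto simp: shifts_def)
    fix X assume "X \<in> shifts C N A"
    then obtain n a where X: "n \<in> N" "a \<in> A" "X = shift C n a" by (auto simp: shifts_def)
    obtain r where r: "r \<in> R" "isomorphic C a r" using R(3)[OF X(2)] by blast
    show "\<exists>Y\<in>\<Union>n\<in>N. shift C n ` R. isomorphic C X Y"
      using isomorphic_shift[OF r(2), of n] X(1,3) r(1) by (intro bexI[of _ "shift C n r"]) auto
  qed
qed

text \<open>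
  Closure under isomorphisms, zero objects and biproducts is a special case of closure under coproducts.
\<close>

lemma generation_induct:
  assumes D: "D \<subseteq> Ob C" "A \<subseteq> D" and cop: "closed_coproducts \<kappa> C D"
    and sh: "\<And>X. X \<in> D \<Longrightarrow> Shift C X \<in> D" "\<And>X. X \<in> Ob C \<Longrightarrow> Shift C X \<in> D \<Longrightarrow> X \<in> D"
    and cone: "\<And>X Y Z f g h. triangle C X Y Z f g h \<Longrightarrow> X \<in> D \<Longrightarrow> Y \<in> D \<Longrightarrow> Z \<in> D"
  shows "D = Ob C"
proof -
  have "triangulated_subcategory C D"
    unfolding triangulated_subcategory_def additive_subcategory_def additive_class_def
  proof (intro conjI ballI allI impI)
    show "closed_iso C D"
      unfolding closed_iso_def
    proof (intro ballI allI impI)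
      fix X Y assume X: "X \<in> D" and iso: "isomorphic C X Y"
      obtain \<iota> where "is_coproduct C {()} (\<lambda>_. X) Y \<iota>" using isomorphic_coproduct[OF iso] .
      from closed_coproducts_any[OF inacc cop _ X this] show "Y \<in> D" by (simp add: small_finite)
    qed
    show "Z \<in> D" if "zero_object C Z" for Z
    proof -
      have "is_coproduct C ({} :: unit set) (\<lambda>_. Z) Z (\<lambda>_. undefined)" using zero_object_coproduct[OF that] .
      from closed_coproducts_any[OF inacc cop _ _ this] show ?thesis by (simp add: small_finite)
    qed
    show "S \<in> D" if XY: "X \<in> D" "Y \<in> D" and b: "is_biproduct C X Y S" for X Y S
    proof -
      obtain \<iota> where "is_coproduct C (UNIV :: bool set) (\<lambda>b. if b then X else Y) S \<iota>"
        using biproduct_coproduct[OF b] .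
      from closed_coproducts_any[OF inacc cop _ _ this] XY show ?thesis by (simp add: small_finite)
    qed
    show "shift C 1 ` D \<subseteq> D" using sh(1) by auto
    show "shift C (- 1) ` D \<subseteq> D"
    proof clarify
      fix X assume "X \<in> D"
      then show "shift C (- 1) X \<in> D" using sh(2)[of "shift C (- 1) X"] D(1) Shift_shift[of X "-1"] by auto
    qed
  qed (use D(1) cone in blast)+
  then have "\<Inter>{D. triangulated_subcategory C D \<and> A \<subseteq> D \<and> closed_coproducts \<kappa> C D} \<subseteq> D"
    using D cop by blast
  then show ?thesis using A_generates D(1) unfolding compactly_generates_def by blast
qed

text \<open>
  The objects without maps to any shift of \<open>Z\<close> contain \<open>A\<close> and are closed under the operations that generate
  the category, so the identity of \<open>Z\<close> vanishes.
\<close>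

lemma zero_objectI:
  assumes Z: "Z \<in> Ob C" and o: "\<And>n a. a \<in> A \<Longrightarrow> orth (shift C n a) Z"
  shows "zero_object C Z"
proof -
  let ?D = "{T \<in> Ob C. \<forall>n. orth T (shift C n Z)}"
  have "?D = Ob C"
  proof (rule generation_induct)
    show "A \<subseteq> ?D"
    proof clarify
      fix a assume a: "a \<in> A"
      then have aO: "a \<in> Ob C" using A_Ob by blast
      have "orth a (shift C n Z)" for n using o[OF a, of "- n"] orth_shift_left[OF aO Z, of "- n"] by simp
      then show "a \<in> Ob C \<and> (\<forall>n. orth a (shift C n Z))" using aO by blast
    qed
    show "closed_coproducts \<kappa> C ?D"
      unfolding closed_coproducts_def
    proof (intro allI impI, elim conjE)
      fix I :: "'u set" and N S \<iota> assume N: "\<forall>i\<in>I. N i \<in> ?D" and cop: "is_coproduct C I N S \<iota>"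
      have "orth S (shift C n Z)" for n by (rule orth_coproduct[OF cop]) (use N Z in auto)
      then show "S \<in> ?D" using coproduct_D(1)[OF cop] by blast
    qed
    have S: "orth (Shift C X) (shift C n Z) \<longleftrightarrow> orth X (shift C (n - 1) Z)" if "X \<in> Ob C" for X n
      using orth_Shift[OF that shift_Ob[OF Z, of "n - 1"]] Z by (simp add: Shift_shift)
    show "Shift C X \<in> ?D" if "X \<in> ?D" for X using that S by simp
    show "X \<in> ?D" if X: "X \<in> Ob C" "Shift C X \<in> ?D" for X
    proof -
      have "orth X (shift C n Z)" for n using X(2) S[OF X(1), of "n + 1"] by simp
      then show ?thesis using X(1) by blast
    qed
    show "T \<in> ?D" if t: "triangle C X Y T f g h" and X: "X \<in> ?D" and Y: "Y \<in> ?D" for X Y T f g h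
    proof -
      have "orth T (shift C n Z)" for n
        by (rule orth_triangle_left[OF triangle_rotate[OF t]]) (use S X Y Z in simp_all)
      then show ?thesis using triangle_Ob[OF t] by simp
    qed
  qed auto
  then have "orth Z (shift C 0 Z)" using Z by blast
  then have "Ident C Z = \<zero> Z Z" using Ident_Hom[OF Z] orthD by simp
  then show ?thesis using zero_object_Ident[OF Z] by simp
qed

text \<open>
  With all shifts of \<open>A\<close> as cells, the cellular approximation represents the functor on \<open>A\<close>, and by the five
  lemma on everything that \<open>A\<close> generates. Identities for \<open>e\<close> give the product of the \<open>N i\<close>; a one-element
  \<open>I\<close> gives the image of an idempotent.
\<close>

lemma brown_representability:
  fixes I :: "'i set"
  assumes I: "small \<kappa> I" and e: "\<And>i. i \<in> I \<Longrightarrow> e i \<in> Hom C (N i) (N i)" "\<And>i. i \<in> I \<Longrightarrow> e i \<cdot> e i = e i"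
  obtains P \<pi> where "P \<in> Ob C" "\<And>i. i \<in> I \<Longrightarrow> \<pi> i \<in> Hom C P (N i)" "\<And>i. i \<in> I \<Longrightarrow> e i \<cdot> \<pi> i = \<pi> i"
    "\<And>T f. T \<in> Ob C \<Longrightarrow> (\<And>i. i \<in> I \<Longrightarrow> f i \<in> Hom C T (N i)) \<Longrightarrow> (\<And>i. i \<in> I \<Longrightarrow> e i \<cdot> f i = f i)
      \<Longrightarrow> \<exists>x\<in>Hom C T P. \<forall>i\<in>I. \<pi> i \<cdot> x = f i"
    "\<And>T x. x \<in> Hom C T P \<Longrightarrow> (\<And>i. i \<in> I \<Longrightarrow> \<pi> i \<cdot> x = \<zero> T (N i)) \<Longrightarrow> x = \<zero> T P"
proof -
  have N: "\<And>i. i \<in> I \<Longrightarrow> N i \<in> Ob C" using e(1) Hom_Ob by blast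
  let ?G = "shifts C UNIV A"
  obtain P \<pi> where P: "P \<in> cellular ?G" and \<pi>: "\<And>i. i \<in> I \<Longrightarrow> \<pi> i \<in> Hom C P (N i)" "\<And>i. i \<in> I \<Longrightarrow> e i \<cdot> \<pi> i = \<pi> i"
    and surj: "\<And>g f. g \<in> ?G \<Longrightarrow> (\<And>i. i \<in> I \<Longrightarrow> f i \<in> Hom C g (N i)) \<Longrightarrow> (\<And>i. i \<in> I \<Longrightarrow> e i \<cdot> f i = f i)
      \<Longrightarrow> \<exists>x\<in>Hom C g P. \<forall>i\<in>I. \<pi> i \<cdot> x = f i"
    and inj: "\<And>g x. g \<in> Ob C \<Longrightarrow> Shift C g \<in> ?G \<Longrightarrow> x \<in> Hom C g P \<Longrightarrow> (\<And>i. i \<in> I \<Longrightarrow> \<pi> i \<cdot> x = \<zero> g (N i))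
      \<Longrightarrow> x = \<zero> g P"
    by (rule cellular_approximation[OF ls shifts_essentially_small shifts_compact I e]) (assumption | blast)+
  note PO = cellular_Ob[OF P]
  define fam where "fam T f \<longleftrightarrow> (\<forall>i\<in>I. f i \<in> Hom C T (N i) \<and> e i \<cdot> f i = f i)" for T f
  define sur where "sur T \<longleftrightarrow> (\<forall>f. fam T f \<longrightarrow> (\<exists>x\<in>Hom C T P. \<forall>i\<in>I. \<pi> i \<cdot> x = f i))" for T
  define mon where "mon T \<longleftrightarrow> (\<forall>x\<in>Hom C T P. (\<forall>i\<in>I. \<pi> i \<cdot> x = \<zero> T (N i)) \<longrightarrow> x = \<zero> T P)" for T
  have famI: "fam T (\<lambda>i. f i \<cdot> v)" if "fam T' f" "v \<in> Hom C T T'" for T T' f v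
    unfolding fam_def
  proof
    fix i assume i: "i \<in> I"
    have f: "f i \<in> Hom C T' (N i)" "e i \<cdot> f i = f i" using that(1) i unfolding fam_def by auto
    show "f i \<cdot> v \<in> Hom C T (N i) \<and> e i \<cdot> (f i \<cdot> v) = f i \<cdot> v"
      using Comp_Hom[OF that(2) f(1)] Comp_assoc[OF that(2) f(1) e(1)[OF i]] f(2) by simp
  qed
  have rep3: "sur T3 \<and> mon T3"
    if t: "triangle C T1 T2 T3 u v w"
      and 1: "mon T1" "sur T2" "mon T2" "sur (Shift C T1)" "mon (Shift C T1)" "sur (Shift C T2)"
    for T1 T2 T3 u v w
  proof
    note D = triangle_D[OF t] and Ob = triangle_Ob[OF t]
    show "sur T3"
      unfolding sur_def
    proof (intro allI impI)
      fix f assume f: "fam T3 f"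
      have fi: "\<And>i. i \<in> I \<Longrightarrow> f i \<in> Hom C T3 (N i)" "\<And>i. i \<in> I \<Longrightarrow> e i \<cdot> f i = f i" using f by (auto simp: fam_def)
      obtain x where x: "x \<in> Hom C T2 P" "\<And>i. i \<in> I \<Longrightarrow> \<pi> i \<cdot> x = f i \<cdot> v"
        using 1(2) famI[OF f D(2)] unfolding sur_def by blast
      have "x \<cdot> u = \<zero> T1 P"
      proof -
        have "\<pi> i \<cdot> (x \<cdot> u) = \<zero> T1 (N i)" if i: "i \<in> I" for i
        proof -
          have "\<pi> i \<cdot> (x \<cdot> u) = f i \<cdot> (v \<cdot> u)"
            using Comp_assoc[OF D(1) x(1) \<pi>(1)[OF i]] Comp_assoc[OF D(1,2) fi(1)[OF i]] x(2)[OF i] by simp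
          then show ?thesis unfolding triangle_Comp_Zero(1)[OF t] using fi(1)[OF i] Ob by (simp add: Hom_iff)
        qed
        then show ?thesis using 1(1) Comp_Hom[OF D(1) x(1)] unfolding mon_def by blast
      qed
      then obtain y where y: "y \<in> Hom C T3 P" "x = y \<cdot> v" using triangle_extend1[OF t x(1)] by blast
      have "\<exists>z. z \<in> Hom C (Shift C T1) (N i) \<and> e i \<cdot> z = z \<and> f i \<ominus> (\<pi> i \<cdot> y) = z \<cdot> w" if i: "i \<in> I" for i
      proof -
        let ?d = "f i \<ominus> (\<pi> i \<cdot> y)"
        note \<pi>y = Comp_Hom[OF y(1) \<pi>(1)[OF i]] and fi' = fi(1)[OF i] and ei = e(1)[OF i]
        have d: "?d \<in> Hom C T3 (N i)" by (rule diff_Hom[OF fi' \<pi>y])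
        have "?d \<cdot> v = (f i \<cdot> v) \<ominus> (\<pi> i \<cdot> (y \<cdot> v))" using fi' \<pi>(1)[OF i] y(1) D(2) by (simp add: Hom_iff)
        then have "?d \<cdot> v = \<zero> T2 (N i)" using x(2)[OF i] y(2) diff_self[OF Comp_Hom[OF D(2) fi']] by simp
        then obtain z where z: "z \<in> Hom C (Shift C T1) (N i)" "?d = z \<cdot> w" using triangle_extend2[OF t d] by blast
        have "e i \<cdot> ?d = (e i \<cdot> f i) \<ominus> ((e i \<cdot> \<pi> i) \<cdot> y)" using fi' \<pi>(1)[OF i] y(1) ei by (simp add: Hom_iff)
        then have "e i \<cdot> ?d = ?d" using fi(2)[OF i] \<pi>(2)[OF i] by simp
        then have "(e i \<cdot> z) \<cdot> w = ?d" using Comp_assoc[OF D(3) z(1) ei] z(2) by simp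
        moreover have "e i \<cdot> (e i \<cdot> z) = e i \<cdot> z" using Comp_assoc[OF z(1) ei ei] e(2)[OF i] by simp
        ultimately show ?thesis using Comp_Hom[OF z(1) ei] by metis
      qed
      then obtain z where z: "\<And>i. i \<in> I \<Longrightarrow> z i \<in> Hom C (Shift C T1) (N i) \<and> e i \<cdot> z i = z i \<and> f i \<ominus> (\<pi> i \<cdot> y) = z i \<cdot> w"
        by metis
      then have "fam (Shift C T1) z" by (simp add: fam_def)
      then obtain z' where z': "z' \<in> Hom C (Shift C T1) P" "\<And>i. i \<in> I \<Longrightarrow> \<pi> i \<cdot> z' = z i"
        using 1(4) unfolding sur_def by blast
      note z'w = Comp_Hom[OF D(3) z'(1)]
      have "\<pi> i \<cdot> ((z' \<cdot> w) \<oplus> y) = f i" if i: "i \<in> I" for i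
      proof -
        have "\<pi> i \<cdot> ((z' \<cdot> w) \<oplus> y) = (z i \<cdot> w) \<oplus> (\<pi> i \<cdot> y)"
          using Comp_Add[OF z'w y(1) \<pi>(1)[OF i]] Comp_assoc[OF D(3) z'(1) \<pi>(1)[OF i]] z'(2)[OF i] by simp
        then show ?thesis using z[OF i] diff_add[OF fi(1)[OF i] Comp_Hom[OF y(1) \<pi>(1)[OF i]]] by simp
      qed
      then show "\<exists>x\<in>Hom C T3 P. \<forall>i\<in>I. \<pi> i \<cdot> x = f i" using Add_Hom[OF z'w y(1)] by blast
    qed
    show "mon T3"
      unfolding mon_def
    proof (intro ballI impI)
      fix y assume y: "y \<in> Hom C T3 P" and 0: "\<forall>i\<in>I. \<pi> i \<cdot> y = \<zero> T3 (N i)"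
      have "\<pi> i \<cdot> (y \<cdot> v) = \<zero> T2 (N i)" if i: "i \<in> I" for i
        using Comp_assoc[OF D(2) y \<pi>(1)[OF i]] 0 i D(2) N[OF i] by (simp add: Hom_iff)
      then have "y \<cdot> v = \<zero> T2 P" using 1(3) Comp_Hom[OF D(2) y] unfolding mon_def by blast
      then obtain z where z: "z \<in> Hom C (Shift C T1) P" "y = z \<cdot> w" using triangle_extend2[OF t y] by blast
      have "\<exists>q. q \<in> Hom C (Shift C T2) (N i) \<and> e i \<cdot> q = q \<and> \<pi> i \<cdot> z = q \<cdot> ShiftA C u" if i: "i \<in> I" for i
      proof -
        note \<pi>z = Comp_Hom[OF z(1) \<pi>(1)[OF i]] and ei = e(1)[OF i]
        have "(\<pi> i \<cdot> z) \<cdot> w = \<zero> T3 (N i)" using Comp_assoc[OF D(3) z(1) \<pi>(1)[OF i]] z(2) 0 i by simp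
        then obtain q where q: "q \<in> Hom C (Shift C T2) (N i)" "\<pi> i \<cdot> z = q \<cdot> ShiftA C u"
          using triangle_extend3[OF t \<pi>z] by blast
        have "(e i \<cdot> q) \<cdot> ShiftA C u = (e i \<cdot> \<pi> i) \<cdot> z"
          using Comp_assoc[OF ShiftA_Hom[OF D(1)] q(1) ei] Comp_assoc[OF z(1) \<pi>(1)[OF i] ei] q(2) by simp
        then have "(e i \<cdot> q) \<cdot> ShiftA C u = \<pi> i \<cdot> z" using \<pi>(2)[OF i] by simp
        moreover have "e i \<cdot> (e i \<cdot> q) = e i \<cdot> q" using Comp_assoc[OF q(1) ei ei] e(2)[OF i] by simp
        ultimately show ?thesis using Comp_Hom[OF q(1) ei] by metis
      qed
      then obtain q where q: "\<And>i. i \<in> I \<Longrightarrow> q i \<in> Hom C (Shift C T2) (N i) \<and> e i \<cdot> q i = q i \<and> \<pi> i \<cdot> z = q i \<cdot> ShiftA C u"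
        by metis
      then have "fam (Shift C T2) q" by (simp add: fam_def)
      then obtain q' where q': "q' \<in> Hom C (Shift C T2) P" "\<And>i. i \<in> I \<Longrightarrow> \<pi> i \<cdot> q' = q i"
        using 1(6) unfolding sur_def by blast
      note Su = ShiftA_Hom[OF D(1)]
      note q'u = Comp_Hom[OF Su q'(1)]
      have "\<pi> i \<cdot> (z \<ominus> (q' \<cdot> ShiftA C u)) = \<zero> (Shift C T1) (N i)" if i: "i \<in> I" for i
      proof -
        have "\<pi> i \<cdot> (z \<ominus> (q' \<cdot> ShiftA C u)) = (\<pi> i \<cdot> z) \<ominus> ((\<pi> i \<cdot> q') \<cdot> ShiftA C u)"
          using \<pi>(1)[OF i] z(1) q'(1) Su by (simp add: Hom_iff)
        then show ?thesis using q'(2)[OF i] q[OF i] diff_self[OF Comp_Hom[OF z(1) \<pi>(1)[OF i]]] by simp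
      qed
      then have "z \<ominus> (q' \<cdot> ShiftA C u) = \<zero> (Shift C T1) P"
        using 1(5) diff_Hom[OF z(1) q'u] unfolding mon_def by blast
      then have "z = q' \<cdot> ShiftA C u" using diff_eq_Zero[OF z(1) q'u] by simp
      then have "y = q' \<cdot> (ShiftA C u \<cdot> w)" using z(2) Comp_assoc[OF D(3) Su q'(1)] by simp
      then show "y = \<zero> T3 P" unfolding triangle_Comp_Zero(3)[OF t] using q'(1) Ob by (simp add: Hom_iff)
    qed
  qed
  let ?D = "{T \<in> Ob C. \<forall>n. sur (shift C n T) \<and> mon (shift C n T)}"
  have "?D = Ob C"
  proof (rule generation_induct)
    show "A \<subseteq> ?D"
    proof clarify
      fix a assume a: "a \<in> A"
      then have aO: "a \<in> Ob C" using A_Ob by blast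
      have G: "shift C n a \<in> ?G" "Shift C (shift C n a) \<in> ?G" for n
        using a aO by (auto simp: shifts_def Shift_shift)
      have "sur (shift C n a)" for n unfolding sur_def fam_def using surj[OF G(1)] by blast
      moreover have "mon (shift C n a)" for n unfolding mon_def using inj[OF shift_Ob[OF aO] G(2)] by blast
      ultimately show "a \<in> Ob C \<and> (\<forall>n. sur (shift C n a) \<and> mon (shift C n a))" using aO by blast
    qed
    show "closed_coproducts \<kappa> C ?D"
      unfolding closed_coproducts_def
    proof (intro allI impI, elim conjE)
      fix K :: "'u set" and M S \<iota>0
      assume M: "\<forall>k\<in>K. M k \<in> ?D" and cop0: "is_coproduct C K M S \<iota>0"
      have "sur (shift C n S) \<and> mon (shift C n S)" for n
      proof -
        obtain \<iota> where cop: "is_coproduct C K (\<lambda>k. shift C n (M k)) (shift C n S) \<iota>"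
          using coproduct_shift_ex[OF cop0, of n] by (elim exE)
        note \<iota> = coproduct_D(3)[OF cop]
        have "sur (shift C n S)"
          unfolding sur_def
        proof (intro allI impI)
          fix f assume f: "fam (shift C n S) f"
          have fi: "\<And>i. i \<in> I \<Longrightarrow> f i \<in> Hom C (shift C n S) (N i)" using f by (auto simp: fam_def)
          have "\<exists>x. x \<in> Hom C (shift C n (M k)) P \<and> (\<forall>i\<in>I. \<pi> i \<cdot> x = f i \<cdot> \<iota> k)" if k: "k \<in> K" for k
            using M k famI[OF f \<iota>[OF k]] unfolding sur_def by blast
          then obtain x where x: "\<And>k. k \<in> K \<Longrightarrow> x k \<in> Hom C (shift C n (M k)) P"
            "\<And>k i. k \<in> K \<Longrightarrow> i \<in> I \<Longrightarrow> \<pi> i \<cdot> x k = f i \<cdot> \<iota> k" by metis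
          let ?x = "copair K (shift C n S) \<iota> P x"
          note c = copair_Hom[OF cop PO x(1)] copair_Comp[OF cop PO x(1)]
          have "\<pi> i \<cdot> ?x = f i" if i: "i \<in> I" for i
          proof (rule coproduct_eqI[OF cop Comp_Hom[OF c(1) \<pi>(1)[OF i]] fi[OF i]])
            fix k assume k: "k \<in> K"
            show "(\<pi> i \<cdot> ?x) \<cdot> \<iota> k = f i \<cdot> \<iota> k"
              using Comp_assoc[OF \<iota>[OF k] c(1) \<pi>(1)[OF i]] c(2)[OF _ k] x(2)[OF k i] by simp
          qed
          then show "\<exists>x\<in>Hom C (shift C n S) P. \<forall>i\<in>I. \<pi> i \<cdot> x = f i" using c(1) by blast
        qed
        moreover have "mon (shift C n S)"
          unfolding mon_def
        proof (intro ballI impI)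
          fix x assume x: "x \<in> Hom C (shift C n S) P" and 0: "\<forall>i\<in>I. \<pi> i \<cdot> x = \<zero> (shift C n S) (N i)"
          show "x = \<zero> (shift C n S) P"
          proof (rule coproduct_eqI[OF cop x Zero_Hom[OF coproduct_D(1)[OF cop] PO]])
            fix k assume k: "k \<in> K"
            have "\<pi> i \<cdot> (x \<cdot> \<iota> k) = \<zero> (shift C n (M k)) (N i)" if i: "i \<in> I" for i
              using Comp_assoc[OF \<iota>[OF k] x \<pi>(1)[OF i]] 0 i \<iota>[OF k] N[OF i] by (simp add: Hom_iff)
            then have "x \<cdot> \<iota> k = \<zero> (shift C n (M k)) P"
              using M k Comp_Hom[OF \<iota>[OF k] x] unfolding mon_def by blast
            then show "x \<cdot> \<iota> k = \<zero> (shift C n S) P \<cdot> \<iota> k" using \<iota>[OF k] PO by (simp add: Hom_iff)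
          qed
        qed
        ultimately show ?thesis by blast
      qed
      then show "S \<in> ?D" using coproduct_D(1)[OF cop0] by blast
    qed
    show "Shift C X \<in> ?D" if "X \<in> ?D" for X using that by (simp add: shift_Shift)
    show "X \<in> ?D" if X: "X \<in> Ob C" "Shift C X \<in> ?D" for X
    proof -
      have "sur (shift C n X) \<and> mon (shift C n X)" for n
        using X(2) shift_Shift[OF X(1), of "n - 1"] by (metis (mono_tags, lifting) diff_add_cancel mem_Collect_eq)
      then show ?thesis using X by blast
    qed
    show "Z \<in> ?D" if t: "triangle C X Y Z f g h" and X: "X \<in> ?D" and Y: "Y \<in> ?D" for X Y Z f g h
    proof -
      have "sur (shift C n Z) \<and> mon (shift C n Z)" for n
      proof -
        obtain f' g' h' where t': "triangle C (shift C n X) (shift C n Y) (shift C n Z) f' g' h'"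
          using triangle_shift[OF t] by blast
        show ?thesis by (rule rep3[OF t']) (use X Y in \<open>simp_all add: Shift_shift\<close>)
      qed
      then show ?thesis using triangle_Ob[OF t] by blast
    qed
  qed auto
  then have rep: "sur T" "mon T" if "T \<in> Ob C" for T
    using that shift_0[of T] by (metis (mono_tags, lifting) mem_Collect_eq)+
  show thesis
  proof (rule that[OF PO \<pi>])
    show "\<exists>x\<in>Hom C T P. \<forall>i\<in>I. \<pi> i \<cdot> x = f i"
      if "T \<in> Ob C" "\<And>i. i \<in> I \<Longrightarrow> f i \<in> Hom C T (N i)" "\<And>i. i \<in> I \<Longrightarrow> e i \<cdot> f i = f i" for T f
      using rep(1)[OF that(1)] that(2,3) unfolding sur_def fam_def by blast
    show "x = \<zero> T P" if "x \<in> Hom C T P" "\<And>i. i \<in> I \<Longrightarrow> \<pi> i \<cdot> x = \<zero> T (N i)" for T x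
      using rep(2)[of T] Hom_Ob[OF that(1)] that unfolding mon_def by blast
  qed
qed

lemma cosmashing: "cosmashing \<kappa> C"
  unfolding cosmashing_def
proof (intro allI impI, elim conjE)
  fix I :: "'u set" and N assume I: "small \<kappa> I" and N: "\<forall>i\<in>I. N i \<in> Ob C"
  have e: "\<And>i. i \<in> I \<Longrightarrow> Ident C (N i) \<in> Hom C (N i) (N i)" "\<And>i. i \<in> I \<Longrightarrow> Ident C (N i) \<cdot> Ident C (N i) = Ident C (N i)"
    using N Ident_Hom by auto
  obtain P \<pi> where P: "P \<in> Ob C" "\<And>i. i \<in> I \<Longrightarrow> \<pi> i \<in> Hom C P (N i)"
    "\<And>T f. T \<in> Ob C \<Longrightarrow> (\<And>i. i \<in> I \<Longrightarrow> f i \<in> Hom C T (N i)) \<Longrightarrow> (\<And>i. i \<in> I \<Longrightarrow> Ident C (N i) \<cdot> f i = f i)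
      \<Longrightarrow> \<exists>x\<in>Hom C T P. \<forall>i\<in>I. \<pi> i \<cdot> x = f i"
    "\<And>T x. x \<in> Hom C T P \<Longrightarrow> (\<And>i. i \<in> I \<Longrightarrow> \<pi> i \<cdot> x = \<zero> T (N i)) \<Longrightarrow> x = \<zero> T P"
    by (rule brown_representability[OF I e]) (assumption | blast)+
  have "is_product C I N P \<pi>"
    unfolding is_product_def
  proof (intro conjI ballI allI impI)
    fix T g assume T: "T \<in> Ob C" and g: "\<forall>i\<in>I. g i \<in> Hom C T (N i)"
    then obtain x where x: "x \<in> Hom C T P" "\<forall>i\<in>I. \<pi> i \<cdot> x = g i"
      using P(3)[OF T, of g] Ident_Comp by blast
    show "\<exists>!h. h \<in> Hom C T P \<and> (\<forall>i\<in>I. \<pi> i \<cdot> h = g i)"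
    proof (rule ex1I[of _ x])
      fix y assume y: "y \<in> Hom C T P \<and> (\<forall>i\<in>I. \<pi> i \<cdot> y = g i)"
      then have y1: "y \<in> Hom C T P" by blast
      have "\<pi> i \<cdot> (y \<ominus> x) = \<zero> T (N i)" if i: "i \<in> I" for i
      proof -
        have "\<pi> i \<cdot> (y \<ominus> x) = (\<pi> i \<cdot> y) \<ominus> (\<pi> i \<cdot> x)" using y1 x(1) P(2)[OF i] by (simp add: Hom_iff)
        then show ?thesis using x y i g diff_self[of "g i" T "N i"] by simp
      qed
      then have "y \<ominus> x = \<zero> T P" using P(4)[OF diff_Hom[OF y1 x(1)]] by blast
      then show "y = x" using diff_eq_Zero[OF y1 x(1)] by simp
    qed (use x in blast)
  qed (use P N in auto)
  then show "\<exists>S \<pi>. is_product C I N S \<pi>" by (intro exI)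
qed

lemma idempotent_splits:
  assumes e: "e \<in> Hom C X X" "e \<cdot> e = e"
  obtains P \<pi> \<rho> where "\<pi> \<in> Hom C P X" "\<rho> \<in> Hom C X P" "\<rho> \<cdot> \<pi> = Ident C P" "\<pi> \<cdot> \<rho> = e"
proof -
  have X: "X \<in> Ob C" using e(1) Hom_Ob by blast
  have I: "small \<kappa> {()}" by (simp add: small_finite)
  obtain P \<pi> where P: "P \<in> Ob C" "\<And>i. i \<in> {()} \<Longrightarrow> \<pi> i \<in> Hom C P X" "\<And>i. i \<in> {()} \<Longrightarrow> e \<cdot> \<pi> i = \<pi> i"
    "\<And>T f. T \<in> Ob C \<Longrightarrow> (\<And>i. i \<in> {()} \<Longrightarrow> f i \<in> Hom C T X) \<Longrightarrow> (\<And>i. i \<in> {()} \<Longrightarrow> e \<cdot> f i = f i)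
      \<Longrightarrow> \<exists>x\<in>Hom C T P. \<forall>i\<in>{()}. \<pi> i \<cdot> x = f i"
    "\<And>T x. x \<in> Hom C T P \<Longrightarrow> (\<And>i. i \<in> {()} \<Longrightarrow> \<pi> i \<cdot> x = \<zero> T X) \<Longrightarrow> x = \<zero> T P"
    by (rule brown_representability[OF I e]) (assumption | blast)+
  let ?\<pi> = "\<pi> ()"
  have \<pi>: "?\<pi> \<in> Hom C P X" "e \<cdot> ?\<pi> = ?\<pi>" using P(2,3) by auto
  obtain \<rho> where \<rho>: "\<rho> \<in> Hom C X P" "?\<pi> \<cdot> \<rho> = e" using P(4)[OF X, of "\<lambda>_. e"] e by auto
  have \<rho>\<pi>: "\<rho> \<cdot> ?\<pi> \<in> Hom C P P" using Comp_Hom[OF \<pi>(1) \<rho>(1)] .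
  note id = Ident_Hom[OF P(1)]
  have "?\<pi> \<cdot> ((\<rho> \<cdot> ?\<pi>) \<ominus> Ident C P) = ((?\<pi> \<cdot> \<rho>) \<cdot> ?\<pi>) \<ominus> ?\<pi>"
    using \<pi>(1) \<rho>(1) id by (simp add: Hom_iff)
  also have "\<dots> = \<zero> P X" unfolding \<rho>(2) \<pi>(2) by (rule diff_self[OF \<pi>(1)])
  finally have "(\<rho> \<cdot> ?\<pi>) \<ominus> Ident C P = \<zero> P P" using P(5)[OF diff_Hom[OF \<rho>\<pi> id]] by simp
  then have "\<rho> \<cdot> ?\<pi> = Ident C P" using diff_eq_Zero[OF \<rho>\<pi> id] by simp
  then show thesis using that \<pi> \<rho> by blast
qed

section \<open>The generated weight structure and t-structure\<close>

abbreviation "wge \<equiv> right_perp C (shifts C {..<0} A)"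
abbreviation "wle \<equiv> left_perp (right_perp C (shifts C {..0} A))"
abbreviation "tle \<equiv> right_perp C (shifts C {0<..} A)"
abbreviation "tge \<equiv> left_perp (right_perp C (shifts C {0..} A))"

lemma cellular_subset_left_perp: "cellular G \<subseteq> left_perp (right_perp C G)"
  using cellular_Ob cellular_left_perp by (auto simp: left_perp_def)

text \<open>
  The classes \<open>left_perp (right_perp G)\<close> and \<open>right_perp G\<close> form a torsion pair. For \<open>G\<close> the union of the \<open>A[i]\<close>
  with \<open>i \<le> 0\<close> this is the decomposition of the weight structure, for \<open>i \<ge> 0\<close> that of the t-structure.
\<close>

lemma decomposition:
  assumes "M \<in> Ob C"
  obtains L R f g h where "L \<in> cellular (shifts C N A)" "L \<in> left_perp (right_perp C (shifts C N A))"
    "R \<in> right_perp C (shifts C N A)" "triangle C L M R f g h"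
proof -
  obtain L R f g h where "L \<in> cellular (shifts C N A)" "R \<in> right_perp C (shifts C N A)" "triangle C L M R f g h"
    using cellular_decomposition[OF ls shifts_essentially_small shifts_compact assms] .
  then show thesis using that cellular_subset_left_perp by blast
qed

lemma shift_wge: "shift C 1 ` wge = right_perp C (shifts C {..0} A)"
proof (rule shift_right_perp[OF A_Ob])
  have "x \<in> (\<lambda>n. n + 1) ` {..<0}" if "x \<le> 0" for x :: int
    using that by (intro image_eqI[of _ _ "x - 1"]) auto
  then show "{..0} = (\<lambda>n. n + 1) ` {..<(0::int)}" by auto
qed

lemma shift_tle: "shift C (- 1) ` tle = right_perp C (shifts C {0..} A)"
proof (rule shift_right_perp[OF A_Ob])
  have "x \<in> (\<lambda>n. n + - 1) ` {0<..}" if "0 \<le> x" for x :: int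
    using that by (intro image_eqI[of _ _ "x + 1"]) auto
  then show "{0..} = (\<lambda>n. n + - 1) ` {(0::int)<..}" by auto
qed

lemma right_perp_subset_Ob: "right_perp C D \<subseteq> Ob C"
  by (auto simp: right_perp_orth)

lemma shift_left_right_perp:
  assumes "M = (\<lambda>n. n + m) ` N"
  shows "shift C m ` left_perp (right_perp C (shifts C N A)) = left_perp (right_perp C (shifts C M A))"
  unfolding shift_left_perp[OF right_perp_subset_Ob] shift_right_perp[OF A_Ob assms] ..

lemma weight_structure: "weight_structure C wle wge"
  unfolding weight_structure_def
proof (intro conjI ballI)
  show "wle \<subseteq> Ob C" "wge \<subseteq> Ob C" using left_perp_Ob right_perp_subset_Ob by auto
  show "closed_retracts C wle" using left_perp_retracts right_perp_subset_Ob by blast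
  show "closed_retracts C wge" using right_perp_retracts shifts_Ob[OF A_Ob] by blast
  show "wle \<subseteq> shift C 1 ` wle"
    unfolding shift_left_right_perp[OF refl]
  proof (rule left_perp_antimono[OF right_perp_shifts_antimono])
    have "x \<in> (\<lambda>n. n + 1) ` {..0}" if "x \<le> 0" for x :: int
      using that by (intro image_eqI[of _ _ "x - 1"]) auto
    then show "{..0} \<subseteq> (\<lambda>n. n + 1) ` {..(0::int)}" by auto
  qed
  show "shift C 1 ` wge \<subseteq> wge" unfolding shift_wge by (rule right_perp_shifts_antimono) auto
  show "perp C wle (shift C 1 ` wge)" unfolding shift_wge by (auto simp: perp_orth left_perp_def)
  fix M assume "M \<in> Ob C"
  then obtain L R f g h where "L \<in> wle" "R \<in> right_perp C (shifts C {..0} A)" "triangle C L M R f g h"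
    by (rule decomposition)
  then show "\<exists>L\<in>wle. \<exists>R\<in>shift C 1 ` wge. \<exists>f g h. triangle C L M R f g h" unfolding shift_wge by blast
qed

lemma t_structure: "t_structure C tle tge"
  unfolding t_structure_def
proof (intro conjI ballI)
  show "tge \<subseteq> Ob C" "tle \<subseteq> Ob C" using left_perp_Ob right_perp_subset_Ob by auto
  show "closed_iso C tge" using closed_retracts_iso left_perp_retracts right_perp_subset_Ob by blast
  show "closed_iso C tle" using closed_retracts_iso right_perp_retracts shifts_Ob[OF A_Ob] by blast
  have e: "(\<lambda>n. n + 1) ` {0..} = {(0::int)<..}"
  proof -
    have "x \<in> (\<lambda>n. n + 1) ` {0..}" if "0 < x" for x :: int
      using that by (intro image_eqI[of _ _ "x - 1"]) auto
    then show ?thesis by auto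
  qed
  have s: "shift C 1 ` tge = left_perp tle" unfolding shift_left_right_perp[OF refl] e ..
  show "shift C 1 ` tge \<subseteq> tge"
    unfolding s by (rule left_perp_antimono[OF right_perp_shifts_antimono]) auto
  show "perp C (shift C 1 ` tge) tle" unfolding s by (auto simp: perp_orth left_perp_def)
  show "tle \<subseteq> shift C 1 ` tle"
    unfolding shift_right_perp[OF A_Ob refl] by (rule right_perp_shifts_antimono) auto
  fix M assume "M \<in> Ob C"
  then obtain L R f g h where "L \<in> tge" "R \<in> right_perp C (shifts C {0..} A)" "triangle C L M R f g h"
    by (rule decomposition)
  then show "\<exists>L\<in>tge. \<exists>R\<in>shift C (- 1) ` tle. \<exists>f g h. triangle C L M R f g h" unfolding shift_tle by blast
qed

lemma right_perp_coproducts: 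
  assumes "G \<subseteq> compacts" shows "closed_coproducts \<kappa> C (right_perp C G)"
  unfolding closed_coproducts_def
proof (intro allI impI, elim conjE)
  fix I :: "'u set" and N S \<iota>
  assume I: "small \<kappa> I" and N: "\<forall>i\<in>I. N i \<in> right_perp C G" and cop: "is_coproduct C I N S \<iota>"
  have S: "S \<in> cells (right_perp C G)" by (rule cellsI[OF I _ cop]) (use N in blast)
  have "orth g S" if g: "g \<in> G" for g
    by (rule compact_orth_cells[OF _ _ S]) (use g assms in \<open>auto simp: right_perp_orth\<close>)
  then show "S \<in> right_perp C G" using coproduct_D(1)[OF cop] by (simp add: right_perp_orth)
qed

lemma right_perp_products:
  assumes G: "G \<subseteq> Ob C" shows "closed_products \<kappa> C (right_perp C G)"
  unfolding closed_products_def
proof (intro allI impI, elim conjE)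
  fix I :: "'u set" and N S \<pi>
  assume N: "\<forall>i\<in>I. N i \<in> right_perp C G" and prod: "is_product C I N S \<pi>"
  have S: "S \<in> Ob C" and \<pi>: "\<And>i. i \<in> I \<Longrightarrow> \<pi> i \<in> Hom C S (N i)" using prod by (auto simp: is_product_def)
  have "orth g S" if g: "g \<in> G" for g
  proof (rule orthI[OF _ S])
    show gO: "g \<in> Ob C" using g G by blast
    fix f assume f: "f \<in> Hom C g S"
    have N': "\<forall>i\<in>I. \<zero> g (N i) \<in> Hom C g (N i)" using N gO Zero_Hom by (auto simp: right_perp_orth)
    have "\<forall>i\<in>I. \<pi> i \<cdot> f = \<zero> g (N i)"
    proof
      fix i assume i: "i \<in> I"
      have "orth g (N i)" using N g i by (simp add: right_perp_orth)
      then show "\<pi> i \<cdot> f = \<zero> g (N i)" using orthD Comp_Hom[OF f \<pi>[OF i]] by blast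
    qed
    moreover have "\<forall>i\<in>I. \<pi> i \<cdot> \<zero> g S = \<zero> g (N i)" using \<pi> gO by (simp add: Hom_iff)
    moreover have "\<exists>!h. h \<in> Hom C g S \<and> (\<forall>i\<in>I. \<pi> i \<cdot> h = \<zero> g (N i))"
      using prod[unfolded is_product_def, THEN conjunct2, THEN conjunct2, rule_format, OF gO, of "\<lambda>i. \<zero> g (N i)"] N'
      by blast
    ultimately show "f = \<zero> g S" using f Zero_Hom[OF gO S] by blast
  qed
  then show "S \<in> right_perp C G" using S by (simp add: right_perp_orth)
qed

end

section \<open>Ideals of a category with semisimple functor category\<close>

lemma AddFun_Hom:
  "f \<in> Hom (AddFun \<kappa> B) F G \<longleftrightarrow>
    (\<exists>\<eta>. f = (F, G, \<eta>) \<and> additive_functor \<kappa> B F \<and> additive_functor \<kappa> B G \<and> nat_transf B F G \<eta>)"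
  by (auto simp: Hom_def AddFun_def)

lemma nat_transfD:
  assumes "nat_transf B F G \<eta>"
  shows "\<eta> \<in> extensional (Ob B)" "X \<in> Ob B \<Longrightarrow> \<eta> X \<in> hom (fst F X) (fst G X)"
    "X \<in> Ob B \<Longrightarrow> \<eta> X \<in> extensional (carrier (fst F X))"
    "f \<in> Arr B \<Longrightarrow> x \<in> carrier (fst F (Src B f)) \<Longrightarrow> \<eta> (Tgt B f) (snd F f x) = snd G f (\<eta> (Src B f) x)"
  using assms by (auto simp: nat_transf_def)

lemma nat_transf_eqI:
  assumes "nat_transf B F G \<eta>" "nat_transf B F G' \<theta>"
    and "\<And>X x. X \<in> Ob B \<Longrightarrow> x \<in> carrier (fst F X) \<Longrightarrow> \<eta> X x = \<theta> X x"
  shows "\<eta> = \<theta>"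
proof (rule extensionalityI)
  show "\<eta> \<in> extensional (Ob B)" "\<theta> \<in> extensional (Ob B)" using assms by (auto simp: nat_transf_def)
  fix X assume X: "X \<in> Ob B"
  show "\<eta> X = \<theta> X"
    by (rule extensionalityI[OF nat_transfD(3)[OF assms(1) X] nat_transfD(3)[OF assms(2) X]]) (rule assms(3)[OF X])
qed

lemma nat_transfI:
  assumes "\<And>X. X \<in> Ob B \<Longrightarrow> \<eta> X \<in> hom (fst F X) (fst G X)"
    and "\<And>X. X \<in> Ob B \<Longrightarrow> group (fst F X)"
    and "\<And>f. f \<in> Arr B \<Longrightarrow> Src B f \<in> Ob B \<and> Tgt B f \<in> Ob B"
    and "\<And>f x. f \<in> Arr B \<Longrightarrow> x \<in> carrier (fst F (Src B f)) \<Longrightarrow> snd F f x \<in> carrier (fst F (Tgt B f)) \<and>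
       \<eta> (Tgt B f) (snd F f x) = snd G f (\<eta> (Src B f) x)"
  shows "nat_transf B F G (\<lambda>X\<in>Ob B. \<lambda>x\<in>carrier (fst F X). \<eta> X x)"
  unfolding nat_transf_def
proof (intro conjI ballI)
  fix X assume X: "X \<in> Ob B"
  interpret group "fst F X" by (rule assms(2)[OF X])
  show "(\<lambda>X\<in>Ob B. \<lambda>x\<in>carrier (fst F X). \<eta> X x) X \<in> extensional (carrier (fst F X))" using X by simp
  show "(\<lambda>X\<in>Ob B. \<lambda>x\<in>carrier (fst F X). \<eta> X x) X \<in> hom (fst F X) (fst G X)"
    using assms(1)[OF X] X by (auto simp: hom_def)
next
  fix f x assume f: "f \<in> Arr B" and x: "x \<in> carrier (fst F (Src B f))"
  then show "(\<lambda>X\<in>Ob B. \<lambda>x\<in>carrier (fst F X). \<eta> X x) (Tgt B f) (snd F f x) =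
      snd G f ((\<lambda>X\<in>Ob B. \<lambda>x\<in>carrier (fst F X). \<eta> X x) (Src B f) x)"
    using assms(3)[OF f] assms(4)[OF f x] by simp
qed simp

locale semisimple_generators = compactly_generated \<kappa> C A
  for \<kappa> :: "'u rel" and C :: "('o, 'm, 'z) triangulated_category_scheme" (structure) and A :: "'o set" +
  assumes ss: "semisimple \<kappa> (AddFun \<kappa> (full_subcategory C A))"
begin

abbreviation "B \<equiv> full_subcategory C A"

lemma B_simps [simp]:
  "Ob B = A" "f \<in> Arr B \<longleftrightarrow> f \<in> Arr C \<and> Src C f \<in> A \<and> Tgt C f \<in> A" "Src B = Src C" "Tgt B = Tgt C"
  "Ident B = Ident C" "Comp B = Comp C" "Add B = Add C" "Zero B = Zero C"
  by (auto simp: full_subcategory_def)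

text \<open>
  Ideals are subfunctors of \<open>Hom(a, -)\<close> on the category \<open>A\<close>, written as sets of arrows with source \<open>a\<close>.
\<close>

definition left_ideal :: "'o \<Rightarrow> 'm set \<Rightarrow> bool"
  where "left_ideal a U \<longleftrightarrow> (\<forall>g\<in>U. g \<in> Arr C \<and> Src C g = a \<and> Tgt C g \<in> A) \<and> (\<forall>b\<in>A. \<zero> a b \<in> U) \<and>
    (\<forall>g\<in>U. \<forall>h\<in>U. Tgt C g = Tgt C h \<longrightarrow> g \<oplus> h \<in> U) \<and>
    (\<forall>g\<in>U. \<forall>f\<in>Arr C. Src C f = Tgt C g \<and> Tgt C f \<in> A \<longrightarrow> f \<cdot> g \<in> U)"

lemma left_idealD:
  assumes "left_ideal a U"
  shows "g \<in> U \<Longrightarrow> g \<in> Arr C \<and> Src C g = a \<and> Tgt C g \<in> A" "b \<in> A \<Longrightarrow> \<zero> a b \<in> U"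
    "\<lbrakk>g \<in> U; h \<in> U; Tgt C g = Tgt C h\<rbrakk> \<Longrightarrow> g \<oplus> h \<in> U"
    "\<lbrakk>g \<in> U; f \<in> Arr C; Src C f = Tgt C g; Tgt C f \<in> A\<rbrakk> \<Longrightarrow> f \<cdot> g \<in> U"
  using assms by (auto simp: left_ideal_def)

lemma A_ObD [simp]: "a \<in> A \<Longrightarrow> a \<in> Ob C"
  using A_Ob by blast

lemma left_ideal_neg:
  assumes U: "left_ideal a U" and g: "g \<in> U" shows "neg g \<in> U"
proof -
  note G = left_idealD(1)[OF U g]
  have "neg (Ident C (Tgt C g)) \<cdot> g \<in> U"
    by (rule left_idealD(4)[OF U g]) (use G in simp_all)
  then show ?thesis using G by simp
qed

lemma left_ideal_diff:
  "left_ideal a U \<Longrightarrow> g \<in> U \<Longrightarrow> h \<in> U \<Longrightarrow> Tgt C g = Tgt C h \<Longrightarrow> g \<ominus> h \<in> U"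
  unfolding diff_def using left_idealD(3)[OF _ _ left_ideal_neg] left_idealD(1) by simp

definition ideal_plus :: "'m set \<Rightarrow> 'm set \<Rightarrow> 'm set"
  where "ideal_plus U V = {u \<oplus> v | u v. u \<in> U \<and> v \<in> V \<and> Tgt C u = Tgt C v}"

lemma left_ideal_plus:
  assumes U: "left_ideal a U" and V: "left_ideal a V" and a: "a \<in> A"
  shows "left_ideal a (ideal_plus U V)"
  unfolding left_ideal_def
proof (intro conjI ballI impI)
  note u = left_idealD(1)[OF U] and v = left_idealD(1)[OF V]
  show "g \<in> Arr C" "Src C g = a" "Tgt C g \<in> A" if "g \<in> ideal_plus U V" for g
    using that u v by (auto simp: ideal_plus_def)
  show "\<zero> a b \<in> ideal_plus U V" if b: "b \<in> A" for b
  proof -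
    have "\<zero> a b = \<zero> a b \<oplus> \<zero> a b" using Add_Zero(1)[OF Zero_Hom] a b by simp
    then show ?thesis unfolding ideal_plus_def using left_idealD(2)[OF U b] left_idealD(2)[OF V b] by blast
  qed
  show "g \<oplus> h \<in> ideal_plus U V"
    if g: "g \<in> ideal_plus U V" and h: "h \<in> ideal_plus U V" and gh: "Tgt C g = Tgt C h" for g h
  proof -
    obtain p q where p: "p \<in> U" "q \<in> V" "Tgt C p = Tgt C q" "g = p \<oplus> q" using g by (auto simp: ideal_plus_def)
    obtain r s where r: "r \<in> U" "s \<in> V" "Tgt C r = Tgt C s" "h = r \<oplus> s" using h by (auto simp: ideal_plus_def)
    have t: "Tgt C q = Tgt C s" using gh p r u[OF p(1)] v[OF p(2)] u[OF r(1)] v[OF r(2)] by simp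
    have H: "p \<in> Hom C a (Tgt C s)" "q \<in> Hom C a (Tgt C s)" "r \<in> Hom C a (Tgt C s)" "s \<in> Hom C a (Tgt C s)"
      using u[OF p(1)] v[OF p(2)] u[OF r(1)] v[OF r(2)] t p r by (auto simp: Hom_def)
    have "(p \<oplus> q) \<oplus> (r \<oplus> s) = (p \<oplus> r) \<oplus> (q \<oplus> s)"
    proof -
      have "(p \<oplus> q) \<oplus> (r \<oplus> s) = p \<oplus> (q \<oplus> (r \<oplus> s))" using group_laws(4)[OF H(1,2) Add_Hom[OF H(3,4)]] .
      also have "q \<oplus> (r \<oplus> s) = (q \<oplus> r) \<oplus> s" using group_laws(4)[OF H(2,3,4)] by simp
      also have "q \<oplus> r = r \<oplus> q" using group_laws(1)[OF H(2,3)] .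
      also have "(r \<oplus> q) \<oplus> s = r \<oplus> (q \<oplus> s)" using group_laws(4)[OF H(3,2,4)] .
      also have "p \<oplus> (r \<oplus> (q \<oplus> s)) = (p \<oplus> r) \<oplus> (q \<oplus> s)" using group_laws(4)[OF H(1,3) Add_Hom[OF H(2,4)]] by simp
      finally show ?thesis .
    qed
    moreover have "p \<oplus> r \<in> U" "q \<oplus> s \<in> V"
      using left_idealD(3)[OF U p(1) r(1)] left_idealD(3)[OF V p(2) r(2)] t p r by auto
    moreover have "Tgt C (p \<oplus> r) = Tgt C (q \<oplus> s)" using H by (simp add: Hom_iff)
    ultimately show ?thesis unfolding ideal_plus_def p(4) r(4) by blast
  qed
  show "f \<cdot> g \<in> ideal_plus U V" if g: "g \<in> ideal_plus U V" and f: "f \<in> Arr C" "Src C f = Tgt C g \<and> Tgt C f \<in> A" for f g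
  proof -
    obtain p q where p: "p \<in> U" "q \<in> V" "Tgt C p = Tgt C q" "g = p \<oplus> q" using g by (auto simp: ideal_plus_def)
    note P = u[OF p(1)] and Q = v[OF p(2)]
    have t: "Tgt C g = Tgt C q" using p(3,4) P Q by simp
    have "f \<cdot> g = (f \<cdot> p) \<oplus> (f \<cdot> q)" using f p(3,4) P Q t by simp
    moreover have "f \<cdot> p \<in> U" "f \<cdot> q \<in> V"
      using left_idealD(4)[OF U p(1) f(1)] left_idealD(4)[OF V p(2) f(1)] f t p(3) by auto
    moreover have "Tgt C (f \<cdot> p) = Tgt C (f \<cdot> q)" using f p(3) P Q t by simp
    ultimately show ?thesis unfolding ideal_plus_def by blast
  qed
qed

lemma ideal_plus_left: 
  assumes U: "left_ideal a U" and V: "left_ideal a V" shows "U \<subseteq> ideal_plus U V"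
proof
  fix u assume u: "u \<in> U"
  note G = left_idealD(1)[OF U u]
  have "u = u \<oplus> \<zero> a (Tgt C u)" using Add_Zero(2)[of u a "Tgt C u"] G by (simp add: Hom_def)
  moreover have "a \<in> Ob C" using G Src_Ob by blast
  ultimately show "u \<in> ideal_plus U V"
    unfolding ideal_plus_def using u left_idealD(2)[OF V, of "Tgt C u"] G by force
qed

lemma ideal_plus_right: 
  assumes U: "left_ideal a U" and V: "left_ideal a V" shows "V \<subseteq> ideal_plus U V"
proof
  fix v assume v: "v \<in> V"
  note G = left_idealD(1)[OF V v]
  have "v = \<zero> a (Tgt C v) \<oplus> v" using Add_Zero(1)[of v a "Tgt C v"] G by (simp add: Hom_def)
  moreover have "a \<in> Ob C" using G Src_Ob by blast
  ultimately show "v \<in> ideal_plus U V"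
    unfolding ideal_plus_def using v left_idealD(2)[OF U, of "Tgt C v"] G by force
qed

definition disjoint_ideals :: "'o \<Rightarrow> 'm set \<Rightarrow> 'm set \<Rightarrow> bool"
  where "disjoint_ideals a U V \<longleftrightarrow> (\<forall>g\<in>U \<inter> V. g = \<zero> a (Tgt C g))"

text \<open>A complement for \<open>U\<close> is a maximal partial sum of simple ideals that is disjoint from \<open>U\<close>.\<close>

lemma ideal_complement:
  assumes a: "a \<in> A" and U: "left_ideal a U" and F: "finite F"
    and S: "\<And>i. i \<in> F \<Longrightarrow> left_ideal a (S i)"
    and simple: "\<And>i V. i \<in> F \<Longrightarrow> left_ideal a V \<Longrightarrow> disjoint_ideals a V (S i) \<or> S i \<subseteq> V"
  shows "\<exists>T. left_ideal a T \<and> disjoint_ideals a U T \<and> (\<forall>i\<in>F. S i \<subseteq> ideal_plus U T)"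
  using F S simple
proof (induction F)
  case empty
  have "left_ideal a {\<zero> a b | b. b \<in> A}"
    unfolding left_ideal_def
  proof (intro conjI ballI impI)
    fix g h assume "g \<in> {\<zero> a b | b. b \<in> A}" "h \<in> {\<zero> a b | b. b \<in> A}" "Tgt C g = Tgt C h"
    then obtain b where "b \<in> A" "g = \<zero> a b" "h = \<zero> a b" using a by auto
    then show "g \<oplus> h \<in> {\<zero> a b | b. b \<in> A}" using Add_Zero(1)[OF Zero_Hom[of a b]] a by auto
  qed (use a in auto)
  moreover have "disjoint_ideals a U {\<zero> a b | b. b \<in> A}" using a by (auto simp: disjoint_ideals_def)
  ultimately show ?case by blast
next
  case (insert i F)
  obtain T where T: "left_ideal a T" "disjoint_ideals a U T" "\<forall>i\<in>F. S i \<subseteq> ideal_plus U T" using insert by blast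
  note UT = left_ideal_plus[OF U T(1) a]
  have Si: "left_ideal a (S i)" using insert(4) by blast
  show ?case
  proof (cases "S i \<subseteq> ideal_plus U T")
    case True
    then show ?thesis using T by blast
  next
    case False
    then have d: "disjoint_ideals a (ideal_plus U T) (S i)" using insert(5)[OF _ UT] by blast
    let ?T = "ideal_plus T (S i)"
    have L: "left_ideal a ?T" using left_ideal_plus[OF T(1) Si a] .
    have "disjoint_ideals a U ?T"
      unfolding disjoint_ideals_def
    proof
      fix g assume g: "g \<in> U \<inter> ?T"
      then obtain t s where ts: "t \<in> T" "s \<in> S i" "Tgt C t = Tgt C s" "g = t \<oplus> s" by (auto simp: ideal_plus_def)
      let ?b = "Tgt C s"
      note tD = left_idealD(1)[OF T(1) ts(1)] and sD = left_idealD(1)[OF Si ts(2)]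
      have H: "t \<in> Hom C a ?b" "s \<in> Hom C a ?b" using tD sD ts(3) by (auto simp: Hom_def)
      have gH: "g \<in> Hom C a ?b" using Add_Hom[OF H] ts(4) by simp
      have "s = g \<oplus> neg t"
        using add_diff[OF H(2,1)] group_laws(1)[OF H] ts(4) by (simp add: diff_def)
      moreover have "g \<oplus> neg t \<in> ideal_plus U T"
      proof -
        have "Tgt C g = Tgt C (neg t)" using gH neg_Hom[OF H(1)] by (simp add: Hom_iff)
        then show ?thesis unfolding ideal_plus_def using g left_ideal_neg[OF T(1) ts(1)] by blast
      qed
      ultimately have "s = \<zero> a ?b" using d ts(2) unfolding disjoint_ideals_def by blast
      then have "g = t" using ts(4) Add_Zero(2)[OF H(1)] by simp
      then show "g = \<zero> a (Tgt C g)" using T(2) g ts(1) unfolding disjoint_ideals_def by blast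
    qed
    moreover have "S k \<subseteq> ideal_plus U ?T" if k: "k \<in> insert i F" for k
    proof (cases "k = i")
      case True
      then show ?thesis using ideal_plus_right[OF T(1) Si] ideal_plus_right[OF U L] by blast
    next
      case False
      then have "S k \<subseteq> ideal_plus U T" using T(3) k by blast
      moreover have "ideal_plus U T \<subseteq> ideal_plus U ?T"
        using ideal_plus_left[OF T(1) Si] unfolding ideal_plus_def[of U] by blast
      ultimately show ?thesis by blast
    qed
    ultimately show ?thesis using L by blast
  qed
qed

text \<open>
  The functor category consists of functors to groups of elements of \<open>'u\<close>. The arrows in an ideal are therefore
  coded by elements of \<open>'u\<close>, which is possible since the category is locally small.
\<close>

definition code :: "'o \<Rightarrow> 'o \<Rightarrow> 'm \<Rightarrow> 'u"
  where "code a b = (SOME c. inj_on c (Hom C a b))"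

definition decode :: "'o \<Rightarrow> 'o \<Rightarrow> 'u \<Rightarrow> 'm"
  where "decode a b = inv_into (Hom C a b) (code a b)"

lemma decode_code:
  assumes "a \<in> A" "b \<in> A" "g \<in> Hom C a b"
  shows "decode a b (code a b g) = g"
proof -
  have "small \<kappa> (Hom C a b)" using ls assms by (simp add: locally_small_def)
  then obtain c :: "'m \<Rightarrow> 'u" where "inj_on c (Hom C a b)" by (rule small_encode)
  then have "inj_on (code a b) (Hom C a b)" unfolding code_def
    by (rule someI[of "\<lambda>c :: 'm \<Rightarrow> 'u. inj_on c (Hom C a b)"])
  then show ?thesis unfolding decode_def using assms(3) by simp
qed

definition ideal_functor :: "'o \<Rightarrow> 'm set \<Rightarrow> ('o, 'm, 'u) ab_functor"
  where "ideal_functor a U =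
    (\<lambda>b. \<lparr>carrier = code a b ` (U \<inter> Hom C a b),
          mult = (\<lambda>x y. code a b (decode a b x \<oplus> decode a b y)), one = code a b (\<zero> a b)\<rparr>,
     \<lambda>f x. code a (Tgt C f) (f \<cdot> decode a (Src C f) x))"

lemma carrier_ideal_functor: "carrier (fst (ideal_functor a U) b) = code a b ` (U \<inter> Hom C a b)"
  by (simp add: ideal_functor_def)

lemma additive_functor_ideal:
  assumes a: "a \<in> A" and U: "left_ideal a U"
  shows "additive_functor \<kappa> B (ideal_functor a U)"
proof -
  let ?F = "ideal_functor a U"
  have grp: "comm_group (fst ?F b)" if b: "b \<in> A" for b
  proof (rule comm_groupI)
    note dc = decode_code[OF a b]
    have Z: "\<zero> a b \<in> Hom C a b" using Zero_Hom a b by simp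
    have add: "g \<oplus> h \<in> U \<inter> Hom C a b" if "g \<in> U \<inter> Hom C a b" "h \<in> U \<inter> Hom C a b" for g h
      using left_idealD(3)[OF U, of g h] that Add_Hom by (auto simp: Hom_def)
    fix x assume "x \<in> carrier (fst ?F b)"
    then obtain g where g: "g \<in> U \<inter> Hom C a b" "x = code a b g" by (auto simp: ideal_functor_def)
    show "\<one>\<^bsub>fst ?F b\<^esub> \<otimes>\<^bsub>fst ?F b\<^esub> x = x"
      using g Z Add_Zero(1)[of g a b] by (simp add: ideal_functor_def dc)
    show "\<exists>y\<in>carrier (fst ?F b). y \<otimes>\<^bsub>fst ?F b\<^esub> x = \<one>\<^bsub>fst ?F b\<^esub>"
    proof (rule bexI[of _ "code a b (neg g)"])
      have n: "neg g \<in> U \<inter> Hom C a b" using left_ideal_neg[OF U] neg_Hom g(1) by auto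
      then show "code a b (neg g) \<in> carrier (fst ?F b)" by (simp add: ideal_functor_def)
      have "neg g \<oplus> g = \<zero> a b" using group_laws(1)[of "neg g" a b g] group_laws(3)[of g a b g] n g(1) by simp
      then show "code a b (neg g) \<otimes>\<^bsub>fst ?F b\<^esub> x = \<one>\<^bsub>fst ?F b\<^esub>" using n g by (simp add: ideal_functor_def dc)
    qed
    fix y assume "y \<in> carrier (fst ?F b)"
    then obtain h where h: "h \<in> U \<inter> Hom C a b" "y = code a b h" by (auto simp: ideal_functor_def)
    show "x \<otimes>\<^bsub>fst ?F b\<^esub> y \<in> carrier (fst ?F b)" using g h add by (simp add: ideal_functor_def dc)
    show "x \<otimes>\<^bsub>fst ?F b\<^esub> y = y \<otimes>\<^bsub>fst ?F b\<^esub> x" using g h group_laws(1)[of g a b h] by (simp add: ideal_functor_def dc)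
    fix z assume "z \<in> carrier (fst ?F b)"
    then obtain k where k: "k \<in> U \<inter> Hom C a b" "z = code a b k" by (auto simp: ideal_functor_def)
    show "x \<otimes>\<^bsub>fst ?F b\<^esub> y \<otimes>\<^bsub>fst ?F b\<^esub> z = x \<otimes>\<^bsub>fst ?F b\<^esub> (y \<otimes>\<^bsub>fst ?F b\<^esub> z)"
      using g h k group_laws(4)[of g a b h k] add Add_Hom[of _ a b] by (simp add: ideal_functor_def dc)
  next
    show "\<one>\<^bsub>fst ?F b\<^esub> \<in> carrier (fst ?F b)"
      using left_idealD(2)[OF U b] Zero_Hom a b by (simp add: ideal_functor_def)
  qed
  have act: "snd ?F f (code a (Src C f) g) = code a (Tgt C f) (f \<cdot> g)" "f \<cdot> g \<in> U \<inter> Hom C a (Tgt C f)"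
    if "f \<in> Arr C" "Src C f \<in> A" "Tgt C f \<in> A" "g \<in> U \<inter> Hom C a (Src C f)" for f g
    using that decode_code[OF a that(2)] left_idealD(4)[OF U, of g f] by (auto simp: ideal_functor_def Hom_iff)
  show ?thesis
    unfolding additive_functor_def
  proof (intro conjI ballI impI; (elim conjE)?)
    fix X assume "X \<in> Ob B"
    then have X: "X \<in> A" by simp
    show "comm_group (fst ?F X)" using grp[OF X] .
    have "small \<kappa> (Hom C a X)" using ls a X by (simp add: locally_small_def)
    from small_image[OF small_subset[OF this Int_lower2[of U]]]
    show "small \<kappa> (carrier (fst ?F X))" unfolding carrier_ideal_functor .
    fix x assume "x \<in> carrier (fst ?F X)"
    then obtain g where g: "g \<in> U \<inter> Hom C a X" "x = code a X g" by (auto simp: carrier_ideal_functor)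
    show "snd ?F (Ident B X) x = x" using act(1)[of "Ident C X" g] g X by (simp add: Hom_iff)
  next
    fix f assume "f \<in> Arr B"
    then have f: "f \<in> Arr C" "Src C f \<in> A" "Tgt C f \<in> A" by auto
    have "snd ?F f \<in> hom (fst ?F (Src C f)) (fst ?F (Tgt C f))"
    proof (rule homI)
      fix x assume "x \<in> carrier (fst ?F (Src C f))"
      then obtain g where g: "g \<in> U \<inter> Hom C a (Src C f)" "x = code a (Src C f) g" by (auto simp: carrier_ideal_functor)
      show "snd ?F f x \<in> carrier (fst ?F (Tgt C f))" using act[OF f g(1)] g(2) by (simp add: carrier_ideal_functor)
      fix y assume "y \<in> carrier (fst ?F (Src C f))"
      then obtain h where h: "h \<in> U \<inter> Hom C a (Src C f)" "y = code a (Src C f) h" by (auto simp: carrier_ideal_functor)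
      have gh: "g \<oplus> h \<in> U \<inter> Hom C a (Src C f)"
        using left_idealD(3)[OF U, of g h] g h Add_Hom by (auto simp: Hom_def)
      have "x \<otimes>\<^bsub>fst ?F (Src C f)\<^esub> y = code a (Src C f) (g \<oplus> h)"
        using g h decode_code[OF a f(2)] by (simp add: ideal_functor_def)
      then have "snd ?F f (x \<otimes>\<^bsub>fst ?F (Src C f)\<^esub> y) = code a (Tgt C f) (f \<cdot> (g \<oplus> h))" using act(1)[OF f gh] by simp
      also have "f \<cdot> (g \<oplus> h) = (f \<cdot> g) \<oplus> (f \<cdot> h)" using g h f by (simp add: Hom_iff)
      also have "code a (Tgt C f) ((f \<cdot> g) \<oplus> (f \<cdot> h)) = snd ?F f x \<otimes>\<^bsub>fst ?F (Tgt C f)\<^esub> snd ?F f y"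
        using act[OF f g(1)] act[OF f h(1)] g(2) h(2) decode_code[OF a f(3)]
        by (simp add: ideal_functor_def)
      finally show "snd ?F f (x \<otimes>\<^bsub>fst ?F (Src C f)\<^esub> y) = snd ?F f x \<otimes>\<^bsub>fst ?F (Tgt C f)\<^esub> snd ?F f y" .
    qed
    then show "snd ?F f \<in> hom (fst ?F (Src B f)) (fst ?F (Tgt B f))" by simp
    fix g x assume "g \<in> Arr B" and "x \<in> carrier (fst ?F (Src B f))"
    then have g: "g \<in> Arr C" "Src C g \<in> A" "Tgt C g \<in> A" and x: "x \<in> carrier (fst ?F (Src C f))" by auto
    then obtain k where k: "k \<in> U \<inter> Hom C a (Src C f)" "x = code a (Src C f) k" by (auto simp: carrier_ideal_functor)
    show "snd ?F (g \<cdot>\<^bsub>B\<^esub> f) x = snd ?F g (snd ?F f x)" if "Tgt B f = Src B g"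
    proof -
      have fg: "Tgt C f = Src C g" using that by simp
      have fk: "f \<cdot> k \<in> U \<inter> Hom C a (Src C g)" using act(2)[OF f k(1)] fg by simp
      have "snd ?F g (snd ?F f x) = code a (Tgt C g) (g \<cdot> (f \<cdot> k))"
        using act(1)[OF f k(1)] act(1)[OF g fk] k(2) fg by simp
      moreover have "snd ?F (g \<cdot> f) x = code a (Tgt C g) ((g \<cdot> f) \<cdot> k)"
        using act(1)[of "g \<cdot> f" k] f g fg k by simp
      moreover have "(g \<cdot> f) \<cdot> k = g \<cdot> (f \<cdot> k)" using f g fg k by (simp add: Hom_iff)
      ultimately show ?thesis by simp
    qed
    show "snd ?F (Add B f g) x = snd ?F f x \<otimes>\<^bsub>fst ?F (Tgt B f)\<^esub> snd ?F g x"
      if "Src B f = Src B g" "Tgt B f = Tgt B g"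
    proof -
      have fg: "Src C f = Src C g" "Tgt C f = Tgt C g" using that by simp_all
      have k': "k \<in> U \<inter> Hom C a (Src C g)" using k fg by simp
      have "snd ?F (f \<oplus> g) x = code a (Tgt C f) ((f \<oplus> g) \<cdot> k)" using act(1)[of "f \<oplus> g" k] f g fg k by simp
      also have "(f \<oplus> g) \<cdot> k = (f \<cdot> k) \<oplus> (g \<cdot> k)" using f g fg k by (simp add: Hom_iff)
      also have "code a (Tgt C f) ((f \<cdot> k) \<oplus> (g \<cdot> k)) = snd ?F f x \<otimes>\<^bsub>fst ?F (Tgt C f)\<^esub> snd ?F g x"
        using act[OF f k(1)] act[OF g k'] k(2) fg decode_code[OF a f(3)] by (simp add: ideal_functor_def)
      finally show ?thesis by simp
    qed
  qed
qed

lemma additive_functorD: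
  assumes "additive_functor \<kappa> B F"
  shows "b \<in> A \<Longrightarrow> comm_group (fst F b)" "b \<in> A \<Longrightarrow> small \<kappa> (carrier (fst F b))"
    "f \<in> Arr B \<Longrightarrow> snd F f \<in> hom (fst F (Src C f)) (fst F (Tgt C f))"
    "b \<in> A \<Longrightarrow> x \<in> carrier (fst F b) \<Longrightarrow> snd F (Ident C b) x = x"
    "\<lbrakk>f \<in> Arr B; g \<in> Arr B; Tgt C f = Src C g; x \<in> carrier (fst F (Src C f))\<rbrakk>
      \<Longrightarrow> snd F (g \<cdot> f) x = snd F g (snd F f x)"
    "\<lbrakk>f \<in> Arr B; g \<in> Arr B; Src C f = Src C g; Tgt C f = Tgt C g; x \<in> carrier (fst F (Src C f))\<rbrakk>
      \<Longrightarrow> snd F (f \<oplus> g) x = snd F f x \<otimes>\<^bsub>fst F (Tgt C f)\<^esub> snd F g x"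
proof -
  note F = assms[unfolded additive_functor_def]
  show "b \<in> A \<Longrightarrow> comm_group (fst F b)" "b \<in> A \<Longrightarrow> small \<kappa> (carrier (fst F b))"
    using F[THEN conjunct1] by simp_all
  show "f \<in> Arr B \<Longrightarrow> snd F f \<in> hom (fst F (Src C f)) (fst F (Tgt C f))"
    using F[THEN conjunct2, THEN conjunct1, rule_format, of f] by simp
  show "b \<in> A \<Longrightarrow> x \<in> carrier (fst F b) \<Longrightarrow> snd F (Ident C b) x = x"
    using F[THEN conjunct2, THEN conjunct2, THEN conjunct1] by simp
  show "\<lbrakk>f \<in> Arr B; g \<in> Arr B; Tgt C f = Src C g; x \<in> carrier (fst F (Src C f))\<rbrakk>
      \<Longrightarrow> snd F (g \<cdot> f) x = snd F g (snd F f x)"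
    using F[THEN conjunct2, THEN conjunct2, THEN conjunct2, THEN conjunct1, rule_format, of f g x] by simp
  show "\<lbrakk>f \<in> Arr B; g \<in> Arr B; Src C f = Src C g; Tgt C f = Tgt C g; x \<in> carrier (fst F (Src C f))\<rbrakk>
      \<Longrightarrow> snd F (f \<oplus> g) x = snd F f x \<otimes>\<^bsub>fst F (Tgt C f)\<^esub> snd F g x"
    using F[THEN conjunct2, THEN conjunct2, THEN conjunct2, THEN conjunct2, rule_format, of f g x] by simp
qed

lemma additive_functor_group: "additive_functor \<kappa> B F \<Longrightarrow> b \<in> A \<Longrightarrow> group (fst F b)"
  using additive_functorD(1) by (simp add: comm_group_def)

lemma nat_transf_subfunctor:
  assumes F: "additive_functor \<kappa> B F"
    and sub: "\<And>b. b \<in> A \<Longrightarrow> carrier (fst F b) \<subseteq> carrier (fst G b) \<and> mult (fst F b) = mult (fst G b)"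
    and act: "snd F = snd G"
  shows "nat_transf B F G (\<lambda>b\<in>Ob B. \<lambda>x\<in>carrier (fst F b). x)"
proof (rule nat_transfI[where \<eta> = "\<lambda>b x. x"])
  show "group (fst F b)" if "b \<in> Ob B" for b using additive_functor_group[OF F] that by simp
  show "(\<lambda>x. x) \<in> hom (fst F b) (fst G b)" if "b \<in> Ob B" for b
    using sub[of b] that by (auto simp: hom_def)
  fix f x assume f: "f \<in> Arr B" and "x \<in> carrier (fst F (Src B f))"
  then show "snd F f x \<in> carrier (fst F (Tgt B f)) \<and> snd F f x = snd G f x"
    using additive_functorD(3)[OF F f] act by (auto simp: hom_def)
qed auto

lemma AddFun_zero_object:
  assumes Z: "zero_object (AddFun \<kappa> B) K" and b: "b \<in> A" and x: "x \<in> carrier (fst K b)"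
  shows "x = \<one>\<^bsub>fst K b\<^esub>"
proof -
  have K: "additive_functor \<kappa> B K" using Z by (simp add: zero_object_def AddFun_def)
  have "\<exists>!f. f \<in> Hom (AddFun \<kappa> B) K K" using Z by (auto simp: zero_object_def)
  then have u: "\<eta> = \<theta>" if "nat_transf B K K \<eta>" "nat_transf B K K \<theta>" for \<eta> \<theta>
    using that K unfolding AddFun_Hom by blast
  have 1: "nat_transf B K K (\<lambda>b\<in>Ob B. \<lambda>x\<in>carrier (fst K b). x)" by (rule nat_transf_subfunctor[OF K]) auto
  have 2: "nat_transf B K K (\<lambda>b\<in>Ob B. \<lambda>x\<in>carrier (fst K b). \<one>\<^bsub>fst K b\<^esub>)"
  proof (rule nat_transfI[where \<eta> = "\<lambda>b x. \<one>\<^bsub>fst K b\<^esub>"])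
    show "group (fst K b)" if "b \<in> Ob B" for b using additive_functor_group[OF K] that by simp
    then show "(\<lambda>x. \<one>\<^bsub>fst K b\<^esub>) \<in> hom (fst K b) (fst K b)" if "b \<in> Ob B" for b
      using that by (auto simp: hom_def group.is_monoid monoid.one_closed)
    fix f x assume f: "f \<in> Arr B" and "x \<in> carrier (fst K (Src B f))"
    then show "snd K f x \<in> carrier (fst K (Tgt B f)) \<and> \<one>\<^bsub>fst K (Tgt B f)\<^esub> = snd K f \<one>\<^bsub>fst K (Src B f)\<^esub>"
      using additive_functorD(3)[OF K f] hom_one[OF additive_functorD(3)[OF K f]] additive_functor_group[OF K]
      by (auto simp: hom_def)
  qed auto
  have "(\<lambda>b\<in>Ob B. \<lambda>x\<in>carrier (fst K b). x) b x = (\<lambda>b\<in>Ob B. \<lambda>x\<in>carrier (fst K b). \<one>\<^bsub>fst K b\<^esub>) b x"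
    using u[OF 1 2] by simp
  then show ?thesis using b x by simp
qed

text \<open>
  The subgroups form a functor whose inclusion is a monomorphism, so simplicity makes it a zero object or the
  inclusion an isomorphism.
\<close>

lemma simple_subfunctor:
  assumes N: "simple_object (AddFun \<kappa> B) N"
    and K: "\<And>b. b \<in> A \<Longrightarrow> subgroup (K b) (fst N b)"
    and act: "\<And>f x. f \<in> Arr B \<Longrightarrow> x \<in> K (Src C f) \<Longrightarrow> snd N f x \<in> K (Tgt C f)"
  shows "(\<forall>b\<in>A. K b = {\<one>\<^bsub>fst N b\<^esub>}) \<or> (\<forall>b\<in>A. K b = carrier (fst N b))"
proof -
  have NF: "additive_functor \<kappa> B N" using N by (simp add: simple_object_def AddFun_def)
  define F :: "('o, 'm, 'u) ab_functor" where "F = (\<lambda>b. (fst N b)\<lparr>carrier := K b\<rparr>, snd N)"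
  have KN: "K b \<subseteq> carrier (fst N b)" if "b \<in> A" for b using K[OF that] subgroup.subset by blast
  have F: "additive_functor \<kappa> B F"
    unfolding additive_functor_def
  proof (intro conjI ballI impI; (elim conjE)?)
    fix b assume "b \<in> Ob B"
    then have b: "b \<in> A" by simp
    interpret comm_group "fst N b" by (rule additive_functorD(1)[OF NF b])
    have "group ((fst N b)\<lparr>carrier := K b\<rparr>)" using subgroup.subgroup_is_group[OF K[OF b] group_axioms] .
    then have "comm_group ((fst N b)\<lparr>carrier := K b\<rparr>)"
      by (rule group.group_comm_groupI) (use KN[OF b] m_comm in auto)
    then show "comm_group (fst F b)" unfolding F_def by simp
    show "small \<kappa> (carrier (fst F b))"
      unfolding F_def using small_subset[OF additive_functorD(2)[OF NF b] KN[OF b]] by simp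
    fix x assume "x \<in> carrier (fst F b)"
    then show "snd F (Ident B b) x = x" using additive_functorD(4)[OF NF b] KN[OF b] by (auto simp: F_def)
  next
    fix f assume fB: "f \<in> Arr B"
    then have f: "f \<in> Arr C" "Src C f \<in> A" "Tgt C f \<in> A" by auto
    show "snd F f \<in> hom (fst F (Src B f)) (fst F (Tgt B f))"
      using additive_functorD(3)[OF NF fB] act[OF fB] KN[OF f(2)] unfolding F_def
      by (auto simp: hom_def subset_eq)
    fix g x assume gB: "g \<in> Arr B" and "x \<in> carrier (fst F (Src B f))"
    then have x: "x \<in> carrier (fst N (Src C f))" using KN[OF f(2)] by (auto simp: F_def)
    show "snd F (g \<cdot>\<^bsub>B\<^esub> f) x = snd F g (snd F f x)" if "Tgt B f = Src B g"
      using additive_functorD(5)[OF NF fB gB _ x] that by (simp add: F_def)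
    show "snd F (Add B f g) x = snd F f x \<otimes>\<^bsub>fst F (Tgt B f)\<^esub> snd F g x" if "Src B f = Src B g" "Tgt B f = Tgt B g"
      using additive_functorD(6)[OF NF fB gB _ _ x] that by (simp add: F_def)
  qed
  define k where "k = (\<lambda>b\<in>Ob B. \<lambda>x\<in>carrier (fst F b). x)"
  have k: "nat_transf B F N k" unfolding k_def
    by (rule nat_transf_subfunctor[OF F]) (use KN in \<open>auto simp: F_def\<close>)
  have kx: "k b x = x" if "b \<in> A" "x \<in> K b" for b x using that by (simp add: k_def F_def)
  have kH: "(F, N, k) \<in> Hom (AddFun \<kappa> B) F N" unfolding AddFun_Hom using F NF k by blast
  have "is_mono (AddFun \<kappa> B) F N (F, N, k)"
    unfolding is_mono_def
  proof (intro conjI ballI impI, rule kH)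
    fix T g h assume "g \<in> Hom (AddFun \<kappa> B) T F" "h \<in> Hom (AddFun \<kappa> B) T F"
      and eq: "(F, N, k) \<cdot>\<^bsub>AddFun \<kappa> B\<^esub> g = (F, N, k) \<cdot>\<^bsub>AddFun \<kappa> B\<^esub> h"
    then obtain \<eta> \<theta> where g: "g = (T, F, \<eta>)" "nat_transf B T F \<eta>" and h: "h = (T, F, \<theta>)" "nat_transf B T F \<theta>"
      unfolding AddFun_Hom by blast
    have "\<eta> = \<theta>"
    proof (rule nat_transf_eqI[OF g(2) h(2)])
      fix b x assume b: "b \<in> Ob B" and x: "x \<in> carrier (fst T b)"
      have "(\<lambda>X\<in>Ob B. \<lambda>x\<in>carrier (fst T X). k X (\<eta> X x)) b x = (\<lambda>X\<in>Ob B. \<lambda>x\<in>carrier (fst T X). k X (\<theta> X x)) b x"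
        using eq unfolding g h by (simp add: AddFun_def)
      then have "k b (\<eta> b x) = k b (\<theta> b x)" using b x by simp
      moreover have "\<eta> b x \<in> K b" "\<theta> b x \<in> K b"
        using nat_transfD(2)[OF g(2) b] nat_transfD(2)[OF h(2) b] x by (auto simp: hom_def F_def)
      ultimately show "\<eta> b x = \<theta> b x" using kx b by simp
    qed
    then show "g = h" using g h by simp
  qed
  moreover have "F \<in> Ob (AddFun \<kappa> B)" using F by (simp add: AddFun_def)
  ultimately have "zero_object (AddFun \<kappa> B) F \<or> is_iso (AddFun \<kappa> B) F N (F, N, k)"
    using N unfolding simple_object_def by blast
  then show ?thesis
  proof
    assume Z: "zero_object (AddFun \<kappa> B) F"
    have "K b = {\<one>\<^bsub>fst N b\<^esub>}" if b: "b \<in> A" for b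
    proof -
      have "x = \<one>\<^bsub>fst N b\<^esub>" if "x \<in> K b" for x
        using AddFun_zero_object[OF Z b, of x] that by (simp add: F_def)
      then show ?thesis using subgroup.one_closed[OF K[OF b]] by blast
    qed
    then show ?thesis by blast
  next
    assume "is_iso (AddFun \<kappa> B) F N (F, N, k)"
    then obtain g where g: "g \<in> Hom (AddFun \<kappa> B) N F" "(F, N, k) \<cdot>\<^bsub>AddFun \<kappa> B\<^esub> g = Ident (AddFun \<kappa> B) N"
      unfolding is_iso_def by blast
    then obtain \<eta> where \<eta>: "g = (N, F, \<eta>)" "nat_transf B N F \<eta>" unfolding AddFun_Hom by blast
    have "carrier (fst N b) \<subseteq> K b" if b: "b \<in> A" for b
    proof
      fix x assume x: "x \<in> carrier (fst N b)"
      have "(\<lambda>X\<in>Ob B. \<lambda>x\<in>carrier (fst N X). k X (\<eta> X x)) b x = (\<lambda>X\<in>Ob B. \<lambda>x\<in>carrier (fst N X). x) b x"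
        using g(2) unfolding \<eta> by (simp add: AddFun_def)
      moreover have \<eta>x: "\<eta> b x \<in> K b" using nat_transfD(2)[OF \<eta>(2)] b x by (auto simp: hom_def F_def)
      ultimately show "x \<in> K b" using b x kx[OF b \<eta>x] by simp
    qed
    then show ?thesis using KN by blast
  qed
qed

text \<open>
  The image of a simple functor is a simple ideal: the preimage of an ideal \<open>V\<close> is a subfunctor of \<open>N\<close>.
\<close>

lemma simple_image_ideal:
  assumes a: "a \<in> A" and H: "left_ideal a H" and N: "simple_object (AddFun \<kappa> B) N"
    and \<eta>: "nat_transf B N (ideal_functor a H) \<eta>"
  defines "S \<equiv> \<Union>b\<in>A. (\<lambda>x. decode a b (\<eta> b x)) ` carrier (fst N b)"
  shows "left_ideal a S" "left_ideal a V \<Longrightarrow> disjoint_ideals a V S \<or> S \<subseteq> V"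
proof -
  have NF: "additive_functor \<kappa> B N" using N by (simp add: simple_object_def AddFun_def)
  define d where "d b x = decode a b (\<eta> b x)" for b x
  have S: "S = (\<Union>b\<in>A. d b ` carrier (fst N b))" unfolding S_def d_def by simp
  have \<eta>c: "\<eta> b x \<in> code a b ` (H \<inter> Hom C a b)" if "b \<in> A" "x \<in> carrier (fst N b)" for b x
    using nat_transfD(2)[OF \<eta>, of b] that by (auto simp: hom_def carrier_ideal_functor)
  have d: "d b x \<in> H \<inter> Hom C a b" "\<eta> b x = code a b (d b x)" if "b \<in> A" "x \<in> carrier (fst N b)" for b x
    using \<eta>c[OF that] decode_code[OF a that(1)] unfolding d_def by auto
  have dadd: "d b (x \<otimes>\<^bsub>fst N b\<^esub> y) = d b x \<oplus> d b y"
    if b: "b \<in> A" and x: "x \<in> carrier (fst N b)" and y: "y \<in> carrier (fst N b)" for b x y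
  proof -
    have "\<eta> b (x \<otimes>\<^bsub>fst N b\<^esub> y) = \<eta> b x \<otimes>\<^bsub>fst (ideal_functor a H) b\<^esub> \<eta> b y"
      using nat_transfD(2)[OF \<eta>, of b] b x y by (auto simp: hom_def)
    also have "\<dots> = code a b (d b x \<oplus> d b y)" by (simp add: ideal_functor_def d_def)
    finally have "d b (x \<otimes>\<^bsub>fst N b\<^esub> y) = decode a b (code a b (d b x \<oplus> d b y))" by (simp add: d_def)
    moreover have "d b x \<oplus> d b y \<in> Hom C a b" using d(1)[OF b x] d(1)[OF b y] Add_Hom by simp
    ultimately show ?thesis using decode_code[OF a b] by simp
  qed
  have d_one: "d b \<one>\<^bsub>fst N b\<^esub> = \<zero> a b" if b: "b \<in> A" for b
  proof -
    interpret G: group "fst N b" by (rule additive_functor_group[OF NF b])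
    have "d b \<one>\<^bsub>fst N b\<^esub> \<oplus> d b \<one>\<^bsub>fst N b\<^esub> = d b \<one>\<^bsub>fst N b\<^esub>" using dadd[OF b G.one_closed G.one_closed] by simp
    then show ?thesis using idem_Zero d(1)[OF b G.one_closed] by blast
  qed
  have dact: "d (Tgt C f) (snd N f x) = f \<cdot> d (Src C f) x" "snd N f x \<in> carrier (fst N (Tgt C f))"
    if f: "f \<in> Arr B" and x: "x \<in> carrier (fst N (Src C f))" for f x
  proof -
    have fA: "f \<in> Arr C" "Src C f \<in> A" "Tgt C f \<in> A" using f by auto
    show "snd N f x \<in> carrier (fst N (Tgt C f))" using additive_functorD(3)[OF NF f] x by (auto simp: hom_def)
    have "\<eta> (Tgt C f) (snd N f x) = code a (Tgt C f) (f \<cdot> d (Src C f) x)"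
      using nat_transfD(4)[OF \<eta> f] x by (simp add: ideal_functor_def d_def)
    moreover have "f \<cdot> d (Src C f) x \<in> Hom C a (Tgt C f)" using d(1)[OF fA(2) x] fA by (simp add: Hom_iff)
    ultimately show "d (Tgt C f) (snd N f x) = f \<cdot> d (Src C f) x"
      using decode_code[OF a fA(3)] by (simp add: d_def)
  qed
  show LS: "left_ideal a S"
    unfolding left_ideal_def
  proof (intro conjI ballI impI)
    fix g assume "g \<in> S"
    then obtain b x where b: "b \<in> A" "x \<in> carrier (fst N b)" "g = d b x" unfolding S by blast
    have g: "g \<in> Hom C a b" using d(1)[OF b(1,2)] b(3) by simp
    then show "g \<in> Arr C" "Src C g = a" "Tgt C g \<in> A" using b by (auto simp: Hom_iff)
    show "f \<cdot> g \<in> S" if f: "f \<in> Arr C" "Src C f = Tgt C g \<and> Tgt C f \<in> A" for f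
    proof -
      have fB: "f \<in> Arr B" "Src C f = b" using f g b by (auto simp: Hom_iff)
      have x: "x \<in> carrier (fst N (Src C f))" using b fB by simp
      have "f \<cdot> g = d (Tgt C f) (snd N f x)" using dact(1)[OF fB(1) x] fB(2) b(3) by simp
      then show ?thesis unfolding S using dact(2)[OF fB(1) x] f by blast
    qed
    show "g \<oplus> h \<in> S" if h: "h \<in> S" "Tgt C g = Tgt C h" for h
    proof -
      obtain c y where c: "c \<in> A" "y \<in> carrier (fst N c)" "h = d c y" using h(1) unfolding S by blast
      have "h \<in> Hom C a c" using d(1)[OF c(1,2)] c(3) by simp
      then have [simp]: "c = b" using g h(2) by (simp add: Hom_iff)
      interpret G: group "fst N b" by (rule additive_functor_group[OF NF b(1)])
      have y: "y \<in> carrier (fst N b)" using c by simp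
      have "g \<oplus> h = d b (x \<otimes>\<^bsub>fst N b\<^esub> y)" using dadd[OF b(1,2) y] b(3) c(3) by simp
      then show ?thesis unfolding S using G.m_closed[OF b(2) y] b(1) by blast
    qed
  next
    fix b assume b: "b \<in> A"
    interpret G: group "fst N b" by (rule additive_functor_group[OF NF b])
    show "\<zero> a b \<in> S" unfolding S using d_one[OF b] b G.one_closed by (intro UN_I[OF b] image_eqI) auto
  qed
  assume V: "left_ideal a V"
  define K where "K b = {x \<in> carrier (fst N b). d b x \<in> V}" for b
  have "(\<forall>b\<in>A. K b = {\<one>\<^bsub>fst N b\<^esub>}) \<or> (\<forall>b\<in>A. K b = carrier (fst N b))"
  proof (rule simple_subfunctor[OF N])
    fix b assume b: "b \<in> A"
    interpret G: group "fst N b" by (rule additive_functor_group[OF NF b])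
    show "subgroup (K b) (fst N b)"
    proof (rule G.subgroupI)
      show "K b \<subseteq> carrier (fst N b)" by (auto simp: K_def)
      show "K b \<noteq> {}" using d_one[OF b] left_idealD(2)[OF V b] G.one_closed by (auto simp: K_def)
      show "x \<otimes>\<^bsub>fst N b\<^esub> y \<in> K b" if "x \<in> K b" "y \<in> K b" for x y
        using that dadd[OF b, of x y] left_idealD(3)[OF V, of "d b x" "d b y"] d(1)[OF b, of x] d(1)[OF b, of y]
        by (auto simp: K_def Hom_iff)
      show "inv\<^bsub>fst N b\<^esub> x \<in> K b" if "x \<in> K b" for x
      proof -
        have x: "x \<in> carrier (fst N b)" "d b x \<in> V" using that by (auto simp: K_def)
        have ix: "inv\<^bsub>fst N b\<^esub> x \<in> carrier (fst N b)" using x by simp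
        have "d b x \<oplus> d b (inv\<^bsub>fst N b\<^esub> x) = \<zero> a b"
          using dadd[OF b x(1) ix] d_one[OF b] G.r_inv[OF x(1)] by simp
        then have "d b (inv\<^bsub>fst N b\<^esub> x) = neg (d b x)" using neg_unique d(1)[OF b x(1)] d(1)[OF b ix] by blast
        then show ?thesis using left_ideal_neg[OF V x(2)] ix by (simp add: K_def)
      qed
    qed
  next
    fix f x assume f: "f \<in> Arr B" and x: "x \<in> K (Src C f)"
    then have x': "x \<in> carrier (fst N (Src C f))" "d (Src C f) x \<in> V" by (auto simp: K_def)
    have fA: "f \<in> Arr C" "Src C f \<in> A" "Tgt C f \<in> A" using f by auto
    have "f \<cdot> d (Src C f) x \<in> V"
      by (rule left_idealD(4)[OF V x'(2) fA(1) _ fA(3)]) (use d(1)[OF fA(2) x'(1)] in \<open>simp add: Hom_iff\<close>)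
    then show "snd N f x \<in> K (Tgt C f)" using dact[OF f x'(1)] by (simp add: K_def)
  qed
  then show "disjoint_ideals a V S \<or> S \<subseteq> V"
  proof
    assume K: "\<forall>b\<in>A. K b = {\<one>\<^bsub>fst N b\<^esub>}"
    have "g = \<zero> a (Tgt C g)" if g: "g \<in> V" "g \<in> S" for g
    proof -
      obtain b x where b: "b \<in> A" "x \<in> carrier (fst N b)" "g = d b x" using g(2) unfolding S by blast
      then have "x \<in> K b" using g(1) by (simp add: K_def)
      then have "g = \<zero> a b" using K b d_one by auto
      then show ?thesis using b(1) a by simp
    qed
    then show ?thesis by (auto simp: disjoint_ideals_def)
  next
    assume K: "\<forall>b\<in>A. K b = carrier (fst N b)"
    have "S \<subseteq> V" unfolding S using K by (auto simp: K_def)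
    then show ?thesis ..
  qed
qed

text \<open>
  \<open>Hom(a, -)\<close> is a sum of simple ideals, and a finite partial sum contains the identity of \<open>a\<close>. So \<open>U\<close> has a
  complement, and the component of the identity in \<open>U\<close> is the idempotent.
\<close>

lemma left_ideal_idempotent:
  assumes a: "a \<in> A" and U: "left_ideal a U"
  obtains e where "e \<in> U" "e \<in> Hom C a a" "\<And>u. u \<in> U \<Longrightarrow> u \<cdot> e = u"
proof -
  define H where "H = {g \<in> Arr C. Src C g = a \<and> Tgt C g \<in> A}"
  have H: "left_ideal a H" unfolding left_ideal_def H_def using a by auto
  let ?F = "ideal_functor a H" and ?C = "AddFun \<kappa> B"
  have FO: "?F \<in> Ob ?C" using additive_functor_ideal[OF a H] by (simp add: AddFun_def)
  obtain I :: "'u set" and N \<iota> where N: "\<And>i. i \<in> I \<Longrightarrow> simple_object ?C (N i)" and cop: "is_coproduct ?C I N ?F \<iota>"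
    using ss FO unfolding semisimple_def by metis
  have "\<exists>\<eta>. \<iota> i = (N i, ?F, \<eta>) \<and> nat_transf B (N i) ?F \<eta>" if "i \<in> I" for i
    using cop that unfolding is_coproduct_def AddFun_Hom by blast
  then obtain \<eta> where \<iota>: "\<And>i. i \<in> I \<Longrightarrow> \<iota> i = (N i, ?F, \<eta> i)" and \<eta>: "\<And>i. i \<in> I \<Longrightarrow> nat_transf B (N i) ?F (\<eta> i)"
    by metis
  define S where "S i = (\<Union>b\<in>A. (\<lambda>x. decode a b (\<eta> i b x)) ` carrier (fst (N i) b))" for i
  have S: "left_ideal a (S i)" "left_ideal a V \<Longrightarrow> disjoint_ideals a V (S i) \<or> S i \<subseteq> V" if "i \<in> I" for i V
    unfolding S_def using simple_image_ideal[OF a H N[OF that] \<eta>[OF that]] by blast+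
  define gen where "gen g F \<longleftrightarrow> finite F \<and> F \<subseteq> I \<and> (\<forall>L. left_ideal a L \<and> (\<forall>i\<in>F. S i \<subseteq> L) \<longrightarrow> g \<in> L)" for g F
  define G where "G = {g \<in> H. \<exists>F. gen g F}"
  have G: "left_ideal a G"
    unfolding left_ideal_def
  proof (intro conjI ballI impI)
    show "g \<in> Arr C" "Src C g = a" "Tgt C g \<in> A" if "g \<in> G" for g using that by (auto simp: G_def H_def)
    show "\<zero> a b \<in> G" if b: "b \<in> A" for b
    proof -
      have "gen (\<zero> a b) {}" unfolding gen_def using left_idealD(2)[OF _ b] by blast
      then show ?thesis unfolding G_def using left_idealD(2)[OF H b] by blast
    qed
    show "g \<oplus> h \<in> G" if g: "g \<in> G" and h: "h \<in> G" and t: "Tgt C g = Tgt C h" for g h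
    proof -
      obtain F F' where F: "gen g F" and F': "gen h F'" using g h by (auto simp: G_def)
      have "gen (g \<oplus> h) (F \<union> F')"
        unfolding gen_def
      proof (intro conjI allI impI; (elim conjE)?)
        fix L assume L: "left_ideal a L" "\<forall>i\<in>F \<union> F'. S i \<subseteq> L"
        then have "g \<in> L" "h \<in> L" using F F' unfolding gen_def by auto
        then show "g \<oplus> h \<in> L" using left_idealD(3)[OF L(1) _ _ t] by blast
      qed (use F F' in \<open>auto simp: gen_def\<close>)
      moreover have "g \<oplus> h \<in> H" using left_idealD(3)[OF H _ _ t] g h by (simp add: G_def)
      ultimately show ?thesis unfolding G_def by blast
    qed
    show "f \<cdot> g \<in> G" if g: "g \<in> G" and f: "f \<in> Arr C" "Src C f = Tgt C g \<and> Tgt C f \<in> A" for f g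
    proof -
      obtain F where F: "gen g F" using g by (auto simp: G_def)
      have "gen (f \<cdot> g) F"
        unfolding gen_def
      proof (intro conjI allI impI; (elim conjE)?)
        fix L assume L: "left_ideal a L" "\<forall>i\<in>F. S i \<subseteq> L"
        then have "g \<in> L" using F unfolding gen_def by blast
        then show "f \<cdot> g \<in> L" using left_idealD(4)[OF L(1) _ f(1)] f by blast
      qed (use F in \<open>auto simp: gen_def\<close>)
      moreover have "f \<cdot> g \<in> H" using left_idealD(4)[OF H _ f(1)] f g by (simp add: G_def)
      ultimately show ?thesis unfolding G_def by blast
    qed
  qed
  have SG: "S i \<subseteq> G" if i: "i \<in> I" for i
  proof
    fix g assume g: "g \<in> S i"
    have "gen g {i}" unfolding gen_def using g i by blast
    moreover have "g \<in> H" using left_idealD(1)[OF S(1)[OF i] g] by (simp add: H_def)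
    ultimately show "g \<in> G" unfolding G_def by blast
  qed
  \<comment> \<open>The coprojections factor through \<open>G\<close>, so the inclusion of \<open>G\<close> is split and \<open>G\<close> is everything.\<close>
  let ?G = "ideal_functor a G"
  have GO: "?G \<in> Ob ?C" using additive_functor_ideal[OF a G] by (simp add: AddFun_def)
  have NF: "additive_functor \<kappa> B (N i)" if "i \<in> I" for i using N[OF that] by (simp add: simple_object_def AddFun_def)
  have \<eta>G: "nat_transf B (N i) ?G (\<eta> i)" if i: "i \<in> I" for i
    unfolding nat_transf_def
  proof (intro conjI ballI)
    show "\<eta> i \<in> extensional (Ob B)" using nat_transfD(1)[OF \<eta>[OF i]] .
    fix b assume b: "b \<in> Ob B"
    show "\<eta> i b \<in> extensional (carrier (fst (N i) b))" using nat_transfD(3)[OF \<eta>[OF i] b] .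
    have h: "\<eta> i b \<in> hom (fst (N i) b) (fst ?F b)" using nat_transfD(2)[OF \<eta>[OF i] b] .
    have "\<eta> i b x \<in> carrier (fst ?G b)" if x: "x \<in> carrier (fst (N i) b)" for x
    proof -
      have "\<eta> i b x \<in> carrier (fst ?F b)" using h x by (auto simp: hom_def)
      then obtain g where g: "g \<in> Hom C a b" "\<eta> i b x = code a b g" by (auto simp: carrier_ideal_functor)
      have "decode a b (\<eta> i b x) \<in> S i" unfolding S_def using b x by auto
      then have "g \<in> G" using SG[OF i] decode_code[OF a _ g(1)] b g(2) by auto
      then show ?thesis using g by (simp add: carrier_ideal_functor)
    qed
    then show "\<eta> i b \<in> hom (fst (N i) b) (fst ?G b)" using h by (auto simp: hom_def ideal_functor_def)
  next
    fix f x assume "f \<in> Arr B" "x \<in> carrier (fst (N i) (Src B f))"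
    then show "\<eta> i (Tgt B f) (snd (N i) f x) = snd ?G f (\<eta> i (Src B f) x)"
      using nat_transfD(4)[OF \<eta>[OF i]] by (simp add: ideal_functor_def)
  qed
  have "\<forall>i\<in>I. (N i, ?G, \<eta> i) \<in> Hom ?C (N i) ?G"
    unfolding AddFun_Hom using NF \<eta>G additive_functor_ideal[OF a G] by blast
  then have "\<exists>!h. h \<in> Hom ?C ?F ?G \<and> (\<forall>i\<in>I. h \<cdot>\<^bsub>?C\<^esub> \<iota> i = (N i, ?G, \<eta> i))"
    using cop[unfolded is_coproduct_def, THEN conjunct2, THEN conjunct2, rule_format, OF GO, of "\<lambda>i. (N i, ?G, \<eta> i)"]
    by blast
  then obtain h where h: "h \<in> Hom ?C ?F ?G" "\<And>i. i \<in> I \<Longrightarrow> h \<cdot>\<^bsub>?C\<^esub> \<iota> i = (N i, ?G, \<eta> i)" by blast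
  obtain \<theta> where \<theta>: "h = (?F, ?G, \<theta>)" "nat_transf B ?F ?G \<theta>" using h(1) unfolding AddFun_Hom by blast
  have GF: "carrier (fst ?G b) \<subseteq> carrier (fst ?F b)" for b by (auto simp: carrier_ideal_functor G_def)
  have \<theta>F: "nat_transf B ?F ?F \<theta>"
    unfolding nat_transf_def
  proof (intro conjI ballI)
    show "\<theta> \<in> extensional (Ob B)" using nat_transfD(1)[OF \<theta>(2)] .
    fix b assume b: "b \<in> Ob B"
    show "\<theta> b \<in> extensional (carrier (fst ?F b))" using nat_transfD(3)[OF \<theta>(2) b] .
    show "\<theta> b \<in> hom (fst ?F b) (fst ?F b)"
    proof (rule homI)
      have h: "\<theta> b \<in> hom (fst ?F b) (fst ?G b)" using nat_transfD(2)[OF \<theta>(2) b] .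
      fix x assume x: "x \<in> carrier (fst ?F b)"
      show "\<theta> b x \<in> carrier (fst ?F b)" using hom_in_carrier[OF h x] GF by blast
      fix y assume y: "y \<in> carrier (fst ?F b)"
      show "\<theta> b (x \<otimes>\<^bsub>fst ?F b\<^esub> y) = \<theta> b x \<otimes>\<^bsub>fst ?F b\<^esub> \<theta> b y"
        using hom_mult[OF h x y] by (simp add: ideal_functor_def)
    qed
  next
    fix f x assume "f \<in> Arr B" "x \<in> carrier (fst ?F (Src B f))"
    then show "\<theta> (Tgt B f) (snd ?F f x) = snd ?F f (\<theta> (Src B f) x)"
      using nat_transfD(4)[OF \<theta>(2)] by (simp add: ideal_functor_def)
  qed
  have FF: "additive_functor \<kappa> B ?F" using additive_functor_ideal[OF a H] .
  define \<iota>d where "\<iota>d = (\<lambda>b\<in>Ob B. \<lambda>x\<in>carrier (fst ?F b). x)"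
  have idF: "nat_transf B ?F ?F \<iota>d" unfolding \<iota>d_def by (rule nat_transf_subfunctor[OF FF]) auto
  have \<iota>H: "\<forall>i\<in>I. \<iota> i \<in> Hom ?C (N i) ?F" using cop unfolding is_coproduct_def by blast
  then have u: "\<exists>!k. k \<in> Hom ?C ?F ?F \<and> (\<forall>i\<in>I. k \<cdot>\<^bsub>?C\<^esub> \<iota> i = \<iota> i)"
    using cop[unfolded is_coproduct_def, THEN conjunct2, THEN conjunct2, rule_format, OF FO, of \<iota>]
    by blast
  have "(?F, ?F, \<theta>) \<cdot>\<^bsub>?C\<^esub> \<iota> i = \<iota> i" if i: "i \<in> I" for i
    using h(2)[OF i] unfolding \<theta>(1) \<iota>[OF i] by (simp add: AddFun_def)
  moreover have "(?F, ?F, \<iota>d) \<cdot>\<^bsub>?C\<^esub> \<iota> i = \<iota> i" if i: "i \<in> I" for i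
  proof -
    have "(\<lambda>b\<in>Ob B. \<lambda>x\<in>carrier (fst (N i) b). \<iota>d b (\<eta> i b x)) = \<eta> i"
    proof (rule extensionalityI[of _ "Ob B"])
      show "\<eta> i \<in> extensional (Ob B)" using nat_transfD(1)[OF \<eta>[OF i]] .
      fix b assume b: "b \<in> Ob B"
      show "(\<lambda>b\<in>Ob B. \<lambda>x\<in>carrier (fst (N i) b). \<iota>d b (\<eta> i b x)) b = \<eta> i b"
        using nat_transfD(2,3)[OF \<eta>[OF i] b] b
        by (intro extensionalityI[of _ "carrier (fst (N i) b)"]) (auto simp: \<iota>d_def hom_def)
    qed simp
    then show ?thesis unfolding \<iota>[OF i] by (simp add: AddFun_def)
  qed
  moreover have "(?F, ?F, \<theta>) \<in> Hom ?C ?F ?F" "(?F, ?F, \<iota>d) \<in> Hom ?C ?F ?F"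
    unfolding AddFun_Hom using FF \<theta>F idF by blast+
  ultimately have "(?F, ?F, \<theta>) = (?F, ?F, \<iota>d)" using u by blast
  then have \<theta>d: "\<theta> = \<iota>d" by simp
  have idH: "Ident C a \<in> H \<inter> Hom C a a" using a Ident_Hom by (auto simp: H_def)
  then have c: "code a a (Ident C a) \<in> carrier (fst ?F a)" by (auto simp: carrier_ideal_functor)
  then have "\<theta> a (code a a (Ident C a)) = code a a (Ident C a)" unfolding \<theta>d \<iota>d_def using a by simp
  moreover have "\<theta> a (code a a (Ident C a)) \<in> carrier (fst ?G a)"
    using nat_transfD(2)[OF \<theta>(2), of a] a c by (auto simp: hom_def)
  ultimately obtain g where g: "g \<in> G" "g \<in> Hom C a a" "code a a (Ident C a) = code a a g"
    by (auto simp: carrier_ideal_functor)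
  then have "Ident C a = g" using decode_code[OF a a] idH by (metis IntD2)
  then obtain F where F: "gen (Ident C a) F" using g(1) by (auto simp: G_def)
  then have Ff: "finite F" "F \<subseteq> I" by (auto simp: gen_def)
  obtain T where T: "left_ideal a T" "disjoint_ideals a U T" "\<forall>i\<in>F. S i \<subseteq> ideal_plus U T"
    using ideal_complement[OF a U Ff(1), of S] S Ff(2) by blast
  then have "Ident C a \<in> ideal_plus U T" using F left_ideal_plus[OF U T(1) a] unfolding gen_def by blast
  then obtain e t where et: "e \<in> U" "t \<in> T" "Tgt C e = Tgt C t" "Ident C a = e \<oplus> t" by (auto simp: ideal_plus_def)
  note eD = left_idealD(1)[OF U et(1)] and tD = left_idealD(1)[OF T(1) et(2)]
  have "Tgt C (e \<oplus> t) = a" using et(4) a by (metis A_ObD Arr_Ident(3))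
  then have tgt: "Tgt C t = a" using eD tD et(3) by simp
  have H': "e \<in> Hom C a a" "t \<in> Hom C a a" using eD tD tgt et(3) a by (auto simp: Hom_iff)
  have "u \<cdot> e = u" if u: "u \<in> U" for u
  proof -
    note uD = left_idealD(1)[OF U u]
    have uH: "u \<in> Hom C a (Tgt C u)" using uD a by (simp add: Hom_iff)
    have ue: "u \<cdot> e \<in> U" "u \<cdot> t \<in> T"
      using left_idealD(4)[OF U et(1), of u] left_idealD(4)[OF T(1) et(2), of u] uD tgt et(3) by auto
    have "u \<cdot> (e \<oplus> t) = (u \<cdot> e) \<oplus> (u \<cdot> t)" using Comp_Add[OF H' uH] .
    then have s: "u = (u \<cdot> e) \<oplus> (u \<cdot> t)" using et(4) Comp_Ident[OF uH] by simp
    have ueH: "u \<cdot> e \<in> Hom C a (Tgt C u)" "u \<cdot> t \<in> Hom C a (Tgt C u)" using Comp_Hom H' uH by auto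
    have "u \<cdot> t = u \<ominus> (u \<cdot> e)" using add_diff[OF ueH(2,1)] group_laws(1)[OF ueH] s by simp
    moreover have "u \<ominus> (u \<cdot> e) \<in> U" using left_ideal_diff[OF U u ue(1)] ueH by (simp add: Hom_iff)
    ultimately have "u \<cdot> t = \<zero> a (Tgt C (u \<cdot> t))" using T(2) ue(2) unfolding disjoint_ideals_def by auto
    then have "u \<cdot> t = \<zero> a (Tgt C u)" using ueH by (simp add: Hom_iff)
    then show ?thesis using s Add_Zero(2)[OF ueH(1)] by simp
  qed
  then show thesis using that et(1) H'(1) by blast
qed

text \<open>
  The ideal of all \<open>g f\<close> is generated by an idempotent \<open>e = g f\<close>, and it contains \<open>f\<close>. In contrast to
  semisimplicity itself, the conclusion is visibly symmetric under reversing arrows.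
\<close>

lemma von_Neumann_regular:
  assumes a: "a \<in> A" and b: "b \<in> A" and f: "f \<in> Hom C a b"
  obtains g where "g \<in> Hom C b a" "f \<cdot> (g \<cdot> f) = f"
proof -
  let ?U = "(\<lambda>g. g \<cdot> f) ` {g \<in> Arr C. Src C g = b \<and> Tgt C g \<in> A}"
  have fA: "f \<in> Arr C" "Src C f = a" "Tgt C f = b" using f by (auto simp: Hom_iff)
  have "left_ideal a ?U"
    unfolding left_ideal_def
  proof (intro conjI ballI impI)
    show "\<zero> a c \<in> ?U" if c: "c \<in> A" for c
      by (rule image_eqI[of _ _ "\<zero> b c"]) (use fA c b in auto)
    show "p \<oplus> q \<in> ?U" if pq: "p \<in> ?U" "q \<in> ?U" and t: "Tgt C p = Tgt C q" for p q
    proof -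
      obtain g h where g: "g \<in> Arr C" "Src C g = b" "Tgt C g \<in> A" "p = g \<cdot> f"
        and h: "h \<in> Arr C" "Src C h = b" "Tgt C h \<in> A" "q = h \<cdot> f" using pq by blast
      have "Tgt C g = Tgt C h" using t g h fA by simp
      then show ?thesis using g h fA by (intro image_eqI[of _ _ "g \<oplus> h"]) auto
    qed
    show "k \<cdot> p \<in> ?U" if p: "p \<in> ?U" and k: "k \<in> Arr C" "Src C k = Tgt C p \<and> Tgt C k \<in> A" for k p
    proof -
      obtain g where g: "g \<in> Arr C" "Src C g = b" "Tgt C g \<in> A" "p = g \<cdot> f" using p by blast
      then show ?thesis using k fA by (intro image_eqI[of _ _ "k \<cdot> g"]) auto
    qed
  qed (use fA in auto)
  then obtain e where e: "e \<in> ?U" "e \<in> Hom C a a" "\<And>u. u \<in> ?U \<Longrightarrow> u \<cdot> e = u" using left_ideal_idempotent[OF a] by blast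
  obtain g where g: "g \<in> Arr C" "Src C g = b" "Tgt C g \<in> A" "e = g \<cdot> f" using e(1) by blast
  have "g \<in> Hom C b a" using g e(2) fA a b by (simp add: Hom_iff)
  moreover have "f \<in> ?U" by (rule image_eqI[of _ _ "Ident C b"]) (use fA b in auto)
  ultimately show thesis using that e(3) g(4) by blast
qed

definition right_ideal :: "'o \<Rightarrow> 'm set \<Rightarrow> bool"
  where "right_ideal a V \<longleftrightarrow> (\<forall>v\<in>V. v \<in> Arr C \<and> Tgt C v = a \<and> Src C v \<in> A) \<and> \<zero> a a \<in> V \<and>
    (\<forall>u\<in>V. \<forall>v\<in>V. Src C u = Src C v \<longrightarrow> u \<oplus> v \<in> V) \<and>
    (\<forall>v\<in>V. \<forall>f\<in>Arr C. Tgt C f = Src C v \<and> Src C f \<in> A \<longrightarrow> v \<cdot> f \<in> V)"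

text \<open>
  Semisimplicity passes from left to right ideals: if the right ideal \<open>V\<close> were not generated by an
  idempotent, regularity would produce nonzero orthogonal idempotents \<open>d\<^sub>0, d\<^sub>1, \<dots>\<close> in \<open>V\<close>,
  and the left ideal that they generate would not be generated by an idempotent.
\<close>

lemma right_ideal_idempotent:
  assumes a: "a \<in> A" and V: "right_ideal a V"
  obtains e where "e \<in> V" "e \<in> Hom C a a" "\<And>v. v \<in> V \<Longrightarrow> e \<cdot> v = v"
proof (rule ccontr)
  assume "\<not> thesis"
  then have no: "\<exists>v\<in>V. e \<cdot> v \<noteq> v" if "e \<in> V" "e \<in> Hom C a a" for e
    using that \<open>\<And>e. \<lbrakk>e \<in> V; e \<in> Hom C a a; \<And>v. v \<in> V \<Longrightarrow> e \<cdot> v = v\<rbrakk> \<Longrightarrow> thesis\<close> by blast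
  have vD: "v \<in> Hom C (Src C v) a" "Src C v \<in> A" if "v \<in> V" for v
    using V that a unfolding right_ideal_def by (auto simp: Hom_def)
  have vadd: "u \<oplus> v \<in> V" if "u \<in> V" "v \<in> V" "Src C u = Src C v" for u v
    using V that unfolding right_ideal_def by blast
  have vcomp: "v \<cdot> f \<in> V" if "v \<in> V" "f \<in> Hom C b (Src C v)" "b \<in> A" for v f b
    using V that unfolding right_ideal_def by (auto simp: Hom_def)
  have vneg: "neg v \<in> V" if v: "v \<in> V" for v
  proof -
    note D = vD[OF v]
    have "v \<cdot> neg (Ident C (Src C v)) \<in> V" using vcomp[OF v neg_Hom[OF Ident_Hom]] D by simp
    then show ?thesis using D by (simp add: Hom_iff)
  qed
  define P where "P e \<longleftrightarrow> e \<in> V \<and> e \<in> Hom C a a \<and> e \<cdot> e = e" for e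
  define Q where "Q e e' \<longleftrightarrow> (\<exists>d. d \<in> Hom C a a \<and> d \<cdot> d = d \<and> d \<cdot> e = \<zero> a a \<and> e \<cdot> d = \<zero> a a \<and> d \<noteq> \<zero> a a \<and> e' = e \<oplus> d)" for e e'
  have step: "\<exists>e'. P e' \<and> Q e e'" if e: "P e" for e
  proof -
    have eV: "e \<in> V" and eH: "e \<in> Hom C a a" and ee: "e \<cdot> e = e" using e by (auto simp: P_def)
    obtain v where v: "v \<in> V" "e \<cdot> v \<noteq> v" using no[OF eV eH] by blast
    let ?b = "Src C v"
    note vH = vD[OF v(1)]
    note ev = Comp_Hom[OF vH(1) eH]
    define w where "w = v \<ominus> (e \<cdot> v)"
    have wH: "w \<in> Hom C ?b a" unfolding w_def by (rule diff_Hom[OF vH(1) ev])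
    have w0: "w \<noteq> \<zero> ?b a" unfolding w_def using diff_eq_Zero[OF vH(1) ev] v(2) by auto
    have evV: "e \<cdot> v \<in> V" by (rule vcomp[OF eV _ vH(2)]) (use vH eH in \<open>simp add: Hom_iff\<close>)
    have wV: "w \<in> V" unfolding w_def diff_def
      by (rule vadd[OF v(1) vneg[OF evV]]) (use ev vH in \<open>simp add: Hom_iff\<close>)
    have ew: "e \<cdot> w = \<zero> ?b a"
    proof -
      have "e \<cdot> w = (e \<cdot> v) \<ominus> ((e \<cdot> e) \<cdot> v)" unfolding w_def using eH vH by (simp add: Hom_iff)
      then show ?thesis using ee diff_self[OF ev] by simp
    qed
    obtain g where g: "g \<in> Hom C a ?b" "w \<cdot> (g \<cdot> w) = w" using von_Neumann_regular[OF vH(2) a wH] .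
    \<comment> \<open>The quasi-inverse \<open>g\<close> is corrected to make the idempotent \<open>w h\<close> orthogonal to \<open>e\<close> on both sides.\<close>
    define h where "h = g \<ominus> (g \<cdot> e)"
    have ge: "g \<cdot> e \<in> Hom C a ?b" using Comp_Hom[OF eH g(1)] .
    have h: "h \<in> Hom C a ?b" unfolding h_def by (rule diff_Hom[OF g(1) ge])
    have hw: "h \<cdot> w = g \<cdot> w"
    proof -
      have "h \<cdot> w = (g \<cdot> w) \<ominus> (g \<cdot> (e \<cdot> w))" unfolding h_def using g eH wH by (simp add: Hom_iff)
      also have "g \<cdot> (e \<cdot> w) = \<zero> ?b ?b" unfolding ew using g vH by (simp add: Hom_iff)
      finally show ?thesis using diff_Zero[OF Comp_Hom[OF wH g(1)]] by simp
    qed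
    have he: "h \<cdot> e = \<zero> a ?b"
    proof -
      have "h \<cdot> e = (g \<cdot> e) \<ominus> (g \<cdot> (e \<cdot> e))" unfolding h_def using g eH by (simp add: Hom_iff)
      then show ?thesis using ee diff_self[OF ge] by simp
    qed
    define d where "d = w \<cdot> h"
    have dH: "d \<in> Hom C a a" unfolding d_def using Comp_Hom[OF h wH] .
    have whw: "w \<cdot> (h \<cdot> w) = w" using hw g(2) by simp
    have dw: "d \<cdot> w = w" unfolding d_def Comp_assoc[OF wH h wH] by (rule whw)
    have dd: "d \<cdot> d = d"
    proof -
      have "d \<cdot> (w \<cdot> h) = (d \<cdot> w) \<cdot> h" using Comp_assoc[OF h wH dH] by simp
      then show ?thesis using dw unfolding d_def by simp
    qed
    have de: "d \<cdot> e = \<zero> a a" unfolding d_def Comp_assoc[OF eH h wH] he using wH a by (simp add: Hom_iff)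
    have ed: "e \<cdot> d = \<zero> a a"
      unfolding d_def Comp_assoc[OF h wH eH, symmetric] ew using h a by (simp add: Hom_iff)
    have d0: "d \<noteq> \<zero> a a"
    proof
      assume "d = \<zero> a a"
      then have "w = \<zero> ?b a" using dw wH a by (simp add: Hom_iff)
      then show False using w0 by simp
    qed
    have dV: "d \<in> V" unfolding d_def by (rule vcomp[OF wV _ a]) (use h wH in \<open>simp add: Hom_iff\<close>)
    have "(e \<oplus> d) \<cdot> (e \<oplus> d) = ((e \<cdot> e) \<oplus> (d \<cdot> e)) \<oplus> ((e \<cdot> d) \<oplus> (d \<cdot> d))" using eH dH by (simp add: Hom_iff)
    also have "\<dots> = e \<oplus> d" unfolding ee de ed dd using Add_Zero[OF eH] Add_Zero[OF dH] by simp
    finally have "P (e \<oplus> d)" unfolding P_def using vadd[OF eV dV] Add_Hom[OF eH dH] eH dH by (simp add: Hom_iff)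
    moreover have "Q e (e \<oplus> d)" unfolding Q_def using dH dd de ed d0 by blast
    ultimately show ?thesis by blast
  qed
  have "P (\<zero> a a)" unfolding P_def using V a Zero_Hom by (simp add: right_ideal_def)
  then obtain E where E: "\<And>n. P (E n)" "\<And>n. Q (E n) (E (Suc n))"
    using dependent_nat_choice[of "\<lambda>n. P" "\<lambda>n. Q"] step by metis
  have EH: "E n \<in> Hom C a a" "E n \<cdot> E n = E n" for n using E(1) by (auto simp: P_def)
  obtain d where d: "\<And>n. d n \<in> Hom C a a" "\<And>n. d n \<cdot> d n = d n" "\<And>n. d n \<cdot> E n = \<zero> a a"
    "\<And>n. E n \<cdot> d n = \<zero> a a" "\<And>n. d n \<noteq> \<zero> a a" "\<And>n. E (Suc n) = E n \<oplus> d n"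
    using E(2) unfolding Q_def by metis
  have EE: "E m \<cdot> E n = E m" if "m \<le> n" for m n using that
  proof (induction n rule: nat_induct_at_least)
    case base then show ?case using EH by blast
  next
    case (Suc n)
    have "E n \<cdot> E (Suc n) = (E n \<cdot> E n) \<oplus> (E n \<cdot> d n)" unfolding d(6) using Comp_Add EH(1) d(1) by blast
    then have "E n \<cdot> E (Suc n) = E n" using EH d(4) Add_Zero(2)[OF EH(1)] by simp
    then show ?case using Comp_assoc[OF EH(1)[of "Suc n"] EH(1)[of n] EH(1)[of m]] Suc by simp
  qed
  let ?U = "{g \<in> Arr C. Src C g = a \<and> Tgt C g \<in> A \<and> (\<exists>n. g \<cdot> E n = g)}"
  have mono: "g \<cdot> E n = g" if "g \<in> Arr C" "Src C g = a" "g \<cdot> E m = g" "m \<le> n" for g m n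
    using Comp_assoc[of "E n" a a "E m" a g "Tgt C g"] EH(1) EE[OF that(4)] that by (simp add: Hom_def)
  have "left_ideal a ?U"
    unfolding left_ideal_def
  proof (intro conjI ballI impI)
    show "\<zero> a b \<in> ?U" if "b \<in> A" for b using that a EH(1)[of 0] by (auto simp: Hom_iff intro!: exI[of _ 0])
    show "g \<oplus> h \<in> ?U" if g: "g \<in> ?U" and h: "h \<in> ?U" and t: "Tgt C g = Tgt C h" for g h
    proof -
      obtain m n where mn: "g \<cdot> E m = g" "h \<cdot> E n = h" using g h by blast
      have "g \<cdot> E (max m n) = g" "h \<cdot> E (max m n) = h"
        using mono[of g m "max m n"] mono[of h n "max m n"] g h mn by auto
      then have "(g \<oplus> h) \<cdot> E (max m n) = g \<oplus> h" using g h t EH(1)[of "max m n"] by (simp add: Hom_iff)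
      then show ?thesis using g h t by auto
    qed
    show "f \<cdot> g \<in> ?U" if g: "g \<in> ?U" and f: "f \<in> Arr C" "Src C f = Tgt C g \<and> Tgt C f \<in> A" for f g
    proof -
      obtain n where n: "g \<cdot> E n = g" using g by blast
      have "(f \<cdot> g) \<cdot> E n = f \<cdot> (g \<cdot> E n)" using g f EH(1)[of n] by (simp add: Hom_iff)
      then show ?thesis using g f n by auto
    qed
  qed auto
  then obtain e where e: "e \<in> ?U" "e \<in> Hom C a a" "\<And>u. u \<in> ?U \<Longrightarrow> u \<cdot> e = u" using left_ideal_idempotent[OF a] by blast
  obtain n where n: "e \<cdot> E n = e" using e(1) by blast
  note dn = d(1)[of n]
  have "d n \<cdot> E (Suc n) = (d n \<cdot> E n) \<oplus> (d n \<cdot> d n)" unfolding d(6) using Comp_Add[OF EH(1) dn dn] .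
  then have "d n \<cdot> E (Suc n) = d n" unfolding d(2,3) using Add_Zero(1)[OF dn] by simp
  then have "d n \<in> ?U" using dn a by (auto simp: Hom_iff)
  then have de: "d n \<cdot> e = d n" by (rule e(3))
  have "d n \<cdot> d n = (d n \<cdot> e) \<cdot> d n" using de by simp
  also have "\<dots> = (d n \<cdot> (e \<cdot> E n)) \<cdot> d n" unfolding n ..
  also have "\<dots> = d n \<cdot> (e \<cdot> (E n \<cdot> d n))" using dn e(2) EH(1)[of n] by (simp add: Hom_iff)
  also have "\<dots> = \<zero> a a" unfolding d(4) using dn e(2) by (simp add: Hom_iff)
  finally show False using d(2,5) by simp
qed

end

section \<open>Covers of the homology in degree zero\<close>

context smashing_triangulated begin

lemma cproj_restr:
  assumes cop: "is_coproduct C I N S \<iota>" and i: "i \<in> I"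
  shows "cproj I N S \<iota> i \<cdot> restr I N S \<iota> J = (if i \<in> J then cproj I N S \<iota> i else \<zero> S (N i))"
proof (rule coproduct_eqI[OF cop])
  note \<pi> = cproj_Hom[OF cop i] and r = restr_Hom[OF cop, of J] and D = coproduct_D[OF cop]
  show "cproj I N S \<iota> i \<cdot> restr I N S \<iota> J \<in> Hom C S (N i)" using Comp_Hom[OF r \<pi>] .
  show "(if i \<in> J then cproj I N S \<iota> i else \<zero> S (N i)) \<in> Hom C S (N i)" using \<pi> Zero_Hom D(1) D(2)[OF i] by simp
  fix k assume k: "k \<in> I"
  have "(cproj I N S \<iota> i \<cdot> restr I N S \<iota> J) \<cdot> \<iota> k = cproj I N S \<iota> i \<cdot> (restr I N S \<iota> J \<cdot> \<iota> k)"
    using Comp_assoc[OF D(3)[OF k] r \<pi>] .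
  also have "\<dots> = (if k \<in> J then cproj I N S \<iota> i \<cdot> \<iota> k else \<zero> (N k) (N i))"
    using restr_in[OF cop k, of J] restr_notin[OF cop k, of J] \<pi> D(2)[OF k] by (simp add: Hom_iff)
  also have "\<dots> = (if i \<in> J then cproj I N S \<iota> i else \<zero> S (N i)) \<cdot> \<iota> k"
    using cproj_other[OF cop i k] D(3)[OF k] D(2)[OF i] by (cases "k = i") (auto simp: Hom_iff)
  finally show "(cproj I N S \<iota> i \<cdot> restr I N S \<iota> J) \<cdot> \<iota> k = (if i \<in> J then cproj I N S \<iota> i else \<zero> S (N i)) \<cdot> \<iota> k" .
qed

lemma compact_restr_eq:
  assumes c: "c \<in> compacts" and I: "small \<kappa> I" and cop: "is_coproduct C I N S \<iota>" and y: "y \<in> Hom C c S"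
    and 0: "\<And>i. i \<in> I \<Longrightarrow> i \<notin> J \<Longrightarrow> cproj I N S \<iota> i \<cdot> y = \<zero> c (N i)"
  shows "restr I N S \<iota> J \<cdot> y = y"
proof -
  note r = restr_Hom[OF cop, of J]
  have ry: "restr I N S \<iota> J \<cdot> y \<in> Hom C c S" using Comp_Hom[OF y r] .
  have "y \<ominus> (restr I N S \<iota> J \<cdot> y) = \<zero> c S"
  proof (rule compact_eq_Zero[OF c I cop diff_Hom[OF y ry]])
    fix i assume i: "i \<in> I"
    note \<pi> = cproj_Hom[OF cop i]
    have \<pi>y: "cproj I N S \<iota> i \<cdot> y \<in> Hom C c (N i)" using Comp_Hom[OF y \<pi>] .
    have "cproj I N S \<iota> i \<cdot> (y \<ominus> (restr I N S \<iota> J \<cdot> y)) =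
      (cproj I N S \<iota> i \<cdot> y) \<ominus> ((cproj I N S \<iota> i \<cdot> restr I N S \<iota> J) \<cdot> y)"
      using y r \<pi> by (simp add: Hom_iff)
    also have "(cproj I N S \<iota> i \<cdot> restr I N S \<iota> J) \<cdot> y = cproj I N S \<iota> i \<cdot> y"
      unfolding cproj_restr[OF cop i] using 0[OF i] y \<pi> by (simp add: Hom_iff)
    finally show "cproj I N S \<iota> i \<cdot> (y \<ominus> (restr I N S \<iota> J \<cdot> y)) = \<zero> c (N i)" using diff_self[OF \<pi>y] by simp
  qed
  then show ?thesis using diff_eq_Zero[OF y ry] by simp
qed

lemma finite_support:
  assumes c: "c \<in> compacts" and I: "small \<kappa> I" and cop: "is_coproduct C I N S \<iota>" and y: "y \<in> Hom C c S"
  shows "finite {i \<in> I. cproj I N S \<iota> i \<cdot> y \<noteq> \<zero> c (N i)}"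
proof -
  obtain J where J: "finite J" "restr I N S \<iota> J \<cdot> y = y" using compactD[OF c I cop y] .
  have "cproj I N S \<iota> i \<cdot> y = \<zero> c (N i)" if i: "i \<in> I" "i \<notin> J" for i
  proof -
    have "cproj I N S \<iota> i \<cdot> (restr I N S \<iota> J \<cdot> y) = (cproj I N S \<iota> i \<cdot> restr I N S \<iota> J) \<cdot> y"
      using Comp_assoc[OF y restr_Hom[OF cop] cproj_Hom[OF cop i(1)]] by simp
    also have "\<dots> = \<zero> c (N i)"
      unfolding cproj_restr[OF cop i(1)] using i y coproduct_D(2)[OF cop i(1)] by (simp add: Hom_iff)
    finally show ?thesis unfolding J(2) .
  qed
  then show ?thesis by (intro finite_subset[OF _ J(1)]) blast
qed

lemma triangle_section:
  assumes t: "triangle C L M R f g h" and 0: "g = \<zero> M R"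
  shows "is_retract C M L"
proof -
  note Ob = triangle_Ob[OF t]
  have "g \<cdot> Ident C M = \<zero> M R" using 0 Ob by simp
  then obtain s where "s \<in> Hom C M L" "Ident C M = f \<cdot> s" using triangle_lift1[OF t Ident_Hom[OF Ob(2)]] by blast
  then show ?thesis unfolding is_retract_def using Ob triangle_D(1)[OF t] by metis
qed

end

lemma finite_has_maximum:
  assumes "Well_order r" "Field r = UNIV" "finite S" "S \<noteq> {}"
  shows "\<exists>m\<in>S. \<forall>l\<in>S. (l, m) \<in> r"
  using assms(3,4)
proof (induction S rule: finite_ne_induct)
  case (singleton x)
  have "(x, x) \<in> r" using assms(1,2) unfolding well_order_on_def linear_order_on_def partial_order_on_def
      preorder_on_def refl_on_def by auto
  then show ?case by simp
next
  case (insert x F)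
  then obtain m where m: "m \<in> F" "\<forall>l\<in>F. (l, m) \<in> r" by blast
  have tr: "trans r" and tot: "total_on UNIV r" and rf: "\<And>z. (z, z) \<in> r"
    using assms(1,2) unfolding well_order_on_def linear_order_on_def partial_order_on_def
      preorder_on_def refl_on_def by auto
  show ?case
  proof (cases "(x, m) \<in> r")
    case True
    then show ?thesis using m by blast
  next
    case False
    then have "x \<noteq> m" using rf[of m] by blast
    then have "(m, x) \<in> r" using tot False unfolding total_on_def by blast
    then have "\<forall>l\<in>F. (l, x) \<in> r" using m(2) tr unfolding trans_def by blast
    then show ?thesis using rf by blast
  qed
qed

context semisimple_generators begin

text \<open>
  The proof is Gauss elimination: all elements \<open>x \<in> Hom(a, M)\<close> are well ordered, those \<open>v\<close> for which \<open>x v\<close> is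
  a combination of earlier elements form a right ideal, generated by an idempotent \<open>e\<close>, and \<open>x (1 - e)\<close> is
  kept. The generators that are kept satisfy no relations, so the functor \<open>Hom(-, M)\<close> on \<open>A\<close> is projective.
\<close>

lemma heart_cover:
  assumes M: "M \<in> Ob C"
  obtains P Q \<psi> where "\<psi> \<in> Hom C P M" "Q \<in> cells A" "is_retract C P Q"
    "\<And>a f. a \<in> A \<Longrightarrow> f \<in> Hom C a M \<Longrightarrow> \<exists>x\<in>Hom C a P. \<psi> \<cdot> x = f"
    "\<And>a x. a \<in> A \<Longrightarrow> x \<in> Hom C a P \<Longrightarrow> \<psi> \<cdot> x = \<zero> a M \<Longrightarrow> x = \<zero> a P"
proof -
  obtain R where R: "R \<subseteq> A" "small \<kappa> R" "\<And>a. a \<in> A \<Longrightarrow> \<exists>r\<in>R. isomorphic C a r"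
    using A_generates[unfolded compactly_generates_def, THEN conjunct1] unfolding essentially_small_def by blast
  define K where "K = Sigma R (\<lambda>a. Hom C a M)"
  have K: "small \<kappa> K" unfolding K_def
    by (rule small_Sigma[OF R(2)]) (use ls M R(1) A_Ob in \<open>auto simp: locally_small_def\<close>)
  have KA: "fst k \<in> A" "snd k \<in> Hom C (fst k) M" if "k \<in> K" for k using that R(1) by (auto simp: K_def)
  have "\<And>k. k \<in> K \<Longrightarrow> fst k \<in> Ob C" using KA by simp
  then obtain Q \<iota> where cop: "is_coproduct C K fst Q \<iota>" using ex_coproduct[OF K] by metis
  note Q = coproduct_D(1)[OF cop] and \<iota> = coproduct_D(3)[OF cop]
  define X where "X = copair K Q \<iota> M snd"
  have X: "X \<in> Hom C Q M" "\<And>k. k \<in> K \<Longrightarrow> X \<cdot> \<iota> k = snd k"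
    unfolding X_def using copair_Hom[OF cop M KA(2)] copair_Comp[OF cop M KA(2)] by auto
  obtain r :: "('o \<times> 'm) rel" where r: "Well_order r" "Field r = UNIV"
    using well_ordering[where 'a = "'o \<times> 'm"] by (elim exE conjE)
  have wf: "wf (r - Id)"
    using r unfolding well_order_on_def linear_order_on_def partial_order_on_def by auto
  define below where "below k = {l. (l, k) \<in> r - Id}" for k
  let ?E = "\<lambda>k. restr K fst Q \<iota> (below k)" and ?\<pi> = "cproj K fst Q \<iota>"
  note Er = restr_Hom[OF cop] and \<pi> = cproj_Hom[OF cop]
  define V where "V k = {v \<in> Arr C. Tgt C v = fst k \<and> Src C v \<in> A \<and>
    (\<exists>y\<in>Hom C (Src C v) Q. ?E k \<cdot> y = y \<and> X \<cdot> y = snd k \<cdot> v)}" for k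
  have V: "right_ideal (fst k) (V k)" if k: "k \<in> K" for k
  proof -
    note kA = KA[OF k]
    have kO: "fst k \<in> Ob C" using kA by simp
    show ?thesis
      unfolding right_ideal_def
    proof (intro conjI ballI impI)
      show "\<zero> (fst k) (fst k) \<in> V k"
        unfolding V_def using kA kO Q X(1) Er[of "below k"] M
        by (auto intro!: bexI[of _ "\<zero> (fst k) Q"] simp: Hom_iff)
      show "u \<oplus> v \<in> V k" if u: "u \<in> V k" and v: "v \<in> V k" and s: "Src C u = Src C v" for u v
      proof -
        obtain y where y: "y \<in> Hom C (Src C v) Q" "?E k \<cdot> y = y" "X \<cdot> y = snd k \<cdot> u" using u s by (auto simp: V_def)
        obtain z where z: "z \<in> Hom C (Src C v) Q" "?E k \<cdot> z = z" "X \<cdot> z = snd k \<cdot> v" using v by (auto simp: V_def)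
        have uv: "u \<in> Hom C (Src C v) (fst k)" "v \<in> Hom C (Src C v) (fst k)" "Src C v \<in> A"
          using u v s kO by (auto simp: V_def Hom_iff)
        have "?E k \<cdot> (y \<oplus> z) = y \<oplus> z" using Comp_Add[OF y(1) z(1) Er] y(2) z(2) by simp
        moreover have "X \<cdot> (y \<oplus> z) = snd k \<cdot> (u \<oplus> v)"
          using Comp_Add[OF y(1) z(1) X(1)] Comp_Add[OF uv(1,2) kA(2)] y(3) z(3) by simp
        ultimately show ?thesis unfolding V_def using Add_Hom[OF y(1) z(1)] uv by (auto simp: Hom_iff)
      qed
      show "v \<cdot> f \<in> V k" if v: "v \<in> V k" and f: "f \<in> Arr C" "Tgt C f = Src C v \<and> Src C f \<in> A" for v f
      proof -
        obtain z where z: "z \<in> Hom C (Src C v) Q" "?E k \<cdot> z = z" "X \<cdot> z = snd k \<cdot> v" using v by (auto simp: V_def)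
        have vH: "v \<in> Hom C (Src C v) (fst k)" using v kO by (auto simp: V_def Hom_iff)
        have fH: "f \<in> Hom C (Src C f) (Src C v)" using f by (auto simp: Hom_def)
        have "?E k \<cdot> (z \<cdot> f) = z \<cdot> f" using Comp_assoc[OF fH z(1) Er, of "below k"] z(2) by simp
        moreover have "X \<cdot> (z \<cdot> f) = snd k \<cdot> (v \<cdot> f)"
          using Comp_assoc[OF fH z(1) X(1)] Comp_assoc[OF fH vH kA(2)] z(3) by simp
        ultimately show ?thesis unfolding V_def using Comp_Hom[OF fH z(1)] vH fH f by (auto simp: Hom_iff)
      qed
    qed (auto simp: V_def)
  qed
  have "\<exists>e. e \<in> V k \<and> e \<in> Hom C (fst k) (fst k) \<and> (\<forall>v\<in>V k. e \<cdot> v = v)" if k: "k \<in> K" for k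
    using right_ideal_idempotent[OF KA(1)[OF k] V[OF k]] by metis
  then obtain e where e: "\<And>k. k \<in> K \<Longrightarrow> e k \<in> V k" "\<And>k. k \<in> K \<Longrightarrow> e k \<in> Hom C (fst k) (fst k)"
    "\<And>k v. k \<in> K \<Longrightarrow> v \<in> V k \<Longrightarrow> e k \<cdot> v = v" by metis
  \<comment> \<open>The summand \<open>P\<close> of \<open>Q\<close> is the image of the idempotent \<open>E\<close> with diagonal entries \<open>c k = 1 - e k\<close>.\<close>
  define c where "c k = Ident C (fst k) \<ominus> e k" for k
  have kO: "fst k \<in> Ob C" if "k \<in> K" for k using KA(1)[OF that] by simp
  have c: "c k \<in> Hom C (fst k) (fst k)" if k: "k \<in> K" for k
    unfolding c_def by (rule diff_Hom[OF Ident_Hom[OF kO[OF k]] e(2)[OF k]])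
  have ec: "e k \<cdot> c k = \<zero> (fst k) (fst k)" if k: "k \<in> K" for k
  proof -
    have "e k \<cdot> c k = e k \<ominus> (e k \<cdot> e k)" unfolding c_def using e(2)[OF k] kO[OF k] by (simp add: Hom_iff)
    then show ?thesis using e(3)[OF k e(1)[OF k]] diff_self[OF e(2)[OF k]] by simp
  qed
  have cc: "c k \<cdot> c k = c k" if k: "k \<in> K" for k
  proof -
    have "(Ident C (fst k) \<ominus> e k) \<cdot> c k = c k \<ominus> (e k \<cdot> c k)"
      using e(2)[OF k] kO[OF k] c[OF k] by (simp add: Hom_iff)
    then have "c k \<cdot> c k = c k \<ominus> (e k \<cdot> c k)" by (simp only: c_def[symmetric])
    then show ?thesis unfolding ec[OF k] using diff_Zero[OF c[OF k]] by simp
  qed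
  have \<iota>c: "\<And>k. k \<in> K \<Longrightarrow> \<iota> k \<cdot> c k \<in> Hom C (fst k) Q" using Comp_Hom[OF c \<iota>] .
  define E where "E = copair K Q \<iota> Q (\<lambda>k. \<iota> k \<cdot> c k)"
  have E: "E \<in> Hom C Q Q" "\<And>k. k \<in> K \<Longrightarrow> E \<cdot> \<iota> k = \<iota> k \<cdot> c k"
    unfolding E_def using copair_Hom[OF cop Q \<iota>c] copair_Comp[OF cop Q \<iota>c] by auto
  have E\<iota>c: "E \<cdot> (\<iota> k \<cdot> c k) = \<iota> k \<cdot> c k" if k: "k \<in> K" for k
    using Comp_assoc[OF c[OF k] \<iota>[OF k] E(1)] E(2)[OF k] Comp_assoc[OF c[OF k] c[OF k] \<iota>[OF k]] cc[OF k] by simp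
  have EE: "E \<cdot> E = E"
  proof (rule coproduct_eqI[OF cop Comp_Hom[OF E(1) E(1)] E(1)])
    fix k assume k: "k \<in> K"
    show "(E \<cdot> E) \<cdot> \<iota> k = E \<cdot> \<iota> k" using Comp_assoc[OF \<iota>[OF k] E(1) E(1)] E(2)[OF k] E\<iota>c[OF k] by simp
  qed
  have \<pi>E: "?\<pi> k \<cdot> E = c k \<cdot> ?\<pi> k" if k: "k \<in> K" for k
  proof (rule coproduct_eqI[OF cop Comp_Hom[OF E(1) \<pi>[OF k]] Comp_Hom[OF \<pi>[OF k] c[OF k]]])
    fix l assume l: "l \<in> K"
    have 1: "(?\<pi> k \<cdot> E) \<cdot> \<iota> l = (?\<pi> k \<cdot> \<iota> l) \<cdot> c l"
      using Comp_assoc[OF \<iota>[OF l] E(1) \<pi>[OF k]] E(2)[OF l] Comp_assoc[OF c[OF l] \<iota>[OF l] \<pi>[OF k]] by simp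
    have 2: "(c k \<cdot> ?\<pi> k) \<cdot> \<iota> l = c k \<cdot> (?\<pi> k \<cdot> \<iota> l)" using Comp_assoc[OF \<iota>[OF l] \<pi>[OF k] c[OF k]] .
    show "(?\<pi> k \<cdot> E) \<cdot> \<iota> l = (c k \<cdot> ?\<pi> k) \<cdot> \<iota> l"
    proof (cases "l = k")
      case True
      then show ?thesis unfolding 1 2 using cproj_same[OF cop k] Ident_Comp[OF c[OF k]] Comp_Ident[OF c[OF k]] by simp
    next
      case False
      then show ?thesis unfolding 1 2 cproj_other[OF cop k l False] using c[OF k] c[OF l] kO[OF k] kO[OF l] by (simp add: Hom_iff)
    qed
  qed
  have span: "k \<in> K \<longrightarrow> (\<exists>z\<in>Hom C (fst k) Q. E \<cdot> z = z \<and> X \<cdot> z = snd k)" for k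
  proof (induction k rule: wf_induct_rule[OF wf])
    case (1 k)
    show ?case
    proof
      assume k: "k \<in> K"
      have "\<exists>z. z \<in> Hom C (fst l) Q \<and> E \<cdot> z = z \<and> (l \<in> below k \<longrightarrow> X \<cdot> z = snd l)" if l: "l \<in> K" for l
      proof (cases "l \<in> below k")
        case True
        then show ?thesis using 1[of l] l unfolding below_def by blast
      next
        case False
        then show ?thesis using Zero_Hom[OF kO[OF l] Q] E(1) kO[OF l]
          by (intro exI[of _ "\<zero> (fst l) Q"]) (simp add: Hom_iff)
      qed
      then obtain z where z: "\<And>l. l \<in> K \<Longrightarrow> z l \<in> Hom C (fst l) Q" "\<And>l. l \<in> K \<Longrightarrow> E \<cdot> z l = z l"
        "\<And>l. l \<in> K \<Longrightarrow> l \<in> below k \<Longrightarrow> X \<cdot> z l = snd l" by metis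
      define Z where "Z = copair K Q \<iota> Q z"
      have Z: "Z \<in> Hom C Q Q" "\<And>l. l \<in> K \<Longrightarrow> Z \<cdot> \<iota> l = z l"
        unfolding Z_def using copair_Hom[OF cop Q z(1)] copair_Comp[OF cop Q z(1)] by auto
      have EZ: "E \<cdot> Z = Z"
      proof (rule coproduct_eqI[OF cop Comp_Hom[OF Z(1) E(1)] Z(1)])
        fix l assume l: "l \<in> K"
        show "(E \<cdot> Z) \<cdot> \<iota> l = Z \<cdot> \<iota> l" using Comp_assoc[OF \<iota>[OF l] Z(1) E(1)] Z(2)[OF l] z(2)[OF l] by simp
      qed
      have XZ: "(X \<cdot> Z) \<cdot> ?E k = X \<cdot> ?E k"
      proof (rule coproduct_eqI[OF cop Comp_Hom[OF Er Comp_Hom[OF Z(1) X(1)]] Comp_Hom[OF Er X(1)]])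
        fix l assume l: "l \<in> K"
        have 2: "((X \<cdot> Z) \<cdot> ?E k) \<cdot> \<iota> l = X \<cdot> (Z \<cdot> (?E k \<cdot> \<iota> l))" "(X \<cdot> ?E k) \<cdot> \<iota> l = X \<cdot> (?E k \<cdot> \<iota> l)"
          using X(1) Z(1) Er[of "below k"] \<iota>[OF l] by (simp_all add: Hom_iff)
        show "((X \<cdot> Z) \<cdot> ?E k) \<cdot> \<iota> l = (X \<cdot> ?E k) \<cdot> \<iota> l"
          unfolding 2 using restr_in[OF cop l, of "below k"] restr_notin[OF cop l, of "below k"] Z(2)[OF l] z(3)[OF l]
            X(2)[OF l] X(1) Z(1) kO[OF l] Q by (cases "l \<in> below k") (simp_all add: Hom_iff)
      qed
      have eH: "e k \<in> Hom C (fst k) (fst k)" and "e k \<in> V k" using e[OF k] by auto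
      then obtain y where y: "y \<in> Hom C (fst k) Q" "?E k \<cdot> y = y" "X \<cdot> y = snd k \<cdot> e k"
        by (auto simp: V_def Hom_iff)
      have Zy: "Z \<cdot> y \<in> Hom C (fst k) Q" using Comp_Hom[OF y(1) Z(1)] .
      have "E \<cdot> (Z \<cdot> y) = Z \<cdot> y" using Comp_assoc[OF y(1) Z(1) E(1)] EZ by simp
      then have Ez: "E \<cdot> ((Z \<cdot> y) \<oplus> (\<iota> k \<cdot> c k)) = (Z \<cdot> y) \<oplus> (\<iota> k \<cdot> c k)"
        using Comp_Add[OF Zy \<iota>c[OF k] E(1)] E\<iota>c[OF k] by simp
      have "X \<cdot> (Z \<cdot> y) = ((X \<cdot> Z) \<cdot> ?E k) \<cdot> y"
        using Comp_assoc[OF y(1) Z(1) X(1)] Comp_assoc[OF y(1) Er Comp_Hom[OF Z(1) X(1)]] y(2) by simp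
      also have "\<dots> = snd k \<cdot> e k" unfolding XZ using Comp_assoc[OF y(1) Er X(1)] y(2,3) by simp
      finally have XZy: "X \<cdot> (Z \<cdot> y) = snd k \<cdot> e k" .
      note x = KA(2)[OF k]
      have xe: "snd k \<cdot> e k \<in> Hom C (fst k) M" using Comp_Hom[OF eH x] .
      have "X \<cdot> (\<iota> k \<cdot> c k) = snd k \<cdot> c k" using Comp_assoc[OF c[OF k] \<iota>[OF k] X(1)] X(2)[OF k] by simp
      also have "\<dots> = snd k \<ominus> (snd k \<cdot> e k)" unfolding c_def using x eH kO[OF k] by (simp add: Hom_iff)
      finally have "X \<cdot> ((Z \<cdot> y) \<oplus> (\<iota> k \<cdot> c k)) = (snd k \<cdot> e k) \<oplus> (snd k \<ominus> (snd k \<cdot> e k))"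
        using Comp_Add[OF Zy \<iota>c[OF k] X(1)] XZy by simp
      also have "\<dots> = snd k" using diff_add[OF x xe] group_laws(1)[OF xe diff_Hom[OF x xe]] by simp
      finally show "\<exists>z\<in>Hom C (fst k) Q. E \<cdot> z = z \<and> X \<cdot> z = snd k"
        using Ez Add_Hom[OF Zy \<iota>c[OF k]] by blast
    qed
  qed
  obtain P \<pi>' \<rho> where P: "\<pi>' \<in> Hom C P Q" "\<rho> \<in> Hom C Q P" "\<rho> \<cdot> \<pi>' = Ident C P" "\<pi>' \<cdot> \<rho> = E"
    using idempotent_splits[OF E(1) EE] .
  have PO: "P \<in> Ob C" using P(1) Hom_Ob by blast
  define \<psi> where "\<psi> = X \<cdot> \<pi>'"
  have \<psi>: "\<psi> \<in> Hom C P M" unfolding \<psi>_def using Comp_Hom[OF P(1) X(1)] .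
  have retr: "is_retract C P Q" unfolding is_retract_def using P PO Q by blast
  have Qc: "Q \<in> cells A" by (rule cellsI[OF K KA(1) cop])
  have surj: "\<exists>x\<in>Hom C a P. \<psi> \<cdot> x = f" if a: "a \<in> A" and f: "f \<in> Hom C a M" for a f
  proof -
    obtain b where b: "b \<in> R" "isomorphic C a b" using R(3)[OF a] by blast
    obtain \<alpha> \<beta> where \<alpha>\<beta>: "\<alpha> \<in> Hom C a b" "\<beta> \<in> Hom C b a" "\<beta> \<cdot> \<alpha> = Ident C a" using b(2) by (rule isomorphicE)
    have "(b, f \<cdot> \<beta>) \<in> K" using b(1) Comp_Hom[OF \<alpha>\<beta>(2) f] by (simp add: K_def)
    then obtain z where z: "z \<in> Hom C b Q" "E \<cdot> z = z" "X \<cdot> z = f \<cdot> \<beta>" using span[of "(b, f \<cdot> \<beta>)"] by auto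
    have "\<psi> \<cdot> (\<rho> \<cdot> (z \<cdot> \<alpha>)) = X \<cdot> (((\<pi>' \<cdot> \<rho>) \<cdot> z) \<cdot> \<alpha>)"
      unfolding \<psi>_def using X(1) P(1,2) z(1) \<alpha>\<beta>(1) by (simp add: Hom_iff)
    also have "\<dots> = (X \<cdot> z) \<cdot> \<alpha>" unfolding P(4) z(2) using Comp_assoc[OF \<alpha>\<beta>(1) z(1) X(1)] by simp
    also have "\<dots> = f" unfolding z(3) Comp_assoc[OF \<alpha>\<beta>(1,2) f] \<alpha>\<beta>(3) using Comp_Ident[OF f] .
    finally show ?thesis using Comp_Hom[OF Comp_Hom[OF \<alpha>\<beta>(1) z(1)] P(2)] by blast
  qed
  have inj: "x = \<zero> a P" if a: "a \<in> A" and x: "x \<in> Hom C a P" and 0: "\<psi> \<cdot> x = \<zero> a M" for a x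
  proof -
    have ac: "a \<in> compacts" and aO: "a \<in> Ob C" using a A_compact by auto
    define y where "y = \<pi>' \<cdot> x"
    have y: "y \<in> Hom C a Q" unfolding y_def using Comp_Hom[OF x P(1)] .
    have \<rho>y: "\<rho> \<cdot> y = x" unfolding y_def using Comp_assoc[OF x P(1,2)] P(3) Ident_Comp[OF x] by simp
    have Ey: "E \<cdot> y = y" using Comp_assoc[OF y P(2,1)] \<rho>y P(4) by (simp add: y_def)
    have Xy: "X \<cdot> y = \<zero> a M" using 0 Comp_assoc[OF x P(1) X(1)] by (simp add: \<psi>_def y_def)
    have "y = \<zero> a Q"
    proof (rule ccontr)
      assume ny: "y \<noteq> \<zero> a Q"
      \<comment> \<open>The last nonzero component \<open>v\<close> of \<open>y\<close> satisfies \<open>e v = v\<close> as \<open>X y = 0\<close>, and \<open>e v = 0\<close> as \<open>E y = y\<close>.\<close>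
      define D where "D = {k \<in> K. ?\<pi> k \<cdot> y \<noteq> \<zero> a (fst k)}"
      have "finite D" unfolding D_def by (rule finite_support[OF ac K cop y])
      moreover have "D \<noteq> {}" using compact_eq_Zero[OF ac K cop y] ny unfolding D_def by blast
      ultimately obtain k where kD: "k \<in> D" and max: "\<And>l. l \<in> D \<Longrightarrow> (l, k) \<in> r"
        using finite_has_maximum[OF r] by metis
      have k: "k \<in> K" and nk: "?\<pi> k \<cdot> y \<noteq> \<zero> a (fst k)" using kD by (auto simp: D_def)
      have kb: "k \<notin> below k" by (simp add: below_def)
      have "restr K fst Q \<iota> (insert k (below k)) \<cdot> y = y"
      proof (rule compact_restr_eq[OF ac K cop y])
        fix l assume "l \<in> K" "l \<notin> insert k (below k)"
        then show "?\<pi> l \<cdot> y = \<zero> a (fst l)" using max[of l] unfolding D_def below_def by auto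
      qed
      then have yd: "y = (?E k \<cdot> y) \<oplus> (\<iota> k \<cdot> (?\<pi> k \<cdot> y))"
        unfolding restr_insert[OF cop k kb] using y Er[of "below k"] \<iota>[OF k] \<pi>[OF k] by (simp add: Hom_iff)
      let ?v = "?\<pi> k \<cdot> y"
      have v: "?v \<in> Hom C a (fst k)" using Comp_Hom[OF y \<pi>[OF k]] .
      have Ey': "?E k \<cdot> y \<in> Hom C a Q" using Comp_Hom[OF y Er] .
      have "X \<cdot> y = (X \<cdot> (?E k \<cdot> y)) \<oplus> (snd k \<cdot> ?v)"
        using Comp_Add[OF Ey' Comp_Hom[OF v \<iota>[OF k]] X(1)] yd Comp_assoc[OF v \<iota>[OF k] X(1)] X(2)[OF k] by simp
      then have "snd k \<cdot> ?v = neg (X \<cdot> (?E k \<cdot> y))"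
        using neg_unique[OF Comp_Hom[OF Ey' X(1)] Comp_Hom[OF v KA(2)[OF k]]] Xy by simp
      then have "X \<cdot> neg (?E k \<cdot> y) = snd k \<cdot> ?v" using X(1) Ey' by (simp add: Hom_iff)
      moreover have "?E k \<cdot> neg (?E k \<cdot> y) = neg (?E k \<cdot> y)"
      proof -
        have "?E k \<cdot> (?E k \<cdot> y) = ?E k \<cdot> y" using Comp_assoc[OF y Er Er, of "below k" "below k"] restr_restr[OF cop, of "below k" "below k"] by simp
        then show ?thesis using Ey' Er[of "below k"] by (simp add: Hom_iff)
      qed
      ultimately have "?v \<in> V k" unfolding V_def using v a neg_Hom[OF Ey'] by (auto simp: Hom_iff)
      then have ev: "e k \<cdot> ?v = ?v" by (rule e(3)[OF k])
      have "c k \<cdot> ?v = ?\<pi> k \<cdot> (E \<cdot> y)"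
        using Comp_assoc[OF y E(1) \<pi>[OF k]] Comp_assoc[OF y \<pi>[OF k] c[OF k]] \<pi>E[OF k] by simp
      then have cv: "c k \<cdot> ?v = ?v" unfolding Ey .
      have "(e k \<cdot> c k) \<cdot> ?v = ?v" using Comp_assoc[OF v c[OF k] e(2)[OF k]] cv ev by simp
      then have "?v = \<zero> a (fst k)" unfolding ec[OF k] using v kO[OF k] by (simp add: Hom_iff)
      then show False using nk by simp
    qed
    then show ?thesis using \<rho>y P(2) aO by (simp add: Hom_iff)
  qed
  show thesis by (rule that[OF \<psi> Qc retr surj inj])
qed

end

section \<open>Adjacency of the weight structure and the t-structure\<close>

locale semisimple_negative = semisimple_generators \<kappa> C A
  for \<kappa> :: "'u rel" and C :: "('o, 'm, 'z) triangulated_category_scheme" (structure) and A :: "'o set" +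
  assumes A_perp: "perp C A (shifts C {..<0} A)"
begin

lemma A_orth_neg: 
  assumes "a \<in> A" "b \<in> A" "m < n" shows "orth (shift C n a) (shift C m b)"
proof -
  have "shift C (m - n) b \<in> shifts C {..<0} A" using assms by (auto simp: shifts_def)
  then have "orth a (shift C (m - n) b)" using A_perp assms(1) by (simp add: perp_orth)
  then have "orth (shift C n a) (shift C n (shift C (m - n) b))" using orth_shift[of a "shift C (m - n) b" n] assms by simp
  then show ?thesis using assms by (simp add: shift_add)
qed

text \<open>
  Objects of \<open>wle\<close> are direct summands of objects with cells \<open>A[i]\<close>, \<open>i \<le> 0\<close>, and compact objects \<open>A[n]\<close> with
  \<open>n > 0\<close> have no maps to such cells.
\<close>

lemma wle_subset_tle: "wle \<subseteq> tle"
proof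
  fix M assume M: "M \<in> wle"
  then have MO: "M \<in> Ob C" using left_perp_Ob by blast
  obtain L R f g h where L: "L \<in> cellular (shifts C {..0} A)" and R: "R \<in> right_perp C (shifts C {..0} A)"
    and t: "triangle C L M R f g h" using decomposition[OF MO] .
  have "orth M R" using M R by (simp add: left_perp_def)
  then have "is_retract C M L" using triangle_section[OF t] orthD triangle_D(2)[OF t] by blast
  moreover have "orth (shift C n a) L" if "0 < n" "a \<in> A" for n a
  proof (rule compact_orth_cellular[OF _ _ L])
    show "shift C n a \<in> compacts" using that A_compact compact_shift by blast
    show "orth (shift C n a) g" if "g \<in> shifts C {..0} A" for g
      using that \<open>0 < n\<close> \<open>a \<in> A\<close> by (auto simp: shifts_def intro: A_orth_neg)
  qed
  ultimately show "M \<in> tle" using orth_retract(2) MO by (auto simp: right_perp_shifts[OF A_Ob])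
qed

text \<open>
  One step of killing the homology of an object \<open>M\<close> without homology in positive degrees: first
  that in negative degrees, then that in degree zero. It is here that semisimplicity is used: the kernel of
  \<open>P \<rightarrow> R\<close> on degree zero homology would otherwise reappear as new homology in degree one.
\<close>

lemma kill_homology:
  assumes M: "M \<in> tle"
  obtains M' j where "M' \<in> tle" "j \<in> Hom C M M'"
    "\<And>n a x. a \<in> A \<Longrightarrow> x \<in> Hom C (shift C n a) M \<Longrightarrow> j \<cdot> x = \<zero> (shift C n a) M'"
    "\<And>Y f. Y \<in> right_perp C (shifts C {..0} A) \<Longrightarrow> f \<in> Hom C M Y \<Longrightarrow> \<exists>f'\<in>Hom C M' Y. f = f' \<cdot> j"
proof -
  have MO: "M \<in> Ob C" using M by (simp add: right_perp_orth)
  have MH: "\<And>n a. 0 < n \<Longrightarrow> a \<in> A \<Longrightarrow> orth (shift C n a) M" using M by (simp add: right_perp_shifts[OF A_Ob])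
  obtain L R l p h where L: "L \<in> cellular (shifts C {..<0} A)" "L \<in> left_perp wge" and R: "R \<in> wge"
    and t: "triangle C L M R l p h" using decomposition[OF MO] .
  note tD = triangle_D[OF t] and tO = triangle_Ob[OF t]
  have LH: "orth (shift C n a) L" if "0 \<le> n" "a \<in> A" for n a
  proof (rule compact_orth_cellular[OF _ _ L(1)])
    show "shift C n a \<in> compacts" using that A_compact compact_shift by blast
    show "orth (shift C n a) g" if "g \<in> shifts C {..<0} A" for g
      using that \<open>0 \<le> n\<close> \<open>a \<in> A\<close> by (auto simp: shifts_def intro: A_orth_neg)
  qed
  have RH: "orth (shift C n a) R" if n: "n \<noteq> 0" and a: "a \<in> A" for n a
  proof (cases "n < 0")
    case True
    then show ?thesis using R a by (simp add: right_perp_shifts[OF A_Ob])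
  next
    case False
    have aO: "shift C n a \<in> Ob C" using a by simp
    have "orth (shift C (n - 1) a) L" by (rule LH) (use n False a in auto)
    then have "orth (shift C n a) (Shift C L)"
      using orth_Shift[of "shift C (n - 1) a" L] a tO by (simp add: Shift_shift)
    then show ?thesis using orth_triangle_right[OF triangle_rotate[OF t] aO] MH[of n a] n False a by simp
  qed
  obtain P Q \<psi> where \<psi>: "\<psi> \<in> Hom C P R" and Q: "Q \<in> cells A" "is_retract C P Q"
    and surj: "\<And>a f. a \<in> A \<Longrightarrow> f \<in> Hom C a R \<Longrightarrow> \<exists>x\<in>Hom C a P. \<psi> \<cdot> x = f"
    and inj: "\<And>a x. a \<in> A \<Longrightarrow> x \<in> Hom C a P \<Longrightarrow> \<psi> \<cdot> x = \<zero> a R \<Longrightarrow> x = \<zero> a P"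
    by (rule heart_cover[OF tO(3)]) (assumption | blast)+
  obtain R' q k where s: "triangle C P R R' \<psi> q k" using ex_cone[OF \<psi>] by blast
  note sD = triangle_D[OF s] and sO = triangle_Ob[OF s]
  have PH: "orth (shift C n a) P" if "0 < n" "a \<in> A" for n a
  proof (rule orth_retract(2)[OF Q(2)])
    show "orth (shift C n a) Q"
    proof (rule compact_orth_cells[OF _ _ Q(1)])
      show "shift C n a \<in> compacts" using that A_compact compact_shift by blast
      show "orth (shift C n a) b" if "b \<in> A" for b using A_orth_neg[OF \<open>a \<in> A\<close> that \<open>0 < n\<close>] by simp
    qed
  qed (use that in simp)
  have R'H: "orth (shift C n a) R'" if n: "0 < n" and a: "a \<in> A" for n a
  proof (rule orth_cone[OF s, of "shift C (n - 1) a"])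
    show "shift C (n - 1) a \<in> Ob C" "shift C n a = Shift C (shift C (n - 1) a)"
      using a by (simp_all add: Shift_shift)
    show "\<exists>z\<in>Hom C (shift C n a) P. \<psi> \<cdot> z = x" if "x \<in> Hom C (shift C n a) R" for x
      using orthD[OF RH[OF _ a] that] n a sO \<psi> by (intro bexI[OF _ Zero_Hom]) (auto simp: Hom_iff)
    show "z = \<zero> (shift C (n - 1) a) P"
      if "z \<in> Hom C (shift C (n - 1) a) P" "\<psi> \<cdot> z = \<zero> (shift C (n - 1) a) R" for z
    proof (cases "n = 1")
      case True
      then show ?thesis using inj[OF a] that by simp
    next
      case False
      then show ?thesis using orthD[OF PH[OF _ a] that(1)] n by simp
    qed
  qed
  then have R': "R' \<in> tle" using sO by (simp add: right_perp_shifts[OF A_Ob])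
  have kill: "(q \<cdot> p) \<cdot> x = \<zero> (shift C n a) R'" if a: "a \<in> A" and x: "x \<in> Hom C (shift C n a) M" for n a x
  proof -
    have aO: "shift C n a \<in> Ob C" using a by simp
    have px: "p \<cdot> x \<in> Hom C (shift C n a) R" using Comp_Hom[OF x tD(2)] .
    have "q \<cdot> (p \<cdot> x) = \<zero> (shift C n a) R'"
    proof (cases "n = 0")
      case True
      then obtain z where z: "z \<in> Hom C a P" "\<psi> \<cdot> z = p \<cdot> x" using surj[OF a, of "p \<cdot> x"] px by auto
      have "q \<cdot> (\<psi> \<cdot> z) = \<zero> a R'"
        using Comp_assoc[OF z(1) \<psi> sD(2)] triangle_Comp_Zero(1)[OF s] z(1) sO by (simp add: Hom_iff)
      then show ?thesis using z(2) True by simp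
    next
      case False
      then have "p \<cdot> x = \<zero> (shift C n a) R" using orthD[OF RH[OF _ a] px] by simp
      then show ?thesis using sD(2) aO by (simp add: Hom_iff)
    qed
    then show ?thesis using Comp_assoc[OF x tD(2) sD(2)] by simp
  qed
  have extend: "\<exists>f'\<in>Hom C R' Y. f = f' \<cdot> (q \<cdot> p)" if Y: "Y \<in> right_perp C (shifts C {..0} A)" and f: "f \<in> Hom C M Y" for Y f
  proof -
    have YO: "Y \<in> Ob C" using Y by (simp add: right_perp_orth)
    have "{..<0} \<subseteq> {..0::int}" by auto
    from right_perp_shifts_antimono[OF this] have "Y \<in> wge" using Y by blast
    then have "orth L Y" using L(2) by (simp add: left_perp_def)
    then have "f \<cdot> l = \<zero> L Y" using orthD Comp_Hom[OF tD(1) f] by blast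
    then obtain g where g: "g \<in> Hom C R Y" "f = g \<cdot> p" using triangle_extend1[OF t f] by blast
    have "a \<in> shifts C {..0} A" if "a \<in> A" for a
      using that unfolding shifts_def by (intro UN_I[of 0] image_eqI[of _ _ a]) auto
    then have "Y \<in> right_perp C A" using Y by (auto simp: right_perp_orth)
    then have "orth P Y" using orth_retract(1)[OF Q(2) cells_left_perp[OF Q(1)] YO] by blast
    then have "g \<cdot> \<psi> = \<zero> P Y" using orthD Comp_Hom[OF \<psi> g(1)] by blast
    then obtain f' where f': "f' \<in> Hom C R' Y" "g = f' \<cdot> q" using triangle_extend1[OF s g(1)] by blast
    then show ?thesis using g(2) Comp_assoc[OF tD(2) sD(2) f'(1)] by auto
  qed
  show thesis by (rule that[OF R' Comp_Hom[OF tD(2) sD(2)] kill extend])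
qed

text \<open>
  Killing homology repeatedly, a map from \<open>M\<close> to an object of \<open>wge[1]\<close> extends to a homotopy colimit
  without homology. This is zero, and so is the map.
\<close>

lemma tle_subset_wle: "tle \<subseteq> wle"
proof
  fix M assume M: "M \<in> tle"
  then have MO: "M \<in> Ob C" by (simp add: right_perp_orth)
  have "orth M Y" if Y: "Y \<in> right_perp C (shifts C {..0} A)" for Y
  proof (rule orthI[OF MO])
    show YO: "Y \<in> Ob C" using Y by (simp add: right_perp_orth)
    fix f assume f: "f \<in> Hom C M Y"
    define good where "good = (\<lambda>(X, f). X \<in> tle \<and> f \<in> Hom C X Y)"
    define kills where "kills = (\<lambda>(X, f) (X', f') j. j \<in> Hom C X X' \<and> f' \<cdot> j = f \<and>
      (\<forall>n. \<forall>a\<in>A. \<forall>x\<in>Hom C (shift C n a) X. j \<cdot> x = \<zero> (shift C n a) X'))"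
    have step: "\<exists>W. good W \<and> (\<exists>j. kills Z W j)" if "good Z" for Z
    proof -
      obtain X g where Z: "Z = (X, g)" by (cases Z)
      have X: "X \<in> tle" and g: "g \<in> Hom C X Y" using that by (auto simp: good_def Z)
      obtain X' j where X': "X' \<in> tle" and j: "j \<in> Hom C X X'"
        and k: "\<And>n a x. a \<in> A \<Longrightarrow> x \<in> Hom C (shift C n a) X \<Longrightarrow> j \<cdot> x = \<zero> (shift C n a) X'"
        and e: "\<And>Y f. Y \<in> right_perp C (shifts C {..0} A) \<Longrightarrow> f \<in> Hom C X Y \<Longrightarrow> \<exists>f'\<in>Hom C X' Y. f = f' \<cdot> j"
        using kill_homology[OF X] by metis
      obtain g' where g': "g' \<in> Hom C X' Y" "g = g' \<cdot> j" using e[OF Y g] by blast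
      have "good (X', g') \<and> kills Z (X', g') j" unfolding good_def kills_def Z using X' g' j k by simp
      then show ?thesis by blast
    qed
    have "\<exists>F. \<forall>n. (good (F n) \<and> (n = 0 \<longrightarrow> F n = (M, f))) \<and> (\<exists>j. kills (F n) (F (Suc n)) j)"
      by (rule dependent_nat_choice) (use M f step in \<open>auto simp: good_def\<close>)
    then obtain F where F: "\<And>n. good (F n)" "F 0 = (M, f)" "\<And>n. \<exists>j. kills (F n) (F (Suc n)) j" by blast
    then obtain j where j: "\<And>n. kills (F n) (F (Suc n)) (j n)" by metis
    define X where "X n = fst (F n)" for n
    define \<phi> where "\<phi> n = snd (F n)" for n
    have FX: "F n = (X n, \<phi> n)" for n by (simp add: X_def \<phi>_def)
    have jX: "j n \<in> Hom C (X n) (X (Suc n))" "\<phi> (Suc n) \<cdot> j n = \<phi> n"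
      "\<And>m a x. a \<in> A \<Longrightarrow> x \<in> Hom C (shift C m a) (X n) \<Longrightarrow> j n \<cdot> x = \<zero> (shift C m a) (X (Suc n))" for n
      using j[of n] unfolding FX kills_def by auto
    have \<phi>: "\<phi> n \<in> Hom C (X n) Y" for n using F(1)[of n] unfolding FX good_def by auto
    obtain T u where hc: "is_hocolim X j T u" using ex_hocolim[of j X, OF jX(1)] .
    note T = hocolim_Ob[OF hc] and u = hocolim_Hom[OF hc] and uj = hocolim_compat[OF hc]
    have "orth (shift C n a) T" if a: "a \<in> A" for n a
    proof (rule orthI[OF _ T])
      show aO: "shift C n a \<in> Ob C" using a by simp
      have ac: "shift C n a \<in> compacts" using a A_compact compact_shift by blast
      fix x assume "x \<in> Hom C (shift C n a) T"
      then obtain k y where y: "y \<in> Hom C (shift C n a) (X k)" "x = u k \<cdot> y" using hocolim_compact[OF hc ac] by blast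
      have "x = u (Suc k) \<cdot> (j k \<cdot> y)" using y(2) uj[of k] Comp_assoc[OF y(1) jX(1) u] by simp
      then show "x = \<zero> (shift C n a) T" unfolding jX(3)[OF a y(1)] using u[of "Suc k"] aO by (simp add: Hom_iff)
    qed
    then have T0: "zero_object C T" by (rule zero_objectI[OF T])
    obtain g where g: "g \<in> Hom C T Y" "\<And>k. g \<cdot> u k = \<phi> k"
      using hocolim_extend[OF hc YO \<phi> jX(2)] by blast
    have "f = g \<cdot> u 0" using g(2)[of 0] F(2) by (simp add: \<phi>_def)
    then have "f = \<zero> (X 0) Y" unfolding from_zero_object[OF T0 g(1)] using u[of 0] YO by (simp add: Hom_iff)
    then show "f = \<zero> M Y" using F(2) by (simp add: X_def)
  qed
  then show "M \<in> wle" using MO by (simp add: left_perp_def)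
qed

lemma wle_eq_tle: "wle = tle"
  using wle_subset_tle tle_subset_wle by blast

end

section \<open>Restriction to small objects\<close>

context compactly_generated begin

text \<open>
  The cone \<open>W\<close> is the coproduct of the \<open>R i\<close>, but it is quicker not to identify it: maps from a compact
  object to the coproducts have finitely many components, and each component lifts along \<open>l i\<close>.
\<close>

lemma coproduct_cone_right_perp:
  assumes G: "G \<subseteq> compacts" and I: "small \<kappa> I"
    and N: "is_coproduct C I N S \<iota>" and L: "is_coproduct C I L S' \<iota>'"
    and t: "\<And>i. i \<in> I \<Longrightarrow> triangle C (L i) (N i) (R i) (l i) (p i) (h i)"
    and R: "\<And>i. i \<in> I \<Longrightarrow> R i \<in> right_perp C G"
    and \<mu>: "\<mu> \<in> Hom C S' S" "\<And>i. i \<in> I \<Longrightarrow> \<mu> \<cdot> \<iota>' i = \<iota> i \<cdot> l i"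
    and s: "triangle C S' S W \<mu> q k"
  shows "W \<in> right_perp C G"
proof -
  note D = triangle_D[OF t] and Ob = triangle_Ob[OF t] and \<iota> = coproduct_D(3)[OF N] and \<iota>' = coproduct_D(3)[OF L]
  note SO = coproduct_D(1)[OF N] coproduct_D(1)[OF L]
  have gR: "orth g (R i)" if "g \<in> G" "i \<in> I" for g i using R that by (simp add: right_perp_orth)
  have \<pi>\<mu>: "cproj I N S \<iota> i \<cdot> \<mu> = l i \<cdot> cproj I L S' \<iota>' i" if i: "i \<in> I" for i
  proof (rule coproduct_eqI[OF L])
    note \<pi> = cproj_Hom[OF N i] and \<pi>' = cproj_Hom[OF L i] and li = D(1)[OF i]
    show "cproj I N S \<iota> i \<cdot> \<mu> \<in> Hom C S' (N i)" "l i \<cdot> cproj I L S' \<iota>' i \<in> Hom C S' (N i)"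
      using Comp_Hom[OF \<mu>(1) \<pi>] Comp_Hom[OF \<pi>' li] .
    fix m assume m: "m \<in> I"
    have 1: "(cproj I N S \<iota> i \<cdot> \<mu>) \<cdot> \<iota>' m = (cproj I N S \<iota> i \<cdot> \<iota> m) \<cdot> l m"
      using Comp_assoc[OF \<iota>'[OF m] \<mu>(1) \<pi>] \<mu>(2)[OF m] Comp_assoc[OF D(1)[OF m] \<iota>[OF m] \<pi>] by simp
    have 2: "(l i \<cdot> cproj I L S' \<iota>' i) \<cdot> \<iota>' m = l i \<cdot> (cproj I L S' \<iota>' i \<cdot> \<iota>' m)"
      using Comp_assoc[OF \<iota>'[OF m] \<pi>' li] .
    show "(cproj I N S \<iota> i \<cdot> \<mu>) \<cdot> \<iota>' m = (l i \<cdot> cproj I L S' \<iota>' i) \<cdot> \<iota>' m"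
    proof (cases "m = i")
      case True
      then show ?thesis unfolding 1 2
        using cproj_same[OF N i] cproj_same[OF L i] Ident_Comp[OF li] Comp_Ident[OF li] by simp
    next
      case False
      then show ?thesis unfolding 1 2 cproj_other[OF N i m False] cproj_other[OF L i m False]
        using li D(1)[OF m] Ob(1,2)[OF i] Ob(1,2)[OF m] by (simp add: Hom_iff)
    qed
  qed
  have "orth g W" if g: "g \<in> G" for g
  proof -
    have gc: "g \<in> compacts" and gO: "g \<in> Ob C" using g G compact_Ob by auto
    obtain g' where g': "g' \<in> Ob C" "g = Shift C g'" using Shift_obtain[OF gO] .
    have g'c: "g' \<in> compacts" using gc g' compact_Shift_iff by simp
    show ?thesis
    proof (rule orth_cone[OF s g'])
      fix x assume x: "x \<in> Hom C g S"
      let ?r = "restr I N S \<iota>"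
      have "\<exists>z\<in>Hom C g S'. \<mu> \<cdot> z = ?r J \<cdot> x" if "finite J" "J \<subseteq> I" for J using that
      proof (induction J)
        case empty
        then show ?case
          using x \<mu>(1) SO by (intro bexI[OF _ Zero_Hom[OF gO SO(2)]]) (simp add: restr_empty[OF N] Hom_iff)
      next
        case (insert i J)
        then obtain z where z: "z \<in> Hom C g S'" "\<mu> \<cdot> z = ?r J \<cdot> x" by blast
        have i: "i \<in> I" using insert by blast
        note \<pi> = cproj_Hom[OF N i]
        have \<pi>x: "cproj I N S \<iota> i \<cdot> x \<in> Hom C g (N i)" using Comp_Hom[OF x \<pi>] .
        have "p i \<cdot> (cproj I N S \<iota> i \<cdot> x) = \<zero> g (R i)"
          by (rule orthD[OF gR[OF g i] Comp_Hom[OF \<pi>x D(2)[OF i]]])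
        then obtain w where w: "w \<in> Hom C g (L i)" "cproj I N S \<iota> i \<cdot> x = l i \<cdot> w"
          using triangle_lift1[OF t[OF i] \<pi>x] by blast
        have iw: "\<iota>' i \<cdot> w \<in> Hom C g S'" using Comp_Hom[OF w(1) \<iota>'[OF i]] .
        have "\<mu> \<cdot> (z \<oplus> (\<iota>' i \<cdot> w)) = (?r J \<cdot> x) \<oplus> (\<iota> i \<cdot> (l i \<cdot> w))"
          using Comp_Add[OF z(1) iw \<mu>(1)] z(2) Comp_assoc[OF w(1) \<iota>'[OF i] \<mu>(1)] \<mu>(2)[OF i]
            Comp_assoc[OF w(1) D(1)[OF i] \<iota>[OF i]] by simp
        also have "\<dots> = ?r (insert i J) \<cdot> x"
          unfolding restr_insert[OF N i insert(2)] w(2)[symmetric]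
          using restr_Hom[OF N, of J] x \<pi> \<iota>[OF i] by (simp add: Hom_iff)
        finally show ?case using Add_Hom[OF z(1) iw] by blast
      qed
      moreover obtain J where "J \<subseteq> I" "finite J" "?r J \<cdot> x = x" using compactD[OF gc I N x] .
      ultimately show "\<exists>z\<in>Hom C g S'. \<mu> \<cdot> z = x" by metis
    next
      fix z assume z: "z \<in> Hom C g' S'" and 0: "\<mu> \<cdot> z = \<zero> g' S"
      show "z = \<zero> g' S'"
      proof (rule compact_eq_Zero[OF g'c I L z])
        fix i assume i: "i \<in> I"
        let ?z = "cproj I L S' \<iota>' i \<cdot> z"
        note \<pi>' = cproj_Hom[OF L i] and \<pi> = cproj_Hom[OF N i] and li = D(1)[OF i] and hi = D(3)[OF i]
        have z': "?z \<in> Hom C g' (L i)" using Comp_Hom[OF z \<pi>'] .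
        have "l i \<cdot> ?z = cproj I N S \<iota> i \<cdot> (\<mu> \<cdot> z)"
          using Comp_assoc[OF z \<pi>' li] Comp_assoc[OF z \<mu>(1) \<pi>] \<pi>\<mu>[OF i] by simp
        then have "l i \<cdot> ?z = \<zero> g' (N i)" using 0 \<pi> g' by (simp add: Hom_iff)
        then have "ShiftA C (l i) \<cdot> ShiftA C ?z = \<zero> (Shift C g') (Shift C (N i))"
          using ShiftA_Comp[OF z' li] g' Ob(2)[OF i] by simp
        then obtain w where w: "w \<in> Hom C (Shift C g') (R i)" "ShiftA C ?z = h i \<cdot> w"
          using triangle_lift3[OF t[OF i] ShiftA_Hom[OF z']] by blast
        have "w = \<zero> (Shift C g') (R i)" using orthD[OF gR[OF g i]] w(1) g' by simp
        then have "ShiftA C ?z = \<zero> (Shift C g') (Shift C (L i))" using w(2) hi g' by (simp add: Hom_iff)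
        then show "?z = \<zero> g' (L i)" using ShiftA_eq_Zero[OF z'] by simp
      qed
    qed
  qed
  then show ?thesis using triangle_Ob(3)[OF s] by (simp add: right_perp_orth)
qed

end

context semisimple_negative begin

lemma tle_unshift: "left_perp (right_perp C (shifts C {..-1} A)) = right_perp C (shifts C {0..} A)"
proof -
  have "x \<in> (\<lambda>n. n + - 1) ` {..0}" if "x \<le> - 1" for x :: int
    using that by (intro image_eqI[of _ _ "x + 1"]) auto
  then have e: "{..-1} = (\<lambda>n. n + - 1) ` {..(0::int)}" by auto
  show ?thesis unfolding shift_left_right_perp[OF e, symmetric] wle_eq_tle shift_tle ..
qed

text \<open>
  The truncation \<open>R\<close> of a small object \<open>M\<close> is small: since \<open>R\<close> lies in a shift of \<open>wle\<close>, a map from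
  \<open>R\<close> to a coproduct of objects \<open>N i\<close> lifts to the coproduct of their weight truncations; these lie in the
  same shift of \<open>tle\<close>, and maps from \<open>R\<close> to such objects are determined by their composites with \<open>M \<rightarrow> R\<close>.
\<close>

lemma truncation_small:
  fixes \<alpha> :: "'c rel"
  assumes \<alpha>: "Card_order \<alpha>" "infinite (Field \<alpha>)" and M: "M \<in> small_objects \<kappa> \<alpha> C"
    and T: "T \<in> tge" and R: "R \<in> right_perp C (shifts C {0..} A)" and t: "triangle C T M R a b d"
  shows "R \<in> small_objects \<kappa> \<alpha> C"
proof (rule small_objectI[OF \<alpha> triangle_Ob(3)[OF t]])
  fix I :: "'u set" and N S \<iota> f
  assume I: "small \<kappa> I" and N: "is_coproduct C I N S \<iota>" and f: "f \<in> Hom C R S"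
  let ?G = "shifts C {..-1} A"
  note b = triangle_D(2)[OF t] and d = triangle_D(3)[OF t] and \<iota> = coproduct_D(3)[OF N] and S = coproduct_D(1)[OF N]
  have "\<exists>L Q l p h. L \<in> left_perp (right_perp C ?G) \<and> Q \<in> right_perp C ?G \<and> triangle C L (N i) Q l p h" if i: "i \<in> I" for i
  proof -
    obtain L Q l p h where "L \<in> left_perp (right_perp C ?G)" "Q \<in> right_perp C ?G" "triangle C L (N i) Q l p h"
      using decomposition[OF coproduct_D(2)[OF N i], of "{..-1}"] .
    then show ?thesis by blast
  qed
  then obtain L Q l p h where L: "\<And>i. i \<in> I \<Longrightarrow> L i \<in> left_perp (right_perp C ?G)"
    and Q: "\<And>i. i \<in> I \<Longrightarrow> Q i \<in> right_perp C ?G" and ti: "\<And>i. i \<in> I \<Longrightarrow> triangle C (L i) (N i) (Q i) (l i) (p i) (h i)"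
    by metis
  obtain S' \<iota>' where cL: "is_coproduct C I L S' \<iota>'" using ex_coproduct[OF I triangle_Ob(1)[OF ti]] .
  note \<iota>' = coproduct_D(3)[OF cL] and li = triangle_D(1)[OF ti]
  define \<mu> where "\<mu> = copair I S' \<iota>' S (\<lambda>i. \<iota> i \<cdot> l i)"
  have \<mu>: "\<mu> \<in> Hom C S' S" "\<And>i. i \<in> I \<Longrightarrow> \<mu> \<cdot> \<iota>' i = \<iota> i \<cdot> l i"
    unfolding \<mu>_def using copair_Hom[OF cL S Comp_Hom[OF li \<iota>]] copair_Comp[OF cL S Comp_Hom[OF li \<iota>]] by auto
  obtain W q k where s: "triangle C S' S W \<mu> q k" using ex_cone[OF \<mu>(1)] by blast
  have W: "W \<in> right_perp C ?G" by (rule coproduct_cone_right_perp[OF shifts_compact I N cL ti Q \<mu> s])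
  have "R \<in> left_perp (right_perp C ?G)" using R unfolding tle_unshift .
  then have "orth R W" using W by (simp add: left_perp_def)
  then have "q \<cdot> f = \<zero> R W" using orthD Comp_Hom[OF f triangle_D(2)[OF s]] by blast
  then obtain f' where f': "f' \<in> Hom C R S'" "f = \<mu> \<cdot> f'" using triangle_lift1[OF s f] by blast
  have S'H: "S' \<in> right_perp C (shifts C {0..} A)"
  proof (rule closed_coproducts_any[OF inacc right_perp_coproducts[OF shifts_compact] I _ cL])
    show "L i \<in> right_perp C (shifts C {0..} A)" if "i \<in> I" for i using L[OF that] unfolding tle_unshift .
  qed
  let ?r = "restr I L S' \<iota>'"
  obtain J where J: "J \<subseteq> I" "|J| <o \<alpha>" "?r J \<cdot> (f' \<cdot> b) = f' \<cdot> b"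
    using small_objectsD[OF \<alpha> M I cL Comp_Hom[OF b f'(1)]] .
  note r = restr_Hom[OF cL, of J]
  have rf: "?r J \<cdot> f' \<in> Hom C R S'" using Comp_Hom[OF f'(1) r] .
  have df: "f' \<ominus> (?r J \<cdot> f') \<in> Hom C R S'" using diff_Hom[OF f'(1) rf] .
  have "(f' \<ominus> (?r J \<cdot> f')) \<cdot> b = (f' \<cdot> b) \<ominus> (?r J \<cdot> (f' \<cdot> b))" using f'(1) b r by (simp add: Hom_iff)
  then have "(f' \<ominus> (?r J \<cdot> f')) \<cdot> b = \<zero> M S'" using J(3) diff_self[OF Comp_Hom[OF b f'(1)]] by simp
  then obtain w where w: "w \<in> Hom C (Shift C T) S'" "f' \<ominus> (?r J \<cdot> f') = w \<cdot> d"
    using triangle_extend2[OF t df] by blast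
  have "Shift C T \<in> tge" using t_structure T unfolding t_structure_def by auto
  then have "orth (Shift C T) S'" using S'H by (simp add: left_perp_def)
  then have "w = \<zero> (Shift C T) S'" using orthD w(1) by blast
  then have "f' \<ominus> (?r J \<cdot> f') = \<zero> R S'" using w(2) d coproduct_D(1)[OF cL] by (simp add: Hom_iff)
  then have f'r: "?r J \<cdot> f' = f'" using diff_eq_Zero[OF f'(1) rf] by simp
  have "restr I N S \<iota> J \<cdot> \<mu> = \<mu> \<cdot> ?r J"
  proof (rule coproduct_eqI[OF cL Comp_Hom[OF \<mu>(1) restr_Hom[OF N]] Comp_Hom[OF r \<mu>(1)]])
    fix i assume i: "i \<in> I"
    have 1: "(restr I N S \<iota> J \<cdot> \<mu>) \<cdot> \<iota>' i = (restr I N S \<iota> J \<cdot> \<iota> i) \<cdot> l i"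
      using Comp_assoc[OF \<iota>'[OF i] \<mu>(1) restr_Hom[OF N]] \<mu>(2)[OF i] Comp_assoc[OF li[OF i] \<iota>[OF i] restr_Hom[OF N]] by simp
    have 2: "(\<mu> \<cdot> ?r J) \<cdot> \<iota>' i = \<mu> \<cdot> (?r J \<cdot> \<iota>' i)" using Comp_assoc[OF \<iota>'[OF i] r \<mu>(1)] .
    show "(restr I N S \<iota> J \<cdot> \<mu>) \<cdot> \<iota>' i = (\<mu> \<cdot> ?r J) \<cdot> \<iota>' i"
      unfolding 1 2 using restr_in[OF N i, of J] restr_notin[OF N i, of J] restr_in[OF cL i, of J]
        restr_notin[OF cL i, of J] \<mu> i li[OF i] S by (cases "i \<in> J") (simp_all add: Hom_iff)
  qed
  then have "restr I N S \<iota> J \<cdot> f = f"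
    using f'(2) f'r Comp_assoc[OF f'(1) \<mu>(1) restr_Hom[OF N, of J]] Comp_assoc[OF f'(1) r \<mu>(1)] by simp
  then show "\<exists>J\<subseteq>I. |J| <o \<alpha> \<and> restr I N S \<iota> J \<cdot> f = f" using J by blast
qed

text \<open>
  In \<open>C\<close> and in the full subcategory of small objects the inverse of the shift is given by different terms;
  they agree on small objects since these are closed under both shifts.
\<close>

lemma t_restricts_small:
  fixes \<alpha> :: "'c rel"
  assumes \<alpha>: "Card_order \<alpha>" "infinite (Field \<alpha>)"
  shows "t_restricts C tle tge (small_objects \<kappa> \<alpha> C)"
  unfolding t_restricts_def
proof
  let ?D = "small_objects \<kappa> \<alpha> C"
  let ?F = "full_subcategory C ?D"
  show "triangulated_subcategory C ?D" by (rule small_objects_triangulated[OF \<alpha>])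
  note DO = small_objects_Ob[OF \<alpha>]
  note ts = t_structure[unfolded t_structure_def]
  have F: "Ob ?F = ?D" "Shift ?F = Shift C" by (simp_all add: full_subcategory_def)
  have FH: "Hom ?F X Y = Hom C X Y" if "X \<in> ?D" "Y \<in> ?D" for X Y
    using that by (auto simp: Hom_def full_subcategory_def)
  have Sh: "shift ?F 1 X = Shift C X" for X by (simp add: shift_def F)
  have DSh: "Shift C X \<in> ?D \<longleftrightarrow> X \<in> ?D" if "X \<in> Ob C" for X by (rule small_objects_Shift_iff[OF \<alpha> that])
  have Dun: "shift C (- 1) X \<in> ?D" if "X \<in> ?D" for X
    using DSh[of "shift C (- 1) X"] that DO Shift_shift[of X "- 1"] by auto
  have Un: "shift ?F (- 1) X = shift C (- 1) X" if X: "X \<in> ?D" for X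
  proof -
    have XO: "X \<in> Ob C" using X DO by blast
    have "inv_into ?D (Shift C) (Shift C (shift C (- 1) X)) = shift C (- 1) X"
    proof (rule inv_into_f_f)
      show "inj_on (Shift C) ?D" using Shift_inj DO by (auto simp: inj_on_def subset_iff)
      show "shift C (- 1) X \<in> ?D" by (rule Dun[OF X])
    qed
    moreover have "Shift C (shift C (- 1) X) = X" using XO by (simp add: Shift_shift)
    ultimately show ?thesis by (simp add: shift_def F)
  qed
  have iso: "isomorphic C X Y" if i: "isomorphic ?F X Y" for X Y
  proof -
    have XY: "X \<in> ?D" "Y \<in> ?D" using i by (auto simp: isomorphic_def F)
    obtain f g where "f \<in> Hom ?F X Y" "g \<in> Hom ?F Y X" "g \<cdot>\<^bsub>?F\<^esub> f = Ident ?F X" "f \<cdot>\<^bsub>?F\<^esub> g = Ident ?F Y"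
      using i by (auto simp: isomorphic_def is_iso_def)
    then show ?thesis using FH XY by (intro isomorphicI[of f X Y g]) (auto simp: full_subcategory_def)
  qed
  show "t_structure ?F (tle \<inter> ?D) (tge \<inter> ?D)"
    unfolding t_structure_def
  proof (intro conjI ballI)
    show "tle \<inter> ?D \<subseteq> Ob ?F" "tge \<inter> ?D \<subseteq> Ob ?F" by (auto simp: F)
    have ci: "closed_iso ?F (E \<inter> ?D)" if E: "closed_iso C E" for E
      unfolding closed_iso_def
    proof (intro ballI allI impI)
      fix X Y assume X: "X \<in> E \<inter> ?D" and i: "isomorphic ?F X Y"
      have "Y \<in> ?D" using i by (simp add: isomorphic_def F)
      moreover have "Y \<in> E" using E X iso[OF i] unfolding closed_iso_def by blast
      ultimately show "Y \<in> E \<inter> ?D" by blast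
    qed
    show "closed_iso ?F (tle \<inter> ?D)" "closed_iso ?F (tge \<inter> ?D)" using ci ts by blast+
    show "tle \<inter> ?D \<subseteq> shift ?F 1 ` (tle \<inter> ?D)"
    proof
      fix X assume X: "X \<in> tle \<inter> ?D"
      then have XO: "X \<in> Ob C" using DO by blast
      have "X \<in> shift C 1 ` tle" using ts X by blast
      then obtain Y where Y: "Y \<in> tle" "X = Shift C Y" by auto
      then have "Y \<in> ?D" using X DSh by (auto simp: right_perp_orth)
      then show "X \<in> shift ?F 1 ` (tle \<inter> ?D)" using Y by (intro image_eqI[of _ _ Y]) (auto simp: Sh)
    qed
    have "Shift C X \<in> tge" if "X \<in> tge" for X using ts that by auto
    moreover have "X \<in> Ob C" if "X \<in> tge" for X using that left_perp_Ob by blast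
    ultimately show "shift ?F 1 ` (tge \<inter> ?D) \<subseteq> tge \<inter> ?D" using DSh Sh by auto
    show "perp ?F (shift ?F 1 ` (tge \<inter> ?D)) (tle \<inter> ?D)"
      unfolding perp_def
    proof (intro ballI)
      fix X Y assume X: "X \<in> shift ?F 1 ` (tge \<inter> ?D)" and Y: "Y \<in> tle \<inter> ?D"
      obtain Z where Z: "Z \<in> tge" "Z \<in> ?D" "X = Shift C Z" using X Sh by auto
      have "X \<in> ?D" using Z DSh DO by blast
      moreover have "orth X Y" using ts Z Y by (auto simp: perp_orth)
      ultimately show "Hom ?F X Y = {Zero ?F X Y}"
        using FH[of X Y] Y by (simp add: orth_def full_subcategory_def)
    qed
    fix M assume "M \<in> Ob ?F"
    then have M: "M \<in> ?D" by (simp add: F)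
    obtain T R a b d where T: "T \<in> tge" and R: "R \<in> right_perp C (shifts C {0..} A)" and t: "triangle C T M R a b d"
      using decomposition[OF subsetD[OF DO M], of "{0..}"] .
    have RD: "R \<in> ?D" by (rule truncation_small[OF \<alpha> M T R t])
    have TD: "T \<in> ?D" by (rule small_objects_fiber[OF \<alpha> t M RD])
    have "R \<in> shift C (- 1) ` tle" using R unfolding shift_tle .
    then obtain Y where Y: "Y \<in> tle" "R = shift C (- 1) Y" by blast
    have YO: "Y \<in> Ob C" using Y by (simp add: right_perp_orth)
    have "Y = Shift C R" using Y YO by (simp add: Shift_shift)
    then have YD: "Y \<in> ?D" using RD DSh DO by blast
    then have "R \<in> shift ?F (- 1) ` (tle \<inter> ?D)" using Y Un[OF YD] YD by (intro image_eqI[of _ _ Y]) auto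
    moreover have "triangle ?F T M R a b d"
    proof -
      have "(a, b, d) \<in> Tri ?F" unfolding full_subcategory_def using t TD M RD by auto
      moreover have "Shift C T \<in> ?D" using TD DSh DO by blast
      ultimately show ?thesis unfolding triangle_def F using FH TD M RD triangle_D[OF t] by simp
    qed
    ultimately show "\<exists>L\<in>tge \<inter> ?D. \<exists>R\<in>shift ?F (- 1) ` (tle \<inter> ?D). \<exists>f g h. triangle ?F L M R f g h"
      using T TD by blast
  qed
qed

section \<open>Compact objects and envelopes\<close>

text \<open>
  A compact \<open>M\<close> in the left class of the torsion pair has no maps to the right class, hence is a direct summand
  of its cellular approximation; the inclusion factors through an object of the envelope, of which \<open>M\<close> is then
  a direct summand.
\<close>

lemma left_perp_compact_envelope:
  "left_perp (right_perp C (shifts C N A)) \<inter> compacts = envelope C (shifts C N A)" (is "?P \<inter> _ = _")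
proof
  show "?P \<inter> compacts \<subseteq> envelope C (shifts C N A)"
    unfolding envelope_def
  proof (intro subsetI InterI, elim CollectE conjE)
    fix M D assume M: "M \<in> ?P \<inter> compacts" and D: "shifts C N A \<subseteq> D" "additive_class C D" "closed_retracts C D" "closed_extensions C D"
    have MO: "M \<in> Ob C" using M compact_Ob by blast
    obtain L R f g h where L: "L \<in> cellular (shifts C N A)" and R: "R \<in> right_perp C (shifts C N A)"
      and t: "triangle C L M R f g h" using decomposition[OF MO] .
    have "orth M R" using M R by (simp add: left_perp_def)
    then have "is_retract C M L" using triangle_section[OF t] orthD triangle_D(2)[OF t] by blast
    then obtain i p where ip: "i \<in> Hom C M L" "p \<in> Hom C L M" "p \<cdot> i = Ident C M" by (auto simp: is_retract_def)
    have E: "additive_class C (D \<inter> compacts)" "closed_extensions C (D \<inter> compacts)" "D \<inter> compacts \<subseteq> compacts"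
      "shifts C N A \<subseteq> D \<inter> compacts"
    proof -
      show "additive_class C (D \<inter> compacts)"
        using D(2) small_objects_additive[OF natLeq_infinite] unfolding additive_class_def compact_objects_def by blast
      show "closed_extensions C (D \<inter> compacts)"
        unfolding closed_extensions_def
      proof (intro ballI allI impI)
        fix X Z Y f g h assume X: "X \<in> D \<inter> compacts" and Z: "Z \<in> D \<inter> compacts" and t: "triangle C X Y Z f g h"
        have "Shift C X \<in> compacts" using X compact_Shift_iff compact_Ob by blast
        then have "Y \<in> compacts" using compact_fiber[OF triangle_rotate[OF t]] Z by blast
        moreover have "Y \<in> D" using D(4) X Z t unfolding closed_extensions_def by blast
        ultimately show "Y \<in> D \<inter> compacts" by blast
      qed
    qed (use D(1) shifts_compact in auto)
    obtain E0 a b where E0: "E0 \<in> D \<inter> compacts" "a \<in> Hom C M E0" "b \<in> Hom C E0 L" "i = b \<cdot> a"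
      using cellular_factor[OF E L _ ip(1)] M by blast
    have "(p \<cdot> b) \<cdot> a = Ident C M" using Comp_assoc[OF E0(2,3) ip(2)] E0(4) ip(3) by simp
    then have "is_retract C M E0"
      unfolding is_retract_def using MO E0(1,2) compact_Ob Comp_Hom[OF E0(3) ip(2)] by blast
    then show "M \<in> D" using D(3) E0(1) unfolding closed_retracts_def by blast
  qed
  have RO: "\<And>Y. Y \<in> right_perp C (shifts C N A) \<Longrightarrow> Y \<in> Ob C" by (simp add: right_perp_orth)
  have "shifts C N A \<subseteq> ?P \<inter> compacts"
    using shifts_compact compact_Ob by (auto simp: left_perp_def right_perp_orth)
  moreover have "additive_class C (?P \<inter> compacts)"
    unfolding additive_class_def
  proof (intro conjI allI ballI impI)
    note ac = small_objects_additive[OF natLeq_infinite, folded compact_objects_def, unfolded additive_class_def]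
    show "?P \<inter> compacts \<subseteq> Ob C" using compact_Ob by blast
    show "Z \<in> ?P \<inter> compacts" if "zero_object C Z" for Z
      using ac that orth_zero_object(1)[OF that] RO compact_Ob by (auto simp: left_perp_def)
    show "S \<in> ?P \<inter> compacts" if "X \<in> ?P \<inter> compacts" "Y \<in> ?P \<inter> compacts" "is_biproduct C X Y S" for X Y S
    proof -
      have S: "S \<in> compacts" using ac that by blast
      have "orth S T" if T: "T \<in> right_perp C (shifts C N A)" for T
        by (rule orth_biproduct(1)[OF \<open>is_biproduct C X Y S\<close> RO[OF T]])
          (use T \<open>X \<in> ?P \<inter> compacts\<close> \<open>Y \<in> ?P \<inter> compacts\<close> in \<open>auto simp: left_perp_def\<close>)
      then show ?thesis using S compact_Ob by (simp add: left_perp_def)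
    qed
  qed
  moreover have "closed_retracts C (?P \<inter> compacts)"
    using left_perp_retracts[OF right_perp_subset_Ob, of "shifts C N A"] small_objects_retract[OF natLeq_infinite]
    unfolding closed_retracts_def compact_objects_def by blast
  moreover have "closed_extensions C (?P \<inter> compacts)"
    unfolding closed_extensions_def
  proof (intro ballI allI impI)
    fix X Z Y f g h assume X: "X \<in> ?P \<inter> compacts" and Z: "Z \<in> ?P \<inter> compacts" and t: "triangle C X Y Z f g h"
    have "Shift C X \<in> compacts" using X compact_Shift_iff compact_Ob by blast
    then have "Y \<in> compacts" using compact_fiber[OF triangle_rotate[OF t]] Z by blast
    moreover have "orth Y T" if T: "T \<in> right_perp C (shifts C N A)" for T
      by (rule orth_triangle_left[OF t RO[OF T]]) (use T X Z in \<open>auto simp: left_perp_def\<close>)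
    ultimately show "Y \<in> ?P \<inter> compacts" using compact_Ob by (simp add: left_perp_def)
  qed
  ultimately show "envelope C (shifts C N A) \<subseteq> ?P \<inter> compacts" unfolding envelope_def by blast
qed

lemma right_adjacent: "right_adjacent C wle wge tle tge"
  unfolding right_adjacent_def
proof
  show "perp C (shift C 1 ` tge) wle" unfolding wle_eq_tle using t_structure by (simp add: t_structure_def)
  show "perp C (shift C (- 1) ` tle) wge"
    unfolding wle_eq_tle[symmetric] perp_orth
  proof (intro ballI)
    fix X Y assume "X \<in> shift C (- 1) ` wle" and Y: "Y \<in> wge"
    then obtain Z where Z: "Z \<in> wle" "X = shift C (- 1) Z" by blast
    have "orth Z (shift C 1 Y)" using weight_structure Z(1) Y unfolding weight_structure_def perp_orth by blast
    then show "orth X Y" using orth_shift_left[of Z Y "- 1"] Z Y left_perp_Ob by (auto simp: right_perp_orth)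
  qed
qed

end

theorem corollary3p4p3:
  fixes \<kappa> :: "'u rel"
    and C :: "('o, 'm) triangulated_category"
    and A :: "'o set"
  assumes "inaccessible \<kappa>"
    and "triangulated_category C"
    and "locally_small \<kappa> C"
    and "smashing \<kappa> C"
    and "additive_subcategory C A"
    and "A \<subseteq> compact_objects \<kappa> C"
    and "compactly_generates \<kappa> C A"
    and "semisimple \<kappa> (AddFun \<kappa> (full_subcategory C A))"
    and "perp C A (shifts C {..<0} A)"
  shows "\<exists>wle wge tle tge.
    smashing_weight_structure \<kappa> C wle wge \<and>
    cosmashing_weight_structure \<kappa> C wle wge \<and>
    t_structure C tle tge \<and>
    generates_weight C A wge \<and>
    generates_t C A tle \<and>
    right_adjacent C wle wge tle tge \<and>
    (\<forall>\<alpha> :: 'u rel. Card_order \<alpha> \<and> infinite (Field \<alpha>) \<longrightarrow>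
       t_restricts C tle tge (small_objects \<kappa> \<alpha> C)) \<and>
    t_restricts C tle tge (compact_objects \<kappa> C) \<and>
    tle \<inter> compact_objects \<kappa> C = envelope C (shifts C {..0} A) \<and>
    tge \<inter> compact_objects \<kappa> C = envelope C (shifts C {0..} A)"
proof -
  interpret triangulated_category C by (rule assms(2))
  interpret semisimple_negative \<kappa> C A
    by unfold_locales (use assms in auto)
  have "smashing_weight_structure \<kappa> C wle wge"
    unfolding smashing_weight_structure_def
    using weight_structure smash right_perp_coproducts[OF shifts_compact] by blast
  moreover have "cosmashing_weight_structure \<kappa> C wle wge"
    unfolding cosmashing_weight_structure_def
    using weight_structure cosmashing right_perp_products[OF shifts_Ob[OF A_Ob]] wle_eq_tle by simp
  moreover have "generates_weight C A wge" "generates_t C A tle"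
    by (simp_all add: generates_weight_def generates_t_def)
  moreover have "t_restricts C tle tge (compact_objects \<kappa> C)"
    unfolding compact_objects_def by (rule t_restricts_small[OF natLeq_infinite])
  moreover have "tle \<inter> compact_objects \<kappa> C = envelope C (shifts C {..0} A)"
    using left_perp_compact_envelope[of "{..0}"] unfolding wle_eq_tle .
  ultimately show ?thesis
    using t_structure right_adjacent t_restricts_small left_perp_compact_envelope[of "{0..}"]
    by (intro exI[of _ wle] exI[of _ wge] exI[of _ tle] exI[of _ tge] conjI) blast+
qed

end
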